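(* Assume the principle $\mathrm{RP}_{\mathrm{internal}}$. Let $R$ be a ring with $|R|\le\aleph_1$. Then for every quotient-hereditary collection $\mathcal{C}$ of countably-presented $R$-modules and every $R$-module $M$, the $\mathcal{C}$-Filtration Game of length $\omega_1$ on $M$, $\mathcal{G}^{\mathrm{Filt}(\mathcal{C})}_{\omega_1}(M)$, is determined (one of the two players has a winning strategy). In particular, if $R$ is a hereditary ring with $|R|\le\aleph_1$, then for every $R$-module $M$ the Projective Filtration Game of length $\omega_1$ on $M$ and the Free Filtration Game of length $\omega_1$ on $M$ are determined.
   Context: All modules are left modules. For a subset $X$ of a module, $\langle X\rangle$ is the submodule generated by $X$. A filtration of a module $M$ is a sequence $\langle M_i : i<\eta\rangle$ ($\eta$ any ordinal) of submodules with $M_i\subseteq M_j$ for $i<j$, $M_i=\bigcup_{k<i}M_k$ for limit $i$, and $\bigcup_{i<\eta}M_i=M$. For a class $\mathcal{C}$ of $R$-modules, $M$ is $\mathcal{C}$-filtered if it has a filtration $\langle M_i:i<\eta\rangle$ with $M_0=\{0\}$ and $M_{i+1}/M_i$ isomorphic to an element of $\mathcal{C}$ whenever $i+1<\eta$. $\mathcal{C}$ is quotient-hereditary if whenever $Z\subseteq Z'$ are $R$-modules with $Z$ and $Z'/Z$ both $\mathcal{C}$-filtered, then for every submodule $U'$ of $Z'$, both $U'\cap Z$ and $U'/(U'\cap Z)$ are $\mathcal{C}$-filtered. For a regular cardinal $\mu$, the $\mathcal{C}$-Filtration Game of length $\mu$ on $M$, $\mathcal{G}^{\mathrm{Filt}(\mathcal{C})}_{\mu}(M)$: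 at round $i<\mu$, Player 1 plays $X_i\subseteq M$ with $|X_i|<\mu$; Player 2 must respond with $Z_i\subseteq M$, $|Z_i|<\mu$, such that $X_i\cup\bigcup_{k<i}Z_k\subseteq\langle Z_i\rangle$ and $\langle Z_i\rangle/\langle\bigcup_{k<i}Z_k\rangle$ is $\mathcal{C}$-filtered. Player 2 wins if she lasts all $\mu$ rounds; otherwise Player 1 wins. The Projective Filtration Game of length $\omega_1$ is the case $\mu=\omega_1$ and $\mathcal{C}$ = all countably presented projective $R$-modules; the Free Filtration Game of length $\omega_1$ is the case $\mu=\omega_1$, $\mathcal{C}=\{R\}$. A ring is hereditary if every submodule of a projective module is projective. $\mathrm{RP}_{\mathrm{internal}}$: for every uncountable set $X$, every stationary $S\subseteq[X]^\omega$, every regular $\theta$ with $X\in H_\theta$, and every first-order structure $\mathfrak{A}$ in a countable language expanding $(H_\theta,\in,X,S)$, there is $W\prec\mathfrak{A}$ with $|W|=\omega_1\subseteq W$ such that $S\cap W\cap[W\cap X]^\omega$ is stationary in $[W\cap X]^\omega$. (Here $[Y]^\omega$ is the set of countable subsets of $Y$, with the usual club/stationary notions.) *)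

theory Defs
  imports "HOL-Algebra.Module" "HOL-Algebra.AbelCoset" "HOL-Library.Equipollence"
begin

section \<open>The set-theoretic universe\<close>

text \<open>
  The principle \<open>RP\<^sub>i\<^sub>n\<^sub>t\<^sub>e\<^sub>r\<^sub>n\<^sub>a\<^sub>l\<close> speaks about the structures \<open>H\<^sub>\<theta>\<close> for all regular \<open>\<theta>\<close>, and the algebra
  quantifies over all \<open>R\<close>-modules.  The background theory ZFC is rendered by a type of sets
  satisfying the (second-order) ZFC axioms; choice is inherited from HOL.  A HOL set \<open>A\<close> of
  elements of the universe is itself a set of the universe (\<open>small\<close>) or a proper class.
\<close>

class zfc_universe =
  fixes elts :: "'a \<Rightarrow> 'a set"
  assumes elts_ext: "elts x = elts y \<Longrightarrow> x = y"
    and elts_foundation: "wf {(x, y). x \<in> elts y}"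
    and elts_separation: "A \<subseteq> elts x \<Longrightarrow> A \<in> range elts"
    and elts_union: "(\<Union>y\<in>elts x. elts y) \<in> range elts"
    and elts_power: "{y. elts y \<subseteq> elts x} \<in> range elts"
    and elts_replacement: "f ` elts x \<in> range elts"
    and elts_infinity: "\<exists>w. (\<exists>z\<in>elts w. elts z = {}) \<and>
          (\<forall>x\<in>elts w. \<exists>y\<in>elts w. elts y = insert x (elts x))"

definition small :: "'v::zfc_universe set \<Rightarrow> bool" where
  "small A \<longleftrightarrow> A \<in> range elts"

text \<open>\<open>vset A\<close> is the element of the universe with extension \<open>A\<close>; meaningful for small \<open>A\<close> only.\<close>

definition vset :: "'v::zfc_universe set \<Rightarrow> 'v" where
  "vset A = (THE x. elts x = A)"

definition vzero :: "'v::zfc_universe" where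
  "vzero = vset {}"

definition vsucc :: "'v::zfc_universe \<Rightarrow> 'v" where
  "vsucc x = vset (insert x (elts x))"

text \<open>Von Neumann ordinals: \<open>i < j\<close> is \<open>i \<in> elts j\<close>.\<close>

definition Ord :: "'v::zfc_universe \<Rightarrow> bool" where
  "Ord \<alpha> \<longleftrightarrow> (\<forall>x\<in>elts \<alpha>. elts x \<subseteq> elts \<alpha>) \<and> (\<forall>x\<in>elts \<alpha>. \<forall>y\<in>elts x. elts y \<subseteq> elts x)"

definition Limit :: "'v::zfc_universe \<Rightarrow> bool" where
  "Limit \<alpha> \<longleftrightarrow> Ord \<alpha> \<and> vzero \<in> elts \<alpha> \<and> (\<forall>\<beta>\<in>elts \<alpha>. vsucc \<beta> \<in> elts \<alpha>)"

definition Card :: "'v::zfc_universe \<Rightarrow> bool" where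
  "Card \<kappa> \<longleftrightarrow> Ord \<kappa> \<and> (\<forall>\<alpha>\<in>elts \<kappa>. elts \<alpha> \<prec> elts \<kappa>)"

definition regular_cardinal :: "'v::zfc_universe \<Rightarrow> bool" where
  "regular_cardinal \<kappa> \<longleftrightarrow> Card \<kappa> \<and> infinite (elts \<kappa>) \<and>
     (\<forall>A\<subseteq>elts \<kappa>. A \<prec> elts \<kappa> \<longrightarrow> (\<exists>\<beta>\<in>elts \<kappa>. \<forall>\<alpha>\<in>A. \<alpha> \<in> elts \<beta>))"

text \<open>\<open>\<omega>\<^sub>1\<close> as the set of all countable ordinals; that this is a set is \<open>elts_omega1\<close> below.\<close>

definition omega1 :: "'v::zfc_universe" where
  "omega1 = vset {\<alpha>. Ord \<alpha> \<and> countable (elts \<alpha>)}"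

definition trcl :: "'v::zfc_universe \<Rightarrow> 'v set" where
  "trcl x = {y. (y, x) \<in> {(a, b). a \<in> elts b}\<^sup>+}"

definition Hset :: "'v::zfc_universe \<Rightarrow> 'v set" where
  "Hset \<theta> = {x. trcl x \<prec> elts \<theta>}"

lemma elts_vset:
  assumes "small A"
  shows "elts (vset A) = A"
proof -
  from assms obtain x where x: "elts x = A"
    by (auto simp: small_def)
  show ?thesis
    unfolding vset_def by (rule theI[of "\<lambda>x. elts x = A", OF x]) (use x elts_ext in auto)
qed

lemma small_image: "small A \<Longrightarrow> small (f ` A)" for A :: "'v::zfc_universe set" and f :: "'v \<Rightarrow> 'v"
  unfolding small_def using elts_replacement by (metis imageE)

lemma small_lepoll:
  fixes A B :: "'v::zfc_universe set"
  assumes "small A" "B \<lesssim> A"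
  shows "small B"
proof -
  from assms(2) obtain f where f: "inj_on f B" "f ` B \<subseteq> A"
    unfolding lepoll_def by blast
  have "small (f ` B)"
    using assms(1) f(2) by (auto simp: small_def intro: elts_separation)
  then have "small (inv_into B f ` f ` B)"
    by (rule small_image)
  then show ?thesis
    using f(1) by (simp add: image_image)
qed

lemma small_doubleton: "small {a, b :: 'v::zfc_universe}"
proof -
  obtain w :: 'v where w: "\<exists>z\<in>elts w. elts z = {}"
    "\<forall>x\<in>elts w. \<exists>y\<in>elts w. elts y = insert x (elts x)"
    using elts_infinity by blast
  then obtain z y where zy: "z \<in> elts w" "elts z = {}" "y \<in> elts w" "elts y = insert z (elts z)"
    by blast
  then have "z \<noteq> y" by auto
  have "small ((\<lambda>u. if u = z then a else b) ` elts w)"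
    by (rule small_image) (simp add: small_def)
  moreover have "(\<lambda>u. if u = z then a else b) ` elts w = {a, b}"
    using zy \<open>z \<noteq> y\<close> by (auto simp: image_iff)
  ultimately show ?thesis by simp
qed

lemma elts_vsucc: "elts (vsucc x) = insert x (elts x)"
proof -
  have X: "elts (vset {x}) = {x}"
    using small_doubleton[of x x] by (simp add: elts_vset)
  have Y: "elts (vset {vset {x}, x}) = {vset {x}, x}"
    by (rule elts_vset[OF small_doubleton])
  have "small (\<Union>y\<in>elts (vset {vset {x}, x}). elts y)"
    unfolding small_def by (rule elts_union)
  then have "small (insert x (elts x))"
    by (simp add: X Y)
  then show ?thesis
    unfolding vsucc_def by (rule elts_vset)
qed

lemma elts_vzero: "elts vzero = {}"
  unfolding vzero_def
  by (rule elts_vset) (auto simp: small_def intro: elts_separation[of _ undefined])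

lemma small_Pow_nat:
  fixes D :: "'v::zfc_universe set"
  assumes "D \<lesssim> (UNIV :: nat set set)"
  shows "small D"
proof -
  obtain w :: 'v where w: "\<exists>z\<in>elts w. elts z = {}"
    "\<forall>x\<in>elts w. \<exists>y\<in>elts w. elts y = insert x (elts x)"
    using elts_infinity by blast
  from w(1) obtain z where z: "z \<in> elts w" "elts z = {}" by blast
  from w(2) obtain s where s: "\<And>x. x \<in> elts w \<Longrightarrow> s x \<in> elts w \<and> elts (s x) = insert x (elts x)"
    by metis
  define g where "g n = (s ^^ n) z" for n
  have g0: "g 0 = z" and gS: "g (Suc n) = s (g n)" for n
    by (auto simp: g_def)
  have gw: "g n \<in> elts w" for n
    by (induction n) (use z s g0 gS in auto)
  have mem: "g m \<in> elts (g (m + Suc k))" for m k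
    by (induction k) (use s gw gS in auto)
  have irrefl: "x \<notin> elts x" for x :: 'v
    using wf_not_refl[OF elts_foundation] by blast
  have inj: "inj g"
  proof (rule linorder_injI)
    fix m n :: nat assume "m < n"
    then obtain k where "n = m + Suc k" using less_iff_Suc_add by auto
    then show "g m \<noteq> g n" using mem[of m k] irrefl[of "g m"] by metis
  qed
  have P: "small {y. elts y \<subseteq> elts w}"
    unfolding small_def by (rule elts_power)
  define h where "h A = vset (g ` A)" for A
  have sm: "small (g ` A)" for A
    unfolding small_def by (rule elts_separation[of _ w]) (use gw in auto)
  have eh: "elts (h A) = g ` A" for A
    unfolding h_def by (rule elts_vset[OF sm])
  have "inj h"
    by (rule injI) (metis eh inj inj_image_eq_iff)
  moreover have "range h \<subseteq> {y. elts y \<subseteq> elts w}"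
    using eh gw by auto
  ultimately have "(UNIV :: nat set set) \<lesssim> {y. elts y \<subseteq> elts w}"
    unfolding lepoll_def by blast
  then show ?thesis
    using assms P small_lepoll lepoll_trans by blast
qed

lemma elts_omega1: "elts omega1 = {\<alpha> :: 'v::zfc_universe. Ord \<alpha> \<and> countable (elts \<alpha>)}"
proof -
  let ?D = "{\<alpha> :: 'v. Ord \<alpha> \<and> countable (elts \<alpha>)}"
  define e where "e \<alpha> = to_nat_on (elts \<alpha>)" for \<alpha> :: 'v
  have e: "inj_on (e \<alpha>) (elts \<alpha>)" if "\<alpha> \<in> ?D" for \<alpha>
    using that inj_on_to_nat_on unfolding e_def by auto
  define c where "c \<alpha> = {(e \<alpha> \<beta>, e \<alpha> \<gamma>) | \<beta> \<gamma>. \<beta> \<in> elts \<alpha> \<and> \<gamma> \<in> elts \<alpha> \<and> (\<beta> \<in> elts \<gamma> \<or> \<beta> = \<gamma>)}"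
    for \<alpha> :: 'v
  have eqd: "elts \<alpha> \<subseteq> elts \<alpha>'" if D: "\<alpha> \<in> ?D" "\<alpha>' \<in> ?D" and eq: "c \<alpha> = c \<alpha>'" for \<alpha> \<alpha>'
  proof -
    have "\<beta> \<in> elts \<alpha> \<longrightarrow> \<beta> \<in> elts \<alpha>' \<and> e \<alpha>' \<beta> = e \<alpha> \<beta>" for \<beta>
    proof (induction \<beta> rule: wf_induct_rule[OF elts_foundation])
      case (1 \<beta>)
      show ?case
      proof
        assume b: "\<beta> \<in> elts \<alpha>"
        then have "(e \<alpha> \<beta>, e \<alpha> \<beta>) \<in> c \<alpha>'"
          unfolding eq[symmetric] by (auto simp: c_def)
        then obtain \<gamma> where g: "\<gamma> \<in> elts \<alpha>'" "e \<alpha>' \<gamma> = e \<alpha> \<beta>"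
          by (auto simp: c_def)
        have "x \<in> elts \<gamma>" if x: "x \<in> elts \<beta>" for x
        proof -
          have xa: "x \<in> elts \<alpha>" using D(1) b x by (auto simp: Ord_def)
          then have IH: "x \<in> elts \<alpha>'" "e \<alpha>' x = e \<alpha> x" using 1 x by auto
          have "(e \<alpha> x, e \<alpha> \<beta>) \<in> c \<alpha>'"
            using xa b x unfolding eq[symmetric] by (auto simp: c_def)
          then have "(e \<alpha>' x, e \<alpha>' \<gamma>) \<in> c \<alpha>'" using IH g by simp
          then obtain y b' where y: "y \<in> elts \<alpha>'" "b' \<in> elts \<alpha>'" "e \<alpha>' y = e \<alpha>' x"
            "e \<alpha>' b' = e \<alpha>' \<gamma>" "y \<in> elts b' \<or> y = b'"
            unfolding c_def by force
          then have "y = x" "b' = \<gamma>" using e[OF D(2)] IH(1) g(1) by (auto dest: inj_onD)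
          then have "x \<in> elts \<gamma> \<or> x = \<gamma>"
            using y by blast
          moreover have "x \<noteq> \<gamma>"
          proof
            assume "x = \<gamma>"
            then have "e \<alpha> x = e \<alpha> \<beta>" using IH g by simp
            then have "x = \<beta>" using e[OF D(1)] xa b by (auto dest: inj_onD)
            then show False using x wf_not_refl[OF elts_foundation] by blast
          qed
          ultimately show ?thesis by blast
        qed
        moreover have "x \<in> elts \<beta>" if x: "x \<in> elts \<gamma>" for x
        proof -
          have xa: "x \<in> elts \<alpha>'" using D(2) g(1) x by (auto simp: Ord_def)
          have "(e \<alpha>' x, e \<alpha>' \<gamma>) \<in> c \<alpha>"
            unfolding eq unfolding c_def using xa g(1) x by blast
          then obtain y b' where y: "y \<in> elts \<alpha>" "b' \<in> elts \<alpha>" "e \<alpha> y = e \<alpha>' x"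
            "e \<alpha> b' = e \<alpha> \<beta>" "y \<in> elts b' \<or> y = b'"
            using g(2) unfolding c_def by force
          then have "b' = \<beta>" using e[OF D(1)] b by (auto dest: inj_onD)
          moreover have "y \<noteq> \<beta>"
          proof
            assume "y = \<beta>"
            then have "e \<alpha>' x = e \<alpha>' \<gamma>" using y g by simp
            then have "x = \<gamma>" using inj_onD[OF e[OF D(2)]] xa g(1) by blast
            then show False using x wf_not_refl[OF elts_foundation] by blast
          qed
          ultimately have "y \<in> elts \<beta>" using y by blast
          then have "y \<in> elts \<alpha>'" "e \<alpha>' y = e \<alpha> y" using 1 y by auto
          then have "y = x" using e[OF D(2)] xa y by (auto dest: inj_onD)
          then show ?thesis using \<open>y \<in> elts \<beta>\<close> by simp
        qed
        ultimately have "\<gamma> = \<beta>" by (intro elts_ext) blast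
        then show "\<beta> \<in> elts \<alpha>' \<and> e \<alpha>' \<beta> = e \<alpha> \<beta>" using g by simp
      qed
    qed
    then show ?thesis by blast
  qed
  have "inj_on c ?D"
    by (intro inj_onI elts_ext) (metis eqd subset_antisym)
  then have "?D \<lesssim> (UNIV :: (nat \<times> nat) set set)"
    unfolding lepoll_def by blast
  moreover have "(UNIV :: (nat \<times> nat) set set) \<lesssim> (UNIV :: nat set set)"
    unfolding lepoll_def
    by (intro exI[of _ "image to_nat"]) (auto intro!: injI simp: inj_image_eq_iff)
  ultimately have "small ?D"
    using small_Pow_nat lepoll_trans by blast
  then show ?thesis
    unfolding omega1_def by (rule elts_vset)
qed


section \<open>Stationary sets of countable sets\<close>

definition ctbl_subsets :: "'v::zfc_universe set \<Rightarrow> 'v set" where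
  "ctbl_subsets Y = {a. elts a \<subseteq> Y \<and> countable (elts a)}"

definition club_in :: "'v::zfc_universe set \<Rightarrow> 'v set \<Rightarrow> bool" where
  "club_in Y D \<longleftrightarrow> D \<subseteq> ctbl_subsets Y \<and>
     (\<forall>a\<in>ctbl_subsets Y. \<exists>b\<in>D. elts a \<subseteq> elts b) \<and>
     (\<forall>f :: nat \<Rightarrow> 'v. (\<forall>n. f n \<in> D \<and> elts (f n) \<subseteq> elts (f (Suc n))) \<longrightarrow>
        vset (\<Union>n. elts (f n)) \<in> D)"

definition stationary_in :: "'v::zfc_universe set \<Rightarrow> 'v set \<Rightarrow> bool" where
  "stationary_in Y S \<longleftrightarrow> S \<subseteq> ctbl_subsets Y \<and> (\<forall>D. club_in Y D \<longrightarrow> S \<inter> D \<noteq> {})"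


section \<open>First-order structures in a countable language\<close>

text \<open>
  Every structure interprets the countable language that has, for each arity \<open>k\<close>, function
  symbols and relation symbols \<open>(n, k)\<close> with \<open>n\<close> a natural number; the arity is the length of the
  argument list.  Every countable language embeds in this one, and surplus symbols may be
  interpreted arbitrarily.
\<close>

datatype fo_term = Var nat | Fn nat "fo_term list"

datatype fo_formula =
    Eq fo_term fo_term
  | Rel nat "fo_term list"
  | Neg fo_formula
  | Conj fo_formula fo_formula
  | Exi nat fo_formula

record 'a fo_structure =
  Dom :: "'a set"
  fun_of :: "nat \<Rightarrow> 'a list \<Rightarrow> 'a"
  rel_of :: "nat \<Rightarrow> 'a list \<Rightarrow> bool"

definition fo_structure :: "'a fo_structure \<Rightarrow> bool" where
  "fo_structure \<AA> \<longleftrightarrow> Dom \<AA> \<noteq> {} \<and> (\<forall>n. \<forall>xs\<in>lists (Dom \<AA>). fun_of \<AA> n xs \<in> Dom \<AA>)"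

primrec fo_eval :: "'a fo_structure \<Rightarrow> (nat \<Rightarrow> 'a) \<Rightarrow> fo_term \<Rightarrow> 'a" where
  "fo_eval \<AA> e (Var n) = e n"
| "fo_eval \<AA> e (Fn n ts) = fun_of \<AA> n (map (fo_eval \<AA> e) ts)"

primrec fo_sat :: "'a fo_structure \<Rightarrow> (nat \<Rightarrow> 'a) \<Rightarrow> fo_formula \<Rightarrow> bool" where
  "fo_sat \<AA> e (Eq s t) \<longleftrightarrow> fo_eval \<AA> e s = fo_eval \<AA> e t"
| "fo_sat \<AA> e (Rel n ts) \<longleftrightarrow> rel_of \<AA> n (map (fo_eval \<AA> e) ts)"
| "fo_sat \<AA> e (Neg \<phi>) \<longleftrightarrow> \<not> fo_sat \<AA> e \<phi>"
| "fo_sat \<AA> e (Conj \<phi> \<psi>) \<longleftrightarrow> fo_sat \<AA> e \<phi> \<and> fo_sat \<AA> e \<psi>"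
| "fo_sat \<AA> e (Exi n \<phi>) \<longleftrightarrow> (\<exists>x\<in>Dom \<AA>. fo_sat \<AA> (e(n := x)) \<phi>)"

definition elementary_sub :: "'a set \<Rightarrow> 'a fo_structure \<Rightarrow> bool" where
  "elementary_sub W \<AA> \<longleftrightarrow> W \<subseteq> Dom \<AA> \<and> fo_structure (\<AA>\<lparr>Dom := W\<rparr>) \<and>
     (\<forall>\<phi> e. range e \<subseteq> W \<longrightarrow> (fo_sat (\<AA>\<lparr>Dom := W\<rparr>) e \<phi> \<longleftrightarrow> fo_sat \<AA> e \<phi>))"

text \<open>\<open>\<AA>\<close> expands \<open>(H\<^sub>\<theta>, \<in>, X, S)\<close>, with \<open>X\<close> a constant and \<open>S\<close> a unary predicate
  (\<open>S \<subseteq> H\<^sub>\<theta>\<close>, but \<open>S\<close> need not be an element of \<open>H\<^sub>\<theta>\<close>).\<close>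

definition expands_H ::
  "'v::zfc_universe fo_structure \<Rightarrow> 'v \<Rightarrow> 'v \<Rightarrow> 'v set \<Rightarrow> bool" where
  "expands_H \<AA> \<theta> X S \<longleftrightarrow> fo_structure \<AA> \<and> Dom \<AA> = Hset \<theta> \<and>
     (\<forall>x\<in>Hset \<theta>. \<forall>y\<in>Hset \<theta>. rel_of \<AA> 0 [x, y] \<longleftrightarrow> x \<in> elts y) \<and>
     fun_of \<AA> 0 [] = X \<and>
     (\<forall>x\<in>Hset \<theta>. rel_of \<AA> 0 [x] \<longleftrightarrow> x \<in> S)"

definition RP_internal :: "'v::zfc_universe itself \<Rightarrow> bool" where
  "RP_internal _ \<longleftrightarrow>
     (\<forall>(X :: 'v) S \<theta> \<AA>.
        uncountable (elts X) \<and> stationary_in (elts X) S \<and>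
        regular_cardinal \<theta> \<and> X \<in> Hset \<theta> \<and> expands_H \<AA> \<theta> X S \<longrightarrow>
        (\<exists>W. elementary_sub W \<AA> \<and> W \<approx> elts (omega1 :: 'v) \<and> elts omega1 \<subseteq> W \<and>
             stationary_in (W \<inter> elts X) (S \<inter> W \<inter> ctbl_subsets (W \<inter> elts X))))"


section \<open>Left modules\<close>

text \<open>The library locale \<open>module\<close> requires a commutative ring; the ring multiplication and unit
  fields of the record \<open>module\<close> are irrelevant for the module.\<close>

locale left_module = R?: ring R + M?: abelian_group M
  for R :: "('r, 's) ring_scheme" (structure) and M :: "('r, 'm, 't) module_scheme" (structure) +
  assumes smult_closed: "\<lbrakk>a \<in> carrier R; x \<in> carrier M\<rbrakk> \<Longrightarrow> a \<odot>\<^bsub>M\<^esub> x \<in> carrier M"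
    and smult_l_distr: "\<lbrakk>a \<in> carrier R; b \<in> carrier R; x \<in> carrier M\<rbrakk> \<Longrightarrow>
      (a \<oplus> b) \<odot>\<^bsub>M\<^esub> x = a \<odot>\<^bsub>M\<^esub> x \<oplus>\<^bsub>M\<^esub> b \<odot>\<^bsub>M\<^esub> x"
    and smult_r_distr: "\<lbrakk>a \<in> carrier R; x \<in> carrier M; y \<in> carrier M\<rbrakk> \<Longrightarrow>
      a \<odot>\<^bsub>M\<^esub> (x \<oplus>\<^bsub>M\<^esub> y) = a \<odot>\<^bsub>M\<^esub> x \<oplus>\<^bsub>M\<^esub> a \<odot>\<^bsub>M\<^esub> y"
    and smult_assoc: "\<lbrakk>a \<in> carrier R; b \<in> carrier R; x \<in> carrier M\<rbrakk> \<Longrightarrow>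
      (a \<otimes> b) \<odot>\<^bsub>M\<^esub> x = a \<odot>\<^bsub>M\<^esub> (b \<odot>\<^bsub>M\<^esub> x)"
    and smult_one: "x \<in> carrier M \<Longrightarrow> \<one> \<odot>\<^bsub>M\<^esub> x = x"

definition rmodule :: "'v ring \<Rightarrow> ('v, 'v::zfc_universe) module \<Rightarrow> bool" where
  "rmodule R M \<longleftrightarrow> left_module R M \<and> small (carrier M)"

definition submod :: "('r, 'm) module \<Rightarrow> 'm set \<Rightarrow> ('r, 'm) module" where
  "submod M N = M\<lparr>carrier := N\<rparr>"

definition quot_module :: "('r, 'm) module \<Rightarrow> 'm set \<Rightarrow> ('r, 'm set) module" where
  "quot_module M N =
     \<lparr>carrier = a_rcosets\<^bsub>M\<^esub> N, mult = undefined, one = undefined, zero = N, add = set_add M,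
      smult = (\<lambda>a A. \<Union>x\<in>A. N +>\<^bsub>M\<^esub> (a \<odot>\<^bsub>M\<^esub> x))\<rparr>"

definition module_hom :: "'r ring \<Rightarrow> ('r, 'm) module \<Rightarrow> ('r, 'n) module \<Rightarrow> ('m \<Rightarrow> 'n) set" where
  "module_hom R M N = {h. h \<in> carrier M \<rightarrow> carrier N \<and>
     (\<forall>x\<in>carrier M. \<forall>y\<in>carrier M. h (x \<oplus>\<^bsub>M\<^esub> y) = h x \<oplus>\<^bsub>N\<^esub> h y) \<and>
     (\<forall>a\<in>carrier R. \<forall>x\<in>carrier M. h (a \<odot>\<^bsub>M\<^esub> x) = a \<odot>\<^bsub>N\<^esub> h x)}"

definition module_iso :: "'r ring \<Rightarrow> ('r, 'm) module \<Rightarrow> ('r, 'n) module \<Rightarrow> bool" where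
  "module_iso R M N \<longleftrightarrow> (\<exists>h\<in>module_hom R M N. bij_betw h (carrier M) (carrier N))"

definition span :: "'r ring \<Rightarrow> ('r, 'm) module \<Rightarrow> 'm set \<Rightarrow> 'm set" where
  "span R M X = \<Inter>{N. submodule N R M \<and> X \<subseteq> N}"

definition regular_module :: "'r ring \<Rightarrow> ('r, 'r) module" where
  "regular_module R = \<lparr>carrier = carrier R, mult = mult R, one = one R, zero = zero R,
     add = add R, smult = mult R\<rparr>"

text \<open>The direct sum of \<open>J\<close> copies of \<open>R\<close>.\<close>

definition free_module :: "'r ring \<Rightarrow> 'j set \<Rightarrow> ('r, 'j \<Rightarrow> 'r) module" where
  "free_module R J =
     \<lparr>carrier = {f. (\<forall>j. f j \<in> carrier R) \<and> (\<forall>j. j \<notin> J \<longrightarrow> f j = \<zero>\<^bsub>R\<^esub>) \<and> finite {j. f j \<noteq> \<zero>\<^bsub>R\<^esub>}},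
      mult = undefined, one = undefined, zero = (\<lambda>j. \<zero>\<^bsub>R\<^esub>),
      add = (\<lambda>f g j. f j \<oplus>\<^bsub>R\<^esub> g j), smult = (\<lambda>a f j. a \<otimes>\<^bsub>R\<^esub> f j)\<rparr>"

definition countably_presented :: "'r ring \<Rightarrow> ('r, 'm) module \<Rightarrow> bool" where
  "countably_presented R M \<longleftrightarrow>
     (\<exists>(J :: nat set) G. countable G \<and> G \<subseteq> carrier (free_module R J) \<and>
        module_iso R (quot_module (free_module R J) (span R (free_module R J) G)) M)"

definition projective :: "'v ring \<Rightarrow> ('v, 'v::zfc_universe) module \<Rightarrow> bool" where
  "projective R P \<longleftrightarrow> rmodule R P \<and>
     (\<forall>(A :: ('v, 'v) module) (B :: ('v, 'v) module) g f.
        rmodule R A \<and> rmodule R B \<and> g \<in> module_hom R A B \<and> g ` carrier A = carrier B \<and>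
        f \<in> module_hom R P B \<longrightarrow>
        (\<exists>h\<in>module_hom R P A. \<forall>x\<in>carrier P. g (h x) = f x))"

definition hereditary_ring :: "'v::zfc_universe ring \<Rightarrow> bool" where
  "hereditary_ring R \<longleftrightarrow> ring R \<and>
     (\<forall>P N. projective R P \<and> submodule N R P \<longrightarrow> projective R (submod P N))"


section \<open>Filtrations\<close>

text \<open>The filtration \<open>\<langle>F i : i < \<eta>\<rangle>\<close> is a function on the universe of which only the values at
  \<open>i < \<eta>\<close> matter.\<close>

definition filtration ::
  "'v ring \<Rightarrow> ('v, 'm) module \<Rightarrow> 'v::zfc_universe \<Rightarrow> ('v \<Rightarrow> 'm set) \<Rightarrow> bool" where
  "filtration R M \<eta> F \<longleftrightarrow> Ord \<eta> \<and>
     (\<forall>i\<in>elts \<eta>. submodule (F i) R M) \<and>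
     (\<forall>j\<in>elts \<eta>. \<forall>i\<in>elts j. F i \<subseteq> F j) \<and>
     (\<forall>i\<in>elts \<eta>. Limit i \<longrightarrow> F i = (\<Union>k\<in>elts i. F k)) \<and>
     (\<Union>i\<in>elts \<eta>. F i) = carrier M"

definition filtered ::
  "'v ring \<Rightarrow> ('v, 'v::zfc_universe) module set \<Rightarrow> ('v, 'm) module \<Rightarrow> bool" where
  "filtered R \<C> M \<longleftrightarrow>
     (\<exists>\<eta> F. filtration R M \<eta> F \<and> F vzero = {\<zero>\<^bsub>M\<^esub>} \<and>
        (\<forall>i. vsucc i \<in> elts \<eta> \<longrightarrow>
           (\<exists>N\<in>\<C>. module_iso R (quot_module (submod M (F (vsucc i))) (F i)) N)))"

definition quotient_hereditary ::
  "'v ring \<Rightarrow> ('v, 'v::zfc_universe) module set \<Rightarrow> bool" where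
  "quotient_hereditary R \<C> \<longleftrightarrow>
     (\<forall>(Z' :: ('v, 'v) module) Z. rmodule R Z' \<and> submodule Z R Z' \<and>
        filtered R \<C> (submod Z' Z) \<and> filtered R \<C> (quot_module Z' Z) \<longrightarrow>
        (\<forall>U'. submodule U' R Z' \<longrightarrow>
           filtered R \<C> (submod Z' (U' \<inter> Z)) \<and>
           filtered R \<C> (quot_module (submod Z' U') (U' \<inter> Z))))"


section \<open>The filtration game\<close>

text \<open>\<open>X i\<close> and \<open>Z i\<close> are the moves of Players 1 and 2 at round \<open>i < \<mu>\<close>.\<close>

definition legal1 :: "('v, 'm) module \<Rightarrow> 'v::zfc_universe \<Rightarrow> 'm set \<Rightarrow> bool" where
  "legal1 M \<mu> A \<longleftrightarrow> A \<subseteq> carrier M \<and> A \<prec> elts \<mu>"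

definition legal2 ::
  "'v ring \<Rightarrow> ('v, 'v::zfc_universe) module set \<Rightarrow> ('v, 'm) module \<Rightarrow> 'v \<Rightarrow>
   ('v \<Rightarrow> 'm set) \<Rightarrow> ('v \<Rightarrow> 'm set) \<Rightarrow> 'v \<Rightarrow> bool" where
  "legal2 R \<C> M \<mu> X Z i \<longleftrightarrow>
     Z i \<subseteq> carrier M \<and> Z i \<prec> elts \<mu> \<and>
     X i \<union> (\<Union>k\<in>elts i. Z k) \<subseteq> span R M (Z i) \<and>
     filtered R \<C> (quot_module (submod M (span R M (Z i))) (span R M (\<Union>k\<in>elts i. Z k)))"

text \<open>A player loses by being the first to violate the rules; this covers being unable to move.
  Player 1 can always move legally, so he wins exactly if Player 2 violates the rules first.\<close>

definition player1_wins ::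
  "'v ring \<Rightarrow> ('v, 'v::zfc_universe) module set \<Rightarrow> ('v, 'm) module \<Rightarrow> 'v \<Rightarrow>
   ('v \<Rightarrow> 'm set) \<Rightarrow> ('v \<Rightarrow> 'm set) \<Rightarrow> bool" where
  "player1_wins R \<C> M \<mu> X Z \<longleftrightarrow>
     (\<exists>i\<in>elts \<mu>. (\<forall>k\<in>elts (vsucc i). legal1 M \<mu> (X k)) \<and>
        (\<forall>k\<in>elts i. legal2 R \<C> M \<mu> X Z k) \<and> \<not> legal2 R \<C> M \<mu> X Z i)"

text \<open>A strategy maps the round and the moves made so far, by both players, to the next move.\<close>

definition follows1 where
  "follows1 \<mu> \<sigma> X Z \<longleftrightarrow>
     (\<forall>i\<in>elts (\<mu> :: 'v::zfc_universe).
        X i = (\<sigma> i (restrict X (elts i)) (restrict Z (elts i)) :: 'm set))"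

definition follows2 where
  "follows2 \<mu> \<tau> X Z \<longleftrightarrow>
     (\<forall>i\<in>elts (\<mu> :: 'v::zfc_universe).
        Z i = (\<tau> i (restrict X (elts (vsucc i))) (restrict Z (elts i)) :: 'm set))"

definition filtration_game_determined ::
  "'v ring \<Rightarrow> ('v, 'v::zfc_universe) module set \<Rightarrow> 'v \<Rightarrow> ('v, 'm) module \<Rightarrow> bool" where
  "filtration_game_determined R \<C> \<mu> M \<longleftrightarrow>
     (\<exists>\<sigma>. \<forall>X Z. follows1 \<mu> \<sigma> X Z \<longrightarrow> player1_wins R \<C> M \<mu> X Z) \<or>
     (\<exists>\<tau>. \<forall>X Z. follows2 \<mu> \<tau> X Z \<longrightarrow> \<not> player1_wins R \<C> M \<mu> X Z)"

end

theory Submission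
  imports Defs "HOL-Library.Countable_Set" "HOL-Library.Nat_Bijection"
begin

text \<open>
  Call a countable \<open>a \<subseteq> M\<close> bad if \<open>\<langle>a\<rangle>\<close> is not \<open>\<C>\<close>-filtered or \<open>\<langle>b\<rangle> / \<langle>a\<rangle>\<close> is not \<open>\<C>\<close>-filtered for
  some countable \<open>b \<supseteq> a\<close>.  If the bad sets are nonstationary, Player 2 wins by playing inside a club
  of good sets.  If they are stationary, reflection yields \<open>B \<subseteq> M\<close> of size at most \<open>\<omega>\<^sub>1\<close> that
  contains, for stationarily many bad \<open>a \<subseteq> B\<close>, a witness \<open>b \<subseteq> B\<close> of badness, and Player 1 wins by
  enumerating \<open>B\<close>: if Player 2 survived, \<open>\<langle>B\<rangle>\<close> would be a submodule of a \<open>\<C>\<close>-filtered module, hence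
  \<open>\<C>\<close>-filtered; as the members of \<open>\<C>\<close> are countably presented, a Hill-type argument makes
  \<open>\<langle>B\<rangle> / \<langle>a\<rangle>\<close> \<open>\<C>\<close>-filtered for club many \<open>a\<close>, and quotient-heredity passes this on to \<open>\<langle>b\<rangle> / \<langle>a\<rangle>\<close>.

  Over a hereditary ring the modules filtered by countably presented projectives are exactly the
  projectives (Kaplansky), so this class is quotient-hereditary.  The class \<open>{R}\<close> is not, and the
  free game needs one more case distinction for modules that are not countably generated.  In the
  nonstationary case of the projective game, either above every countable set some \<open>\<langle>c\<rangle>\<close>, \<open>c\<close> in
  the club, still has \<open>R\<close> as a quotient modulo that set, and then Player 2 turns projective steps
  into free ones by the Eilenberg swindle; or this fails above some \<open>b\<^sub>0\<close>, and Player 1 wins within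
  \<open>\<omega>\<close> rounds after playing \<open>b\<^sub>0\<close>.
\<close>


section \<open>Ordinals in the universe\<close>

text \<open>A quotient of M has elements of type \<open>'m set\<close>, so iterated quotients change
  type at every stage. All algebra therefore takes place between submodules A \<subseteq> B of one
  fixed module: \<open>quo\<close> expresses B / A \<cong> K by an epimorphism from B with kernel A,
  \<open>psplit\<close> expresses projectivity of B / A by maps between B and a free module, and
  \<open>filtered\<close> is translated into \<open>Filt\<close> only where the game or
  quotient-heredity requires it. \<open>Filt\<close> has closure under unions of chains in place of
  ordinal indices, so tails and refinements of filtrations need no ordinal arithmetic. Of the two
  kinds of badness, the first concerns Player 2's opening move, from 0 to \<langle>a\<rangle>, the
  second all later moves. Reflection has to be internal because a witness b for a bad a must lie
  inside W: functions enumerating a chosen witness are added to the structure, and W is closed under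
  them, but they help only for those a that are elements of W. The free game borrows its club from
  the projective game, since quotient-heredity is at hand only there.\<close>

lemma elts_not_refl: "x \<notin> elts (x :: 'v::zfc_universe)"
  using wf_not_refl[OF elts_foundation] by blast

lemma elts_not_sym: "x \<in> elts y \<Longrightarrow> y \<notin> elts (x :: 'v::zfc_universe)"
  using wf_not_sym[OF elts_foundation] by blast

lemmas elts_induct = wf_induct_rule[OF elts_foundation, simplified, case_names step]

lemma small_elts [simp]: "small (elts x)"
  by (simp add: small_def)

lemma small_subset: "small B \<Longrightarrow> A \<subseteq> B \<Longrightarrow> small A"
  using small_lepoll subset_imp_lepoll by blast

text \<open>Replacement maps elements to elements and the union axiom unites elements of a set, so
  each set \<open>A i\<close> is first coded as the element \<open>vset (A i)\<close>; its smallness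
  makes the code faithful.\<close>

lemma small_UN:
  fixes I :: "'v::zfc_universe set" and A :: "'v \<Rightarrow> 'v set"
  assumes "small I" "\<And>i. i \<in> I \<Longrightarrow> small (A i)"
  shows "small (\<Union>i\<in>I. A i)"
proof -
  have "small ((\<lambda>i. vset (A i)) ` I)"
    using assms(1) by (rule small_image)
  then obtain x where x: "elts x = (\<lambda>i. vset (A i)) ` I"
    by (auto simp: small_def)
  have "small (\<Union>y\<in>elts x. elts y)"
    unfolding small_def by (rule elts_union)
  also have "(\<Union>y\<in>elts x. elts y) = (\<Union>i\<in>I. A i)"
    using assms(2) by (auto simp: x elts_vset)
  finally show ?thesis .
qed

lemma small_Un:
  assumes "small A" "small (B :: 'v::zfc_universe set)"
  shows "small (A \<union> B)"
proof -
  \<comment> \<open>Two distinct elements of the universe serve as indices, which makes the binary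
    union an instance of \<open>small_UN\<close>.\<close>
  have "small (\<Union>i\<in>{vzero, vsucc vzero :: 'v}. if i = vzero then A else B)"
    by (rule small_UN) (use small_doubleton assms in auto)
  moreover have "vsucc vzero \<noteq> (vzero :: 'v)"
    by (metis elts_vsucc elts_vzero insert_not_empty)
  ultimately show ?thesis
    by (simp add: Un_commute)
qed

lemma small_insert: "small A \<Longrightarrow> small (insert a A)"
  using small_Un[of "{a}" A] small_doubleton[of a a] by simp

section \<open>Order theory of the von Neumann ordinals\<close>

lemma Ord_elt: "Ord \<alpha> \<Longrightarrow> \<beta> \<in> elts \<alpha> \<Longrightarrow> Ord \<beta>"
  unfolding Ord_def by blast

lemma Ord_trans: "Ord \<alpha> \<Longrightarrow> \<beta> \<in> elts \<alpha> \<Longrightarrow> \<gamma> \<in> elts \<beta> \<Longrightarrow> \<gamma> \<in> elts \<alpha>"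
  unfolding Ord_def by blast

lemma OrdI: "(\<And>x. x \<in> elts \<alpha> \<Longrightarrow> Ord x) \<Longrightarrow> (\<And>x. x \<in> elts \<alpha> \<Longrightarrow> elts x \<subseteq> elts \<alpha>) \<Longrightarrow> Ord \<alpha>"
  unfolding Ord_def by blast

text \<open>Nested \<in>-induction: if \<alpha> and \<beta> were incomparable, the outer hypothesis
  would put every element of \<alpha> into \<beta>, the inner one every element of \<beta> into
  \<alpha>, and extensionality would make them equal.\<close>

lemma Ord_linear:
  fixes \<alpha> \<beta> :: "'v::zfc_universe"
  shows "Ord \<alpha> \<Longrightarrow> Ord \<beta> \<Longrightarrow> \<alpha> \<in> elts \<beta> \<or> \<alpha> = \<beta> \<or> \<beta> \<in> elts \<alpha>"
proof (induction \<alpha> arbitrary: \<beta> rule: elts_induct)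
  case (step \<alpha>)
  note IH\<alpha> = step.IH and \<alpha> = step.prems(1)
  show ?case using step.prems(2)
  proof (induction \<beta> rule: elts_induct)
    case (step \<beta>)
    show ?case
    proof (rule ccontr)
      assume neg: "\<not> ?thesis"
      have "elts \<alpha> \<subseteq> elts \<beta>"
      proof
        fix x assume x: "x \<in> elts \<alpha>"
        then have "x \<in> elts \<beta> \<or> x = \<beta> \<or> \<beta> \<in> elts x"
          using IH\<alpha> \<alpha> step.prems Ord_elt by blast
        then show "x \<in> elts \<beta>"
          using neg x Ord_trans[OF \<alpha> x] by blast
      qed
      moreover have "elts \<beta> \<subseteq> elts \<alpha>"
      proof
        fix x assume x: "x \<in> elts \<beta>"
        then have "\<alpha> \<in> elts x \<or> \<alpha> = x \<or> x \<in> elts \<alpha>"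
          using step.IH[OF x] step.prems Ord_elt by blast
        then show "x \<in> elts \<alpha>"
          using neg x Ord_trans[OF step.prems x] by blast
      qed
      ultimately show False
        using neg elts_ext by blast
    qed
  qed
qed

lemma Ord_vzero [simp]: "Ord vzero"
  by (simp add: Ord_def elts_vzero)

lemma Ord_vsucc [simp]: "Ord (vsucc \<alpha>) \<longleftrightarrow> Ord \<alpha>"
proof
  show "Ord (vsucc \<alpha>) \<Longrightarrow> Ord \<alpha>"
    by (erule Ord_elt) (simp add: elts_vsucc)
  show "Ord \<alpha> \<Longrightarrow> Ord (vsucc \<alpha>)"
    by (rule OrdI) (auto simp: elts_vsucc intro: Ord_elt dest: Ord_trans)
qed

lemma vzero_or: "Ord \<alpha> \<Longrightarrow> \<alpha> = vzero \<or> vzero \<in> elts \<alpha>"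
  using Ord_linear[of \<alpha> vzero] by (auto simp: elts_vzero)

lemma vsucc_le: "Ord \<alpha> \<Longrightarrow> \<beta> \<in> elts \<alpha> \<Longrightarrow> vsucc \<beta> = \<alpha> \<or> vsucc \<beta> \<in> elts \<alpha>"
  using Ord_linear[of \<alpha> "vsucc \<beta>"] Ord_elt[of \<alpha> \<beta>] elts_not_sym[of \<beta> \<alpha>] elts_not_refl[of \<beta>]
  by (auto simp: elts_vsucc)

lemma Ord_cases:
  assumes "Ord \<alpha>"
  obtains "\<alpha> = vzero" | \<beta> where "Ord \<beta>" "\<alpha> = vsucc \<beta>" | "Limit \<alpha>"
  using assms vzero_or[of \<alpha>] vsucc_le[of \<alpha>] Ord_elt[of \<alpha>] unfolding Limit_def by metis

lemma vsucc_inj: "vsucc a = vsucc b \<Longrightarrow> a = b"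
  by (metis elts_vsucc elts_not_sym insertE insertI1)

lemma not_Limit_vsucc: "\<not> Limit (vsucc a)"
  using elts_not_refl[of "vsucc a"] elts_vsucc[of a] unfolding Limit_def by blast

lemma not_Limit_vzero: "\<not> Limit vzero"
  by (simp add: Limit_def elts_vzero)

lemma vsucc_not_vzero [simp]: "vsucc a \<noteq> vzero"
  by (metis elts_vsucc elts_vzero insert_not_empty)

text \<open>Burali-Forti: the set of all ordinals would itself be an ordinal. This is what stops the
  transfinite recursion in \<open>Filt_ordinalE\<close>.\<close>

lemma not_small_Ord: "\<not> small {\<alpha> :: 'v::zfc_universe. Ord \<alpha>}"
proof
  assume "small {\<alpha> :: 'v. Ord \<alpha>}"
  then obtain x :: 'v where x: "elts x = {\<alpha>. Ord \<alpha>}"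
    by (auto simp: small_def)
  have "Ord x"
    by (rule OrdI) (use x Ord_elt in blast)+
  then show False
    using x elts_not_refl[of x] by blast
qed

section \<open>Comparison of cardinalities by injections\<close>

lemma lepoll_linear: "A \<lesssim> B \<or> B \<lesssim> A"
  unfolding lepoll_def using ordLeq_total[OF card_of_Well_order card_of_Well_order, of A B]
  unfolding card_of_ordLeq[symmetric] by simp

lemma not_lepoll: "\<not> A \<lesssim> B \<Longrightarrow> B \<prec> A"
  using lepoll_linear[of A B] lesspoll_def lepoll_iff_leqpoll eqpoll_imp_lepoll eqpoll_sym by metis

lemma lesspoll_not_lepoll: "A \<prec> B \<longleftrightarrow> \<not> B \<lesssim> A"
  using not_lepoll lesspoll_trans1 lesspoll_not_refl by metis

lemma infinite_times_lepoll: "infinite A \<Longrightarrow> A \<times> A \<lesssim> A"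
  unfolding lepoll_def using card_of_Times_same_infinite[of A] ordIso_imp_ordLeq card_of_ordLeq
  by blast

lemma UN_lepoll:
  assumes "infinite Y" "I \<lesssim> Y" "\<And>i. i \<in> I \<Longrightarrow> A i \<lesssim> Y"
  shows "(\<Union>i\<in>I. A i) \<lesssim> Y"
proof -
  have "(\<Union>i\<in>I. A i) \<lesssim> Sigma I A"
    by (rule subset_image_lepoll[of _ snd]) force
  also have "\<dots> \<lesssim> I \<times> Y"
    by (rule Sigma_lepoll_mono) (use assms in auto)
  also have "\<dots> \<lesssim> Y \<times> Y"
    using assms by (intro times_lepoll_mono) auto
  also have "\<dots> \<lesssim> Y"
    using assms by (intro infinite_times_lepoll)
  finally show ?thesis .
qed

text \<open>Uniqueness of the Mostowski collapse: by \<in>-induction f fixes every element.\<close>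

lemma transitive_iso_unique:
  fixes \<alpha> \<beta> :: "'v::zfc_universe"
  assumes tr: "\<And>x. x \<in> elts \<alpha> \<Longrightarrow> elts x \<subseteq> elts \<alpha>" "\<And>x. x \<in> elts \<beta> \<Longrightarrow> elts x \<subseteq> elts \<beta>"
    and f: "bij_betw f (elts \<alpha>) (elts \<beta>)"
    and iso: "\<And>x y. x \<in> elts \<alpha> \<Longrightarrow> y \<in> elts \<alpha> \<Longrightarrow> x \<in> elts y \<longleftrightarrow> f x \<in> elts (f y)"
  shows "\<alpha> = \<beta>"
proof -
  have "x \<in> elts \<alpha> \<longrightarrow> f x = x" for x
  proof (induction x rule: elts_induct)
    case (step x)
    show ?case
    proof
      assume x: "x \<in> elts \<alpha>"
      have "elts (f x) = elts x"
      proof (intro subset_antisym subsetI)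
        fix y assume y: "y \<in> elts (f x)"
        then have "y \<in> elts \<beta>"
          using tr(2) f x by (auto simp: bij_betw_def)
        then obtain z where z: "z \<in> elts \<alpha>" "y = f z"
          using f by (auto simp: bij_betw_def)
        then have "z \<in> elts x"
          using iso x y by blast
        then show "y \<in> elts x"
          using step z by auto
      next
        fix y assume y: "y \<in> elts x"
        then have "y \<in> elts \<alpha>"
          using tr(1) x by auto
        then show "y \<in> elts (f x)"
          using step y iso x by metis
      qed
      then show "f x = x"
        by (rule elts_ext)
    qed
  qed
  then have "elts \<alpha> = elts \<beta>"
    using f by (auto simp: bij_betw_def)
  then show ?thesis
    by (rule elts_ext)
qed

text \<open>Subsets of Y are coded by elements of a power set of the universe. Since
  \<open>\<P>\<close> may have any element type, the conclusion is only a bound by some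
  \<open>elts x\<close>; this is how carriers outside the universe are measured.\<close>

lemma small_Pow:
  assumes "small (Y :: 'v::zfc_universe set)" "\<P> \<lesssim> Pow Y"
  shows "\<exists>x :: 'v. \<P> \<lesssim> elts x"
proof -
  obtain y where y: "elts y = Y"
    using assms(1) by (auto simp: small_def)
  have "small {z. elts z \<subseteq> elts y}"
    unfolding small_def by (rule elts_power)
  then obtain x where x: "elts x = {z. elts z \<subseteq> elts y}"
    by (auto simp: small_def)
  have "inj_on vset (Pow Y)"
    by (rule inj_onI) (metis PowD assms(1) elts_vset small_subset)
  moreover have "vset ` Pow Y \<subseteq> elts x"
    using assms(1) by (auto simp: x y elts_vset[OF small_subset])
  ultimately have "Pow Y \<lesssim> elts x"
    unfolding lepoll_def by blast
  then show ?thesis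
    using assms(2) lepoll_trans by blast
qed

text \<open>Hartogs' argument: an injection into Y turns \<alpha> into a well-order of a subset of
  Y, a member of \<open>Pow (Y \<times> Y)\<close>, and by \<open>transitive_iso_unique\<close>
  different ordinals get different codes. As Y is infinite, \<open>Pow (Y \<times> Y)\<close>
  injects into \<open>Pow Y\<close>.\<close>

lemma small_Hartogs:
  fixes Y :: "'v::zfc_universe set"
  assumes "small Y" "infinite Y"
  shows "small {\<alpha> :: 'v. Ord \<alpha> \<and> elts \<alpha> \<lesssim> Y}"
proof -
  let ?D = "{\<alpha> :: 'v. Ord \<alpha> \<and> elts \<alpha> \<lesssim> Y}"
  have "\<forall>\<alpha>\<in>?D. \<exists>e. inj_on e (elts \<alpha>) \<and> e ` elts \<alpha> \<subseteq> Y"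
    by (auto simp: lepoll_def)
  then obtain e where e: "\<And>\<alpha>. \<alpha> \<in> ?D \<Longrightarrow> inj_on (e \<alpha>) (elts \<alpha>)" "\<And>\<alpha>. \<alpha> \<in> ?D \<Longrightarrow> e \<alpha> ` elts \<alpha> \<subseteq> Y"
    by metis
  \<comment> \<open>The order is made reflexive so that the range of \<open>e \<alpha>\<close> can
    be read off as the domain of the code, even if \<alpha> has a single element.\<close>
  define c where "c \<alpha> = {(e \<alpha> \<beta>, e \<alpha> \<gamma>) | \<beta> \<gamma>. \<beta> \<in> elts \<alpha> \<and> \<gamma> \<in> elts \<alpha> \<and> (\<beta> \<in> elts \<gamma> \<or> \<beta> = \<gamma>)}"
    for \<alpha>
  have c: "(e \<alpha> \<beta>, e \<alpha> \<gamma>) \<in> c \<alpha> \<longleftrightarrow> \<beta> \<in> elts \<gamma> \<or> \<beta> = \<gamma>"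
    if "\<alpha> \<in> ?D" "\<beta> \<in> elts \<alpha>" "\<gamma> \<in> elts \<alpha>" for \<alpha> \<beta> \<gamma>
    using that inj_onD[OF e(1)[OF that(1)]] unfolding c_def by blast
  have range: "e \<alpha> ` elts \<alpha> = Domain (c \<alpha>)" if "\<alpha> \<in> ?D" for \<alpha>
    unfolding c_def by blast
  have "inj_on c ?D"
  proof (rule inj_onI)
    fix \<alpha> \<beta> assume D: "\<alpha> \<in> ?D" "\<beta> \<in> ?D" and eq: "c \<alpha> = c \<beta>"
    define f where "f x = inv_into (elts \<beta>) (e \<beta>) (e \<alpha> x)" for x
    have img: "e \<alpha> ` elts \<alpha> = e \<beta> ` elts \<beta>"
      using range D eq by auto
    have f: "f x \<in> elts \<beta>" "e \<beta> (f x) = e \<alpha> x" if "x \<in> elts \<alpha>" for x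
      using that img inv_into_into[of "e \<alpha> x" "e \<beta>" "elts \<beta>"] f_inv_into_f[of "e \<alpha> x" "e \<beta>" "elts \<beta>"]
      unfolding f_def by auto
    have bij: "bij_betw f (elts \<alpha>) (elts \<beta>)"
    proof (intro bij_betw_imageI inj_onI subset_antisym subsetI)
      fix x y assume "x \<in> elts \<alpha>" "y \<in> elts \<alpha>" "f x = f y"
      then show "x = y" using f inj_onD[OF e(1)[OF D(1)]] by metis
    next
      fix y assume y: "y \<in> elts \<beta>"
      then obtain x where "x \<in> elts \<alpha>" "e \<alpha> x = e \<beta> y" using img by (metis imageE imageI)
      then show "y \<in> f ` elts \<alpha>" using f y inj_onD[OF e(1)[OF D(2)]] by (metis imageI)
    qed (use f in auto)
    have cc: "x \<in> elts y \<or> x = y \<longleftrightarrow> f x \<in> elts (f y) \<or> f x = f y" if "x \<in> elts \<alpha>" "y \<in> elts \<alpha>" for x y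
      using c[OF D(1) that] c[OF D(2) f(1)[OF that(1)] f(1)[OF that(2)]] f(2) that eq by simp
    show "\<alpha> = \<beta>"
    proof (rule transitive_iso_unique[OF _ _ bij])
      fix x y assume xy: "x \<in> elts \<alpha>" "y \<in> elts \<alpha>"
      have "x = y \<longleftrightarrow> f x = f y"
        using bij xy by (auto simp: bij_betw_def dest: inj_onD)
      then show "x \<in> elts y \<longleftrightarrow> f x \<in> elts (f y)"
        using cc[OF xy] elts_not_refl by metis
    qed (use D in \<open>auto simp: Ord_def\<close>)
  qed
  moreover have "c ` ?D \<subseteq> Pow (Y \<times> Y)"
    unfolding c_def using e(2) by blast
  ultimately have "?D \<lesssim> Pow (Y \<times> Y)"
    unfolding lepoll_def by blast
  also obtain g where "inj_on g (Y \<times> Y)" "g ` (Y \<times> Y) \<subseteq> Y"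
    using infinite_times_lepoll[OF assms(2)] unfolding lepoll_def by blast
  then have "inj_on (image g) (Pow (Y \<times> Y))" "image g ` Pow (Y \<times> Y) \<subseteq> Pow Y"
    by (auto intro: inj_on_image_Pow)
  then have "Pow (Y \<times> Y) \<lesssim> Pow Y"
    unfolding lepoll_def by blast
  finally show ?thesis
    using small_Pow[OF assms(1)] small_lepoll small_elts by metis
qed

text \<open>\<open>\<theta>\<close> is the successor cardinal of |Y|. Everything rests on one count:
  fewer than |\<open>\<theta>\<close>| initial segments, each of size at most |Y|, do not exhaust
  \<open>\<theta>\<close>, and an ordinal outside their union is a bound.\<close>

lemma regular_Hartogs:
  fixes Y :: "'v::zfc_universe set"
  assumes Y: "small Y" "infinite Y" and \<theta>: "elts \<theta> = {\<alpha> :: 'v. Ord \<alpha> \<and> elts \<alpha> \<lesssim> Y}"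
  shows "regular_cardinal \<theta>" "\<not> elts \<theta> \<lesssim> Y"
    "\<And>A. A \<subseteq> elts \<theta> \<Longrightarrow> A \<prec> elts \<theta> \<Longrightarrow> A \<lesssim> Y"
proof -
  have Ord: "Ord \<theta>"
    by (rule OrdI) (auto simp: \<theta> intro: Ord_elt lepoll_trans[OF subset_imp_lepoll] dest: Ord_trans)
  show *: "\<not> elts \<theta> \<lesssim> Y"
    using Ord \<theta> elts_not_refl[of \<theta>] by blast
  have ins: "insert \<alpha> (elts \<alpha>) \<lesssim> Y" "insert \<alpha> (elts \<alpha>) \<subseteq> elts \<theta>" if "\<alpha> \<in> elts \<theta>" for \<alpha>
  proof -
    have "elts \<alpha> \<lesssim> Y" using that \<theta> by auto
    moreover have "insert \<alpha> (elts \<alpha>) \<lesssim> elts \<alpha> \<or> finite (elts \<alpha>)"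
      by (metis eqpoll_imp_lepoll infinite_insert_eqpoll)
    ultimately show "insert \<alpha> (elts \<alpha>) \<lesssim> Y"
      using lepoll_trans finite_lepoll_infinite[OF Y(2)] by (metis finite_insert)
    show "insert \<alpha> (elts \<alpha>) \<subseteq> elts \<theta>"
      using that Ord_trans[OF Ord that] by blast
  qed
  have bd: "\<exists>\<beta>\<in>elts \<theta>. \<forall>\<alpha>\<in>A. \<alpha> \<in> elts \<beta>"
    if A: "A \<subseteq> elts \<theta>" and U: "(\<Union>\<alpha>\<in>A. insert \<alpha> (elts \<alpha>)) \<noteq> elts \<theta>" for A
  proof -
    have "(\<Union>\<alpha>\<in>A. insert \<alpha> (elts \<alpha>)) \<subseteq> elts \<theta>"
      using A ins(2) by blast
    then obtain \<beta> where \<beta>: "\<beta> \<in> elts \<theta>" "\<beta> \<notin> (\<Union>\<alpha>\<in>A. insert \<alpha> (elts \<alpha>))"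
      using U by blast
    have "\<alpha> \<in> elts \<beta>" if "\<alpha> \<in> A" for \<alpha>
      using Ord_linear[of \<alpha> \<beta>] that A \<theta> \<beta> by blast
    then show ?thesis using \<beta> by blast
  qed
  have U: "(\<Union>\<alpha>\<in>A. insert \<alpha> (elts \<alpha>)) \<noteq> elts \<theta>" if A: "A \<subseteq> elts \<theta>" "A \<prec> elts \<theta>" for A
  proof
    assume eq: "(\<Union>\<alpha>\<in>A. insert \<alpha> (elts \<alpha>)) = elts \<theta>"
    have sub: "insert \<alpha> (elts \<alpha>) \<lesssim> Y" if "\<alpha> \<in> A" for \<alpha>
      using that A(1) ins(1) by blast
    show False
    \<comment> \<open>That A injects into Y is a consequence of the bound being proved, so both
      cases are counted: the union has size at most |Y|, or at most |A|, and both are too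
      small.\<close>
    proof (cases "A \<lesssim> Y")
      case True
      then show ?thesis
        using UN_lepoll[OF Y(2) True, of "\<lambda>\<alpha>. insert \<alpha> (elts \<alpha>)"] sub eq * by auto
    next
      case False
      then have YA: "Y \<lesssim> A" using lepoll_linear by blast
      then have "infinite A" using Y(2) by (meson False finite_lepoll_infinite)
      then have "(\<Union>\<alpha>\<in>A. insert \<alpha> (elts \<alpha>)) \<lesssim> A"
        by (rule UN_lepoll) (use sub YA lepoll_trans in blast)+
      then show False
        using eq A(2) lesspoll_not_lepoll by metis
    qed
  qed
  show "A \<lesssim> Y" if A: "A \<subseteq> elts \<theta>" "A \<prec> elts \<theta>" for A
  proof -
    obtain \<beta> where "\<beta> \<in> elts \<theta>" "A \<subseteq> elts \<beta>"
      using bd[OF A(1) U[OF A]] by blast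
    then show ?thesis
      using \<theta> lepoll_trans subset_imp_lepoll by blast
  qed
  have "Card \<theta>"
    unfolding Card_def using Ord * \<theta> lepoll_trans lesspoll_not_lepoll by blast
  moreover have "infinite (elts \<theta>)"
    using * Y(2) finite_lepoll_infinite by blast
  ultimately show "regular_cardinal \<theta>"
    unfolding regular_cardinal_def by (intro conjI allI impI bd U)
qed

section \<open>Finite ordinals and the first uncountable ordinal\<close>

primrec ord_of :: "nat \<Rightarrow> 'v::zfc_universe" where
  "ord_of 0 = vzero"
| "ord_of (Suc n) = vsucc (ord_of n)"

lemma elts_ord_of: "elts (ord_of n) = ord_of ` {..<n}"
  by (induction n) (auto simp: elts_vzero elts_vsucc lessThan_Suc)

lemma Ord_ord_of [simp]: "Ord (ord_of n)"
  by (induction n) auto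

lemma inj_ord_of: "inj ord_of"
proof (rule linorder_injI)
  show "m < n \<Longrightarrow> (ord_of m :: 'a) \<noteq> ord_of n" for m n
    using elts_ord_of[of n] elts_not_refl by (metis imageI lessThan_iff)
qed

text \<open>Recognizes \<open>omega1\<close> as the Hartogs number of a copy of \<omega> in the
  universe, so that \<open>regular_Hartogs\<close> applies.\<close>

lemma elts_omega1_lepoll:
  "elts (omega1 :: 'v::zfc_universe) = {\<alpha>. Ord \<alpha> \<and> elts \<alpha> \<lesssim> range (ord_of :: nat \<Rightarrow> 'v)}"
proof -
  have "range (ord_of :: nat \<Rightarrow> 'v) \<approx> (UNIV :: nat set)"
    by (rule inj_on_image_eqpoll_self) (rule inj_ord_of)
  then have "A \<lesssim> range (ord_of :: nat \<Rightarrow> 'v) \<longleftrightarrow> A \<lesssim> (UNIV :: nat set)" for A :: "'v set"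
    by (meson eqpoll_sym lepoll_trans2)
  then show ?thesis
    by (auto simp: elts_omega1 countable_def lepoll_def)
qed

lemma small_ord_of: "small (range (ord_of :: nat \<Rightarrow> 'v::zfc_universe))"
  by (rule small_Pow_nat[OF lepoll_trans[OF image_lepoll]]) (use lepoll_Pow_self[of UNIV] in simp)

lemma infinite_ord_of: "infinite (range (ord_of :: nat \<Rightarrow> 'v::zfc_universe))"
  using inj_ord_of finite_imageD by blast

lemmas regular_omega1 = regular_Hartogs[OF small_ord_of infinite_ord_of elts_omega1_lepoll]

lemma Ord_omega1: "Ord (omega1 :: 'v::zfc_universe)"
  using regular_omega1(1) by (auto simp: regular_cardinal_def Card_def)

lemma uncountable_omega1: "uncountable (elts (omega1 :: 'v::zfc_universe))"
  using Ord_omega1 elts_omega1 elts_not_refl by blast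

text \<open>Turns the size restriction on moves in the game of length \<open>omega1\<close> into
  countability.\<close>

lemma lesspoll_omega1_iff: "A \<prec> elts (omega1 :: 'v::zfc_universe) \<longleftrightarrow> countable A"
proof
  assume A: "A \<prec> elts (omega1 :: 'v)"
  then obtain f where f: "inj_on f A" "f ` A \<subseteq> elts (omega1 :: 'v)"
    unfolding lesspoll_def lepoll_def by blast
  moreover have "f ` A \<prec> elts (omega1 :: 'v)"
    using f(1) A by simp
  ultimately have "f ` A \<lesssim> range (ord_of :: nat \<Rightarrow> 'v)"
    using regular_omega1(3) by blast
  then have "countable (f ` A)"
    by (rule countable_lepoll[rotated]) simp
  then show "countable A"
    using f(1) countable_image_inj_on by blast
next
  assume "countable A"
  then show "A \<prec> elts (omega1 :: 'v)"
    using uncountable_omega1 countable_lepoll lesspoll_not_lepoll by blast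
qed

lemma ord_of_in_omega1: "ord_of n \<in> elts omega1"
  by (auto simp: elts_omega1 elts_ord_of intro: countable_finite)

lemma vsucc_in_omega1: "i \<in> elts omega1 \<Longrightarrow> vsucc i \<in> elts omega1"
  by (auto simp: elts_omega1 elts_vsucc)

section \<open>Transitive closures and the structures \<open>Hset \<theta>\<close>\<close>

lemma trcl_subset: "y \<in> elts x \<Longrightarrow> trcl y \<subseteq> trcl x"
  unfolding trcl_def by (auto intro: trancl_into_trancl)

lemma elts_subset_trcl: "elts x \<subseteq> trcl x"
  unfolding trcl_def by auto

lemma small_trcl: "small (trcl (x :: 'v::zfc_universe))"
proof (induction x rule: elts_induct)
  case (step x)
  have "trcl x = elts x \<union> (\<Union>y\<in>elts x. trcl y)"
  proof (intro subset_antisym subsetI)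
    fix z assume "z \<in> trcl x"
    then show "z \<in> elts x \<union> (\<Union>y\<in>elts x. trcl y)"
      unfolding trcl_def by (auto elim: tranclE)
  qed (use trcl_subset elts_subset_trcl in blast)
  also have "\<dots> = (\<Union>y\<in>elts x. insert y (trcl y))"
    by blast
  also have "small \<dots>"
    by (rule small_UN) (use step in \<open>auto intro: small_insert\<close>)
  finally show ?case .
qed

text \<open>\<open>\<theta>\<close> is the successor cardinal of the transitive closure of X; the
  finite ordinals are adjoined to have an infinite set for the Hartogs construction.\<close>

lemma obtain_regular:
  fixes X :: "'v::zfc_universe"
  obtains \<theta> where "regular_cardinal \<theta>" "X \<in> Hset \<theta>" "elts X \<subseteq> Hset \<theta>"
proof -
  let ?Y = "trcl X \<union> range ord_of"
  have Y: "small ?Y" "infinite ?Y"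
    using small_Un[OF small_trcl small_ord_of] infinite_ord_of by auto
  obtain \<theta> where \<theta>: "elts \<theta> = {\<alpha> :: 'v. Ord \<alpha> \<and> elts \<alpha> \<lesssim> ?Y}"
    using elts_vset[OF small_Hartogs[OF Y]] by blast
  have "\<not> elts \<theta> \<lesssim> trcl X"
    using regular_Hartogs(2)[OF Y \<theta>] by (meson Un_upper1 lepoll_trans subset_imp_lepoll)
  then have X: "X \<in> Hset \<theta>"
    by (simp add: Hset_def not_lepoll)
  then have "elts X \<subseteq> Hset \<theta>"
    unfolding Hset_def using trcl_subset lesspoll_trans1 subset_imp_lepoll by blast
  then show thesis
    using that regular_Hartogs(1)[OF Y \<theta>] X by blast
qed

section \<open>Transfinite towers\<close>

text \<open>A filtration without indices; the members of the family need not form a chain.\<close>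

definition Filt :: "('a set \<Rightarrow> 'a set \<Rightarrow> bool) \<Rightarrow> 'a set \<Rightarrow> 'a set \<Rightarrow> bool" where
  "Filt Q A B \<longleftrightarrow> (\<exists>\<F>. A \<in> \<F> \<and> (\<forall>N\<in>\<F>. A \<subseteq> N \<and> N \<subseteq> B) \<and>
     (\<forall>\<G>\<subseteq>\<F>. \<G> \<noteq> {} \<and> chain\<^sub>\<subseteq> \<G> \<longrightarrow> \<Union>\<G> \<in> \<F>) \<and>
     (\<forall>N\<in>\<F>. N \<noteq> B \<longrightarrow> (\<exists>N'\<in>\<F>. N \<subset> N' \<and> Q N N')))"

lemma FiltE:
  assumes "Filt Q A B"
  obtains \<F> where "A \<in> \<F>" "\<And>N. N \<in> \<F> \<Longrightarrow> A \<subseteq> N" "\<And>N. N \<in> \<F> \<Longrightarrow> N \<subseteq> B"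
    "\<And>\<G>. \<G> \<subseteq> \<F> \<Longrightarrow> \<G> \<noteq> {} \<Longrightarrow> chain\<^sub>\<subseteq> \<G> \<Longrightarrow> \<Union>\<G> \<in> \<F>"
    "\<And>N. N \<in> \<F> \<Longrightarrow> N \<noteq> B \<Longrightarrow> \<exists>N'\<in>\<F>. N \<subset> N' \<and> Q N N'"
proof -
  obtain \<F> where "A \<in> \<F> \<and> (\<forall>N\<in>\<F>. A \<subseteq> N \<and> N \<subseteq> B) \<and>
     (\<forall>\<G>\<subseteq>\<F>. \<G> \<noteq> {} \<and> chain\<^sub>\<subseteq> \<G> \<longrightarrow> \<Union>\<G> \<in> \<F>) \<and>
     (\<forall>N\<in>\<F>. N \<noteq> B \<longrightarrow> (\<exists>N'\<in>\<F>. N \<subset> N' \<and> Q N N'))"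
    using assms unfolding Filt_def by (elim exE)
  then show thesis
    by (intro that[of \<F>]) simp_all
qed

lemma FiltI:
  assumes "A \<in> \<F>" "\<And>N. N \<in> \<F> \<Longrightarrow> A \<subseteq> N" "\<And>N. N \<in> \<F> \<Longrightarrow> N \<subseteq> B"
    "\<And>\<G>. \<G> \<subseteq> \<F> \<Longrightarrow> \<G> \<noteq> {} \<Longrightarrow> chain\<^sub>\<subseteq> \<G> \<Longrightarrow> \<Union>\<G> \<in> \<F>"
    "\<And>N. N \<in> \<F> \<Longrightarrow> N \<noteq> B \<Longrightarrow> \<exists>N'\<in>\<F>. N \<subset> N' \<and> Q N N'"
  shows "Filt Q A B"
  unfolding Filt_def by (rule exI[of _ \<F>]) (use assms in simp)

lemma Filt_subset: "Filt Q A B \<Longrightarrow> A \<subseteq> B"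
  unfolding Filt_def by auto

lemma Filt_mono:
  assumes "Filt Q A B" "\<And>N N'. A \<subseteq> N \<Longrightarrow> N \<subset> N' \<Longrightarrow> N' \<subseteq> B \<Longrightarrow> Q N N' \<Longrightarrow> Q' N N'"
  shows "Filt Q' A B"
proof -
  obtain \<F> where \<F>: "A \<in> \<F>" "\<And>N. N \<in> \<F> \<Longrightarrow> A \<subseteq> N" "\<And>N. N \<in> \<F> \<Longrightarrow> N \<subseteq> B"
    "\<And>\<G>. \<G> \<subseteq> \<F> \<Longrightarrow> \<G> \<noteq> {} \<Longrightarrow> chain\<^sub>\<subseteq> \<G> \<Longrightarrow> \<Union>\<G> \<in> \<F>"
    "\<And>N. N \<in> \<F> \<Longrightarrow> N \<noteq> B \<Longrightarrow> \<exists>N'\<in>\<F>. N \<subset> N' \<and> Q N N'"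
    by (rule FiltE[OF assms(1)]) (rule that)
  show ?thesis
  proof (rule FiltI[of _ \<F>])
    fix N assume "N \<in> \<F>" "N \<noteq> B"
    then obtain N' where "N' \<in> \<F>" "N \<subset> N'" "Q N N'" using \<F>(5) by blast
    then show "\<exists>N'\<in>\<F>. N \<subset> N' \<and> Q' N N'"
      using assms(2) \<F>(2,3) \<open>N \<in> \<F>\<close> by meson
  qed (use \<F> in simp_all)
qed

lemma Filt_refl [simp]: "Filt Q A A"
  by (rule FiltI[of _ "{A}"]) auto

lemma Filt_step:
  assumes "A \<subseteq> B" "Q A B"
  shows "Filt Q A B"
proof (cases "A = B")
  case False
  show ?thesis
  proof (rule FiltI[of _ "{A, B}"])
    fix \<G> assume "\<G> \<subseteq> {A, B}" "\<G> \<noteq> {}"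
    then have "\<G> = {A} \<or> \<G> = {B} \<or> \<G> = {A, B}" by blast
    then show "\<Union>\<G> \<in> {A, B}" using assms(1) by auto
  qed (use assms False in auto)
qed simp

text \<open>Members of the family that do not contain N are discarded; the rest stays closed under
  unions of chains. It serves to isolate a first nonzero quotient.\<close>

lemma Filt_split:
  assumes "Filt Q A B" "A \<noteq> B"
  obtains N where "A \<subset> N" "Q A N" "Filt Q N B"
proof -
  obtain \<F> where \<F>: "A \<in> \<F>" "\<And>N. N \<in> \<F> \<Longrightarrow> A \<subseteq> N" "\<And>N. N \<in> \<F> \<Longrightarrow> N \<subseteq> B"
    "\<And>\<G>. \<G> \<subseteq> \<F> \<Longrightarrow> \<G> \<noteq> {} \<Longrightarrow> chain\<^sub>\<subseteq> \<G> \<Longrightarrow> \<Union>\<G> \<in> \<F>"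
    "\<And>N. N \<in> \<F> \<Longrightarrow> N \<noteq> B \<Longrightarrow> \<exists>N'\<in>\<F>. N \<subset> N' \<and> Q N N'"
    by (rule FiltE[OF assms(1)]) (rule that)
  obtain N where N: "N \<in> \<F>" "A \<subset> N" "Q A N"
    using \<F>(1,5) assms(2) by blast
  have "Filt Q N B"
  proof (rule FiltI[of _ "{K \<in> \<F>. N \<subseteq> K}"])
    fix \<G> assume "\<G> \<subseteq> {K \<in> \<F>. N \<subseteq> K}" "\<G> \<noteq> {}" "chain\<^sub>\<subseteq> \<G>"
    then show "\<Union>\<G> \<in> {K \<in> \<F>. N \<subseteq> K}"
      using \<F>(4)[of \<G>] by blast
  next
    fix K assume "K \<in> {K \<in> \<F>. N \<subseteq> K}" "K \<noteq> B"
    then show "\<exists>N'\<in>{K \<in> \<F>. N \<subseteq> K}. K \<subset> N' \<and> Q K N'"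
      using \<F>(5)[of K] by blast
  qed (use N \<F> in auto)
  then show thesis using that N by blast
qed

text \<open>The coarse family \<open>\<Q>\<close> is refined by a filtration between each N and its
  least proper successor in \<open>\<Q>\<close>. Closure of \<open>\<Q>\<close> under all nonempty
  unions, not only unions of chains, yields a largest member below any set containing A, and this
  decides in which inserted filtration a chain ends.\<close>

lemma Filt_compose:
  assumes A: "A \<in> \<Q>" and bd: "\<And>N. N \<in> \<Q> \<Longrightarrow> A \<subseteq> N" "\<And>N. N \<in> \<Q> \<Longrightarrow> N \<subseteq> B"
    and un: "\<And>\<G>. \<G> \<subseteq> \<Q> \<Longrightarrow> \<G> \<noteq> {} \<Longrightarrow> \<Union>\<G> \<in> \<Q>"
    and step: "\<And>N. N \<in> \<Q> \<Longrightarrow> N \<noteq> B \<Longrightarrow>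
      \<exists>N'\<in>\<Q>. N \<subset> N' \<and> Filt Q N N' \<and> (\<forall>K\<in>\<Q>. N \<subset> K \<longrightarrow> N' \<subseteq> K)"
  shows "Filt Q A B"
proof -
  obtain nx where nx: "\<And>N. N \<in> \<Q> \<Longrightarrow> N \<noteq> B \<Longrightarrow> nx N \<in> \<Q> \<and> N \<subset> nx N \<and> Filt Q N (nx N)"
    "\<And>N K. N \<in> \<Q> \<Longrightarrow> N \<noteq> B \<Longrightarrow> K \<in> \<Q> \<Longrightarrow> N \<subset> K \<Longrightarrow> nx N \<subseteq> K"
    using step by metis
  define ok where "ok \<F> N \<longleftrightarrow> N \<in> \<F> \<and> (\<forall>K\<in>\<F>. N \<subseteq> K \<and> K \<subseteq> nx N) \<and>
     (\<forall>\<G>\<subseteq>\<F>. \<G> \<noteq> {} \<and> chain\<^sub>\<subseteq> \<G> \<longrightarrow> \<Union>\<G> \<in> \<F>) \<and>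
     (\<forall>K\<in>\<F>. K \<noteq> nx N \<longrightarrow> (\<exists>N'\<in>\<F>. K \<subset> N' \<and> Q K N'))" for \<F> N
  have "\<exists>\<F>. ok \<F> N" if "N \<in> \<Q>" "N \<noteq> B" for N
    using nx(1)[OF that] unfolding Filt_def ok_def by blast
  then obtain fam where "\<And>N. N \<in> \<Q> \<Longrightarrow> N \<noteq> B \<Longrightarrow> ok (fam N) N"
    by metis
  then have fam: "N \<in> fam N" "\<And>K. K \<in> fam N \<Longrightarrow> N \<subseteq> K" "\<And>K. K \<in> fam N \<Longrightarrow> K \<subseteq> nx N"
      "\<And>\<G>. \<G> \<subseteq> fam N \<Longrightarrow> \<G> \<noteq> {} \<Longrightarrow> chain\<^sub>\<subseteq> \<G> \<Longrightarrow> \<Union>\<G> \<in> fam N"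
      "\<And>K. K \<in> fam N \<Longrightarrow> K \<noteq> nx N \<Longrightarrow> \<exists>N'\<in>fam N. K \<subset> N' \<and> Q K N'"
    if "N \<in> \<Q>" "N \<noteq> B" for N
    using that unfolding ok_def by simp_all
  let ?F = "\<Q> \<union> (\<Union>N\<in>\<Q> - {B}. fam N)"
  have bd': "A \<subseteq> K" "K \<subseteq> B" if K: "K \<in> ?F" for K
  proof (atomize (full), cases "K \<in> \<Q>")
    case False
    then obtain N where N: "N \<in> \<Q>" "N \<noteq> B" "K \<in> fam N" using K by blast
    then have "nx N \<in> \<Q>" using nx(1) by simp
    then show "A \<subseteq> K \<and> K \<subseteq> B"
      using fam(2,3)[OF N] bd(1)[OF N(1)] bd(2)[of "nx N"] by blast
  qed (use bd in simp)
  have step': "\<exists>N'\<in>?F. N \<subset> N' \<and> Q N N'" if N: "N \<in> \<Q>" "N \<noteq> B" for N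
  proof -
    have "N \<noteq> nx N" using nx(1)[OF N] by blast
    then obtain N' where "N' \<in> fam N" "N \<subset> N'" "Q N N'"
      using fam(5)[OF N fam(1)[OF N]] by blast
    then show ?thesis using N by blast
  qed
  show ?thesis
  proof (rule FiltI[of _ ?F])
    fix K assume K: "K \<in> ?F" "K \<noteq> B"
    show "\<exists>N'\<in>?F. K \<subset> N' \<and> Q K N'"
    proof (cases "K \<in> \<Q>")
      case False
      then obtain N where N: "N \<in> \<Q>" "N \<noteq> B" "K \<in> fam N" using K by blast
      then have "K \<noteq> nx N" using nx(1) False by metis
      then obtain N' where "N' \<in> fam N" "K \<subset> N'" "Q K N'" using fam(5) N by blast
      then show ?thesis using N by blast
    qed (use step' K in blast)
  next
    fix K assume K: "K \<in> ?F"
    show "A \<subseteq> K" "K \<subseteq> B" using bd'[OF K] by simp_all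
  next
    fix \<G> assume \<G>: "\<G> \<subseteq> ?F" "\<G> \<noteq> {}" "chain\<^sub>\<subseteq> \<G>"
    let ?U = "\<Union>\<G>"
    \<comment> \<open>\<open>Q0\<close> is the largest coarse member inside \<open>?U\<close>. A
      member of the chain not contained in \<open>Q0\<close> comes from the filtration inserted
      above \<open>Q0\<close>: had it been inserted above a smaller N, it would stay below
      \<open>nx N\<close>, hence below \<open>Q0\<close>.\<close>
    define Q0 where "Q0 = \<Union>{N \<in> \<Q>. N \<subseteq> ?U}"
    have "A \<subseteq> G" if "G \<in> \<G>" for G
      using \<G>(1) that bd' by blast
    then have "A \<subseteq> ?U" using \<G>(2) by blast
    then have Q0: "Q0 \<in> \<Q>" unfolding Q0_def using A by (intro un) blast+
    have Q0U: "Q0 \<subseteq> ?U" unfolding Q0_def by blast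
    have max: "N \<subseteq> Q0" if "N \<in> \<Q>" "N \<subseteq> ?U" for N
      using that unfolding Q0_def by blast
    show "?U \<in> ?F"
    proof (cases "Q0 = ?U")
      case False
      have "G \<subseteq> B" if "G \<in> \<G>" for G
        using \<G>(1) that bd' by blast
      then have Q0B: "Q0 \<noteq> B" using False Q0U by blast
      define \<H> where "\<H> = {G \<in> \<G>. \<not> G \<subseteq> Q0}"
      have \<H>: "\<H> \<subseteq> fam Q0"
      proof
        fix G assume "G \<in> \<H>"
        then have G: "G \<in> \<G>" "\<not> G \<subseteq> Q0" by (auto simp: \<H>_def)
        then have "G \<notin> \<Q>" using max by blast
        then obtain N where N: "N \<in> \<Q>" "N \<noteq> B" "G \<in> fam N" using G \<G>(1) by blast
        then have "N \<subseteq> Q0" using max fam(2)[of N] G by blast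
        have "N = Q0"
        proof (rule ccontr)
          assume "N \<noteq> Q0"
          then have "nx N \<subseteq> Q0" using nx(2)[OF N(1,2) Q0] \<open>N \<subseteq> Q0\<close> by blast
          then show False using fam(3)[OF N] G by blast
        qed
        then show "G \<in> fam Q0" using N by simp
      qed
      have ne: "\<H> \<noteq> {}" using False Q0U unfolding \<H>_def by blast
      have "?U = \<Union>\<H>"
        using ne \<H> fam(2)[OF Q0 Q0B] unfolding \<H>_def by blast
      also have "\<Union>\<H> \<in> fam Q0"
        using fam(4)[OF Q0 Q0B \<H> ne] \<G>(3) unfolding \<H>_def chain_subset_def by blast
      finally show ?thesis using Q0 Q0B by blast
    qed (use Q0 in simp)
  qed (use A in blast)
qed

section \<open>Filtrations indexed by ordinals\<close>

lemma chain_image: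
  assumes "\<And>i. i \<in> I \<Longrightarrow> Ord i" "\<And>i j. i \<in> I \<Longrightarrow> j \<in> I \<Longrightarrow> i \<in> elts j \<Longrightarrow> F i \<subseteq> F j"
  shows "chain\<^sub>\<subseteq> (F ` I)"
  unfolding chain_subset_def
proof (intro ballI)
  fix C D assume "C \<in> F ` I" "D \<in> F ` I"
  then obtain i j where "i \<in> I" "j \<in> I" "C = F i" "D = F j" by blast
  then show "C \<subseteq> D \<or> D \<subseteq> C"
    using assms Ord_linear[of i j] by blast
qed

lemma elts_least:
  fixes P :: "'v::zfc_universe \<Rightarrow> bool"
  assumes "P i"
  obtains j where "P j" "\<And>k. k \<in> elts j \<Longrightarrow> \<not> P k"
  using assms elts_foundation[unfolded wf_eq_minimal, rule_format, of i "Collect P"] by auto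

text \<open>The coarse family for \<open>Filt_compose\<close> consists of the values of F and of B,
  which is adjoined because it is the union of the values and need not be one of them.\<close>

lemma Filt_ordinal:
  fixes \<eta> :: "'v::zfc_universe"
  assumes \<eta>: "Ord \<eta>" "vzero \<in> elts \<eta>"
    and F: "F vzero = A" "\<And>i j. j \<in> elts \<eta> \<Longrightarrow> i \<in> elts j \<Longrightarrow> F i \<subseteq> F j"
      "\<And>i. i \<in> elts \<eta> \<Longrightarrow> Limit i \<Longrightarrow> F i = (\<Union>k\<in>elts i. F k)"
      "(\<Union>i\<in>elts \<eta>. F i) = B"
    and step: "\<And>i. vsucc i \<in> elts \<eta> \<Longrightarrow> Filt Q (F i) (F (vsucc i))"
  shows "Filt Q A B"
proof -
  have mono: "F i \<subseteq> F j \<or> j \<in> elts i" if "i \<in> elts \<eta>" "j \<in> elts \<eta>" for i j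
    using that Ord_linear[of i j] Ord_elt[OF \<eta>(1)] F(2) by blast
  have A: "A \<subseteq> F i" if "i \<in> elts \<eta>" for i
    using vzero_or[of i] Ord_elt[OF \<eta>(1) that] F(1,2) that by auto
  \<comment> \<open>The least index whose value is not contained in U is neither zero nor a limit,
    hence some \<open>vsucc k\<close>, and every value is at most \<open>F k\<close> or at least
    \<open>F (vsucc k)\<close>. This gives both the unions of subfamilies and the least successors
    of members, even if F is constant for long stretches.\<close>
  have key: "\<exists>k. vsucc k \<in> elts \<eta> \<and> F k \<subseteq> U \<and> \<not> F (vsucc k) \<subseteq> U \<and>
      (\<forall>i\<in>elts \<eta>. F i \<subseteq> F k \<or> F (vsucc k) \<subseteq> F i)"
    if U: "A \<subseteq> U" "\<not> B \<subseteq> U" for U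
  proof -
    obtain i where "i \<in> elts \<eta> \<and> \<not> F i \<subseteq> U"
      using U(2) F(4) by blast
    then obtain j where j: "j \<in> elts \<eta>" "\<not> F j \<subseteq> U"
      and min: "\<And>k. k \<in> elts j \<Longrightarrow> \<not> (k \<in> elts \<eta> \<and> \<not> F k \<subseteq> U)"
      by (rule elts_least) blast
    have below: "F k \<subseteq> U" if "k \<in> elts j" for k
      using min[OF that] Ord_trans[OF \<eta>(1) j(1) that] by blast
    obtain k where k: "j = vsucc k"
    proof (rule Ord_cases[OF Ord_elt[OF \<eta>(1) j(1)]])
      assume "j = vzero" then show thesis using j(2) U(1) F(1) by simp
    next
      assume "Limit j" then show thesis using F(3)[OF j(1)] j(2) below by blast
    qed (rule that)
    have kj: "k \<in> elts j" using k by (simp add: elts_vsucc)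
    have "F i \<subseteq> F k \<or> F j \<subseteq> F i" if i: "i \<in> elts \<eta>" for i
    proof (cases "i \<in> elts j")
      case True
      then have "i = k \<or> i \<in> elts k" using k by (auto simp: elts_vsucc)
      then show ?thesis using F(2) Ord_trans[OF \<eta>(1) j(1) kj] by auto
    qed (use mono[OF j(1) i] in blast)
    then show ?thesis using j below[OF kj] k by blast
  qed
  let ?Q = "insert B (F ` elts \<eta>)"
  show ?thesis
  proof (rule Filt_compose[of _ ?Q])
    fix \<G> assume \<G>: "\<G> \<subseteq> ?Q" "\<G> \<noteq> {}"
    show "\<Union>\<G> \<in> ?Q"
    proof (cases "B \<subseteq> \<Union>\<G>")
      case True
      have "\<Union>\<G> \<subseteq> B" using \<G>(1) F(4) by blast
      then have "\<Union>\<G> = B" using True by blast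
      then show ?thesis by simp
    next
      case False
      have \<G>F: "\<G> \<subseteq> F ` elts \<eta>" using \<G>(1) False by blast
      then have "A \<subseteq> \<Union>\<G>" using \<G>(2) A by blast
      then obtain k where k: "vsucc k \<in> elts \<eta>" "F k \<subseteq> \<Union>\<G>" "\<not> F (vsucc k) \<subseteq> \<Union>\<G>"
        "\<forall>i\<in>elts \<eta>. F i \<subseteq> F k \<or> F (vsucc k) \<subseteq> F i"
        using key[OF _ False] by blast
      have "\<Union>\<G> \<subseteq> F k" using k \<G>F by blast
      then have "\<Union>\<G> = F k" using k(2) by blast
      moreover have "k \<in> elts \<eta>" using Ord_trans[OF \<eta>(1) k(1)] by (simp add: elts_vsucc)
      ultimately show ?thesis by blast
    qed
  next
    fix N assume N: "N \<in> ?Q" "N \<noteq> B"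
    then obtain i where i: "i \<in> elts \<eta>" "N = F i" by blast
    then have "\<not> B \<subseteq> N" using N F(4) by blast
    then obtain k where k: "vsucc k \<in> elts \<eta>" "F k \<subseteq> N" "\<not> F (vsucc k) \<subseteq> N"
        "\<forall>i\<in>elts \<eta>. F i \<subseteq> F k \<or> F (vsucc k) \<subseteq> F i"
      using key[of N] A i by blast
    then have "N = F k" using i by blast
    have "k \<in> elts (vsucc k)" by (simp add: elts_vsucc)
    then have "F k \<subseteq> F (vsucc k)" using F(2) k(1) by blast
    moreover have "F (vsucc k) \<subseteq> K" if "K \<in> ?Q" "N \<subset> K" for K
      using that k(1,4) F(4) \<open>N = F k\<close> by blast
    ultimately show "\<exists>N'\<in>?Q. N \<subset> N' \<and> Filt Q N N' \<and> (\<forall>K\<in>?Q. N \<subset> K \<longrightarrow> N' \<subseteq> K)"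
      using k step[OF k(1)] \<open>N = F k\<close> by (intro bexI[of _ "F (vsucc k)"]) auto
  qed (use A F \<eta> in \<open>auto intro!: image_eqI[of _ F vzero]\<close>)
qed

text \<open>The sequence is moved to the indices \<open>ord_of n\<close>; none of them is a limit,
  so continuity is vacuous.\<close>

lemma Filt_nat:
  fixes N :: "nat \<Rightarrow> 'v::zfc_universe set"
  assumes "\<And>n. N n \<subseteq> N (Suc n)" "\<And>n. Filt Q (N n) (N (Suc n))"
  shows "Filt Q (N 0) (\<Union>n. N n)"
proof -
  obtain w :: 'v where w: "elts w = range ord_of"
    using small_ord_of by (auto simp: small_def)
  define F where "F i = N (inv_into UNIV ord_of i)" for i :: 'v
  have F: "F (ord_of n) = N n" for n
    unfolding F_def by (simp add: inj_ord_of)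
  have FS: "F (vsucc (ord_of n)) = N (Suc n)" for n
    using F[of "Suc n"] by simp
  have mono: "m \<le> n \<Longrightarrow> N m \<subseteq> N n" for m n
    using assms(1) by (rule lift_Suc_mono_le)
  have lim: "\<not> Limit (ord_of n :: 'v)" for n
    by (cases n) (auto simp: not_Limit_vzero not_Limit_vsucc)
  have sm: "(ord_of m :: 'v) \<in> elts (ord_of n) \<longleftrightarrow> m < n" for m n
    unfolding elts_ord_of by (simp add: inj_image_mem_iff[OF inj_ord_of])
  show ?thesis
  proof (rule Filt_ordinal[of w F])
    show "Ord w"
      by (rule OrdI) (auto simp: w elts_ord_of)
    show "vzero \<in> elts w"
      unfolding w by (rule range_eqI[of _ _ 0]) simp
    show "F vzero = N 0"
      using F[of 0] by simp
    show "Limit i \<Longrightarrow> i \<in> elts w \<Longrightarrow> F i = (\<Union>k\<in>elts i. F k)" for i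
      using lim w by auto
    show "\<Union> (F ` elts w) = \<Union> (range N)"
      using F w by auto
    show "F i \<subseteq> F j" if "j \<in> elts w" "i \<in> elts j" for i j
    proof -
      obtain n where "j = ord_of n" using \<open>j \<in> elts w\<close> w by blast
      moreover then obtain m where "i = ord_of m" "m < n"
        using \<open>i \<in> elts j\<close> elts_ord_of by blast
      ultimately have "F i = N m" "F j = N n" "m < n" using F by simp_all
      then show ?thesis using mono by simp
    qed
    show "Filt Q (F i) (F (vsucc i))" if i: "vsucc i \<in> elts w" for i
    proof -
      obtain n where n: "vsucc i = ord_of n" using i w by auto
      then obtain m where "n = Suc m" by (cases n) auto
      then have "i = ord_of m" using n vsucc_inj by auto
      then show ?thesis using assms(2)[of m] F FS by simp
    qed
  qed
qed

text \<open>Converse of \<open>Filt_ordinal\<close>: a next member is chosen again and again along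
  the ordinals. If B were never reached, the growth would be strict and would inject the class of
  ordinals into \<open>Pow B\<close>, which \<open>B \<lesssim> elts x\<close> excludes.\<close>

lemma Filt_ordinalE:
  fixes x :: "'v::zfc_universe"
  assumes "Filt Q A B" "B \<lesssim> elts x"
  obtains \<eta> :: 'v and F where "Ord \<eta>" "vzero \<in> elts \<eta>"
    "F vzero = A" "\<And>i j. j \<in> elts \<eta> \<Longrightarrow> i \<in> elts j \<Longrightarrow> F i \<subseteq> F j"
      "\<And>i. i \<in> elts \<eta> \<Longrightarrow> Limit i \<Longrightarrow> F i = (\<Union>k\<in>elts i. F k)"
      "(\<Union>i\<in>elts \<eta>. F i) = B" "\<And>i. vsucc i \<in> elts \<eta> \<Longrightarrow> F i \<noteq> F (vsucc i) \<and> Q (F i) (F (vsucc i))"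
proof -
  obtain \<F> where \<F>: "A \<in> \<F>" "\<And>N. N \<in> \<F> \<Longrightarrow> A \<subseteq> N" "\<And>N. N \<in> \<F> \<Longrightarrow> N \<subseteq> B"
    "\<And>\<G>. \<G> \<subseteq> \<F> \<Longrightarrow> \<G> \<noteq> {} \<Longrightarrow> chain\<^sub>\<subseteq> \<G> \<Longrightarrow> \<Union>\<G> \<in> \<F>"
    "\<And>N. N \<in> \<F> \<Longrightarrow> N \<noteq> B \<Longrightarrow> \<exists>N'\<in>\<F>. N \<subset> N' \<and> Q N N'"
    by (rule FiltE[OF assms(1)]) (rule that)
  obtain nx where nx: "\<And>N. N \<in> \<F> \<Longrightarrow> N \<noteq> B \<Longrightarrow> nx N \<in> \<F> \<and> N \<subset> nx N \<and> Q N (nx N)"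
    using \<F>(5) by metis
  define st where "st N = (if N = B then B else nx N)" for N
  \<comment> \<open>One formula covers all indices: A united with \<open>st\<close> of all earlier
    values. The zero, successor and limit clauses are recovered afterwards. Since \<open>st\<close>
    fixes B, the recursion runs through all ordinals.\<close>
  define F where "F = wfrec {(x, y). x \<in> elts y} (\<lambda>f (\<alpha> :: 'v). A \<union> (\<Union>\<beta>\<in>elts \<alpha>. st (f \<beta>)))"
  have F: "F \<alpha> = A \<union> (\<Union>\<beta>\<in>elts \<alpha>. st (F \<beta>))" for \<alpha>
    unfolding F_def by (subst wfrec[OF elts_foundation]) (simp add: cut_apply)
  have st: "st N \<in> \<F>" "N \<subseteq> st N" if "N \<in> \<F>" for N
    using nx[OF that] that by (auto simp: st_def)
  have F0: "F vzero = A"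
    by (subst F) (simp add: elts_vzero)
  have all: "(Ord \<alpha> \<longrightarrow> F \<alpha> \<in> \<F>) \<and> (\<forall>\<beta>. Ord \<beta> \<and> \<alpha> = vsucc \<beta> \<longrightarrow> F \<alpha> = st (F \<beta>)) \<and>
    (Limit \<alpha> \<longrightarrow> F \<alpha> = (\<Union>\<beta>\<in>elts \<alpha>. F \<beta>))" for \<alpha>
  proof (induction \<alpha> rule: elts_induct)
    case (step \<alpha>)
    have mem: "F \<beta> \<in> \<F>" if "\<beta> \<in> elts \<alpha>" "Ord \<alpha>" for \<beta>
      using step(1)[OF that(1)] Ord_elt that by blast
    have mono: "F \<gamma> \<subseteq> F \<beta>" if "Ord \<alpha>" "\<beta> \<in> elts \<alpha>" "\<gamma> \<in> elts \<beta>" for \<beta> \<gamma>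
    proof -
      have "F \<gamma> \<subseteq> st (F \<gamma>)" using mem st that Ord_trans by blast
      then show ?thesis using that(3) by (subst (2) F) blast
    qed
    have suc: "F \<alpha> = st (F \<beta>)" if "Ord \<beta>" "\<alpha> = vsucc \<beta>" for \<beta>
    proof -
      have "\<beta> \<in> elts \<alpha>" "Ord \<alpha>" using that by (auto simp: elts_vsucc)
      then have "F \<beta> \<subseteq> st (F \<beta>)" using st(2) mem by blast
      moreover have "F \<alpha> = F \<beta> \<union> st (F \<beta>)"
        using that(2) by (subst (1 2) F) (auto simp: elts_vsucc)
      ultimately show ?thesis by blast
    qed
    have lim: "F \<alpha> = (\<Union>\<beta>\<in>elts \<alpha>. F \<beta>)" if "Limit \<alpha>"
    proof (intro subset_antisym subsetI)
      have O: "Ord \<alpha>" "vzero \<in> elts \<alpha>" using that by (auto simp: Limit_def)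
      fix x assume "x \<in> F \<alpha>"
      then consider "x \<in> A" | \<beta> where "\<beta> \<in> elts \<alpha>" "x \<in> st (F \<beta>)" by (subst (asm) F) blast
      then show "x \<in> (\<Union>\<beta>\<in>elts \<alpha>. F \<beta>)"
      proof cases
        case 2
        then have s: "vsucc \<beta> \<in> elts \<alpha>" using that by (auto simp: Limit_def)
        then have "F (vsucc \<beta>) = st (F \<beta>)"
          using step[OF s] Ord_elt[OF O(1) 2(1)] by blast
        then show ?thesis using s 2 by blast
      qed (use O F0 in blast)
    next
      have O: "Ord \<alpha>" using that by (auto simp: Limit_def)
      fix x assume "x \<in> (\<Union>\<beta>\<in>elts \<alpha>. F \<beta>)"
      then obtain \<beta> where "\<beta> \<in> elts \<alpha>" "x \<in> F \<beta>" by blast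
      then have "\<beta> \<in> elts \<alpha>" "x \<in> st (F \<beta>)" using st(2) mem O by blast+
      then show "x \<in> F \<alpha>" by (subst F) blast
    qed
    have "F \<alpha> \<in> \<F>" if O: "Ord \<alpha>"
      using O
    proof (cases rule: Ord_cases)
      case 1 then show ?thesis using F0 \<F>(1) by simp
    next
      case (2 \<beta>) then show ?thesis using suc[OF 2] st(1) mem[OF _ O] by (simp add: elts_vsucc)
    next
      case 3
      have "(\<Union>\<beta>\<in>elts \<alpha>. F \<beta>) \<in> \<F>"
      proof (rule \<F>(4))
        show "F ` elts \<alpha> \<noteq> {}" using 3 by (auto simp: Limit_def)
        show "F ` elts \<alpha> \<subseteq> \<F>" using mem O by blast
        show "chain\<^sub>\<subseteq> (F ` elts \<alpha>)"
          unfolding chain_subset_def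
        proof (intro ballI)
          fix C D assume "C \<in> F ` elts \<alpha>" "D \<in> F ` elts \<alpha>"
          then obtain \<beta> \<gamma> where "\<beta> \<in> elts \<alpha>" "\<gamma> \<in> elts \<alpha>" "C = F \<beta>" "D = F \<gamma>" by blast
          then show "C \<subseteq> D \<or> D \<subseteq> C" using Ord_linear[of \<beta> \<gamma>] Ord_elt[OF O] mono[OF O] by blast
        qed
      qed
      then show ?thesis using lim 3 by simp
    qed
    then show ?case using suc lim by blast
  qed
  then have mem: "Ord \<alpha> \<Longrightarrow> F \<alpha> \<in> \<F>" and FS: "Ord \<beta> \<Longrightarrow> F (vsucc \<beta>) = st (F \<beta>)"
    and lim: "Limit \<alpha> \<Longrightarrow> F \<alpha> = (\<Union>\<beta>\<in>elts \<alpha>. F \<beta>)" for \<alpha> \<beta>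
    by simp_all
  have mono: "F \<gamma> \<subseteq> F \<beta>" "F \<gamma> \<noteq> B \<Longrightarrow> F \<gamma> \<subset> F \<beta>" if "Ord \<beta>" "\<gamma> \<in> elts \<beta>" for \<beta> \<gamma>
  proof -
    have "F \<gamma> \<in> \<F>" using mem Ord_elt that by blast
    moreover have "st (F \<gamma>) \<subseteq> F \<beta>" using that(2) by (subst (2) F) blast
    ultimately show "F \<gamma> \<subseteq> F \<beta>" "F \<gamma> \<noteq> B \<Longrightarrow> F \<gamma> \<subset> F \<beta>"
      using st(2)[of "F \<gamma>"] nx[of "F \<gamma>"] by (auto simp: st_def)
  qed
  have "\<exists>\<alpha>. Ord \<alpha> \<and> F \<alpha> = B"
  proof (rule ccontr)
    assume neg: "\<not> ?thesis"
    have "inj_on F {\<alpha>. Ord \<alpha>}"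
    proof (rule inj_onI)
      fix \<alpha> \<beta> assume "\<alpha> \<in> {\<alpha>. Ord \<alpha>}" "\<beta> \<in> {\<alpha>. Ord \<alpha>}" "F \<alpha> = F \<beta>"
      then show "\<alpha> = \<beta>" using Ord_linear[of \<alpha> \<beta>] mono(2) neg by blast
    qed
    moreover have "F ` {\<alpha>. Ord \<alpha>} \<subseteq> Pow B" using mem \<F>(3) by blast
    ultimately have "{\<alpha> :: 'v. Ord \<alpha>} \<lesssim> Pow B" unfolding lepoll_def by blast
    also have "Pow B \<lesssim> Pow (elts x)"
    proof -
      obtain g where "inj_on g B" "g ` B \<subseteq> elts x" using assms(2) unfolding lepoll_def by blast
      then have "inj_on (image g) (Pow B)" "image g ` Pow B \<subseteq> Pow (elts x)"
        by (auto intro: inj_on_image_Pow)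
      then show ?thesis unfolding lepoll_def by blast
    qed
    finally obtain y :: 'v where "{\<alpha> :: 'v. Ord \<alpha>} \<lesssim> elts y"
      using small_Pow[OF small_elts] by blast
    then show False using not_small_Ord small_lepoll small_elts by blast
  qed
  then obtain \<alpha>' where "Ord \<alpha>' \<and> F \<alpha>' = B" by blast
  then obtain \<alpha> where \<alpha>: "Ord \<alpha>" "F \<alpha> = B" and min: "\<And>\<beta>. \<beta> \<in> elts \<alpha> \<Longrightarrow> \<not> (Ord \<beta> \<and> F \<beta> = B)"
    by (rule elts_least) (rule that, blast+)
  show thesis
  \<comment> \<open>\<alpha> is the least index with value B, so all steps before it are strict, and
    the length \<open>vsucc \<alpha>\<close> still includes the index \<alpha> itself.\<close>
  proof (rule that[of "vsucc \<alpha>" F])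
    show "Ord (vsucc \<alpha>)" using \<alpha> by simp
    then show "vzero \<in> elts (vsucc \<alpha>)" using vzero_or[of "vsucc \<alpha>"] by simp
    have O: "Ord i" if "i \<in> elts (vsucc \<alpha>)" for i
      using \<open>Ord (vsucc \<alpha>)\<close> that Ord_elt by blast
    show "F i \<subseteq> F j" if "j \<in> elts (vsucc \<alpha>)" "i \<in> elts j" for i j
      using mono(1) O that by blast
    show "F i = (\<Union>k\<in>elts i. F k)" if "Limit i" for i using lim that by blast
    show "(\<Union>i\<in>elts (vsucc \<alpha>). F i) = B"
      using \<alpha> mem O \<F>(3) by (auto simp: elts_vsucc)
    show "F i \<noteq> F (vsucc i) \<and> Q (F i) (F (vsucc i))" if i: "vsucc i \<in> elts (vsucc \<alpha>)" for i
    proof -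
      have "Ord i" using O[OF i] by simp
      have "i \<in> elts \<alpha>"
        using i Ord_trans[OF \<alpha>(1), of "vsucc i" i] by (auto simp: elts_vsucc)
      then have "F i \<noteq> B" using min \<open>Ord i\<close> by blast
      then show ?thesis
        using FS[of i] \<open>Ord i\<close> nx[of "F i"] mem by (auto simp: st_def)
    qed
  qed (rule F0)
qed

section \<open>Left modules\<close>

lemma submod_simps [simp]:
  "carrier (submod M N) = N" "zero (submod M N) = zero M" "add (submod M N) = add M"
  "smult (submod M N) = smult M" "submod (submod M B) N = submod M N"
  "submod M (carrier M) = M"
  by (simp_all add: submod_def)

text \<open>\<open>left_module\<close> at records without further fields, the types for which
  \<open>submod\<close>, \<open>quot_module\<close> and \<open>span\<close> are defined.\<close>

locale lmod = left_module R M for R :: "'r ring" (structure) and M :: "('r, 'm) module" (structure)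
begin

lemma smult_l_null: "x \<in> carrier M \<Longrightarrow> \<zero> \<odot>\<^bsub>M\<^esub> x = \<zero>\<^bsub>M\<^esub>"
proof -
  assume x: "x \<in> carrier M"
  have "\<zero> \<odot>\<^bsub>M\<^esub> x \<oplus>\<^bsub>M\<^esub> \<zero> \<odot>\<^bsub>M\<^esub> x = \<zero> \<odot>\<^bsub>M\<^esub> x"
    using smult_l_distr[of \<zero> \<zero> x] x by simp
  then show ?thesis
    using x smult_closed by (metis M.add.r_cancel_one R.zero_closed)
qed

lemma smult_r_null: "a \<in> carrier R \<Longrightarrow> a \<odot>\<^bsub>M\<^esub> \<zero>\<^bsub>M\<^esub> = \<zero>\<^bsub>M\<^esub>"
proof -
  assume a: "a \<in> carrier R"
  have "a \<odot>\<^bsub>M\<^esub> \<zero>\<^bsub>M\<^esub> \<oplus>\<^bsub>M\<^esub> a \<odot>\<^bsub>M\<^esub> \<zero>\<^bsub>M\<^esub> = a \<odot>\<^bsub>M\<^esub> \<zero>\<^bsub>M\<^esub>"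
    using smult_r_distr[of a "\<zero>\<^bsub>M\<^esub>" "\<zero>\<^bsub>M\<^esub>"] a by simp
  then show ?thesis
    using a smult_closed by (metis M.add.r_cancel_one M.zero_closed)
qed

lemma smult_minus_one: "x \<in> carrier M \<Longrightarrow> (\<ominus> \<one>) \<odot>\<^bsub>M\<^esub> x = \<ominus>\<^bsub>M\<^esub> x"
proof -
  assume x: "x \<in> carrier M"
  have "(\<ominus> \<one>) \<odot>\<^bsub>M\<^esub> x \<oplus>\<^bsub>M\<^esub> x = (\<ominus> \<one> \<oplus> \<one>) \<odot>\<^bsub>M\<^esub> x"
    using x smult_l_distr[of "\<ominus> \<one>" \<one> x] smult_one by simp
  then show ?thesis
    using x smult_l_null smult_closed by (simp add: R.l_neg M.minus_equality)
qed

section \<open>Submodules, spans and sums\<close>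

lemma subI:
  assumes "N \<subseteq> carrier M" "\<zero>\<^bsub>M\<^esub> \<in> N" "\<And>x y. x \<in> N \<Longrightarrow> y \<in> N \<Longrightarrow> x \<oplus>\<^bsub>M\<^esub> y \<in> N"
    "\<And>a x. a \<in> carrier R \<Longrightarrow> x \<in> N \<Longrightarrow> a \<odot>\<^bsub>M\<^esub> x \<in> N"
  shows "submodule N R M"
proof (intro submodule.intro M.add.subgroupI)
  fix x assume x: "x \<in> N"
  then have "\<ominus>\<^bsub>M\<^esub> x = (\<ominus> \<one>) \<odot>\<^bsub>M\<^esub> x" using assms(1) smult_minus_one by auto
  then show "\<ominus>\<^bsub>M\<^esub> x \<in> N" using assms(4) x by simp
qed (use assms in \<open>auto simp: submodule_axioms_def\<close>)

lemma subD:
  assumes "submodule N R M"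
  shows "N \<subseteq> carrier M" "x \<in> N \<Longrightarrow> x \<in> carrier M" "\<zero>\<^bsub>M\<^esub> \<in> N" "x \<in> N \<Longrightarrow> y \<in> N \<Longrightarrow> x \<oplus>\<^bsub>M\<^esub> y \<in> N"
    "a \<in> carrier R \<Longrightarrow> x \<in> N \<Longrightarrow> a \<odot>\<^bsub>M\<^esub> x \<in> N" "x \<in> N \<Longrightarrow> \<ominus>\<^bsub>M\<^esub> x \<in> N" "x \<in> N \<Longrightarrow> y \<in> N \<Longrightarrow> x \<ominus>\<^bsub>M\<^esub> y \<in> N"
proof -
  note S = submodule.axioms(1)[OF assms]
  show 1: "N \<subseteq> carrier M" "x \<in> N \<Longrightarrow> x \<in> carrier M" "\<zero>\<^bsub>M\<^esub> \<in> N" "x \<in> N \<Longrightarrow> y \<in> N \<Longrightarrow> x \<oplus>\<^bsub>M\<^esub> y \<in> N" for x y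
    using subgroup.subset[OF S] subgroup.one_closed[OF S] subgroup.m_closed[OF S, of x y] by auto
  show 2: "a \<in> carrier R \<Longrightarrow> x \<in> N \<Longrightarrow> a \<odot>\<^bsub>M\<^esub> x \<in> N" for a x
    using submodule.smult_closed[OF assms] .
  show 3: "x \<in> N \<Longrightarrow> \<ominus>\<^bsub>M\<^esub> x \<in> N" for x
    using 2[of "\<ominus> \<one>" x] 1(2) smult_minus_one by simp
  show "x \<in> N \<Longrightarrow> y \<in> N \<Longrightarrow> x \<ominus>\<^bsub>M\<^esub> y \<in> N"
    unfolding a_minus_def using 1(4) 3 by blast
qed

lemma sub_carrier: "submodule (carrier M) R M"
  by (rule subI) (auto simp: smult_closed)

lemma sub_zero: "submodule {\<zero>\<^bsub>M\<^esub>} R M"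
  by (rule subI) (auto simp: smult_r_null)

lemma sub_Int: "submodule A R M \<Longrightarrow> submodule B R M \<Longrightarrow> submodule (A \<inter> B) R M"
  by (rule subI) (use subD in auto)

lemma sub_Union:
  assumes "\<G> \<noteq> {}" "\<And>N. N \<in> \<G> \<Longrightarrow> submodule N R M" "chain\<^sub>\<subseteq> \<G>"
  shows "submodule (\<Union>\<G>) R M"
proof (rule subI)
  fix x y assume "x \<in> \<Union>\<G>" "y \<in> \<Union>\<G>"
  then obtain N N' where N: "N \<in> \<G>" "N' \<in> \<G>" "x \<in> N" "y \<in> N'" by blast
  then have "N \<subseteq> N' \<or> N' \<subseteq> N" using assms(3) unfolding chain_subset_def by blast
  then obtain K where "K \<in> \<G>" "x \<in> K" "y \<in> K" using N by blast
  then show "x \<oplus>\<^bsub>M\<^esub> y \<in> \<Union>\<G>" using subD(4)[OF assms(2)] by blast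
next
  show "\<Union>\<G> \<subseteq> carrier M" using subD(1)[OF assms(2)] by blast
  show "\<zero>\<^bsub>M\<^esub> \<in> \<Union>\<G>" using subD(3)[OF assms(2)] assms(1) by blast
  show "a \<odot>\<^bsub>M\<^esub> x \<in> \<Union>\<G>" if "a \<in> carrier R" "x \<in> \<Union>\<G>" for a x
    using subD(5)[OF assms(2)] that by blast
qed

lemma sub_INT:
  assumes "\<G> \<noteq> {}" "\<And>N. N \<in> \<G> \<Longrightarrow> submodule N R M"
  shows "submodule (\<Inter>\<G>) R M"
proof (rule subI)
  show "\<Inter>\<G> \<subseteq> carrier M" using subD(1)[OF assms(2)] assms(1) by blast
  show "\<zero>\<^bsub>M\<^esub> \<in> \<Inter>\<G>" using subD(3)[OF assms(2)] by blast
  show "a \<odot>\<^bsub>M\<^esub> x \<in> \<Inter>\<G>" if "a \<in> carrier R" "x \<in> \<Inter>\<G>" for a x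
    using subD(5)[OF assms(2)] that by blast
  show "x \<oplus>\<^bsub>M\<^esub> y \<in> \<Inter>\<G>" if "x \<in> \<Inter>\<G>" "y \<in> \<Inter>\<G>" for x y
    using subD(4)[OF assms(2)] that by blast
qed



lemma left_module_submod:
  assumes "submodule N R M" shows "left_module R (submod M N)"
proof -
  note N = subD[OF assms]
  have "abelian_group (submod M N)"
  proof (rule abelian_groupI)
    fix x assume "x \<in> carrier (submod M N)"
    then show "\<exists>y\<in>carrier (submod M N). y \<oplus>\<^bsub>submod M N\<^esub> x = \<zero>\<^bsub>submod M N\<^esub>"
      using N(2,6) by (auto intro!: bexI[of _ "\<ominus>\<^bsub>M\<^esub> x"] simp: M.l_neg)
  qed (use N in \<open>auto simp: M.a_ac\<close>)
  then show ?thesis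
    by (intro left_module.intro R.ring_axioms left_module_axioms.intro)
      (use N smult_l_distr smult_r_distr smult_assoc smult_one in auto)
qed

lemma lmod_submod: "submodule N R M \<Longrightarrow> lmod R (submod M N)"
  by (simp add: lmod_def left_module_submod)

lemma sub_submod:
  assumes "submodule B R M"
  shows "submodule N R (submod M B) \<longleftrightarrow> submodule N R M \<and> N \<subseteq> B"
proof -
  interpret S: lmod R "submod M B" by (rule lmod_submod[OF assms])
  show ?thesis
  proof
    assume "submodule N R (submod M B)"
    note N = S.subD[OF this]
    have "N \<subseteq> B" using N(1) by simp
    moreover have "submodule N R M"
      by (rule subI) (use N subD(1)[OF assms] in auto)
    ultimately show "submodule N R M \<and> N \<subseteq> B" by simp
  next
    assume *: "submodule N R M \<and> N \<subseteq> B"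
    show "submodule N R (submod M B)"
      by (rule S.subI) (use * subD[of N] in auto)
  qed
qed

lemma diff_zero: "x \<in> carrier M \<Longrightarrow> x \<ominus>\<^bsub>M\<^esub> \<zero>\<^bsub>M\<^esub> = x"
  using M.minus_equality[of "\<zero>\<^bsub>M\<^esub>" "\<zero>\<^bsub>M\<^esub>"] by (simp add: a_minus_def)

lemma diff_self: "x \<in> carrier M \<Longrightarrow> x \<ominus>\<^bsub>M\<^esub> x = \<zero>\<^bsub>M\<^esub>"
  by (simp add: a_minus_def M.r_neg)

lemma diff_zero_iff: "x \<in> carrier M \<Longrightarrow> y \<in> carrier M \<Longrightarrow> x \<ominus>\<^bsub>M\<^esub> y = \<zero>\<^bsub>M\<^esub> \<longleftrightarrow> x = y"
  using M.minus_equality[of x "\<ominus>\<^bsub>M\<^esub> y"] by (auto simp: a_minus_def M.r_neg)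

lemma span_sub:
  assumes "X \<subseteq> carrier M"
  shows "submodule (span R M X) R M"
  unfolding span_def by (rule sub_INT) (use assms sub_carrier in auto)

lemma span_superset: "X \<subseteq> span R M X"
  unfolding span_def by blast

lemma span_least: "submodule N R M \<Longrightarrow> X \<subseteq> N \<Longrightarrow> span R M X \<subseteq> N"
  unfolding span_def by blast

lemma span_mono: "X \<subseteq> Y \<Longrightarrow> span R M X \<subseteq> span R M Y"
  unfolding span_def by blast

lemma span_closed: "X \<subseteq> carrier M \<Longrightarrow> span R M X \<subseteq> carrier M"
  by (rule span_least[OF sub_carrier])

lemma span_of_sub: "submodule N R M \<Longrightarrow> span R M N = N"
  by (intro subset_antisym span_least span_superset) auto

lemma span_empty: "span R M {} = {\<zero>\<^bsub>M\<^esub>}"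
  using span_least[OF sub_zero, of "{}"] subD(3)[OF span_sub[of "{}"]] by auto

lemma span_subset_iff: "Y \<subseteq> carrier M \<Longrightarrow> span R M X \<subseteq> span R M Y \<longleftrightarrow> X \<subseteq> span R M Y"
  using span_superset span_least[OF span_sub] by blast

text \<open>The generating sets need to be nested only up to span; their spans then form a chain,
  whose union is a submodule.\<close>

lemma span_UN:
  fixes X :: "nat \<Rightarrow> 'm set"
  assumes "\<And>n. X n \<subseteq> carrier M" "\<And>n. X n \<subseteq> span R M (X (Suc n))"
  shows "span R M (\<Union>n. X n) = (\<Union>n. span R M (X n))"
proof
  have mono: "m \<le> n \<Longrightarrow> span R M (X m) \<subseteq> span R M (X n)" for m n
    by (rule lift_Suc_mono_le[of "\<lambda>n. span R M (X n)"]) (use span_subset_iff assms in auto)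
  have "chain\<^sub>\<subseteq> (range (\<lambda>n. span R M (X n)))"
    unfolding chain_subset_def using mono nat_le_linear by blast
  then have "submodule (\<Union>n. span R M (X n)) R M"
    by (intro sub_Union) (use span_sub assms(1) in auto)
  then show "span R M (\<Union>n. X n) \<subseteq> (\<Union>n. span R M (X n))"
    by (rule span_least) (use span_superset in blast)
  show "(\<Union>n. span R M (X n)) \<subseteq> span R M (\<Union>n. X n)"
    by (intro UN_least span_mono) auto
qed

text \<open>The elements that lie in the span of some finite subset of X form a submodule containing
  X.\<close>

lemma span_finite:
  assumes "X \<subseteq> carrier M" "x \<in> span R M X"
  obtains D where "finite D" "D \<subseteq> X" "x \<in> span R M D"
proof -
  let ?N = "{x. \<exists>D. finite D \<and> D \<subseteq> X \<and> x \<in> span R M D}"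
  have sp: "submodule (span R M D) R M" if "D \<subseteq> X" for D
    using that assms(1) by (intro span_sub) auto
  have "submodule ?N R M"
  proof (rule subI)
    show "?N \<subseteq> carrier M" using sp subD(2) by blast
    show "\<zero>\<^bsub>M\<^esub> \<in> ?N" using subD(3)[OF sp[of "{}"]] by (intro CollectI exI[of _ "{}"]) auto
    show "a \<odot>\<^bsub>M\<^esub> x \<in> ?N" if "a \<in> carrier R" "x \<in> ?N" for a x
      using that subD(5)[OF sp] by blast
    fix x y assume "x \<in> ?N" "y \<in> ?N"
    then obtain D E where D: "finite D" "D \<subseteq> X" "x \<in> span R M D" and E: "finite E" "E \<subseteq> X" "y \<in> span R M E"
      by blast
    then have "x \<in> span R M (D \<union> E)" "y \<in> span R M (D \<union> E)"
      using span_mono[of D "D \<union> E"] span_mono[of E "D \<union> E"] by blast+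
    then have "x \<oplus>\<^bsub>M\<^esub> y \<in> span R M (D \<union> E)" using subD(4)[OF sp] D E by simp
    then show "x \<oplus>\<^bsub>M\<^esub> y \<in> ?N" using D E by (intro CollectI exI[of _ "D \<union> E"]) auto
  qed
  moreover have "X \<subseteq> ?N"
  proof
    fix x assume "x \<in> X"
    then show "x \<in> ?N" using span_superset[of "{x}"] by (intro CollectI exI[of _ "{x}"]) auto
  qed
  ultimately have "span R M X \<subseteq> ?N" by (rule span_least)
  then show thesis using assms(2) that by blast
qed

definition msum :: "'m set \<Rightarrow> 'm set \<Rightarrow> 'm set" where
  "msum A B = {a \<oplus>\<^bsub>M\<^esub> b | a b. a \<in> A \<and> b \<in> B}"

lemma msum_sub:
  assumes A: "submodule A R M" and B: "submodule B R M"
  shows "submodule (msum A B) R M"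
proof (rule subI)
  note a = subD[OF A] and b = subD[OF B]
  show "msum A B \<subseteq> carrier M" unfolding msum_def using a(2) b(2) by auto
  show "\<zero>\<^bsub>M\<^esub> \<in> msum A B" unfolding msum_def using a(3) b(3) M.l_zero[OF M.zero_closed] by (smt (verit) mem_Collect_eq)
  fix x y assume "x \<in> msum A B" "y \<in> msum A B"
  then obtain p q p' q' where *: "x = p \<oplus>\<^bsub>M\<^esub> q" "y = p' \<oplus>\<^bsub>M\<^esub> q'" "p \<in> A" "p' \<in> A" "q \<in> B" "q' \<in> B"
    unfolding msum_def by blast
  then have "x \<oplus>\<^bsub>M\<^esub> y = (p \<oplus>\<^bsub>M\<^esub> p') \<oplus>\<^bsub>M\<^esub> (q \<oplus>\<^bsub>M\<^esub> q')"
    using a(2) b(2) by (simp add: M.a_ac)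
  then show "x \<oplus>\<^bsub>M\<^esub> y \<in> msum A B" unfolding msum_def using a(4) b(4) * by blast
next
  note a = subD[OF A] and b = subD[OF B]
  fix r x assume r: "r \<in> carrier R" and "x \<in> msum A B"
  then obtain p q where *: "x = p \<oplus>\<^bsub>M\<^esub> q" "p \<in> A" "q \<in> B"
    unfolding msum_def by blast
  then have "r \<odot>\<^bsub>M\<^esub> x = r \<odot>\<^bsub>M\<^esub> p \<oplus>\<^bsub>M\<^esub> r \<odot>\<^bsub>M\<^esub> q"
    using r smult_r_distr a(2) b(2) by simp
  then show "r \<odot>\<^bsub>M\<^esub> x \<in> msum A B"
    unfolding msum_def using a(5)[OF r *(2)] b(5)[OF r *(3)] by blast
qed

lemma msum_upper:
  assumes A: "submodule A R M" and B: "submodule B R M"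
  shows "A \<subseteq> msum A B" "B \<subseteq> msum A B"
proof
  note a = subD[OF A] and b = subD[OF B]
  show "x \<in> msum A B" if "x \<in> A" for x
    unfolding msum_def using that b(3) a(2) by (intro CollectI exI[of _ x] exI[of _ "\<zero>\<^bsub>M\<^esub>"]) simp
  show "B \<subseteq> msum A B"
  proof
    fix x assume "x \<in> B"
    then show "x \<in> msum A B"
      unfolding msum_def using a(3) b(2) by (intro CollectI exI[of _ "\<zero>\<^bsub>M\<^esub>"] exI[of _ x]) simp
  qed
qed

lemma msum_least:
  "submodule N R M \<Longrightarrow> A \<subseteq> N \<Longrightarrow> B \<subseteq> N \<Longrightarrow> msum A B \<subseteq> N"
  unfolding msum_def using subD(4) by blast

lemma msum_mono: "A \<subseteq> A' \<Longrightarrow> B \<subseteq> B' \<Longrightarrow> msum A B \<subseteq> msum A' B'"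
  unfolding msum_def by blast

lemma add_diff_cancel: "x \<in> carrier M \<Longrightarrow> y \<in> carrier M \<Longrightarrow> y \<oplus>\<^bsub>M\<^esub> (x \<ominus>\<^bsub>M\<^esub> y) = x"
  by (simp add: a_minus_def M.a_lcomm M.r_neg)

lemma sub_diff_iff:
  assumes "submodule N R M" "y \<in> N" "x \<in> carrier M"
  shows "x \<ominus>\<^bsub>M\<^esub> y \<in> N \<longleftrightarrow> x \<in> N" "y \<ominus>\<^bsub>M\<^esub> x \<in> N \<longleftrightarrow> x \<in> N" "x \<oplus>\<^bsub>M\<^esub> y \<in> N \<longleftrightarrow> x \<in> N" "y \<oplus>\<^bsub>M\<^esub> x \<in> N \<longleftrightarrow> x \<in> N"
proof -
  note N = subD[OF assms(1)]
  have y: "y \<in> carrier M" using N(2) assms(2) .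
  show 1: "x \<ominus>\<^bsub>M\<^esub> y \<in> N \<longleftrightarrow> x \<in> N"
    using N(4)[OF assms(2), of "x \<ominus>\<^bsub>M\<^esub> y"] N(7)[OF _ assms(2)] add_diff_cancel[OF assms(3) y] by auto
  have "x = y \<ominus>\<^bsub>M\<^esub> (y \<ominus>\<^bsub>M\<^esub> x)"
    using y assms(3) by (simp add: a_minus_def M.minus_add M.r_neg2)
  then show "y \<ominus>\<^bsub>M\<^esub> x \<in> N \<longleftrightarrow> x \<in> N"
    using N(7)[OF assms(2)] by metis
  have "x = (x \<oplus>\<^bsub>M\<^esub> y) \<ominus>\<^bsub>M\<^esub> y"
    using y assms(3) by (simp add: a_minus_def M.a_assoc M.r_neg)
  then show 3: "x \<oplus>\<^bsub>M\<^esub> y \<in> N \<longleftrightarrow> x \<in> N"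
    using N(7)[OF _ assms(2)] N(4)[OF _ assms(2)] by metis
  then show "y \<oplus>\<^bsub>M\<^esub> x \<in> N \<longleftrightarrow> x \<in> N"
    using M.a_comm[OF y assms(3)] by simp
qed

end

subsection \<open>Homomorphisms\<close>

lemma module_homI:
  assumes "\<And>x. x \<in> carrier M \<Longrightarrow> h x \<in> carrier N"
    "\<And>x y. x \<in> carrier M \<Longrightarrow> y \<in> carrier M \<Longrightarrow> h (x \<oplus>\<^bsub>M\<^esub> y) = h x \<oplus>\<^bsub>N\<^esub> h y"
    "\<And>a x. a \<in> carrier R \<Longrightarrow> x \<in> carrier M \<Longrightarrow> h (a \<odot>\<^bsub>M\<^esub> x) = a \<odot>\<^bsub>N\<^esub> h x"
  shows "h \<in> module_hom R M N"
  using assms by (auto simp: module_hom_def)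

lemma module_homD:
  assumes "h \<in> module_hom R M N"
  shows "x \<in> carrier M \<Longrightarrow> h x \<in> carrier N"
    "x \<in> carrier M \<Longrightarrow> y \<in> carrier M \<Longrightarrow> h (x \<oplus>\<^bsub>M\<^esub> y) = h x \<oplus>\<^bsub>N\<^esub> h y"
    "a \<in> carrier R \<Longrightarrow> x \<in> carrier M \<Longrightarrow> h (a \<odot>\<^bsub>M\<^esub> x) = a \<odot>\<^bsub>N\<^esub> h x"
  using assms by (auto simp: module_hom_def)

lemma module_hom_id: "(\<lambda>x. x) \<in> module_hom R M M"
  by (rule module_homI) auto

lemma module_hom_comp:
  assumes "g \<in> module_hom R M N" "h \<in> module_hom R N K"
  shows "(\<lambda>x. h (g x)) \<in> module_hom R M K"
  by (rule module_homI) (use module_homD[OF assms(1)] module_homD[OF assms(2)] in simp_all)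

lemma module_hom_restrict_dom:
  assumes "h \<in> module_hom R (submod M B) N" "B' \<subseteq> B"
  shows "h \<in> module_hom R (submod M B') N"
  by (rule module_homI) (use module_homD[OF assms(1)] subsetD[OF assms(2)] in simp_all)

lemma module_hom_restrict_dom':
  assumes "h \<in> module_hom R M N" "B' \<subseteq> carrier M"
  shows "h \<in> module_hom R (submod M B') N"
  by (rule module_homI) (use module_homD[OF assms(1)] subsetD[OF assms(2)] in simp_all)

lemma module_hom_restrict_cod:
  assumes "h \<in> module_hom R M (submod N B)" "B \<subseteq> carrier N"
  shows "h \<in> module_hom R M N"
  by (rule module_homI) (use module_homD[OF assms(1)] assms(2) in auto)

lemma module_hom_cod:
  assumes "h \<in> module_hom R M N" "h ` carrier M \<subseteq> B"
  shows "h \<in> module_hom R M (submod N B)"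
  by (rule module_homI) (use module_homD[OF assms(1)] assms(2) in auto)

lemma module_hom_cong:
  assumes "h \<in> module_hom R M N" "lmod R M" "\<And>x. x \<in> carrier M \<Longrightarrow> g x = h x"
  shows "g \<in> module_hom R M N"
proof -
  interpret lmod R M by fact
  show ?thesis
    by (rule module_homI) (use assms(3) smult_closed module_homD[OF assms(1)] in auto)
qed

lemma hom_props:
  assumes "h \<in> module_hom R M N" "lmod R M" "lmod R N"
  shows "h \<zero>\<^bsub>M\<^esub> = \<zero>\<^bsub>N\<^esub>" "x \<in> carrier M \<Longrightarrow> h (\<ominus>\<^bsub>M\<^esub> x) = \<ominus>\<^bsub>N\<^esub> h x"
    "x \<in> carrier M \<Longrightarrow> y \<in> carrier M \<Longrightarrow> h (x \<ominus>\<^bsub>M\<^esub> y) = h x \<ominus>\<^bsub>N\<^esub> h y"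
proof -
  interpret M: lmod R M by fact
  interpret N: lmod R N by fact
  note h = module_homD[OF assms(1)]
  have "h \<zero>\<^bsub>M\<^esub> \<oplus>\<^bsub>N\<^esub> h \<zero>\<^bsub>M\<^esub> = h \<zero>\<^bsub>M\<^esub>" using h(2)[of "\<zero>\<^bsub>M\<^esub>" "\<zero>\<^bsub>M\<^esub>"] by simp
  then show 0: "h \<zero>\<^bsub>M\<^esub> = \<zero>\<^bsub>N\<^esub>" using h(1) by (metis N.M.add.r_cancel_one M.M.zero_closed)
  show 1: "h (\<ominus>\<^bsub>M\<^esub> x) = \<ominus>\<^bsub>N\<^esub> h x" if "x \<in> carrier M" for x
    using that h(3)[of "\<ominus>\<^bsub>R\<^esub> \<one>\<^bsub>R\<^esub>" x] h(1)[OF that] M.smult_minus_one N.smult_minus_one by simp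
  show "h (x \<ominus>\<^bsub>M\<^esub> y) = h x \<ominus>\<^bsub>N\<^esub> h y" if "x \<in> carrier M" "y \<in> carrier M"
    using that h(1,2) 1 by (simp add: a_minus_def)
qed

lemma hom_add:
  assumes "f \<in> module_hom R M N" "g \<in> module_hom R M N" "lmod R N"
  shows "(\<lambda>x. f x \<oplus>\<^bsub>N\<^esub> g x) \<in> module_hom R M N"
proof -
  interpret N: lmod R N by fact
  note f = module_homD[OF assms(1)] and g = module_homD[OF assms(2)]
  show ?thesis
    by (rule module_homI) (use f g N.smult_r_distr in \<open>auto simp: N.M.a_ac\<close>)
qed

lemma hom_diff:
  assumes "f \<in> module_hom R M N" "g \<in> module_hom R M N" "lmod R N" "lmod R M"
  shows "(\<lambda>x. f x \<ominus>\<^bsub>N\<^esub> g x) \<in> module_hom R M N"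
proof -
  interpret N: lmod R N by fact
  interpret M: lmod R M by fact
  note f = module_homD[OF assms(1)] and g = module_homD[OF assms(2)]
  have "(\<lambda>x. f x \<oplus>\<^bsub>N\<^esub> g (\<ominus>\<^bsub>M\<^esub> x)) \<in> module_hom R M N"
  proof (rule hom_add[OF assms(1) _ assms(3)])
    have "(\<lambda>x. \<ominus>\<^bsub>M\<^esub> x) \<in> module_hom R M M"
    proof (rule module_homI)
      fix a x assume a: "a \<in> carrier R" "x \<in> carrier M"
      have "\<ominus>\<^bsub>M\<^esub> (a \<odot>\<^bsub>M\<^esub> x) \<oplus>\<^bsub>M\<^esub> a \<odot>\<^bsub>M\<^esub> x = a \<odot>\<^bsub>M\<^esub> (\<ominus>\<^bsub>M\<^esub> x) \<oplus>\<^bsub>M\<^esub> a \<odot>\<^bsub>M\<^esub> x"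
        using a M.smult_closed M.smult_r_distr[of a "\<ominus>\<^bsub>M\<^esub> x" x] by (simp add: M.M.l_neg M.smult_r_null)
      then show "\<ominus>\<^bsub>M\<^esub> (a \<odot>\<^bsub>M\<^esub> x) = a \<odot>\<^bsub>M\<^esub> (\<ominus>\<^bsub>M\<^esub> x)"
        using a M.smult_closed by simp
    qed (auto simp: M.M.minus_add)
    then show "(\<lambda>x. g (\<ominus>\<^bsub>M\<^esub> x)) \<in> module_hom R M N"
      using module_hom_comp assms(2) by blast
  qed
  then show ?thesis
    by (rule module_hom_cong) (use hom_props(2)[OF assms(2,4,3)] assms in \<open>auto simp: a_minus_def\<close>)
qed

lemma hom_ker_sub:
  assumes "h \<in> module_hom R M N" "lmod R M" "lmod R N" "submodule P R N"
  shows "submodule {x \<in> carrier M. h x \<in> P} R M"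
proof -
  interpret M: lmod R M by fact
  interpret N: lmod R N by fact
  show ?thesis
    by (rule M.subI) (use hom_props(1)[OF assms(1-3)] module_homD[OF assms(1)] N.subD[OF assms(4)] M.smult_closed in auto)
qed

lemma hom_image_sub:
  assumes "h \<in> module_hom R M N" "lmod R M" "lmod R N" "submodule P R M"
  shows "submodule (h ` P) R N"
proof -
  interpret M: lmod R M by fact
  interpret N: lmod R N by fact
  note h = module_homD[OF assms(1)] and P = M.subD[OF assms(4)]
  show ?thesis
  proof (rule N.subI)
    show "h ` P \<subseteq> carrier N" using h(1) P(2) by blast
    show "\<zero>\<^bsub>N\<^esub> \<in> h ` P" using P(3) hom_props(1)[OF assms(1-3)] by (metis imageI)
    show "x \<oplus>\<^bsub>N\<^esub> y \<in> h ` P" if "x \<in> h ` P" "y \<in> h ` P" for x y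
      using that h(2) P(2,4) by (smt (verit) image_iff)
    show "a \<odot>\<^bsub>N\<^esub> x \<in> h ` P" if "a \<in> carrier R" "x \<in> h ` P" for a x
      using that h(3) P(2,5) by (smt (verit) image_iff)
  qed
qed

text \<open>Each module law is carried over by a surjective homomorphism. The zero has to be matched
  by hypothesis because K is not yet known to be a group. Applied to coset modules and to copies
  inside the universe.\<close>

lemma left_module_image:
  assumes "left_module R M" "h \<in> module_hom R M K" "h ` carrier M = carrier K" "zero K = h (zero M)"
  shows "left_module R K"
proof -
  interpret M: left_module R M by fact
  note h = module_homD[OF assms(2)]
  have ex: "\<exists>y\<in>carrier M. x = h y" if "x \<in> carrier K" for x
    using that assms(3) by blast
  have "abelian_group K"
  proof (rule abelian_groupI)
    fix x y z assume "x \<in> carrier K" "y \<in> carrier K" "z \<in> carrier K"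
    then obtain a b c where *: "x = h a" "y = h b" "z = h c" "a \<in> carrier M" "b \<in> carrier M" "c \<in> carrier M"
      using ex by metis
    show "x \<oplus>\<^bsub>K\<^esub> y \<oplus>\<^bsub>K\<^esub> z = x \<oplus>\<^bsub>K\<^esub> (y \<oplus>\<^bsub>K\<^esub> z)" using * h(2)[symmetric] by (simp add: M.M.a_assoc)
  next
    fix x y assume "x \<in> carrier K" "y \<in> carrier K"
    then obtain a b where *: "x = h a" "y = h b" "a \<in> carrier M" "b \<in> carrier M"
      using ex by metis
    show "x \<oplus>\<^bsub>K\<^esub> y \<in> carrier K" "x \<oplus>\<^bsub>K\<^esub> y = y \<oplus>\<^bsub>K\<^esub> x"
      using * h(1) h(2)[symmetric] by (simp_all add: M.M.a_comm)
  next
    show "\<zero>\<^bsub>K\<^esub> \<in> carrier K" using assms(4) h(1) by simp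
    fix x assume "x \<in> carrier K"
    then obtain a where *: "x = h a" "a \<in> carrier M" using ex by metis
    show "\<zero>\<^bsub>K\<^esub> \<oplus>\<^bsub>K\<^esub> x = x" using * h(2)[symmetric] assms(4) by simp
    show "\<exists>y\<in>carrier K. y \<oplus>\<^bsub>K\<^esub> x = \<zero>\<^bsub>K\<^esub>"
      using * h(1) h(2)[symmetric] assms(4) by (intro bexI[of _ "h (\<ominus>\<^bsub>M\<^esub> a)"]) (simp_all add: M.M.l_neg)
  qed
  then show ?thesis
  proof (intro left_module.intro M.R.ring_axioms left_module_axioms.intro)
    fix r x assume "r \<in> carrier R" "x \<in> carrier K"
    then obtain a where *: "x = h a" "a \<in> carrier M" using ex by metis
    show "r \<odot>\<^bsub>K\<^esub> x \<in> carrier K" using * \<open>r \<in> _\<close> h(1) h(3)[symmetric] M.smult_closed by simp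
  next
    fix r s x assume rs: "r \<in> carrier R" "s \<in> carrier R" and "x \<in> carrier K"
    then obtain a where *: "x = h a" "a \<in> carrier M" using ex by metis
    show "(r \<oplus>\<^bsub>R\<^esub> s) \<odot>\<^bsub>K\<^esub> x = r \<odot>\<^bsub>K\<^esub> x \<oplus>\<^bsub>K\<^esub> s \<odot>\<^bsub>K\<^esub> x"
      using * rs h(2,3)[symmetric] M.smult_closed M.smult_l_distr by simp
    show "(r \<otimes>\<^bsub>R\<^esub> s) \<odot>\<^bsub>K\<^esub> x = r \<odot>\<^bsub>K\<^esub> (s \<odot>\<^bsub>K\<^esub> x)"
      using * rs h(3)[symmetric] M.smult_closed M.smult_assoc by simp
  next
    fix r x y assume r: "r \<in> carrier R" and "x \<in> carrier K" "y \<in> carrier K"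
    then obtain a b where *: "x = h a" "y = h b" "a \<in> carrier M" "b \<in> carrier M"
      using ex by metis
    show "r \<odot>\<^bsub>K\<^esub> (x \<oplus>\<^bsub>K\<^esub> y) = r \<odot>\<^bsub>K\<^esub> x \<oplus>\<^bsub>K\<^esub> r \<odot>\<^bsub>K\<^esub> y"
      using * r h(2,3)[symmetric] M.smult_closed M.smult_r_distr by simp
  next
    fix x assume "x \<in> carrier K"
    then obtain a where *: "x = h a" "a \<in> carrier M" using ex by metis
    show "\<one>\<^bsub>R\<^esub> \<odot>\<^bsub>K\<^esub> x = x" using * h(3)[symmetric] M.smult_one by simp
  qed
qed

text \<open>The homomorphism theorem with an arbitrary epimorphism \<theta> in the role of the coset
  projection: \<phi> is constant on the fibres of \<theta>, so a chosen preimage may be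
  used.\<close>

lemma hom_factor:
  assumes "\<theta> \<in> module_hom R M N" "\<theta> ` carrier M = carrier N" "\<phi> \<in> module_hom R M K"
    "lmod R M" "lmod R N" "lmod R K" "\<And>x. x \<in> carrier M \<Longrightarrow> \<theta> x = \<zero>\<^bsub>N\<^esub> \<Longrightarrow> \<phi> x = \<zero>\<^bsub>K\<^esub>"
  obtains \<phi>' where "\<phi>' \<in> module_hom R N K" "\<And>x. x \<in> carrier M \<Longrightarrow> \<phi>' (\<theta> x) = \<phi> x"
proof -
  interpret M: lmod R M by fact
  interpret N: lmod R N by fact
  interpret K: lmod R K by fact
  note t = module_homD[OF assms(1)] and p = module_homD[OF assms(3)]
  define \<phi>' where "\<phi>' y = \<phi> (inv_into (carrier M) \<theta> y)" for y
  have eq: "\<phi> x = \<phi> y" if "x \<in> carrier M" "y \<in> carrier M" "\<theta> x = \<theta> y" for x y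
  proof -
    have "\<theta> (x \<ominus>\<^bsub>M\<^esub> y) = \<zero>\<^bsub>N\<^esub>"
      using that hom_props(3)[OF assms(1,4,5)] t(1) by (simp add: N.diff_self)
    then have "\<phi> (x \<ominus>\<^bsub>M\<^esub> y) = \<zero>\<^bsub>K\<^esub>" using assms(7) that by simp
    then show ?thesis
      using that hom_props(3)[OF assms(3,4,6)] p(1) by (simp add: K.diff_zero_iff)
  qed
  have *: "\<phi>' (\<theta> x) = \<phi> x" if "x \<in> carrier M" for x
    unfolding \<phi>'_def by (rule eq) (use that in \<open>auto intro: inv_into_into f_inv_into_f\<close>)
  have ex: "\<exists>y\<in>carrier M. x = \<theta> y" if "x \<in> carrier N" for x
    using that assms(2) by blast
  have "\<phi>' \<in> module_hom R N K"
  proof (rule module_homI)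
    fix x y assume "x \<in> carrier N" "y \<in> carrier N"
    then obtain a b where ab: "x = \<theta> a" "y = \<theta> b" "a \<in> carrier M" "b \<in> carrier M" using ex by metis
    show "\<phi>' (x \<oplus>\<^bsub>N\<^esub> y) = \<phi>' x \<oplus>\<^bsub>K\<^esub> \<phi>' y"
      using ab * t(2)[symmetric] p(2) by simp
    show "\<phi>' x \<in> carrier K" using ab * p(1) by simp
  next
    fix r x assume r: "r \<in> carrier R" and "x \<in> carrier N"
    then obtain a where a: "x = \<theta> a" "a \<in> carrier M" using ex by metis
    show "\<phi>' (r \<odot>\<^bsub>N\<^esub> x) = r \<odot>\<^bsub>K\<^esub> \<phi>' x"
      using a r * t(3)[symmetric] p(3) M.smult_closed by simp
  qed
  then show thesis using that * by blast
qed

subsection \<open>Quotients and filtrations inside a module\<close>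

lemma (in lmod) minus_submod:
  assumes "submodule B R M" "x \<in> B" "y \<in> B"
  shows "x \<ominus>\<^bsub>submod M B\<^esub> y = x \<ominus>\<^bsub>M\<^esub> y"
proof -
  interpret S: lmod R "submod M B" by (rule lmod_submod[OF assms(1)])
  have "\<ominus>\<^bsub>submod M B\<^esub> y = \<ominus>\<^bsub>M\<^esub> y"
    by (rule S.M.minus_equality) (use assms subD[OF assms(1)] in \<open>auto simp: M.l_neg\<close>)
  then show ?thesis by (simp add: a_minus_def)
qed

text \<open>The isomorphism B / A \<cong> K without cosets: the type does not change with the
  quotient, and K may have any element type.\<close>

definition quo ::
  "'r ring \<Rightarrow> ('r, 'm) module \<Rightarrow> 'm set \<Rightarrow> 'm set \<Rightarrow> ('r, 'n) module \<Rightarrow> bool" where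
  "quo R M A B K \<longleftrightarrow> (\<exists>\<theta>\<in>module_hom R (submod M B) K. \<theta> ` B = carrier K \<and> (\<forall>x\<in>B. \<theta> x = \<zero>\<^bsub>K\<^esub> \<longleftrightarrow> x \<in> A))"

text \<open>The step relation used in \<open>Filt\<close>. It asserts that both ends are submodules
  because the families of \<open>Filt\<close> consist of arbitrary sets.\<close>

definition quo_class ::
  "'r ring \<Rightarrow> ('r, 'n) module set \<Rightarrow> ('r, 'm) module \<Rightarrow> 'm set \<Rightarrow> 'm set \<Rightarrow> bool" where
  "quo_class R \<C> M A B \<longleftrightarrow> submodule A R M \<and> submodule B R M \<and> A \<subseteq> B \<and> (\<exists>K\<in>\<C>. quo R M A B K)"

lemma quoE:
  assumes "quo R M A B K"
  obtains \<theta> where "\<theta> \<in> module_hom R (submod M B) K" "\<theta> ` B = carrier K" "\<And>x. x \<in> B \<Longrightarrow> \<theta> x = \<zero>\<^bsub>K\<^esub> \<longleftrightarrow> x \<in> A"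
  using assms unfolding quo_def by blast

lemma quoI:
  assumes "\<theta> \<in> module_hom R (submod M B) K" "\<theta> ` B = carrier K" "\<And>x. x \<in> B \<Longrightarrow> \<theta> x = \<zero>\<^bsub>K\<^esub> \<longleftrightarrow> x \<in> A"
  shows "quo R M A B K"
  using assms unfolding quo_def by blast

context lmod
begin

lemma coset_absorb:
  assumes "submodule A R M" "b \<in> A" "y \<in> carrier M"
  shows "A +>\<^bsub>M\<^esub> (b \<oplus>\<^bsub>M\<^esub> y) = A +>\<^bsub>M\<^esub> y"
proof (intro subset_antisym subsetI)
  note A = subD[OF assms(1)]
  fix z assume "z \<in> A +>\<^bsub>M\<^esub> (b \<oplus>\<^bsub>M\<^esub> y)"
  then obtain a where "a \<in> A" "z = a \<oplus>\<^bsub>M\<^esub> (b \<oplus>\<^bsub>M\<^esub> y)" unfolding a_r_coset_def' by blast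
  then have "z = (a \<oplus>\<^bsub>M\<^esub> b) \<oplus>\<^bsub>M\<^esub> y" "a \<oplus>\<^bsub>M\<^esub> b \<in> A" using A(2,4) assms(2,3) by (auto simp: M.a_assoc)
  then show "z \<in> A +>\<^bsub>M\<^esub> y" unfolding a_r_coset_def' by blast
next
  note A = subD[OF assms(1)]
  fix z assume "z \<in> A +>\<^bsub>M\<^esub> y"
  then obtain a where "a \<in> A" "z = a \<oplus>\<^bsub>M\<^esub> y" unfolding a_r_coset_def' by blast
  then have "z = (a \<ominus>\<^bsub>M\<^esub> b) \<oplus>\<^bsub>M\<^esub> (b \<oplus>\<^bsub>M\<^esub> y)" "a \<ominus>\<^bsub>M\<^esub> b \<in> A"
    using A(2,7) assms(2,3) by (auto simp: a_minus_def M.a_assoc M.r_neg1)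
  then show "z \<in> A +>\<^bsub>M\<^esub> (b \<oplus>\<^bsub>M\<^esub> y)" unfolding a_r_coset_def' by blast
qed

lemma coset_eq_iff:
  assumes "submodule A R M" "x \<in> carrier M"
  shows "A +>\<^bsub>M\<^esub> x = A \<longleftrightarrow> x \<in> A"
proof
  note A = subD[OF assms(1)]
  assume "A +>\<^bsub>M\<^esub> x = A"
  moreover have "x \<in> A +>\<^bsub>M\<^esub> x"
    unfolding a_r_coset_def' using A(3) assms(2) by (intro UN_I[of "\<zero>\<^bsub>M\<^esub>"]) auto
  ultimately show "x \<in> A" by simp
next
  note A = subD[OF assms(1)]
  assume x: "x \<in> A"
  have "A +>\<^bsub>M\<^esub> \<zero>\<^bsub>M\<^esub> = A" using A(1) by (rule M.a_coset_add_zero)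
  then show "A +>\<^bsub>M\<^esub> x = A" using coset_absorb[OF assms(1) x, of "\<zero>\<^bsub>M\<^esub>"] assms(2) by simp
qed

lemma coset_hom:
  assumes "submodule A R M"
  shows "(\<lambda>x. A +>\<^bsub>M\<^esub> x) \<in> module_hom R M (quot_module M A)"
    and "(\<lambda>x. A +>\<^bsub>M\<^esub> x) ` carrier M = carrier (quot_module M A)"
proof -
  note A = subD[OF assms]
  show 1: "(\<lambda>x. A +>\<^bsub>M\<^esub> x) ` carrier M = carrier (quot_module M A)"
    by (auto simp: quot_module_def A_RCOSETS_def')
  show "(\<lambda>x. A +>\<^bsub>M\<^esub> x) \<in> module_hom R M (quot_module M A)"
  proof (rule module_homI)
    show "x \<in> carrier M \<Longrightarrow> A +>\<^bsub>M\<^esub> x \<in> carrier (quot_module M A)" for x using 1 by blast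
    fix x y assume xy: "x \<in> carrier M" "y \<in> carrier M"
    have "A +>\<^bsub>M\<^esub> (x \<oplus>\<^bsub>M\<^esub> y) = (A +>\<^bsub>M\<^esub> x) <+>\<^bsub>M\<^esub> (A +>\<^bsub>M\<^esub> y)"
    proof (intro subset_antisym subsetI)
      fix z assume "z \<in> A +>\<^bsub>M\<^esub> (x \<oplus>\<^bsub>M\<^esub> y)"
      then obtain a where "a \<in> A" "z = a \<oplus>\<^bsub>M\<^esub> (x \<oplus>\<^bsub>M\<^esub> y)" unfolding a_r_coset_def' by blast
      then have "z = (a \<oplus>\<^bsub>M\<^esub> x) \<oplus>\<^bsub>M\<^esub> (\<zero>\<^bsub>M\<^esub> \<oplus>\<^bsub>M\<^esub> y)" using xy A(2) by (simp add: M.a_assoc)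
      then show "z \<in> (A +>\<^bsub>M\<^esub> x) <+>\<^bsub>M\<^esub> (A +>\<^bsub>M\<^esub> y)"
        unfolding a_r_coset_def' set_add_def' using \<open>a \<in> A\<close> A(3) by blast
    next
      fix z assume "z \<in> (A +>\<^bsub>M\<^esub> x) <+>\<^bsub>M\<^esub> (A +>\<^bsub>M\<^esub> y)"
      then obtain a b where "a \<in> A" "b \<in> A" "z = (a \<oplus>\<^bsub>M\<^esub> x) \<oplus>\<^bsub>M\<^esub> (b \<oplus>\<^bsub>M\<^esub> y)"
        unfolding a_r_coset_def' set_add_def' by blast
      then have "z = (a \<oplus>\<^bsub>M\<^esub> b) \<oplus>\<^bsub>M\<^esub> (x \<oplus>\<^bsub>M\<^esub> y)" "a \<oplus>\<^bsub>M\<^esub> b \<in> A" using xy A(2,4) by (auto simp: M.a_ac)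
      then show "z \<in> A +>\<^bsub>M\<^esub> (x \<oplus>\<^bsub>M\<^esub> y)" unfolding a_r_coset_def' by blast
    qed
    then show "A +>\<^bsub>M\<^esub> (x \<oplus>\<^bsub>M\<^esub> y) = (A +>\<^bsub>M\<^esub> x) \<oplus>\<^bsub>quot_module M A\<^esub> (A +>\<^bsub>M\<^esub> y)"
      by (simp add: quot_module_def)
  next
    fix r x assume rx: "r \<in> carrier R" "x \<in> carrier M"
    have const: "A +>\<^bsub>M\<^esub> (r \<odot>\<^bsub>M\<^esub> z) = A +>\<^bsub>M\<^esub> (r \<odot>\<^bsub>M\<^esub> x)" if "z \<in> A +>\<^bsub>M\<^esub> x" for z
    proof -
      obtain a where "a \<in> A" "z = a \<oplus>\<^bsub>M\<^esub> x" using \<open>z \<in> A +>\<^bsub>M\<^esub> x\<close> unfolding a_r_coset_def' by blast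
      then show ?thesis
        using coset_absorb[OF assms A(5)[OF rx(1)], of a "r \<odot>\<^bsub>M\<^esub> x"] rx A(2) smult_closed smult_r_distr by simp
    qed
    have "x \<in> A +>\<^bsub>M\<^esub> x"
      unfolding a_r_coset_def' using A(3) rx(2) by (intro UN_I[of "\<zero>\<^bsub>M\<^esub>"]) auto
    then have "(\<Union>z\<in>A +>\<^bsub>M\<^esub> x. A +>\<^bsub>M\<^esub> (r \<odot>\<^bsub>M\<^esub> z)) = (\<Union>z\<in>A +>\<^bsub>M\<^esub> x. A +>\<^bsub>M\<^esub> (r \<odot>\<^bsub>M\<^esub> x))"
      using const by (intro SUP_cong refl)
    also have "\<dots> = A +>\<^bsub>M\<^esub> (r \<odot>\<^bsub>M\<^esub> x)" using \<open>x \<in> A +>\<^bsub>M\<^esub> x\<close> by auto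
    finally show "A +>\<^bsub>M\<^esub> (r \<odot>\<^bsub>M\<^esub> x) = r \<odot>\<^bsub>quot_module M A\<^esub> (A +>\<^bsub>M\<^esub> x)"
      by (simp add: quot_module_def)
  qed
qed

lemma left_module_quot:
  assumes "submodule A R M"
  shows "left_module R (quot_module M A)"
proof (rule left_module_image[OF left_module_axioms coset_hom[OF assms]])
  show "\<zero>\<^bsub>quot_module M A\<^esub> = A +>\<^bsub>M\<^esub> \<zero>\<^bsub>M\<^esub>"
    using coset_eq_iff[OF assms, of "\<zero>\<^bsub>M\<^esub>"] subD(3)[OF assms] by (simp add: quot_module_def)
qed

text \<open>In one direction the isomorphism is composed with the coset projection; in the other the
  epimorphism is factored through it, and equality of the kernels gives injectivity.\<close>

lemma quo_iff_iso:
  assumes A: "submodule A R M" and B: "submodule B R M" and AB: "A \<subseteq> B" and K: "left_module R K"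
  shows "module_iso R (quot_module (submod M B) A) K \<longleftrightarrow> quo R M A B K"
proof -
  interpret S: lmod R "submod M B" by (rule lmod_submod[OF B])
  interpret K: lmod R K using K by (simp add: lmod_def)
  have A': "submodule A R (submod M B)" using A AB sub_submod[OF B] by blast
  let ?Q = "quot_module (submod M B) A" and ?p = "\<lambda>x. A +>\<^bsub>submod M B\<^esub> x"
  interpret Q: lmod R ?Q using S.left_module_quot[OF A'] by (simp add: lmod_def)
  note p = S.coset_hom[OF A']
  have zero: "\<zero>\<^bsub>?Q\<^esub> = A" by (simp add: quot_module_def)
  show ?thesis
  proof
    assume "module_iso R ?Q K"
    then obtain h where h: "h \<in> module_hom R ?Q K" "bij_betw h (carrier ?Q) (carrier K)"
      unfolding module_iso_def by blast
    have h0: "h A = \<zero>\<^bsub>K\<^esub>" using hom_props(1)[OF h(1) Q.lmod_axioms K.lmod_axioms] zero by simp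
    show "quo R M A B K"
    proof (rule quoI[of "\<lambda>x. h (?p x)"])
      show "(\<lambda>x. h (?p x)) \<in> module_hom R (submod M B) K"
        by (rule module_hom_comp[OF p(1) h(1)])
      show "(\<lambda>x. h (?p x)) ` B = carrier K"
        using p(2) h(2) by (simp add: bij_betw_def image_image[symmetric])
      fix x assume x: "x \<in> B"
      have "h (?p x) = h A \<longleftrightarrow> ?p x = A"
        by (rule inj_on_eq_iff[of h "carrier ?Q"])
          (use h(2) Q.M.zero_closed x zero module_homD(1)[OF p(1)] in \<open>auto simp: bij_betw_def\<close>)
      then show "h (?p x) = \<zero>\<^bsub>K\<^esub> \<longleftrightarrow> x \<in> A"
        using S.coset_eq_iff[OF A'] x h0 by simp
    qed
  next
    assume "quo R M A B K"
    then obtain \<theta> where \<theta>: "\<theta> \<in> module_hom R (submod M B) K" "\<theta> ` B = carrier K"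
      "\<And>x. x \<in> B \<Longrightarrow> \<theta> x = \<zero>\<^bsub>K\<^esub> \<longleftrightarrow> x \<in> A" by (rule quoE) (rule that)
    obtain h where h: "h \<in> module_hom R ?Q K" "\<And>x. x \<in> carrier (submod M B) \<Longrightarrow> h (?p x) = \<theta> x"
      by (rule hom_factor[OF p(1,2) \<theta>(1) S.lmod_axioms Q.lmod_axioms K.lmod_axioms])
        (use S.coset_eq_iff[OF A'] \<theta>(3) zero in auto)
    have "bij_betw h (carrier ?Q) (carrier K)"
    proof (rule bij_betw_imageI)
      show "h ` carrier ?Q = carrier K"
        using h(2) \<theta>(2) unfolding p(2)[symmetric] by (simp add: image_image)
      show "inj_on h (carrier ?Q)"
      proof (rule inj_onI)
        fix X Y assume XY: "X \<in> carrier ?Q" "Y \<in> carrier ?Q" "h X = h Y"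
        obtain z where z: "z \<in> B" "X \<ominus>\<^bsub>?Q\<^esub> Y = ?p z"
          using Q.M.minus_closed[OF XY(1,2)] unfolding p(2)[symmetric] by auto
        have "h (?p z) = \<zero>\<^bsub>K\<^esub>"
          using hom_props(3)[OF h(1) Q.lmod_axioms K.lmod_axioms XY(1,2)] XY z module_homD(1)[OF h(1) XY(2)]
          by (simp add: K.diff_self)
        then have "?p z = A" using h(2) \<theta>(3) S.coset_eq_iff[OF A'] z by simp
        then show "X = Y" using z(2) zero Q.diff_zero_iff XY by simp
      qed
    qed
    then show "module_iso R ?Q K" unfolding module_iso_def using h by blast
  qed
qed

end

section \<open>Transport of filtrations along epimorphisms\<close>

lemma quo_comp:
  assumes "\<theta> \<in> module_hom R M1 M2" "\<theta> ` carrier M1 = carrier M2"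
    and "lmod R M1" "lmod R M2" "B \<subseteq> carrier M2" "quo R M2 A B K"
  shows "quo R M1 {x \<in> carrier M1. \<theta> x \<in> A} {x \<in> carrier M1. \<theta> x \<in> B} K"
proof -
  obtain \<phi> where \<phi>: "\<phi> \<in> module_hom R (submod M2 B) K" "\<phi> ` B = carrier K"
    "\<And>x. x \<in> B \<Longrightarrow> \<phi> x = \<zero>\<^bsub>K\<^esub> \<longleftrightarrow> x \<in> A" by (rule quoE[OF assms(6)]) (rule that)
  let ?B = "{x \<in> carrier M1. \<theta> x \<in> B}"
  have "\<theta> \<in> module_hom R (submod M1 ?B) (submod M2 B)"
    by (rule module_homI) (use module_homD[OF assms(1)] in auto)
  then have "(\<lambda>x. \<phi> (\<theta> x)) \<in> module_hom R (submod M1 ?B) K"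
    using module_hom_comp \<phi>(1) by blast
  moreover have "\<theta> ` ?B = B" using assms(5) unfolding assms(2)[symmetric] by auto
  then have "(\<lambda>x. \<phi> (\<theta> x)) ` ?B = carrier K"
    using \<phi>(2) by (metis image_image)
  moreover have "\<phi> (\<theta> y) = \<zero>\<^bsub>K\<^esub> \<longleftrightarrow> y \<in> {x \<in> carrier M1. \<theta> x \<in> A}" if "y \<in> ?B" for y
    using that \<phi>(3) by simp
  ultimately show ?thesis
    by (rule quoI[of "\<lambda>x. \<phi> (\<theta> x)"])
qed

lemma quo_image:
  assumes "\<theta> \<in> module_hom R M1 M2" "lmod R M1" "lmod R M2" "lmod R K"
    and "submodule B R M1" "\<And>x. x \<in> B \<Longrightarrow> \<theta> x = \<zero>\<^bsub>M2\<^esub> \<Longrightarrow> x \<in> A" "A \<subseteq> B" "quo R M1 A B K"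
  shows "quo R M2 (\<theta> ` A) (\<theta> ` B) K"
proof -
  interpret M1: lmod R M1 by fact
  interpret M2: lmod R M2 by fact
  obtain \<phi> where \<phi>: "\<phi> \<in> module_hom R (submod M1 B) K" "\<phi> ` B = carrier K"
    "\<And>x. x \<in> B \<Longrightarrow> \<phi> x = \<zero>\<^bsub>K\<^esub> \<longleftrightarrow> x \<in> A" by (rule quoE[OF assms(8)]) (rule that)
  note B = M1.subD[OF assms(5)]
  have im: "submodule (\<theta> ` B) R M2" by (rule hom_image_sub[OF assms(1-3,5)])
  have t: "\<theta> \<in> module_hom R (submod M1 B) (submod M2 (\<theta> ` B))"
    by (rule module_homI) (use module_homD[OF assms(1)] B(2) in auto)
  obtain \<psi> where \<psi>: "\<psi> \<in> module_hom R (submod M2 (\<theta> ` B)) K"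
    "\<And>x. x \<in> carrier (submod M1 B) \<Longrightarrow> \<psi> (\<theta> x) = \<phi> x"
    by (rule hom_factor[OF t _ \<phi>(1) M1.lmod_submod[OF assms(5)] M2.lmod_submod[OF im] assms(4)])
      (use assms(6) \<phi>(3) in auto)
  show ?thesis
  proof (rule quoI[OF \<psi>(1)])
    show "\<psi> ` \<theta> ` B = carrier K" using \<psi>(2) \<phi>(2) by (simp add: image_image)
    fix y assume "y \<in> \<theta> ` B"
    then obtain x where x: "x \<in> B" "y = \<theta> x" by blast
    have "x \<in> A" if "\<theta> x = \<theta> a" "a \<in> A" for a
    proof -
      have a: "a \<in> B" using that assms(7) by blast
      then have "\<theta> (x \<ominus>\<^bsub>M1\<^esub> a) = \<zero>\<^bsub>M2\<^esub>"
        using that x hom_props(3)[OF assms(1-3)] B(2) module_homD(1)[OF assms(1)]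
        by (simp add: M2.diff_self)
      then have "x \<ominus>\<^bsub>M1\<^esub> a \<in> A" using assms(6) B(7) x a by blast
      then have "\<phi> (x \<ominus>\<^bsub>M1\<^esub> a) = \<zero>\<^bsub>K\<^esub>" using \<phi>(3) assms(7) by blast
      then have "\<phi> x = \<phi> a"
        using hom_props(3)[OF \<phi>(1) M1.lmod_submod[OF assms(5)] assms(4)] x a
          lmod.diff_zero_iff[OF assms(4)] module_homD(1)[OF \<phi>(1)]
        by (simp add: M1.minus_submod[OF assms(5)])
      then show "x \<in> A" using \<phi>(3) a x that by metis
    qed
    then show "\<psi> y = \<zero>\<^bsub>K\<^esub> \<longleftrightarrow> y \<in> \<theta> ` A"
      using \<psi>(2) \<phi>(3) x by auto
  qed
qed

text \<open>Preimages turn a filtration of M2 into one between the kernel A and M1, and images lead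
  back. With the identity as \<theta> this treats submodules, with the coset projection quotients;
  hence the free element type of M2.\<close>

lemma filtered_iff_Filt:
  fixes \<theta> :: "'m \<Rightarrow> 'n" and x :: "'v::zfc_universe" and M1 :: "('v, 'm) module"
  assumes \<theta>: "\<theta> \<in> module_hom R M1 M2" "\<theta> ` carrier M1 = carrier M2"
    and M: "lmod R M1" "lmod R M2" and \<C>: "\<And>K. K \<in> \<C> \<Longrightarrow> left_module R K"
    and A: "A = {x \<in> carrier M1. \<theta> x = \<zero>\<^bsub>M2\<^esub>}" and small: "carrier M1 \<lesssim> elts x"
  shows "filtered R \<C> M2 \<longleftrightarrow> Filt (quo_class R \<C> M1) A (carrier M1)"
proof
  interpret M1: lmod R M1 by fact
  interpret M2: lmod R M2 by fact
  assume "filtered R \<C> M2"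
  then obtain \<eta> F where F: "filtration R M2 \<eta> F" "F vzero = {\<zero>\<^bsub>M2\<^esub>}"
    and step: "\<And>i. vsucc i \<in> elts \<eta> \<Longrightarrow> \<exists>N\<in>\<C>. module_iso R (quot_module (submod M2 (F (vsucc i))) (F i)) N"
    unfolding filtered_def by blast
  have F': "Ord \<eta>" "\<And>i. i \<in> elts \<eta> \<Longrightarrow> submodule (F i) R M2"
    "\<And>i j. j \<in> elts \<eta> \<Longrightarrow> i \<in> elts j \<Longrightarrow> F i \<subseteq> F j"
    "\<And>i. i \<in> elts \<eta> \<Longrightarrow> Limit i \<Longrightarrow> F i = (\<Union>k\<in>elts i. F k)" "(\<Union>i\<in>elts \<eta>. F i) = carrier M2"
    using F(1) unfolding filtration_def by blast+
  define G where "G i = {x \<in> carrier M1. \<theta> x \<in> F i}" for i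
  show "Filt (quo_class R \<C> M1) A (carrier M1)"
  proof (rule Filt_ordinal[of \<eta> G])
    show "vzero \<in> elts \<eta>"
      using vzero_or[OF F'(1)] F'(5) M2.M.zero_closed by (auto simp: elts_vzero)
    show "G vzero = A" unfolding G_def A F(2) by simp
    show "(\<Union>i\<in>elts \<eta>. G i) = carrier M1"
      unfolding G_def using F'(5) module_homD(1)[OF \<theta>(1)] by blast
    fix i assume i: "vsucc i \<in> elts \<eta>"
    have "i \<in> elts (vsucc i)" by (simp add: elts_vsucc)
    then have "i \<in> elts \<eta>" "F i \<subseteq> F (vsucc i)" using Ord_trans[OF F'(1) i] F'(3)[OF i] by auto
    moreover obtain N where N: "N \<in> \<C>" "module_iso R (quot_module (submod M2 (F (vsucc i))) (F i)) N"
      using step[OF i] by blast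
    ultimately have "quo R M2 (F i) (F (vsucc i)) N"
      using M2.quo_iff_iso F'(2) i \<C> by blast
    then have "quo R M1 (G i) (G (vsucc i)) N"
      unfolding G_def by (rule quo_comp[OF \<theta> M, rotated]) (use F'(5) i in blast)
    moreover have "submodule (G j) R M1" if "j \<in> elts \<eta>" for j
      unfolding G_def by (rule hom_ker_sub[OF \<theta>(1) M F'(2)[OF that]])
    moreover have "G i \<subseteq> G (vsucc i)" using \<open>F i \<subseteq> _\<close> unfolding G_def by blast
    ultimately have "quo_class R \<C> M1 (G i) (G (vsucc i))"
      unfolding quo_class_def using N(1) i \<open>i \<in> elts \<eta>\<close> by blast
    then show "Filt (quo_class R \<C> M1) (G i) (G (vsucc i))"
      using \<open>G i \<subseteq> _\<close> by (rule Filt_step[rotated])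
  qed (use F' in \<open>auto simp: G_def\<close>)
next
  interpret M1: lmod R M1 by fact
  interpret M2: lmod R M2 by fact
  assume "Filt (quo_class R \<C> M1) A (carrier M1)"
  then obtain \<eta> :: 'v and F where F: "Ord \<eta>" "vzero \<in> elts \<eta>"
    "F vzero = A" "\<And>i j. j \<in> elts \<eta> \<Longrightarrow> i \<in> elts j \<Longrightarrow> F i \<subseteq> F j"
      "\<And>i. i \<in> elts \<eta> \<Longrightarrow> Limit i \<Longrightarrow> F i = (\<Union>k\<in>elts i. F k)"
      "(\<Union>i\<in>elts \<eta>. F i) = carrier M1"
      "\<And>i. vsucc i \<in> elts \<eta> \<Longrightarrow> F i \<noteq> F (vsucc i) \<and> quo_class R \<C> M1 (F i) (F (vsucc i))"
    by (rule Filt_ordinalE[OF _ small]) (rule that)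
  have Asub: "submodule A R M1"
    using hom_ker_sub[OF \<theta>(1) M M2.sub_zero] by (simp add: A)
  \<comment> \<open>\<open>quo_class\<close> vouches only for the ends of successor steps; a limit
    stage is the union of a chain of such submodules.\<close>
  have sub: "submodule (F i) R M1" if i: "i \<in> elts \<eta>" for i
  proof (rule Ord_cases[OF Ord_elt[OF F(1) i]])
    assume "i = vzero" then show ?thesis using F(3) Asub by simp
  next
    fix j assume "i = vsucc j" then show ?thesis using F(7) i by (auto simp: quo_class_def)
  next
    assume lim: "Limit i"
    have "submodule (\<Union>(F ` elts i)) R M1"
    proof (rule M1.sub_Union)
      show "F ` elts i \<noteq> {}" using lim by (auto simp: Limit_def)
      show "submodule N R M1" if N: "N \<in> F ` elts i" for N
      proof -
        obtain k where k: "k \<in> elts i" "N = F k" using N by blast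
        then have "vsucc k \<in> elts \<eta>" using lim Ord_trans[OF F(1) i] by (auto simp: Limit_def)
        then show ?thesis using F(7) k by (auto simp: quo_class_def)
      qed
      show "chain\<^sub>\<subseteq> (F ` elts i)"
        by (rule chain_image) (use F(4) Ord_elt[OF F(1)] Ord_trans[OF F(1) i] in blast)+
    qed
    then show ?thesis using F(5)[OF i lim] by simp
  qed
  have AF: "A \<subseteq> F i" if "i \<in> elts \<eta>" for i
    using vzero_or[OF Ord_elt[OF F(1) that]] F(3) F(4)[OF that] by auto
  show "filtered R \<C> M2"
    unfolding filtered_def filtration_def
  proof (intro exI[of _ \<eta>] exI[of _ "\<lambda>i. \<theta> ` F i"] conjI ballI allI impI)
    show "submodule (\<theta> ` F i) R M2" if "i \<in> elts \<eta>" for i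
      by (rule hom_image_sub[OF \<theta>(1) M sub[OF that]])
    show "\<theta> ` F i \<subseteq> \<theta> ` F j" if "j \<in> elts \<eta>" "i \<in> elts j" for i j using F(4) that by blast
    show "\<theta> ` F i = (\<Union>k\<in>elts i. \<theta> ` F k)" if "i \<in> elts \<eta>" "Limit i" for i
      using F(5)[OF that] by (simp add: image_UN)
    show "(\<Union>i\<in>elts \<eta>. \<theta> ` F i) = carrier M2"
      using F(6) \<theta>(2) by (simp add: image_UN[symmetric])
    show "\<theta> ` F vzero = {\<zero>\<^bsub>M2\<^esub>}"
      unfolding F(3) A using hom_props(1)[OF \<theta>(1) M] M1.M.zero_closed by force
    fix i assume i: "vsucc i \<in> elts \<eta>"
    then have i': "i \<in> elts \<eta>" using Ord_trans[OF F(1) i] by (simp add: elts_vsucc)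
    obtain K where K: "K \<in> \<C>" "quo R M1 (F i) (F (vsucc i)) K" "F i \<subseteq> F (vsucc i)"
      using F(7)[OF i] unfolding quo_class_def by blast
    have "quo R M2 (\<theta> ` F i) (\<theta> ` F (vsucc i)) K"
      by (rule quo_image[OF \<theta>(1) M _ sub[OF i] _ K(3,2)])
        (use AF[OF i'] \<C>[OF K(1)] A M1.subD(2)[OF sub[OF i]] in \<open>auto simp: lmod_def\<close>)
    then have "module_iso R (quot_module (submod M2 (\<theta> ` F (vsucc i))) (\<theta> ` F i)) K"
      using M2.quo_iff_iso[OF hom_image_sub[OF \<theta>(1) M sub[OF i']] hom_image_sub[OF \<theta>(1) M sub[OF i]]]
        K(3) \<C>[OF K(1)] by blast
    then show "\<exists>N\<in>\<C>. module_iso R (quot_module (submod M2 (\<theta> ` F (vsucc i))) (\<theta> ` F i)) N"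
      using K(1) by blast
  qed (rule F(1))
qed

text \<open>Coset modules and free modules have elements outside the universe, while
  \<open>projective\<close> and the members of a class \<open>\<C>\<close> only involve modules
  carried by the universe; the structure is copied along an injection.\<close>

lemma exists_rmodule_copy:
  fixes N :: "('v::zfc_universe, 'n) module" and x :: 'v
  assumes "left_module R N" "carrier N \<lesssim> elts x"
  obtains K h where "rmodule R K" "h \<in> module_hom R N K" "bij_betw h (carrier N) (carrier K)"
proof -
  obtain f where f: "inj_on f (carrier N)" "f ` carrier N \<subseteq> elts x"
    using assms(2) unfolding lepoll_def by blast
  define g where "g = inv_into (carrier N) f"
  have g: "g (f a) = a" if "a \<in> carrier N" for a
    unfolding g_def using f(1) that by simp
  define K :: "('v, 'v) module" where "K = \<lparr>carrier = f ` carrier N, mult = undefined, one = undefined, zero = f \<zero>\<^bsub>N\<^esub>,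
    add = (\<lambda>a b. f (g a \<oplus>\<^bsub>N\<^esub> g b)), smult = (\<lambda>r a. f (r \<odot>\<^bsub>N\<^esub> g a))\<rparr>"
  have h: "f \<in> module_hom R N K" "f ` carrier N = carrier K"
    by (auto intro!: module_homI simp: K_def g)
  have "left_module R K"
    by (rule left_module_image[OF assms(1) h]) (simp add: K_def)
  moreover have "small (carrier K)"
    unfolding h(2)[symmetric] using f(2) small_subset[OF small_elts] by blast
  ultimately show thesis
    using that[of K f] h f(1) by (auto simp: rmodule_def bij_betw_def)
qed

lemma rmodule_lmod: "rmodule R M \<Longrightarrow> lmod R M"
  by (simp add: rmodule_def lmod_def)

lemma rmodule_lepoll:
  fixes M :: "('v::zfc_universe, 'v) module"
  assumes "rmodule R M" "B \<subseteq> carrier M"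
  shows "\<exists>x :: 'v. B \<lesssim> elts x"
proof -
  obtain x :: 'v where "carrier M = elts x" using assms(1) by (auto simp: rmodule_def small_def)
  then show ?thesis using assms(2) subset_imp_lepoll by metis
qed

lemma rmodule_submod: "rmodule R M \<Longrightarrow> submodule B R M \<Longrightarrow> rmodule R (submod M B)"
  using lmod.left_module_submod[of R M B] lmod.subD(1)[of R M B] small_subset
  by (auto simp: rmodule_def lmod_def)

lemma exists_quo:
  fixes M :: "('v::zfc_universe, 'v) module"
  assumes M: "rmodule R M" and AB: "submodule A R M" "submodule B R M" "A \<subseteq> B"
  obtains K :: "('v, 'v) module" where "rmodule R K" "quo R M A B K"
proof -
  interpret M: lmod R M using M by (rule rmodule_lmod)
  interpret S: lmod R "submod M B" by (rule M.lmod_submod[OF AB(2)])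
  have A': "submodule A R (submod M B)" using AB M.sub_submod by blast
  let ?Q = "quot_module (submod M B) A"
  obtain x :: 'v where "B \<lesssim> elts x" using rmodule_lepoll[OF M M.subD(1)[OF AB(2)]] by blast
  moreover have "carrier ?Q \<lesssim> B"
    using S.coset_hom(2)[OF A'] by (metis image_lepoll submod_simps(1))
  ultimately have "carrier ?Q \<lesssim> elts x" using lepoll_trans by blast
  then obtain K h where K: "rmodule R K" "h \<in> module_hom R ?Q K" "bij_betw h (carrier ?Q) (carrier K)"
    using exists_rmodule_copy[OF S.left_module_quot[OF A']] by blast
  then have "module_iso R ?Q K" unfolding module_iso_def by blast
  then have "quo R M A B K" using M.quo_iff_iso[OF AB, of K] K(1) by (simp add: rmodule_def)
  then show thesis using that K(1) by blast
qed

lemma quo_class_submod: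
  assumes "lmod R M" "submodule B R M" "N' \<subseteq> B"
  shows "quo_class R \<C> (submod M B) N N' \<longleftrightarrow> quo_class R \<C> M N N'"
proof -
  interpret M: lmod R M by fact
  show ?thesis unfolding quo_class_def quo_def using M.sub_submod[OF assms(2)] assms(3) by auto
qed

lemma Filt_quo_class_submod:
  assumes "lmod R M" "submodule B R M" "C \<subseteq> B"
  shows "Filt (quo_class R \<C> (submod M B)) A C \<longleftrightarrow> Filt (quo_class R \<C> M) A C"
proof
  have *: "N' \<subseteq> C \<Longrightarrow> quo_class R \<C> (submod M B) N N' \<longleftrightarrow> quo_class R \<C> M N N'" for N N'
    using quo_class_submod[OF assms(1,2)] assms(3) by blast
  show "Filt (quo_class R \<C> M) A C" if "Filt (quo_class R \<C> (submod M B)) A C"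
    by (rule Filt_mono[OF that]) (use * in simp)
  show "Filt (quo_class R \<C> (submod M B)) A C" if "Filt (quo_class R \<C> M) A C"
    by (rule Filt_mono[OF that]) (use * in simp)
qed

lemma filtered_submod:
  fixes M :: "('v::zfc_universe, 'v) module"
  assumes M: "rmodule R M" and B: "submodule B R M" and \<C>: "\<And>K. K \<in> \<C> \<Longrightarrow> left_module R K"
  shows "filtered R \<C> (submod M B) \<longleftrightarrow> Filt (quo_class R \<C> M) {\<zero>\<^bsub>M\<^esub>} B"
proof -
  interpret M: lmod R M using M by (rule rmodule_lmod)
  obtain x :: 'v where x: "B \<lesssim> elts x" using rmodule_lepoll[OF M M.subD(1)[OF B]] by blast
  have "filtered R \<C> (submod M B) \<longleftrightarrow> Filt (quo_class R \<C> (submod M B)) {\<zero>\<^bsub>M\<^esub>} (carrier (submod M B))"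
    by (rule filtered_iff_Filt[OF module_hom_id _ M.lmod_submod[OF B] M.lmod_submod[OF B] \<C>, where x = x])
      (use x M.subD(3)[OF B] in auto)
  also have "\<dots> \<longleftrightarrow> Filt (quo_class R \<C> M) {\<zero>\<^bsub>M\<^esub>} B"
    unfolding submod_simps by (rule Filt_quo_class_submod[OF M.lmod_axioms B]) simp
  finally show ?thesis .
qed

lemma filtered_quot:
  fixes M :: "('v::zfc_universe, 'v) module"
  assumes M: "rmodule R M" and AB: "submodule A R M" "submodule B R M" "A \<subseteq> B"
    and \<C>: "\<And>K. K \<in> \<C> \<Longrightarrow> left_module R K"
  shows "filtered R \<C> (quot_module (submod M B) A) \<longleftrightarrow> Filt (quo_class R \<C> M) A B"
proof -
  interpret M: lmod R M using M by (rule rmodule_lmod)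
  interpret S: lmod R "submod M B" by (rule M.lmod_submod[OF AB(2)])
  have A': "submodule A R (submod M B)" using AB M.sub_submod by blast
  obtain x :: 'v where x: "B \<lesssim> elts x" using rmodule_lepoll[OF M M.subD(1)[OF AB(2)]] by blast
  have "filtered R \<C> (quot_module (submod M B) A) \<longleftrightarrow> Filt (quo_class R \<C> (submod M B)) A (carrier (submod M B))"
  proof (rule filtered_iff_Filt[OF S.coset_hom[OF A'] S.lmod_axioms _ \<C>, where x = x])
    show "lmod R (quot_module (submod M B) A)" using S.left_module_quot[OF A'] by (simp add: lmod_def)
    show "A = {x \<in> carrier (submod M B). A +>\<^bsub>submod M B\<^esub> x = \<zero>\<^bsub>quot_module (submod M B) A\<^esub>}"
      using S.coset_eq_iff[OF A'] AB(3) by (auto simp: quot_module_def)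
  qed (use x in auto)
  also have "\<dots> \<longleftrightarrow> Filt (quo_class R \<C> M) A B"
    unfolding submod_simps by (rule Filt_quo_class_submod[OF M.lmod_axioms AB(2)]) simp
  finally show ?thesis .
qed

subsection \<open>Free modules\<close>

definition unit_vec :: "'r ring \<Rightarrow> 'j \<Rightarrow> 'j \<Rightarrow> 'r" where
  "unit_vec R j = (\<lambda>i. if i = j then \<one>\<^bsub>R\<^esub> else \<zero>\<^bsub>R\<^esub>)"

lemma free_module_simps [simp]:
  "zero (free_module R J) = (\<lambda>j. \<zero>\<^bsub>R\<^esub>)" "f \<oplus>\<^bsub>free_module R J\<^esub> g = (\<lambda>j. f j \<oplus>\<^bsub>R\<^esub> g j)"
  "a \<odot>\<^bsub>free_module R J\<^esub> f = (\<lambda>j. a \<otimes>\<^bsub>R\<^esub> f j)"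
  by (simp_all add: free_module_def)

lemma free_module_carrier:
  "f \<in> carrier (free_module R J) \<longleftrightarrow>
     (\<forall>j. f j \<in> carrier R) \<and> (\<forall>j. f j \<noteq> \<zero>\<^bsub>R\<^esub> \<longrightarrow> j \<in> J) \<and> finite {j. f j \<noteq> \<zero>\<^bsub>R\<^esub>}"
  by (auto simp: free_module_def)

locale plain_ring = ring R for R :: "'r ring" (structure)

sublocale lmod \<subseteq> free: plain_ring R
  by unfold_locales

context plain_ring
begin

lemma free_add_closed:
  assumes "f \<in> carrier (free_module R J)" "g \<in> carrier (free_module R J)"
  shows "(\<lambda>j. f j \<oplus> g j) \<in> carrier (free_module R J)"
proof -
  have "{j. f j \<oplus> g j \<noteq> \<zero>} \<subseteq> {j. f j \<noteq> \<zero>} \<union> {j. g j \<noteq> \<zero>}" by auto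
  moreover have "finite ({j. f j \<noteq> \<zero>} \<union> {j. g j \<noteq> \<zero>})"
    using assms by (simp add: free_module_carrier)
  ultimately have "finite {j. f j \<oplus> g j \<noteq> \<zero>}"
    by (rule finite_subset)
  moreover have "f j \<oplus> g j \<noteq> \<zero> \<Longrightarrow> j \<in> J" for j
    using assms by (cases "f j = \<zero>") (auto simp: free_module_carrier)
  ultimately show ?thesis using assms by (simp add: free_module_carrier)
qed

lemma free_smult_closed:
  assumes "a \<in> carrier R" "f \<in> carrier (free_module R J)"
  shows "(\<lambda>j. a \<otimes> f j) \<in> carrier (free_module R J)"
proof -
  have "{j. a \<otimes> f j \<noteq> \<zero>} \<subseteq> {j. f j \<noteq> \<zero>}" using assms(1) by auto
  moreover have "finite {j. f j \<noteq> \<zero>}"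
    using assms by (simp add: free_module_carrier)
  ultimately have "finite {j. a \<otimes> f j \<noteq> \<zero>}"
    by (rule finite_subset)
  moreover have "a \<otimes> f j \<noteq> \<zero> \<Longrightarrow> j \<in> J" for j
    using assms by (cases "f j = \<zero>") (auto simp: free_module_carrier)
  ultimately show ?thesis using assms by (simp add: free_module_carrier)
qed

lemma free_lmod: "lmod R (free_module R J)"
proof -
  have "abelian_group (free_module R J)"
  proof (rule abelian_groupI)
    fix f assume f: "f \<in> carrier (free_module R J)"
    then have "(\<lambda>j. (\<ominus> \<one>) \<otimes> f j) \<in> carrier (free_module R J)"
      by (rule free_smult_closed[rotated]) simp
    moreover have "(\<lambda>j. (\<ominus> \<one>) \<otimes> f j \<oplus> f j) = (\<lambda>j. \<zero>)"
      using f by (auto simp: free_module_carrier l_minus l_neg)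
    ultimately show "\<exists>g\<in>carrier (free_module R J). g \<oplus>\<^bsub>free_module R J\<^esub> f = \<zero>\<^bsub>free_module R J\<^esub>"
      by (intro bexI[of _ "\<lambda>j. (\<ominus> \<one>) \<otimes> f j"]) simp_all
  qed (simp add: free_add_closed, auto simp: free_module_carrier a_ac)
  moreover have "left_module_axioms R (free_module R J)"
  proof
    fix a f assume "a \<in> carrier R" "f \<in> carrier (free_module R J)"
    then show "a \<odot>\<^bsub>free_module R J\<^esub> f \<in> carrier (free_module R J)" by (simp add: free_smult_closed)
  qed (auto simp: free_module_carrier l_distr r_distr m_assoc)
  ultimately show ?thesis
    unfolding lmod_def by (intro left_module.intro ring_axioms)
qed

lemma unit_vec_closed: "j \<in> J \<Longrightarrow> unit_vec R j \<in> carrier (free_module R J)"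
proof -
  have "{i. unit_vec R j i \<noteq> \<zero>} \<subseteq> {j}" by (auto simp: unit_vec_def)
  then have "finite {i. unit_vec R j i \<noteq> \<zero>}" using finite_subset by blast
  then show "j \<in> J \<Longrightarrow> ?thesis" by (auto simp: free_module_carrier unit_vec_def)
qed

text \<open>Induction on a finite set containing the support: one coordinate is erased, and the
  corresponding multiple of a unit vector is added back.\<close>

lemma free_mem_submodule:
  assumes "submodule N R (free_module R J)" "f \<in> carrier (free_module R J)"
    "\<And>j. f j \<noteq> \<zero> \<Longrightarrow> unit_vec R j \<in> N"
  shows "f \<in> N"
proof -
  interpret F: lmod R "free_module R J" by (rule free_lmod)
  note N = F.subD[OF assms(1)]
  have "\<forall>f\<in>carrier (free_module R J). {j. f j \<noteq> \<zero>} \<subseteq> S \<longrightarrow> (\<forall>j\<in>S. unit_vec R j \<in> N) \<longrightarrow> f \<in> N"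
    if "finite S" for S
    using that
  proof (induction S)
    case empty
    show ?case
    proof (intro ballI impI)
      fix f assume "f \<in> carrier (free_module R J)" "{j. f j \<noteq> \<zero>} \<subseteq> {}"
      then have "f = (\<lambda>j. \<zero>)" by auto
      then show "f \<in> N" using N(3) by simp
    qed
  next
    case (insert k S)
    show ?case
    proof (intro ballI impI)
      fix f assume f: "f \<in> carrier (free_module R J)" "{j. f j \<noteq> \<zero>} \<subseteq> insert k S"
        and e: "\<forall>j\<in>insert k S. unit_vec R j \<in> N"
      define g where "g = (\<lambda>j. if j = k then \<zero> else f j)"
      have "{j. g j \<noteq> \<zero>} \<subseteq> {j. f j \<noteq> \<zero>}" by (auto simp: g_def)
      then have "finite {j. g j \<noteq> \<zero>}" using f(1) finite_subset by (auto simp: free_module_carrier)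
      then have "g \<in> carrier (free_module R J)"
        using f(1) by (auto simp: free_module_carrier g_def)
      moreover have "{j. g j \<noteq> \<zero>} \<subseteq> S" using f(2) by (auto simp: g_def)
      ultimately have "g \<in> N" using insert.IH e by blast
      moreover have "f k \<in> carrier R" using f(1) by (simp add: free_module_carrier)
      ultimately have "(\<lambda>j. g j \<oplus> f k \<otimes> unit_vec R k j) \<in> N"
        using N(4)[OF \<open>g \<in> N\<close> N(5)[of "f k" "unit_vec R k"]] e by simp
      moreover have "(\<lambda>j. g j \<oplus> f k \<otimes> unit_vec R k j) = f"
        using f(1) by (auto simp: g_def unit_vec_def free_module_carrier)
      ultimately show "f \<in> N" by simp
    qed
  qed
  from this[of "{j. f j \<noteq> \<zero>}"] show ?thesis
    using assms(2,3) by (simp add: free_module_carrier)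
qed

text \<open>The kernel of the difference is a submodule, so \<open>free_mem_submodule\<close>
  applies. Agreement is asked on the support of f, which lies in J, where the unit vectors belong to
  the module.\<close>

lemma free_hom_eqI:
  assumes "g \<in> module_hom R (free_module R J) M" "h \<in> module_hom R (free_module R J) M" "lmod R M"
    "\<And>j. f j \<noteq> \<zero> \<Longrightarrow> g (unit_vec R j) = h (unit_vec R j)" "f \<in> carrier (free_module R J)"
  shows "g f = h f"
proof -
  interpret F: lmod R "free_module R J" by (rule free_lmod)
  interpret M: lmod R M by fact
  let ?d = "\<lambda>x. g x \<ominus>\<^bsub>M\<^esub> h x"
  have d: "?d \<in> module_hom R (free_module R J) M"
    by (rule hom_diff[OF assms(1-3) free_lmod])
  have "f \<in> {x \<in> carrier (free_module R J). ?d x \<in> {\<zero>\<^bsub>M\<^esub>}}"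
  proof (rule free_mem_submodule[OF hom_ker_sub[OF d free_lmod assms(3) M.sub_zero] assms(5)])
    fix j assume j: "f j \<noteq> \<zero>"
    then have "unit_vec R j \<in> carrier (free_module R J)"
      using assms(5) unit_vec_closed[of j J] by (simp add: free_module_carrier)
    then show "unit_vec R j \<in> {x \<in> carrier (free_module R J). ?d x \<in> {\<zero>\<^bsub>M\<^esub>}}"
      using assms(4)[OF j] module_homD(1)[OF assms(2)] by (simp add: M.diff_self)
  qed
  then show ?thesis
    using M.diff_zero_iff module_homD(1)[OF assms(1) assms(5)] module_homD(1)[OF assms(2) assms(5)] by simp
qed

lemma free_hom_exists:
  assumes "lmod R M" "\<And>j. j \<in> J \<Longrightarrow> y j \<in> carrier M"
  obtains h where "h \<in> module_hom R (free_module R J) M" "\<And>j. j \<in> J \<Longrightarrow> h (unit_vec R j) = y j"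
proof -
  interpret M: lmod R M by fact
  define h where "h f = finsum M (\<lambda>j. f j \<odot>\<^bsub>M\<^esub> y j) {j. f j \<noteq> \<zero>}" for f
  have cl: "(\<lambda>j. f j \<odot>\<^bsub>M\<^esub> y j) \<in> S \<rightarrow> carrier M" if "f \<in> carrier (free_module R J)" "S \<subseteq> J" for f S
    using that assms(2) M.smult_closed by (auto simp: free_module_carrier)
  \<comment> \<open>The sum may run over any finite subset of J containing the support; additivity
    needs a common index set for both summands, and y takes values in M only on J.\<close>
  have ext: "h f = finsum M (\<lambda>j. f j \<odot>\<^bsub>M\<^esub> y j) S"
    if "f \<in> carrier (free_module R J)" "finite S" "S \<subseteq> J" "{j. f j \<noteq> \<zero>} \<subseteq> S" for f S
    unfolding h_def
    by (rule M.M.add.finprod_mono_neutral_cong_left)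
      (use that cl[OF that(1,3)] assms(2) in \<open>auto simp: M.smult_l_null dest: subsetD\<close>)
  have smult: "finsum M (\<lambda>j. r \<odot>\<^bsub>M\<^esub> z j) S = r \<odot>\<^bsub>M\<^esub> finsum M z S"
    if "r \<in> carrier R" "finite S" "z \<in> S \<rightarrow> carrier M" for r z S
    using that(2,3)
  proof (induction S)
    case empty then show ?case using that(1) by (simp add: M.smult_r_null)
  next
    case (insert k S)
    then have "finsum M z S \<in> carrier M" "z k \<in> carrier M" by auto
    moreover have "(\<lambda>j. r \<odot>\<^bsub>M\<^esub> z j) \<in> S \<rightarrow> carrier M" using insert that(1) M.smult_closed by auto
    ultimately show ?case using insert that(1) M.smult_r_distr M.smult_closed by simp
  qed
  have "h \<in> module_hom R (free_module R J) M"
  proof (rule module_homI)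
    fix f assume f: "f \<in> carrier (free_module R J)"
    then have S: "{j. f j \<noteq> \<zero>} \<subseteq> J" "finite {j. f j \<noteq> \<zero>}" by (auto simp: free_module_carrier)
    show "h f \<in> carrier M" unfolding h_def using cl[OF f S(1)] by (rule M.M.finsum_closed)
    fix a assume a: "a \<in> carrier R"
    have fa: "f j \<in> carrier R" for j using f by (simp add: free_module_carrier)
    have "h (\<lambda>j. a \<otimes> f j) = finsum M (\<lambda>j. (a \<otimes> f j) \<odot>\<^bsub>M\<^esub> y j) {j. f j \<noteq> \<zero>}"
      by (rule ext[OF free_smult_closed[OF a f] S(2,1)]) (use a in auto)
    also have "\<dots> = finsum M (\<lambda>j. a \<odot>\<^bsub>M\<^esub> (f j \<odot>\<^bsub>M\<^esub> y j)) {j. f j \<noteq> \<zero>}"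
      by (rule M.M.finsum_cong') (use a fa S assms(2) M.smult_assoc M.smult_closed in auto)
    also have "\<dots> = a \<odot>\<^bsub>M\<^esub> h f"
      unfolding h_def by (rule smult[OF a S(2) cl[OF f S(1)]])
    finally show "h (a \<odot>\<^bsub>free_module R J\<^esub> f) = a \<odot>\<^bsub>M\<^esub> h f" by simp
  next
    fix f g assume fg: "f \<in> carrier (free_module R J)" "g \<in> carrier (free_module R J)"
    let ?S = "{j. f j \<noteq> \<zero>} \<union> {j. g j \<noteq> \<zero>}"
    have S: "finite ?S" "?S \<subseteq> J" using fg by (auto simp: free_module_carrier)
    have "h (\<lambda>j. f j \<oplus> g j) = finsum M (\<lambda>j. (f j \<oplus> g j) \<odot>\<^bsub>M\<^esub> y j) ?S"
      by (rule ext[OF free_add_closed[OF fg] S]) auto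
    also have "\<dots> = finsum M (\<lambda>j. f j \<odot>\<^bsub>M\<^esub> y j \<oplus>\<^bsub>M\<^esub> g j \<odot>\<^bsub>M\<^esub> y j) ?S"
      by (rule M.M.finsum_cong')
        (use fg S assms(2) M.smult_l_distr M.smult_closed in \<open>auto simp: free_module_carrier\<close>)
    also have "\<dots> = finsum M (\<lambda>j. f j \<odot>\<^bsub>M\<^esub> y j) ?S \<oplus>\<^bsub>M\<^esub> finsum M (\<lambda>j. g j \<odot>\<^bsub>M\<^esub> y j) ?S"
      using cl fg S by (intro M.M.finsum_addf) auto
    also have "\<dots> = h f \<oplus>\<^bsub>M\<^esub> h g"
      using ext[OF fg(1) S] ext[OF fg(2) S] by auto
    finally show "h (f \<oplus>\<^bsub>free_module R J\<^esub> g) = h f \<oplus>\<^bsub>M\<^esub> h g" by simp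
  qed
  moreover have "h (unit_vec R j) = y j" if "j \<in> J" for j
  proof -
    have "h (unit_vec R j) = finsum M (\<lambda>i. unit_vec R j i \<odot>\<^bsub>M\<^esub> y i) {j}"
      by (rule ext[OF unit_vec_closed[OF that]]) (use that in \<open>auto simp: unit_vec_def\<close>)
    also have "\<dots> = y j" using assms(2)[OF that] by (simp add: unit_vec_def M.smult_one)
    finally show ?thesis .
  qed
  ultimately show thesis using that by blast
qed

end

subsection \<open>Countably presented steps\<close>

lemma (in lmod) span_image:
  assumes "h \<in> module_hom R N M" "lmod R N" "X \<subseteq> carrier N"
  shows "h ` span R N X = span R M (h ` X)"
proof
  interpret N: lmod R N by fact
  have X: "h ` X \<subseteq> carrier M" using module_homD(1)[OF assms(1)] assms(3) by blast
  have "span R N X \<subseteq> {x \<in> carrier N. h x \<in> span R M (h ` X)}"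
    by (rule N.span_least[OF hom_ker_sub[OF assms(1,2) lmod_axioms span_sub[OF X]]])
      (use span_superset assms(3) in blast)
  then show "h ` span R N X \<subseteq> span R M (h ` X)" by blast
  show "span R M (h ` X) \<subseteq> h ` span R N X"
    by (rule span_least[OF hom_image_sub[OF assms(1,2) lmod_axioms N.span_sub[OF assms(3)]]])
      (use N.span_superset in blast)
qed

lemma (in lmod) span_submod:
  assumes "submodule B R M" "X \<subseteq> B"
  shows "span R (submod M B) X = span R M X"
proof
  interpret S: lmod R "submod M B" by (rule lmod_submod[OF assms(1)])
  have X: "X \<subseteq> carrier M" using assms subD(1) by blast
  have "submodule (span R M X) R (submod M B)"
    using sub_submod[OF assms(1)] span_sub[OF X] span_least[OF assms] by blast
  then show "span R (submod M B) X \<subseteq> span R M X"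
    using S.span_least span_superset by blast
  have "submodule (span R (submod M B) X) R M"
    using sub_submod[OF assms(1)] S.span_sub[of X] assms(2) by simp
  then show "span R M X \<subseteq> span R (submod M B) X"
    using span_least S.span_superset by blast
qed

lemma (in plain_ring) free_carrier_span: "carrier (free_module R J) = span R (free_module R J) (unit_vec R ` J)"
proof
  interpret F: lmod R "free_module R J" by (rule free_lmod)
  have *: "unit_vec R ` J \<subseteq> carrier (free_module R J)" by (rule image_subsetI) (rule unit_vec_closed)
  show "span R (free_module R J) (unit_vec R ` J) \<subseteq> carrier (free_module R J)"
    by (rule F.span_closed[OF *])
  show "carrier (free_module R J) \<subseteq> span R (free_module R J) (unit_vec R ` J)"
  proof
    fix f assume f: "f \<in> carrier (free_module R J)"
    show "f \<in> span R (free_module R J) (unit_vec R ` J)"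
      by (rule free_mem_submodule[OF F.span_sub[OF *] f])
        (use f F.span_superset[of "unit_vec R ` J"] in \<open>auto simp: free_module_carrier dest: subsetD\<close>)
  qed
qed

text \<open>The presentation of K is lifted into B: G consists of preimages of the images of the
  basis vectors, V of the images of the relations under the resulting map h. As \<theta> composed
  with h is \<kappa>, an element of \<langle>G\<rangle> \<inter> A comes from the kernel of
  \<kappa>, which the relations span.\<close>

lemma (in lmod) countably_presented_step:
  assumes AB: "submodule A R M" "submodule B R M" "A \<subseteq> B" and K: "lmod R K"
    and q: "quo R M A B K" and cp: "countably_presented R K"
  obtains G V where "countable G" "countable V" "G \<subseteq> B" "V \<subseteq> A"
    "B \<subseteq> msum A (span R M G)" "span R M G \<inter> A \<subseteq> span R M V"
proof -
  interpret S: lmod R "submod M B" by (rule lmod_submod[OF AB(2)])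
  interpret K: lmod R K by (rule K)
  obtain J :: "nat set" and G0 where G0: "countable G0" "G0 \<subseteq> carrier (free_module R J)"
    and iso: "module_iso R (quot_module (free_module R J) (span R (free_module R J) G0)) K"
    using cp unfolding countably_presented_def by blast
  let ?F = "free_module R J"
  interpret F: lmod R ?F by (rule free.free_lmod)
  have "quo R ?F (span R ?F G0) (carrier ?F) K"
    using F.quo_iff_iso[OF F.span_sub[OF G0(2)] F.sub_carrier F.span_closed[OF G0(2)] K.left_module_axioms] iso
    by simp
  then obtain \<kappa> where \<kappa>: "\<kappa> \<in> module_hom R ?F K" "\<kappa> ` carrier ?F = carrier K"
    "\<And>x. x \<in> carrier ?F \<Longrightarrow> \<kappa> x = \<zero>\<^bsub>K\<^esub> \<longleftrightarrow> x \<in> span R ?F G0"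
    unfolding quo_def by auto
  obtain \<theta> where \<theta>: "\<theta> \<in> module_hom R (submod M B) K" "\<theta> ` B = carrier K"
    "\<And>x. x \<in> B \<Longrightarrow> \<theta> x = \<zero>\<^bsub>K\<^esub> \<longleftrightarrow> x \<in> A" using q unfolding quo_def by blast
  have "\<exists>y\<in>B. \<theta> y = \<kappa> (unit_vec R j)" if "j \<in> J" for j
    using module_homD(1)[OF \<kappa>(1) free.unit_vec_closed[OF that]] \<theta>(2) by (metis imageE)
  then obtain y where y: "\<And>j. j \<in> J \<Longrightarrow> y j \<in> B" "\<And>j. j \<in> J \<Longrightarrow> \<theta> (y j) = \<kappa> (unit_vec R j)"
    by metis
  obtain h where h: "h \<in> module_hom R ?F (submod M B)" "\<And>j. j \<in> J \<Longrightarrow> h (unit_vec R j) = y j"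
    by (rule free.free_hom_exists[OF S.lmod_axioms, of J y]) (use y(1) in \<open>auto intro: that\<close>)
  have hB: "h f \<in> B" if "f \<in> carrier ?F" for f using module_homD(1)[OF h(1) that] by simp
  have \<theta>h: "\<theta> (h f) = \<kappa> f" if "f \<in> carrier ?F" for f
    by (rule free.free_hom_eqI[OF module_hom_comp[OF h(1) \<theta>(1)] \<kappa>(1) K _ that])
      (use that h(2) y(2) in \<open>auto simp: free_module_carrier\<close>)
  have h': "h \<in> module_hom R ?F M"
    by (rule module_hom_restrict_cod[OF h(1) subD(1)[OF AB(2)]])
  have im: "h ` carrier ?F = span R M (y ` J)"
  proof -
    have *: "unit_vec R ` J \<subseteq> carrier ?F" by (rule image_subsetI) (rule free.unit_vec_closed)
    have "h ` carrier ?F = span R M (h ` unit_vec R ` J)"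
      using span_image[OF h' F.lmod_axioms *] free.free_carrier_span[of J] by simp
    then show ?thesis using h(2) by (simp add: image_image)
  qed
  show thesis
  proof (rule that[of "y ` J" "h ` G0"])
    show "y ` J \<subseteq> B" using y by blast
    have G0s: "G0 \<subseteq> span R ?F G0" by (rule F.span_superset)
    have "h g \<in> A" if "g \<in> G0" for g
    proof -
      have "g \<in> carrier ?F" "\<kappa> g = \<zero>\<^bsub>K\<^esub>" using that G0(2) G0s \<kappa>(3) by blast+
      then show ?thesis using \<theta>(3)[OF hB] \<theta>h by auto
    qed
    then show "h ` G0 \<subseteq> A" by blast
    show "B \<subseteq> msum A (span R M (y ` J))"
    proof
      fix b assume b: "b \<in> B"
      then have "\<theta> b \<in> carrier K" using \<theta>(2) by blast
      then obtain f where f: "f \<in> carrier ?F" "\<kappa> f = \<theta> b" using \<kappa>(2) by (metis imageE)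
      have "\<theta> (b \<ominus>\<^bsub>M\<^esub> h f) = \<zero>\<^bsub>K\<^esub>"
        using hom_props(3)[OF \<theta>(1) S.lmod_axioms K] b hB[OF f(1)] \<theta>h[OF f(1)] f(2) \<open>\<theta> b \<in> carrier K\<close>
        by (simp add: minus_submod[OF AB(2)] K.diff_self)
      moreover have "b \<ominus>\<^bsub>M\<^esub> h f \<in> B" using subD(7)[OF AB(2) b hB[OF f(1)]] .
      ultimately have "b \<ominus>\<^bsub>M\<^esub> h f \<in> A" using \<theta>(3) by blast
      moreover have "b = (b \<ominus>\<^bsub>M\<^esub> h f) \<oplus>\<^bsub>M\<^esub> h f"
        using b hB[OF f(1)] subD(2)[OF AB(2)] by (simp add: a_minus_def M.a_assoc M.l_neg)
      ultimately show "b \<in> msum A (span R M (y ` J))"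
        unfolding msum_def using im f(1) by blast
    qed
    show "span R M (y ` J) \<inter> A \<subseteq> span R M (h ` G0)"
    proof
      fix x assume x: "x \<in> span R M (y ` J) \<inter> A"
      then obtain f where f: "f \<in> carrier ?F" "x = h f" unfolding im[symmetric] by blast
      then have "\<kappa> f = \<zero>\<^bsub>K\<^esub>" using \<theta>(3)[OF hB] \<theta>h x by auto
      then have "f \<in> span R ?F G0" using \<kappa>(3) f by blast
      then show "x \<in> span R M (h ` G0)"
        using span_image[OF h' F.lmod_axioms G0(2)] f(2) by blast
    qed
  qed (use G0(1) in auto)
qed

lemma (in lmod) diff_cancel_right:
  assumes "x \<in> carrier M" "y \<in> carrier M" "z \<in> carrier M"
  shows "(x \<oplus>\<^bsub>M\<^esub> z) \<ominus>\<^bsub>M\<^esub> (y \<oplus>\<^bsub>M\<^esub> z) = x \<ominus>\<^bsub>M\<^esub> y"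
  using assms M.a_lcomm[of z "\<ominus>\<^bsub>M\<^esub> y" "\<ominus>\<^bsub>M\<^esub> z"]
  by (simp add: a_minus_def M.minus_add M.a_assoc M.r_neg)

text \<open>Two B-components of one element of B + P differ by an element of B \<inter> P
  \<subseteq> A, which \<phi> kills; so applying \<phi> to a chosen B-component is well defined. It
  describes the steps of a filtration that survive the addition of P.\<close>

lemma (in lmod) quo_msum:
  assumes AB: "submodule A R M" "submodule B R M" "A \<subseteq> B" and K: "lmod R K"
    and q: "quo R M A B K" and P: "submodule P R M" "B \<inter> P \<subseteq> A"
  shows "quo R M (msum A P) (msum B P) K"
proof -
  interpret K: lmod R K by (rule K)
  interpret S: lmod R "submod M B" by (rule lmod_submod[OF AB(2)])
  note b = subD[OF AB(2)] and p = subD[OF P(1)]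
  obtain \<phi> where \<phi>: "\<phi> \<in> module_hom R (submod M B) K" "\<phi> ` B = carrier K"
    "\<And>x. x \<in> B \<Longrightarrow> \<phi> x = \<zero>\<^bsub>K\<^esub> \<longleftrightarrow> x \<in> A" using q unfolding quo_def by blast
  define \<psi> where "\<psi> x = \<phi> (SOME f. f \<in> B \<and> (\<exists>k\<in>P. x = f \<oplus>\<^bsub>M\<^esub> k))" for x
  have \<psi>: "\<psi> (f \<oplus>\<^bsub>M\<^esub> k) = \<phi> f" if fk: "f \<in> B" "k \<in> P" for f k
  proof -
    define f' where "f' = (SOME g. g \<in> B \<and> (\<exists>l\<in>P. f \<oplus>\<^bsub>M\<^esub> k = g \<oplus>\<^bsub>M\<^esub> l))"
    have "f' \<in> B \<and> (\<exists>l\<in>P. f \<oplus>\<^bsub>M\<^esub> k = f' \<oplus>\<^bsub>M\<^esub> l)"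
      unfolding f'_def by (rule someI[of _ f]) (use fk in blast)
    then obtain l where l: "f' \<in> B" "l \<in> P" "f \<oplus>\<^bsub>M\<^esub> k = f' \<oplus>\<^bsub>M\<^esub> l" by blast
    have "f \<ominus>\<^bsub>M\<^esub> f' = (f \<oplus>\<^bsub>M\<^esub> k) \<ominus>\<^bsub>M\<^esub> (f' \<oplus>\<^bsub>M\<^esub> k)"
      using diff_cancel_right[OF b(2)[OF fk(1)] b(2)[OF l(1)] p(2)[OF fk(2)]] by (rule sym)
    also have "\<dots> = (l \<oplus>\<^bsub>M\<^esub> f') \<ominus>\<^bsub>M\<^esub> (k \<oplus>\<^bsub>M\<^esub> f')"
      unfolding l(3) using fk l b(2) p(2) by (simp add: M.a_comm)
    also have "\<dots> = l \<ominus>\<^bsub>M\<^esub> k"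
      using fk l b(2) p(2) diff_cancel_right by simp
    finally have "f \<ominus>\<^bsub>M\<^esub> f' \<in> A" using P(2) b(7)[OF fk(1) l(1)] p(7)[OF l(2) fk(2)] by auto
    then have "\<phi> (f \<ominus>\<^bsub>M\<^esub> f') = \<zero>\<^bsub>K\<^esub>" using \<phi>(3) AB(3) by blast
    then have "\<phi> f = \<phi> f'"
      using hom_props(3)[OF \<phi>(1) S.lmod_axioms K] fk l module_homD(1)[OF \<phi>(1)] K.diff_zero_iff
      by (simp add: minus_submod[OF AB(2)])
    then show ?thesis unfolding \<psi>_def f'_def by simp
  qed
  show ?thesis
  proof (rule quoI[of \<psi>])
    show "\<psi> \<in> module_hom R (submod M (msum B P)) K"
    proof (rule module_homI)
      fix x assume "x \<in> carrier (submod M (msum B P))"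
      then obtain f k where x: "x = f \<oplus>\<^bsub>M\<^esub> k" "f \<in> B" "k \<in> P" by (auto simp: msum_def)
      then show "\<psi> x \<in> carrier K" using \<psi> module_homD(1)[OF \<phi>(1)] by simp
      fix a assume a: "a \<in> carrier R"
      have "a \<odot>\<^bsub>M\<^esub> x = a \<odot>\<^bsub>M\<^esub> f \<oplus>\<^bsub>M\<^esub> a \<odot>\<^bsub>M\<^esub> k" using x a b(2) p(2) smult_r_distr by simp
      then show "\<psi> (a \<odot>\<^bsub>submod M (msum B P)\<^esub> x) = a \<odot>\<^bsub>K\<^esub> \<psi> x"
        using x a \<psi> b(5) p(5) module_homD(3)[OF \<phi>(1)] by simp
    next
      fix x y assume "x \<in> carrier (submod M (msum B P))" "y \<in> carrier (submod M (msum B P))"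
      then obtain f k f' k' where x: "x = f \<oplus>\<^bsub>M\<^esub> k" "f \<in> B" "k \<in> P" "y = f' \<oplus>\<^bsub>M\<^esub> k'" "f' \<in> B" "k' \<in> P"
        by (auto simp: msum_def)
      have "x \<oplus>\<^bsub>M\<^esub> y = (f \<oplus>\<^bsub>M\<^esub> f') \<oplus>\<^bsub>M\<^esub> (k \<oplus>\<^bsub>M\<^esub> k')" using x b(2) p(2) by (simp add: M.a_ac)
      then show "\<psi> (x \<oplus>\<^bsub>submod M (msum B P)\<^esub> y) = \<psi> x \<oplus>\<^bsub>K\<^esub> \<psi> y"
        using x \<psi> b(4) p(4) module_homD(2)[OF \<phi>(1)] by simp
    qed
    have "\<psi> ` msum B P = \<phi> ` B"
    proof (intro subset_antisym subsetI)
      fix z assume "z \<in> \<psi> ` msum B P"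
      then show "z \<in> \<phi> ` B" using \<psi> by (auto simp: msum_def)
    next
      fix z assume "z \<in> \<phi> ` B"
      then obtain f where f: "f \<in> B" "z = \<phi> f" by blast
      then have "z = \<psi> (f \<oplus>\<^bsub>M\<^esub> \<zero>\<^bsub>M\<^esub>)" using \<psi> p(3) by simp
      then show "z \<in> \<psi> ` msum B P" unfolding msum_def using f p(3) by blast
    qed
    then show "\<psi> ` msum B P = carrier K" using \<phi>(2) by simp
    fix x assume "x \<in> msum B P"
    then obtain f k where x: "x = f \<oplus>\<^bsub>M\<^esub> k" "f \<in> B" "k \<in> P" by (auto simp: msum_def)
    have "\<phi> f = \<zero>\<^bsub>K\<^esub>" if "x = a \<oplus>\<^bsub>M\<^esub> l" "a \<in> A" "l \<in> P" for a l
    proof -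
      have "a \<in> B" using that(2) AB(3) by blast
      then have "\<phi> f = \<phi> a" using \<psi>[of a l] \<psi>[of f k] x that by auto
      then show ?thesis using \<phi>(3)[OF \<open>a \<in> B\<close>] that(2) by simp
    qed
    then show "\<psi> x = \<zero>\<^bsub>K\<^esub> \<longleftrightarrow> x \<in> msum A P"
      using x \<psi> \<phi>(3) by (auto simp: msum_def)
  qed
qed

subsection \<open>A Hill-type closure operator\<close>

text \<open>This is where countable presentation enters: with countably generated kernels
  \<open>\<langle>G i\<rangle> \<inter> F i\<close>, the submodules spanned by closed sets of generators intersect each step
  \<open>F (i + 1) / F i\<close> trivially or fully.\<close>

lemma Filt_closure_operator:
  fixes M :: "('v::zfc_universe, 'v) module"
  assumes M: "rmodule R M" and W: "submodule W R M"
    and \<C>: "\<And>K. K \<in> \<C> \<Longrightarrow> rmodule R K \<and> countably_presented R K"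
    and filt: "Filt (quo_class R \<C> M) {\<zero>\<^bsub>M\<^esub>} W" and B: "B \<subseteq> carrier M" "W = span R M B"
  obtains c where "\<And>w. w \<in> B \<Longrightarrow> countable (c w) \<and> c w \<subseteq> B"
    "\<And>a. a \<subseteq> B \<Longrightarrow> \<forall>w\<in>a. c w \<subseteq> a \<Longrightarrow> Filt (quo_class R \<C> M) (span R M a) W"
proof -
  interpret M: lmod R M using M by (rule rmodule_lmod)
  note Wc = M.subD(1)[OF W]
  have \<C>': "lmod R K" if "K \<in> \<C>" for K using \<C>[OF that] rmodule_lmod by blast
  have "filtered R \<C> (submod M W)"
    using filtered_submod[OF M W] \<C>' filt by (auto simp: lmod_def)
  then obtain \<eta> F where F: "filtration R (submod M W) \<eta> F" "F vzero = {\<zero>\<^bsub>M\<^esub>}"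
    and step: "\<And>i. vsucc i \<in> elts \<eta> \<Longrightarrow> \<exists>N\<in>\<C>. module_iso R (quot_module (submod M (F (vsucc i))) (F i)) N"
    unfolding filtered_def by auto
  have \<eta>: "Ord \<eta>" and mono: "\<And>i j. j \<in> elts \<eta> \<Longrightarrow> i \<in> elts j \<Longrightarrow> F i \<subseteq> F j"
    and lim: "\<And>i. i \<in> elts \<eta> \<Longrightarrow> Limit i \<Longrightarrow> F i = (\<Union>k\<in>elts i. F k)" and top: "(\<Union>i\<in>elts \<eta>. F i) = W"
    and "\<And>i. i \<in> elts \<eta> \<Longrightarrow> submodule (F i) R (submod M W)"
    using F(1) unfolding filtration_def by auto
  then have sub: "submodule (F i) R M" "F i \<subseteq> W" if "i \<in> elts \<eta>" for i
    using that M.sub_submod[OF W] by blast+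
  have zero: "vzero \<in> elts \<eta>"
    using vzero_or[OF \<eta>] top M.subD(3)[OF W] by (auto simp: elts_vzero)
  define I where "I = {i. vsucc i \<in> elts \<eta>}"
  have I: "i \<in> elts \<eta>" "vsucc i \<in> elts \<eta>" "Ord i" if "i \<in> I" for i
    using that Ord_trans[OF \<eta>, of "vsucc i" i] Ord_elt[OF \<eta>, of "vsucc i"] by (auto simp: I_def elts_vsucc)
  have FS: "F i \<subseteq> F (vsucc i)" if "i \<in> I" for i
    using mono[OF I(2)[OF that], of i] by (simp add: elts_vsucc)
  have quo: "\<exists>N\<in>\<C>. quo R M (F i) (F (vsucc i)) N" if i: "i \<in> I" for i
  proof -
    obtain N where N: "N \<in> \<C>" "module_iso R (quot_module (submod M (F (vsucc i))) (F i)) N"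
      using step[OF I(2)[OF i]] by blast
    then have "quo R M (F i) (F (vsucc i)) N"
      using M.quo_iff_iso[OF sub(1)[OF I(1)[OF i]] sub(1)[OF I(2)[OF i]] FS[OF i], of N]
        \<C>'[OF N(1)] by (simp add: lmod_def)
    then show ?thesis using N(1) by blast
  qed
  define gens where "gens i G V \<longleftrightarrow> countable G \<and> countable V \<and> G \<subseteq> F (vsucc i) \<and> V \<subseteq> F i \<and>
      F (vsucc i) \<subseteq> M.msum (F i) (span R M G) \<and> span R M G \<inter> F i \<subseteq> span R M V" for i G V
  have "\<exists>G V. gens i G V" if i: "i \<in> I" for i
  proof -
    obtain N where N: "N \<in> \<C>" "quo R M (F i) (F (vsucc i)) N" using quo[OF i] by blast
    show ?thesis
      unfolding gens_def
      by (rule M.countably_presented_step[OF sub(1)[OF I(1)[OF i]] sub(1)[OF I(2)[OF i]] FS[OF i] \<C>'[OF N(1)] N(2)])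
        (use \<C>[OF N(1)] in blast)+
  qed
  then obtain G V where "\<And>i. i \<in> I \<Longrightarrow> gens i (G i) (V i)" by metis
  then have GV: "\<And>i. i \<in> I \<Longrightarrow> countable (G i)" "\<And>i. i \<in> I \<Longrightarrow> countable (V i)"
    "\<And>i. i \<in> I \<Longrightarrow> G i \<subseteq> F (vsucc i)" "\<And>i. i \<in> I \<Longrightarrow> V i \<subseteq> F i"
    "\<And>i. i \<in> I \<Longrightarrow> F (vsucc i) \<subseteq> M.msum (F i) (span R M (G i))"
    "\<And>i. i \<in> I \<Longrightarrow> span R M (G i) \<inter> F i \<subseteq> span R M (V i)"
    unfolding gens_def by simp_all
  define Sp where "Sp A = span R M (\<Union>i\<in>A. G i)" for A
  have Gc: "(\<Union>i\<in>A. G i) \<subseteq> carrier M" if "A \<subseteq> I" for A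
    using that GV(3) sub(2)[OF I(2)] Wc by blast
  have Sp: "submodule (Sp A) R M" if "A \<subseteq> I" for A
    unfolding Sp_def by (rule M.span_sub[OF Gc[OF that]])
  have Sp_mono: "A \<subseteq> A' \<Longrightarrow> Sp A \<subseteq> Sp A'" for A A'
    unfolding Sp_def by (rule M.span_mono) blast
  have G_Sp: "i \<in> A \<Longrightarrow> G i \<subseteq> Sp A" for i A
    unfolding Sp_def using M.span_superset by blast
  \<comment> \<open>Hill's condition: the relations \<open>V i\<close> of a chosen step lie in the
    span of the generators of chosen steps before i. A combination of generators of step i that
    falls into \<open>F i\<close> can then be rewritten with earlier generators.\<close>
  define closed where "closed A \<longleftrightarrow> A \<subseteq> I \<and> (\<forall>i\<in>A. V i \<subseteq> Sp {j \<in> A. j \<in> elts i})" for A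
  have closed_Un: "closed (\<Union>\<A>)" if "\<And>A. A \<in> \<A> \<Longrightarrow> closed A" for \<A>
    unfolding closed_def
  proof (intro conjI ballI)
    show "\<Union>\<A> \<subseteq> I" using that by (auto simp: closed_def)
    fix i assume "i \<in> \<Union>\<A>"
    then obtain A where A: "A \<in> \<A>" "i \<in> A" by blast
    then have "V i \<subseteq> Sp {j \<in> A. j \<in> elts i}" using that by (auto simp: closed_def)
    also have "\<dots> \<subseteq> Sp {j \<in> \<Union>\<A>. j \<in> elts i}" using A by (intro Sp_mono) blast
    finally show "V i \<subseteq> Sp {j \<in> \<Union>\<A>. j \<in> elts i}" .
  qed
  \<comment> \<open>Every element depends on countably many steps. At a successor of \<beta> it is f
    + g with f in \<open>F \<beta>\<close> and g in the span of \<open>G \<beta>\<close>; the step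
    \<beta> is adjoined together with the supports of f and of the countably many members of
    \<open>V \<beta>\<close>, all of which lie below \<beta>.\<close>
  have support: "\<gamma> \<in> elts \<eta> \<longrightarrow> (\<forall>w\<in>F \<gamma>. \<exists>A. countable A \<and> closed A \<and> A \<subseteq> elts \<gamma> \<and> w \<in> Sp A)" for \<gamma>
  proof (induction \<gamma> rule: elts_induct)
    case (step \<gamma>)
    show ?case
    proof (intro impI ballI)
      fix w assume \<gamma>: "\<gamma> \<in> elts \<eta>" and w: "w \<in> F \<gamma>"
      from Ord_elt[OF \<eta> \<gamma>] show "\<exists>A. countable A \<and> closed A \<and> A \<subseteq> elts \<gamma> \<and> w \<in> Sp A"
      proof (cases rule: Ord_cases)
        case 1
        then have "w \<in> Sp {}" using w F(2) M.subD(3)[OF Sp[of "{}"]] by auto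
        then show ?thesis by (intro exI[of _ "{}"]) (auto simp: closed_def)
      next
        case 3
        then obtain k where k: "k \<in> elts \<gamma>" "w \<in> F k" using lim[OF \<gamma>] w by blast
        then obtain A where "countable A" "closed A" "A \<subseteq> elts k" "w \<in> Sp A"
          using step Ord_trans[OF \<eta> \<gamma>] by blast
        moreover have "elts k \<subseteq> elts \<gamma>" using Ord_trans[OF Ord_elt[OF \<eta> \<gamma>] k(1)] by blast
        ultimately show ?thesis by blast
      next
        case (2 \<beta>)
        then have \<beta>: "\<beta> \<in> I" "\<beta> \<in> elts \<gamma>" using \<gamma> by (auto simp: I_def elts_vsucc)
        have IH: "\<exists>A. countable A \<and> closed A \<and> A \<subseteq> elts \<beta> \<and> u \<in> Sp A" if "u \<in> F \<beta>" for u
          using step[OF \<beta>(2)] I(1)[OF \<beta>(1)] that by blast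
        have "w \<in> M.msum (F \<beta>) (span R M (G \<beta>))" using GV(5)[OF \<beta>(1)] w 2 by blast
        then obtain f g where fg: "w = f \<oplus>\<^bsub>M\<^esub> g" "f \<in> F \<beta>" "g \<in> span R M (G \<beta>)"
          unfolding M.msum_def by blast
        obtain A where A: "countable (A u)" "closed (A u)" "A u \<subseteq> elts \<beta>" "u \<in> Sp (A u)" if "u \<in> F \<beta>" for u
          using IH by metis
        define T where "T = A f \<union> (\<Union>v\<in>V \<beta>. A v)"
        have V: "v \<in> F \<beta>" if "v \<in> V \<beta>" for v using that GV(4)[OF \<beta>(1)] by blast
        have T: "countable T" "closed T" "T \<subseteq> elts \<beta>" "f \<in> Sp T" "V \<beta> \<subseteq> Sp T"
        proof -
          show "countable T" unfolding T_def using A(1) V fg(2) GV(2)[OF \<beta>(1)] by auto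
          show "T \<subseteq> elts \<beta>" unfolding T_def using A(3) V fg(2) by blast
          have "T = \<Union>(A ` insert f (V \<beta>))" unfolding T_def by auto
          then show "closed T" using closed_Un[of "A ` insert f (V \<beta>)"] A(2) V fg(2) by auto
          show "f \<in> Sp T" using A(4)[OF fg(2)] Sp_mono[of "A f" T] unfolding T_def by blast
          show "V \<beta> \<subseteq> Sp T"
          proof
            fix v assume v: "v \<in> V \<beta>"
            then show "v \<in> Sp T" using A(4)[OF V[OF v]] Sp_mono[of "A v" T] unfolding T_def by blast
          qed
        qed
        let ?A = "insert \<beta> T"
        have "closed ?A"
          unfolding closed_def
        proof (intro conjI ballI)
          show "?A \<subseteq> I" using T(2) \<beta>(1) by (auto simp: closed_def)
          fix i assume "i \<in> ?A"
          then consider "i = \<beta>" | "i \<in> T" by blast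
          then show "V i \<subseteq> Sp {j \<in> ?A. j \<in> elts i}"
          proof cases
            case 1
            have "Sp T \<subseteq> Sp {j \<in> ?A. j \<in> elts i}" using T(3) 1 by (intro Sp_mono) blast
            then show ?thesis using T(5) 1 by blast
          next
            case 2
            have "Sp {j \<in> T. j \<in> elts i} \<subseteq> Sp {j \<in> ?A. j \<in> elts i}" by (intro Sp_mono) blast
            then show ?thesis using T(2) 2 unfolding closed_def by blast
          qed
        qed
        moreover have "?A \<subseteq> elts \<gamma>" using T(3) 2 by (auto simp: elts_vsucc)
        moreover have "w \<in> Sp ?A"
        proof -
          have s: "submodule (Sp ?A) R M" using \<open>closed ?A\<close> Sp by (simp add: closed_def)
          have "g \<in> Sp ?A" using M.span_least[OF s G_Sp[of \<beta> ?A]] fg(3) by blast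
          moreover have "f \<in> Sp ?A" using T(4) Sp_mono[of T ?A] by blast
          ultimately show ?thesis using M.subD(4)[OF s] fg(1) by simp
        qed
        ultimately show ?thesis using T(1) by (intro exI[of _ ?A]) simp
      qed
    qed
  qed
  have "\<exists>A. countable A \<and> closed A \<and> w \<in> Sp A" if "w \<in> W" for w
    using support that top by blast
  then obtain A where A: "\<And>w. w \<in> W \<Longrightarrow> countable (A w)" "\<And>w. w \<in> W \<Longrightarrow> closed (A w)" "\<And>w. w \<in> W \<Longrightarrow> w \<in> Sp (A w)"
    by metis
  have "\<exists>D. finite D \<and> D \<subseteq> B \<and> w \<in> span R M D" if "w \<in> W" for w
    using M.span_finite[OF B(1)] that B(2) by metis
  then obtain D where D: "\<And>w. w \<in> W \<Longrightarrow> finite (D w)" "\<And>w. w \<in> W \<Longrightarrow> D w \<subseteq> B" "\<And>w. w \<in> W \<Longrightarrow> w \<in> span R M (D w)"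
    by metis
  have BW: "B \<subseteq> W" using B(2) M.span_superset by blast
  have GW: "g \<in> W" if "i \<in> I" "g \<in> G i" for i g using GV(3)[OF that(1)] sub(2)[OF I(2)[OF that(1)]] that(2) by blast
  have AI: "A w \<subseteq> I" if "w \<in> W" for w using A(2)[OF that] by (simp add: closed_def)
  \<comment> \<open>\<open>A w\<close> is the support of w, and every generator g of a step in it is
    written with the finite set \<open>D g\<close> of elements of B. For a set a closed under c,
    \<langle>a\<rangle> is then the span of the generators of all steps in the union T of its
    supports.\<close>
  define c where "c w = (\<Union>i\<in>A w. \<Union>g\<in>G i. D g)" for w
  show thesis
  proof (rule that)
    fix w assume "w \<in> B"
    then have w: "w \<in> W" using BW by blast
    have "countable (\<Union>g\<in>G i. D g)" if "i \<in> A w" for i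
    proof -
      have "i \<in> I" using that AI[OF w] by blast
      then show ?thesis using GV(1) countable_finite[OF D(1)[OF GW]] by (intro countable_UN) auto
    qed
    then have "countable (c w)" unfolding c_def by (intro countable_UN[OF A(1)[OF w]])
    moreover have "c w \<subseteq> B" unfolding c_def using AI[OF w] D(2)[OF GW] by blast
    ultimately show "countable (c w) \<and> c w \<subseteq> B" ..
  next
    fix a assume a': "a \<subseteq> B" "\<forall>w\<in>a. c w \<subseteq> a"
    have a: "a \<subseteq> B" "\<And>w. w \<in> a \<Longrightarrow> c w \<subseteq> a" using a' by simp_all
    define T where "T = \<Union>(A ` a)"
    have aW: "a \<subseteq> W" using a(1) BW by blast
    have T: "closed T" unfolding T_def by (rule closed_Un) (use A(2) aW in auto)
    then have TI: "T \<subseteq> I" by (simp add: closed_def)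
    have SpT: "submodule (Sp (T \<inter> X)) R M" for X using TI by (intro Sp) blast
    define K where "K = Sp T"
    have Ksub: "submodule K R M" unfolding K_def by (rule Sp[OF TI])
    have "span R M a = K"
    proof
      show "span R M a \<subseteq> K"
      proof (rule M.span_least[OF Ksub])
        show "a \<subseteq> K"
        proof
          fix w assume w: "w \<in> a"
          then have "w \<in> Sp (A w)" using A(3) aW by blast
          also have "Sp (A w) \<subseteq> K" unfolding K_def T_def using w by (intro Sp_mono) blast
          finally show "w \<in> K" .
        qed
      qed
      show "K \<subseteq> span R M a"
        unfolding K_def Sp_def
      proof (rule M.span_least)
        show "submodule (span R M a) R M" using a(1) B(1) by (intro M.span_sub) blast
        show "(\<Union>i\<in>T. G i) \<subseteq> span R M a"
        proof
          fix g assume "g \<in> (\<Union>i\<in>T. G i)"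
          then obtain w i where w: "w \<in> a" "i \<in> A w" "g \<in> G i" unfolding T_def by blast
          then have "g \<in> W" using GW[of i g] AI[of w] aW by blast
          then have "g \<in> span R M (D g)" by (rule D(3))
          moreover have "D g \<subseteq> a" using a(2)[OF w(1)] w unfolding c_def by blast
          ultimately show "g \<in> span R M a" using M.span_mono by blast
        qed
      qed
    qed
    have KW: "K \<subseteq> W"
      unfolding K_def Sp_def by (rule M.span_least[OF W]) (use TI GW in blast)
    have below: "Sp (T \<inter> elts \<gamma>) \<subseteq> F \<gamma>" if "\<gamma> \<in> elts \<eta>" for \<gamma>
      unfolding Sp_def
    proof (rule M.span_least[OF sub(1)[OF that]])
      have "G i \<subseteq> F \<gamma>" if "i \<in> T \<inter> elts \<gamma>" for i
      proof -
        have i: "i \<in> I" "i \<in> elts \<gamma>" using that TI by auto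
        then have "vsucc i = \<gamma> \<or> vsucc i \<in> elts \<gamma>" using vsucc_le[OF Ord_elt[OF \<eta> \<open>\<gamma> \<in> elts \<eta>\<close>]] by blast
        then have "F (vsucc i) \<subseteq> F \<gamma>" using mono[OF \<open>\<gamma> \<in> elts \<eta>\<close>] by auto
        then show ?thesis using GV(3)[OF i(1)] by blast
      qed
      then show "(\<Union>i\<in>T \<inter> elts \<gamma>. G i) \<subseteq> F \<gamma>" by blast
    qed
    \<comment> \<open>A step outside T is not touched by K: what K contributes to
      \<open>F (vsucc i)\<close> lies in \<open>F i\<close> already. The induction runs over a bound
      \<gamma> for the steps used; the critical case is a last step \<delta> after i.\<close>
    have avoid: "Ord \<gamma> \<longrightarrow> Sp (T \<inter> elts \<gamma>) \<inter> F (vsucc i) \<subseteq> F i" if i: "i \<in> I" "i \<notin> T" for i \<gamma>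
    proof (induction \<gamma> rule: elts_induct)
      case (step \<gamma>)
      show ?case
      proof (intro impI subsetI)
        fix x assume O: "Ord \<gamma>" and x: "x \<in> Sp (T \<inter> elts \<gamma>) \<inter> F (vsucc i)"
        from O show "x \<in> F i"
        proof (cases rule: Ord_cases)
          case 1
          then have "x = \<zero>\<^bsub>M\<^esub>" using x by (simp add: Sp_def elts_vzero M.span_empty)
          then show ?thesis using M.subD(3)[OF sub(1)[OF I(1)[OF i(1)]]] by simp
        next
          case 3
          have "Sp (T \<inter> elts \<gamma>) \<subseteq> (\<Union>\<delta>\<in>elts \<gamma>. Sp (T \<inter> elts \<delta>))"
            unfolding Sp_def[of "T \<inter> elts \<gamma>"]
          proof (rule M.span_least)
            show "submodule (\<Union>\<delta>\<in>elts \<gamma>. Sp (T \<inter> elts \<delta>)) R M"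
            proof (rule M.sub_Union)
              show "(\<lambda>\<delta>. Sp (T \<inter> elts \<delta>)) ` elts \<gamma> \<noteq> {}" using 3 by (auto simp: Limit_def)
              show "N \<in> (\<lambda>\<delta>. Sp (T \<inter> elts \<delta>)) ` elts \<gamma> \<Longrightarrow> submodule N R M" for N using SpT by auto
              show "chain\<^sub>\<subseteq> ((\<lambda>\<delta>. Sp (T \<inter> elts \<delta>)) ` elts \<gamma>)"
              proof (rule chain_image)
                show "\<delta> \<in> elts \<gamma> \<Longrightarrow> Ord \<delta>" for \<delta> using Ord_elt[OF O] .
                fix \<delta> \<epsilon> assume "\<delta> \<in> elts \<gamma>" "\<epsilon> \<in> elts \<gamma>" "\<delta> \<in> elts \<epsilon>"
                then have "elts \<delta> \<subseteq> elts \<epsilon>" using Ord_trans[OF Ord_elt[OF O]] by blast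
                then show "Sp (T \<inter> elts \<delta>) \<subseteq> Sp (T \<inter> elts \<epsilon>)" by (intro Sp_mono) blast
              qed
            qed
            have "G j \<subseteq> Sp (T \<inter> elts (vsucc j))" "vsucc j \<in> elts \<gamma>" if "j \<in> T \<inter> elts \<gamma>" for j
              using that 3 G_Sp[of j "T \<inter> elts (vsucc j)"] by (auto simp: Limit_def elts_vsucc)
            then show "(\<Union>j\<in>T \<inter> elts \<gamma>. G j) \<subseteq> (\<Union>\<delta>\<in>elts \<gamma>. Sp (T \<inter> elts \<delta>))" by blast
          qed
          then obtain \<delta> where "\<delta> \<in> elts \<gamma>" "x \<in> Sp (T \<inter> elts \<delta>)" using x by blast
          then show ?thesis using step Ord_elt[OF O] x by blast
        next
          case (2 \<delta>)
          have IH: "Sp (T \<inter> elts \<delta>) \<inter> F (vsucc i) \<subseteq> F i"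
            using step[of \<delta>] 2 by (simp add: elts_vsucc)
          show ?thesis
          proof (cases "\<delta> \<in> T")
            case False
            then have "T \<inter> elts \<gamma> = T \<inter> elts \<delta>" using 2 by (auto simp: elts_vsucc)
            then show ?thesis using IH x by auto
          next
            case True
            then have \<delta>: "\<delta> \<in> I" using TI by blast
            have "\<delta> \<noteq> i" using True i(2) by blast
            then consider "\<delta> \<in> elts i" | "i \<in> elts \<delta>" using Ord_linear[OF 2(1) I(3)[OF i(1)]] by blast
            then show ?thesis
            proof cases
              case 1
              have "\<gamma> = i \<or> \<gamma> \<in> elts i" using vsucc_le[OF I(3)[OF i(1)] 1] 2 by simp
              then have "F \<gamma> \<subseteq> F i" using mono[OF I(1)[OF i(1)]] by auto
              moreover have "\<gamma> \<in> elts \<eta>" using I(2)[OF \<delta>] 2 by simp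
              ultimately show ?thesis using below[of \<gamma>] x by blast
            next
              case lt: 2
              have "vsucc i = \<delta> \<or> vsucc i \<in> elts \<delta>" using vsucc_le[OF 2(1) lt] .
              then have x\<delta>: "x \<in> F \<delta>" using mono[OF I(1)[OF \<delta>]] x by auto
              note K' = SpT[of "elts \<delta>"]
              have G\<delta>: "submodule (span R M (G \<delta>)) R M"
                using Gc[of "{\<delta>}"] \<delta> by (intro M.span_sub) auto
              have "Sp (T \<inter> elts \<gamma>) \<subseteq> M.msum (Sp (T \<inter> elts \<delta>)) (span R M (G \<delta>))"
                unfolding Sp_def[of "T \<inter> elts \<gamma>"]
              proof (rule M.span_least[OF M.msum_sub[OF K' G\<delta>]])
                have "G j \<subseteq> M.msum (Sp (T \<inter> elts \<delta>)) (span R M (G \<delta>))" if "j \<in> T \<inter> elts \<gamma>" for j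
                proof (cases "j = \<delta>")
                  case True
                  then show ?thesis using M.msum_upper(2)[OF K' G\<delta>] M.span_superset[of "G \<delta>"] by blast
                next
                  case False
                  then have "j \<in> T \<inter> elts \<delta>" using that 2 by (auto simp: elts_vsucc)
                  then show ?thesis using G_Sp M.msum_upper(1)[OF K' G\<delta>] by blast
                qed
                then show "(\<Union>j\<in>T \<inter> elts \<gamma>. G j) \<subseteq> M.msum (Sp (T \<inter> elts \<delta>)) (span R M (G \<delta>))" by blast
              qed
              then obtain k y where ky: "x = k \<oplus>\<^bsub>M\<^esub> y" "k \<in> Sp (T \<inter> elts \<delta>)" "y \<in> span R M (G \<delta>)"
                using x unfolding M.msum_def by blast
              have kF: "k \<in> F \<delta>" using below[OF I(1)[OF \<delta>]] ky(2) by blast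
              have "y \<in> F \<delta>"
                using M.sub_diff_iff(4)[OF sub(1)[OF I(1)[OF \<delta>]] kF M.subD(2)[OF G\<delta> ky(3)]] ky(1) x\<delta> by simp
              \<comment> \<open>Both x and k lie in \<open>F \<delta>\<close>, hence so does the
                contribution y of the last step. By the choice of V it is a combination of
                relations, which closedness of T expresses by generators before \<delta>. So the
                step \<delta> can be dispensed with, and the induction hypothesis applies.\<close>
              then have "y \<in> span R M (V \<delta>)" using GV(6)[OF \<delta>] ky(3) by blast
              also have "span R M (V \<delta>) \<subseteq> Sp (T \<inter> elts \<delta>)"
              proof (rule M.span_least[OF K'])
                have "{j \<in> T. j \<in> elts \<delta>} = T \<inter> elts \<delta>" by blast
                moreover have "V \<delta> \<subseteq> Sp {j \<in> T. j \<in> elts \<delta>}" using T True by (simp add: closed_def)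
                ultimately show "V \<delta> \<subseteq> Sp (T \<inter> elts \<delta>)" by simp
              qed
              finally have "x \<in> Sp (T \<inter> elts \<delta>)" using ky(1,2) M.subD(4)[OF K'] by simp
              then show ?thesis using IH x by blast
            qed
          qed
        qed
      qed
    qed
    have T\<eta>: "T \<inter> elts \<eta> = T" using TI I(1) by blast
    \<comment> \<open>Adding K collapses the steps in T and, by \<open>avoid\<close> and
      \<open>quo_msum\<close>, preserves the quotients of all others; this filters W over K.\<close>
    define F' where "F' i = M.msum (F i) K" for i
    have F'sub: "submodule (F' i) R M" if "i \<in> elts \<eta>" for i
      unfolding F'_def by (rule M.msum_sub[OF sub(1)[OF that] Ksub])
    have "Filt (quo_class R \<C> M) K W"
    proof (rule Filt_ordinal[OF \<eta> zero, of F'])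
      show "F' vzero = K"
      proof
        show "F' vzero \<subseteq> K"
          unfolding F'_def F(2) by (rule M.msum_least[OF Ksub]) (use M.subD(3)[OF Ksub] in auto)
        show "K \<subseteq> F' vzero"
          unfolding F'_def by (rule M.msum_upper(2)[OF sub(1)[OF zero] Ksub])
      qed
      show "F' i \<subseteq> F' j" if "j \<in> elts \<eta>" "i \<in> elts j" for i j
        unfolding F'_def using mono[OF that] by (intro M.msum_mono) auto
      show "F' i = (\<Union>k\<in>elts i. F' k)" if "i \<in> elts \<eta>" "Limit i" for i
        unfolding F'_def lim[OF that] M.msum_def by blast
      show "(\<Union>i\<in>elts \<eta>. F' i) = W"
      proof
        show "(\<Union>i\<in>elts \<eta>. F' i) \<subseteq> W"
          unfolding F'_def using M.msum_least[OF W sub(2) KW] by blast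
        have "F i \<subseteq> F' i" if "i \<in> elts \<eta>" for i
          unfolding F'_def by (rule M.msum_upper(1)[OF sub(1)[OF that] Ksub])
        then show "W \<subseteq> (\<Union>i\<in>elts \<eta>. F' i)" using top by blast
      qed
      fix i assume "vsucc i \<in> elts \<eta>"
      then have i: "i \<in> I" by (simp add: I_def)
      have F'le: "F' i \<subseteq> F' (vsucc i)" unfolding F'_def using FS[OF i] by (intro M.msum_mono) auto
      show "Filt (quo_class R \<C> M) (F' i) (F' (vsucc i))"
      proof (cases "i \<in> T")
        case True
        have "span R M (G i) \<subseteq> K" using M.span_least[OF Ksub] G_Sp[OF True] K_def by blast
        then have "F (vsucc i) \<subseteq> F' i"
          using GV(5)[OF i] M.msum_mono[of "F i" "F i" "span R M (G i)" K] unfolding F'_def by blast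
        moreover have "K \<subseteq> F' i" unfolding F'_def by (rule M.msum_upper(2)[OF sub(1)[OF I(1)[OF i]] Ksub])
        ultimately have "F' (vsucc i) \<subseteq> F' i"
          using M.msum_least[OF F'sub[OF I(1)[OF i]]] unfolding F'_def[of "vsucc i"] by blast
        then have "F' (vsucc i) = F' i" using F'le by blast
        then show ?thesis by simp
      next
        case False
        obtain N where N: "N \<in> \<C>" "quo R M (F i) (F (vsucc i)) N" using quo[OF i] by blast
        have "F (vsucc i) \<inter> K \<subseteq> F i"
          using avoid[OF i False, of \<eta>] \<eta> unfolding K_def T\<eta> by blast
        then have "quo R M (F' i) (F' (vsucc i)) N"
          unfolding F'_def
          using M.quo_msum[OF sub(1)[OF I(1)[OF i]] sub(1)[OF I(2)[OF i]] FS[OF i] \<C>'[OF N(1)] N(2) Ksub] by blast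
        then have "quo_class R \<C> M (F' i) (F' (vsucc i))"
          unfolding quo_class_def using F'sub I(1,2)[OF i] F'le N(1) by blast
        then show ?thesis using F'le by (intro Filt_step)
      qed
    qed
    then show "Filt (quo_class R \<C> M) (span R M a) W"
      using \<open>span R M a = K\<close> by simp
  qed
qed

section \<open>Winning the filtration game\<close>

text \<open>\<open>player1_wins\<close> refers to the first violation of the rules. If Player 1
  moves legally after every legal position and still does not win, induction shows that Player 2 is
  legal in every round.\<close>

lemma play_legal:
  fixes \<mu> :: "'v::zfc_universe"
  assumes \<mu>: "Ord \<mu>"
    and leg: "\<And>i. i \<in> elts \<mu> \<Longrightarrow> (\<forall>k\<in>elts i. legal1 M \<mu> (X k)) \<Longrightarrow> (\<forall>k\<in>elts i. legal2 R \<C> M \<mu> X Z k) \<Longrightarrow> legal1 M \<mu> (X i)"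
    and nw: "\<not> player1_wins R \<C> M \<mu> X Z"
  shows "i \<in> elts \<mu> \<longrightarrow> legal1 M \<mu> (X i) \<and> legal2 R \<C> M \<mu> X Z i"
proof (induction i rule: elts_induct)
  case (step i)
  show ?case
  proof
    assume i: "i \<in> elts \<mu>"
    then have IH: "legal1 M \<mu> (X k) \<and> legal2 R \<C> M \<mu> X Z k" if "k \<in> elts i" for k
      using step[OF that] Ord_trans[OF \<mu> i that] by blast
    then have "legal1 M \<mu> (X i)" using leg[OF i] by blast
    moreover have "legal2 R \<C> M \<mu> X Z i"
      using nw i IH \<open>legal1 M \<mu> (X i)\<close> unfolding player1_wins_def by (auto simp: elts_vsucc)
    ultimately show "legal1 M \<mu> (X i) \<and> legal2 R \<C> M \<mu> X Z i" ..
  qed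
qed

text \<open>The rules force \<langle>\<open>Z i\<close>\<rangle> to contain all earlier moves of
  Player 2.\<close>

lemma legal2_span:
  assumes "lmod R M" "legal2 R \<C> M \<mu> X Z i"
  shows "span R M (\<Union>k\<in>elts (vsucc i). Z k) = span R M (Z i)"
proof
  interpret lmod R M by fact
  have "Z i \<subseteq> carrier M" "(\<Union>k\<in>elts i. Z k) \<subseteq> span R M (Z i)" using assms by (auto simp: legal2_def)
  then show "span R M (\<Union>k\<in>elts (vsucc i). Z k) \<subseteq> span R M (Z i)"
    using span_superset[of "Z i"] by (intro span_least span_sub) (auto simp: elts_vsucc)
  show "span R M (Z i) \<subseteq> span R M (\<Union>k\<in>elts (vsucc i). Z k)"
    by (rule span_mono) (auto simp: elts_vsucc)
qed

lemma legal2_Filt: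
  fixes M :: "('v::zfc_universe, 'v) module"
  assumes M: "rmodule R M" and \<C>: "\<And>K. K \<in> \<C> \<Longrightarrow> left_module R K"
    and l: "legal2 R \<C> M \<mu> X Z i"
  shows "Filt (quo_class R \<C> M) (span R M (\<Union>k\<in>elts i. Z k)) (span R M (Z i))"
proof -
  interpret M: lmod R M using M by (rule rmodule_lmod)
  have Z: "Z i \<subseteq> carrier M" "(\<Union>k\<in>elts i. Z k) \<subseteq> span R M (Z i)" using l by (auto simp: legal2_def)
  then have U: "(\<Union>k\<in>elts i. Z k) \<subseteq> carrier M" using M.span_closed by blast
  have "span R M (\<Union>k\<in>elts i. Z k) \<subseteq> span R M (Z i)"
    by (rule M.span_least[OF M.span_sub[OF Z(1)] Z(2)])
  then show ?thesis
    using l filtered_quot[OF M M.span_sub[OF U] M.span_sub[OF Z(1)] _ \<C>] unfolding legal2_def by blast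
qed

text \<open>In round i Player 1 plays the element of W with index i under the injection f, if there
  is one, whatever the opponent does. If Player 2 survives, the spans of her moves before i, for i
  in \<open>omega1\<close>, filter a submodule containing W.\<close>

lemma player1_strategy_enumerate:
  fixes M :: "('v::zfc_universe, 'v) module"
  assumes M: "rmodule R M" and \<C>: "\<And>K. K \<in> \<C> \<Longrightarrow> left_module R K"
    and W: "W \<subseteq> carrier M" "W \<lesssim> elts (omega1 :: 'v)"
    and no: "\<And>V. submodule V R M \<Longrightarrow> W \<subseteq> V \<Longrightarrow> \<not> Filt (quo_class R \<C> M) {\<zero>\<^bsub>M\<^esub>} V"
  shows "\<exists>\<sigma>. \<forall>X Z. follows1 omega1 \<sigma> X Z \<longrightarrow> player1_wins R \<C> M omega1 X Z"
proof -
  interpret M: lmod R M using M by (rule rmodule_lmod)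
  obtain f where f: "inj_on f W" "f ` W \<subseteq> elts (omega1 :: 'v)"
    using W(2) unfolding lepoll_def by blast
  have "player1_wins R \<C> M omega1 X Z"
    if fol: "follows1 omega1 (\<lambda>i _ _. {x \<in> W. f x = i}) X Z" for X Z
  proof (rule ccontr)
    assume nw: "\<not> player1_wins R \<C> M omega1 X Z"
    have X: "X i = {x \<in> W. f x = i}" if "i \<in> elts omega1" for i
      using fol that by (simp add: follows1_def)
    have l1: "legal1 M omega1 (X i)" if "i \<in> elts omega1" for i
    proof -
      have "finite (f ` X i)" unfolding X[OF that] by (rule finite_subset[of _ "{i}"]) auto
      moreover have "inj_on f (X i)" unfolding X[OF that] using f(1) by (rule inj_on_subset) blast
      ultimately have "finite (X i)" using finite_imageD by blast
      then show ?thesis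
        using W(1) X[OF that] by (auto simp: legal1_def lesspoll_omega1_iff intro: countable_finite)
    qed
    have l2: "legal2 R \<C> M omega1 X Z i" if "i \<in> elts omega1" for i
      using play_legal[OF Ord_omega1 l1 nw] that by blast
    define F where "F i = span R M (\<Union>k\<in>elts i. Z k)" for i
    have Zc: "Z i \<subseteq> carrier M" if "i \<in> elts omega1" for i using l2[OF that] by (simp add: legal2_def)
    have below: "k \<in> elts omega1" if "i \<in> elts omega1" "k \<in> elts i" for i k
      using Ord_trans[OF Ord_omega1 that] .
    have Fsub: "submodule (F i) R M" if "i \<in> elts omega1" for i
      unfolding F_def by (rule M.span_sub) (use Zc below[OF that] in blast)
    have FS: "F (vsucc i) = span R M (Z i)" if "i \<in> elts omega1" for i
      unfolding F_def by (rule legal2_span[OF M.lmod_axioms l2[OF that]])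
    have mono: "F i \<subseteq> F j" if "j \<in> elts omega1" "i \<in> elts j" for i j
      unfolding F_def using Ord_trans[OF Ord_elt[OF Ord_omega1 that(1)] that(2)] by (intro M.span_mono) blast
    have chain: "submodule (\<Union>i\<in>elts j. F i) R M" if j: "Ord j" "elts j \<subseteq> elts omega1" "vzero \<in> elts j" for j
    proof (rule M.sub_Union)
      show "F ` elts j \<noteq> {}" using j(3) by blast
      show "N \<in> F ` elts j \<Longrightarrow> submodule N R M" for N using Fsub j(2) by blast
      show "chain\<^sub>\<subseteq> (F ` elts j)"
        by (rule chain_image) (use Ord_elt[OF j(1)] mono j(2) in blast)+
    qed
    let ?V = "\<Union>i\<in>elts omega1. F i"
    have zero: "vzero \<in> elts omega1" using ord_of_in_omega1[of 0] by simp
    have "Filt (quo_class R \<C> M) {\<zero>\<^bsub>M\<^esub>} ?V"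
    proof (rule Filt_ordinal[OF Ord_omega1 zero, of F])
      show "F vzero = {\<zero>\<^bsub>M\<^esub>}" by (simp add: F_def elts_vzero M.span_empty)
      show "F i \<subseteq> F j" if "j \<in> elts omega1" "i \<in> elts j" for i j by (rule mono[OF that])
      show "F i = (\<Union>k\<in>elts i. F k)" if i: "i \<in> elts omega1" "Limit i" for i
      proof
        have sub: "submodule (\<Union>k\<in>elts i. F k) R M"
          using i below[OF i(1)] by (intro chain) (auto simp: Limit_def)
        have "Z k \<subseteq> F (vsucc k) \<and> vsucc k \<in> elts i" if "k \<in> elts i" for k
          using FS[OF below[OF i(1) that]] M.span_superset[of "Z k"] i(2) that by (auto simp: Limit_def)
        then have "(\<Union>k\<in>elts i. Z k) \<subseteq> (\<Union>k\<in>elts i. F k)" by blast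
        then show "F i \<subseteq> (\<Union>k\<in>elts i. F k)" unfolding F_def[of i] by (rule M.span_least[OF sub])
        show "(\<Union>k\<in>elts i. F k) \<subseteq> F i" using mono[OF i(1)] by blast
      qed
      show "Filt (quo_class R \<C> M) (F i) (F (vsucc i))" if "vsucc i \<in> elts omega1" for i
      proof -
        have i: "i \<in> elts omega1" using below[OF that, of i] by (simp add: elts_vsucc)
        show ?thesis unfolding FS[OF i] unfolding F_def by (rule legal2_Filt[OF M \<C> l2[OF i]])
      qed
    qed simp
    moreover have "submodule ?V R M" by (rule chain[OF Ord_omega1 _ zero]) simp
    moreover have "W \<subseteq> ?V"
    proof
      fix x assume x: "x \<in> W"
      then have i: "f x \<in> elts omega1" using f(2) by blast
      have "x \<in> X (f x)" using X[OF i] x by simp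
      then have "x \<in> span R M (Z (f x))" using l2[OF i] by (auto simp: legal2_def)
      then have "x \<in> F (vsucc (f x))" using FS[OF i] by simp
      then show "x \<in> ?V" using vsucc_in_omega1[OF i] by blast
    qed
    ultimately show False using no by blast
  qed
  then show ?thesis by blast
qed

lemma player2_strategy_club:
  fixes M :: "('v::zfc_universe, 'v) module"
  assumes M: "rmodule R M" and \<C>: "\<And>K. K \<in> \<C> \<Longrightarrow> left_module R K"
    and \<D>: "\<And>a. a \<in> \<D> \<Longrightarrow> countable a \<and> a \<subseteq> carrier M"
    and un: "\<And>f :: nat \<Rightarrow> 'v set. (\<And>n. f n \<in> \<D>) \<Longrightarrow> (\<And>n. f n \<subseteq> f (Suc n)) \<Longrightarrow> (\<Union>n. f n) \<in> \<D>"
    and ext: "\<And>a X. a \<in> insert {} \<D> \<Longrightarrow> countable X \<Longrightarrow> X \<subseteq> carrier M \<Longrightarrow>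
      \<exists>b\<in>\<D>. a \<union> X \<subseteq> b \<and> Filt (quo_class R \<C> M) (span R M a) (span R M b)"
  shows "\<exists>\<tau>. \<forall>X Z. follows2 omega1 \<tau> X Z \<longrightarrow> \<not> player1_wins R \<C> M omega1 X Z"
proof -
  interpret M: lmod R M using M by (rule rmodule_lmod)
  define good where "good U X b \<longleftrightarrow> b \<in> \<D> \<and> U \<union> X \<subseteq> b \<and> Filt (quo_class R \<C> M) (span R M U) (span R M b)"
    for U X b
  define \<tau> where "\<tau> i X Z = (SOME b. good (\<Union>k\<in>elts i. Z k) (X i) b)" for i :: 'v and X Z
  have "\<not> player1_wins R \<C> M omega1 X Z" if fol: "follows2 omega1 \<tau> X Z" for X Z
  proof
    assume "player1_wins R \<C> M omega1 X Z"
    then obtain i where i: "i \<in> elts omega1" "\<And>k. k \<in> elts (vsucc i) \<Longrightarrow> legal1 M omega1 (X k)"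
      "\<not> legal2 R \<C> M omega1 X Z i"
      unfolding player1_wins_def by blast
    have i': "elts (vsucc i) \<subseteq> elts omega1"
      using i(1) Ord_trans[OF Ord_omega1 i(1)] by (auto simp: elts_vsucc)
    have Oi: "Ord (vsucc i)" using Ord_elt[OF Ord_omega1 i(1)] by simp
    have Z: "Z k = (SOME b. good (\<Union>j\<in>elts k. Z j) (X k) b)" if "k \<in> elts omega1" for k
      using fol that by (simp add: follows2_def \<tau>_def elts_vsucc)
    have good: "k \<in> elts (vsucc i) \<longrightarrow> good (\<Union>j\<in>elts k. Z j) (X k) (Z k)" for k
    proof (induction k rule: elts_induct)
      case (step k)
      show ?case
      proof
        assume k: "k \<in> elts (vsucc i)"
        have IH: "good (\<Union>j\<in>elts l. Z j) (X l) (Z l)" if "l \<in> elts k" for l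
          using step[OF that] Ord_trans[OF Oi k that] by blast
        have D: "Z l \<in> \<D>" if "l \<in> elts k" for l using IH[OF that] by (simp add: good_def)
        have mono: "Z j \<subseteq> Z l" if "l \<in> elts k" "j \<in> elts l" for j l
          using IH[OF that(1)] that(2) unfolding good_def by blast
        have Ol: "Ord l" if "l \<in> elts k" for l using Ord_elt[OF Ord_elt[OF Oi k] that] .
        let ?U = "\<Union>j\<in>elts k. Z j"
        have "?U \<in> insert {} \<D>"
        proof (cases "elts k = {}")
          case False
          have "countable (elts k)" using k i' elts_omega1 by blast
          then obtain e :: "nat \<Rightarrow> 'v" where e: "range e = elts k"
            using range_from_nat_into[OF False] by metis
          \<comment> \<open>The running maximum along an enumeration e of the earlier rounds: a
            nondecreasing \<omega>-sequence of rounds cofinal in k, to which closure of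
            \<open>\<D>\<close> under increasing unions applies.\<close>
          define g where "g = rec_nat (e 0) (\<lambda>n x. if e (Suc n) \<in> elts x then x else e (Suc n))"
          have g0: "g 0 = e 0" and gS: "g (Suc n) = (if e (Suc n) \<in> elts (g n) then g n else e (Suc n))" for n
            by (simp_all add: g_def)
          have ek: "e n \<in> elts k" for n using e by blast
          have gk: "g n \<in> elts k" for n by (induction n) (simp_all add: g0 gS ek)
          have inc: "Z (g n) \<subseteq> Z (g (Suc n))" for n
            using gS[of n] Ord_linear[OF Ol[OF gk[of n]] Ol[OF ek[of "Suc n"]]] mono[OF ek[of "Suc n"]] by auto
          have "Z (e n) \<subseteq> Z (g n)" for n
          proof (cases n)
            case (Suc m)
            then show ?thesis using gS[of m] mono[OF gk[of m]] by auto
          qed (simp add: g0)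
          then have "(\<Union>n. Z (e n)) \<subseteq> (\<Union>n. Z (g n))" by blast
          moreover have "(\<Union>n. Z (e n)) = ?U" unfolding e[symmetric] by simp
          moreover have "(\<Union>n. Z (g n)) \<subseteq> ?U" using gk by (intro UN_least UN_upper)
          ultimately have "(\<Union>n. Z (g n)) = ?U" by simp
          moreover have "(\<Union>n. Z (g n)) \<in> \<D>" by (rule un) (use D gk inc in auto)
          ultimately show ?thesis by simp
        qed simp
        moreover have "countable (X k)" "X k \<subseteq> carrier M"
          using i(2)[OF k] by (auto simp: legal1_def lesspoll_omega1_iff)
        ultimately have "\<exists>b\<in>\<D>. ?U \<union> X k \<subseteq> b \<and> Filt (quo_class R \<C> M) (span R M ?U) (span R M b)"
          by (rule ext)
        then have "\<exists>b. good ?U (X k) b" unfolding good_def by (simp add: Bex_def)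
        then show "good ?U (X k) (Z k)"
          using Z[of k] i' k someI_ex[of "good ?U (X k)"] by auto
      qed
    qed
    have gi: "good (\<Union>j\<in>elts i. Z j) (X i) (Z i)" using good[of i] by (simp add: elts_vsucc)
    have Zi: "countable (Z i)" "Z i \<subseteq> carrier M" using gi \<D> by (auto simp: good_def)
    have sub: "(\<Union>j\<in>elts i. Z j) \<subseteq> Z i" "X i \<subseteq> Z i" using gi by (auto simp: good_def)
    have "legal2 R \<C> M omega1 X Z i"
      unfolding legal2_def
    proof (intro conjI)
      show "Z i \<prec> elts omega1" using Zi by (simp add: lesspoll_omega1_iff)
      show "X i \<union> (\<Union>k\<in>elts i. Z k) \<subseteq> span R M (Z i)" using sub M.span_superset[of "Z i"] by blast
      have U: "(\<Union>j\<in>elts i. Z j) \<subseteq> carrier M" using sub Zi by blast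
      show "filtered R \<C> (quot_module (submod M (span R M (Z i))) (span R M (\<Union>k\<in>elts i. Z k)))"
        using filtered_quot[OF M M.span_sub[OF U] M.span_sub[OF Zi(2)] M.span_mono[OF sub(1)] \<C>] gi
        by (simp add: good_def)
    qed (rule Zi)
    then show False using i(3) by blast
  qed
  then show ?thesis by blast
qed

text \<open>Once a move contains the generating set m, its span is M and stays M; the outcome
  depends only on whether M itself is filtered.\<close>

lemma determined_countably_generated:
  fixes M :: "('v::zfc_universe, 'v) module"
  assumes M: "rmodule R M" and \<C>: "\<And>K. K \<in> \<C> \<Longrightarrow> left_module R K"
    and m: "countable m" "m \<subseteq> carrier M" "span R M m = carrier M"
  shows "filtration_game_determined R \<C> omega1 M"
proof -
  interpret M: lmod R M using M by (rule rmodule_lmod)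
  have top: "span R M b = carrier M" if "m \<subseteq> b" "b \<subseteq> carrier M" for b
    using M.span_mono[OF that(1)] M.span_closed[OF that(2)] m(3) by blast
  show ?thesis
  proof (cases "Filt (quo_class R \<C> M) {\<zero>\<^bsub>M\<^esub>} (carrier M)")
    case True
    let ?D = "{b. countable b \<and> m \<subseteq> b \<and> b \<subseteq> carrier M}"
    have "\<exists>\<tau>. \<forall>X Z. follows2 omega1 \<tau> X Z \<longrightarrow> \<not> player1_wins R \<C> M omega1 X Z"
    proof (rule player2_strategy_club[OF M \<C>, of _ ?D])
      fix a X assume a: "a \<in> insert {} ?D" and X: "countable X" "X \<subseteq> carrier M"
      have "Filt (quo_class R \<C> M) (span R M a) (carrier M)"
        using a True top[of a] by (auto simp: M.span_empty)
      moreover have "span R M (a \<union> X \<union> m) = carrier M" by (rule top) (use a X m in auto)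
      ultimately show "\<exists>b\<in>?D. a \<union> X \<subseteq> b \<and> Filt (quo_class R \<C> M) (span R M a) (span R M b)"
        using a X m by (intro bexI[of _ "a \<union> X \<union> m"]) auto
    next
      fix f :: "nat \<Rightarrow> 'v set" assume f: "\<And>n. f n \<in> ?D"
      then show "(\<Union>n. f n) \<in> ?D" by blast
    qed blast+
    then show ?thesis by (simp add: filtration_game_determined_def)
  next
    case False
    have "\<exists>\<sigma>. \<forall>X Z. follows1 omega1 \<sigma> X Z \<longrightarrow> player1_wins R \<C> M omega1 X Z"
    proof (rule player1_strategy_enumerate[OF M \<C> m(2)])
      show "m \<lesssim> elts (omega1 :: 'v)"
        using m(1) lesspoll_omega1_iff lesspoll_imp_lepoll by blast
      fix V assume "submodule V R M" "m \<subseteq> V"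
      then have "V = carrier M" using M.span_least[of V m] m(3) M.subD(1)[of V] by blast
      then show "\<not> Filt (quo_class R \<C> M) {\<zero>\<^bsub>M\<^esub>} V" using False by simp
    qed
    then show ?thesis by (simp add: filtration_game_determined_def)
  qed
qed

section \<open>Reflection\<close>

lemma small_countable: "countable (A :: 'v::zfc_universe set) \<Longrightarrow> small A"
proof (rule small_Pow_nat)
  assume "countable A"
  then have "A \<lesssim> (UNIV :: nat set)" by (auto simp: countable_def lepoll_def)
  also have "(UNIV :: nat set) \<lesssim> (UNIV :: nat set set)" using lepoll_Pow_self[of UNIV] by simp
  finally show "A \<lesssim> (UNIV :: nat set set)" .
qed

lemma countable_closure:
  assumes "\<And>w. w \<in> Y \<Longrightarrow> countable (c w) \<and> c w \<subseteq> Y" "countable X" "X \<subseteq> Y"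
  obtains T where "countable T" "X \<subseteq> T" "T \<subseteq> Y" "\<And>w. w \<in> T \<Longrightarrow> c w \<subseteq> T"
proof -
  define s where "s n = ((\<lambda>s. s \<union> \<Union>(c ` s)) ^^ n) X" for n
  have s0: "s 0 = X" and sS: "s (Suc n) = s n \<union> \<Union>(c ` s n)" for n by (simp_all add: s_def)
  have s: "countable (s n) \<and> s n \<subseteq> Y" for n
  proof (induction n)
    case (Suc n)
    then have "countable (\<Union>(c ` s n))" "\<Union>(c ` s n) \<subseteq> Y" using assms(1) by (auto intro!: countable_UN)
    then show ?case using Suc by (simp add: sS)
  qed (use assms in \<open>simp add: s0\<close>)
  show thesis
  proof (rule that[of "\<Union>n. s n"])
    fix w assume "w \<in> (\<Union>n. s n)"
    then obtain n where "w \<in> s n" by blast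
    then have "c w \<subseteq> s (Suc n)" by (auto simp: sS)
    then show "c w \<subseteq> (\<Union>n. s n)" by blast
  next
    show "X \<subseteq> (\<Union>n. s n)" unfolding s0[symmetric] by blast
  qed (use s in auto)
qed

text \<open>Closing off in \<omega> steps makes the closed sets cofinal. This is how the operator of
  \<open>Filt_closure_operator\<close> meets a stationary set.\<close>

lemma club_closed_under:
  fixes c :: "'v::zfc_universe \<Rightarrow> 'v set"
  assumes c: "\<And>w. w \<in> Y \<Longrightarrow> countable (c w) \<and> c w \<subseteq> Y"
  shows "club_in Y {a \<in> ctbl_subsets Y. \<forall>w\<in>elts a. c w \<subseteq> elts a}"
  unfolding club_in_def
proof (intro conjI ballI allI impI)
  fix a assume a: "a \<in> ctbl_subsets Y"
  obtain T where T: "countable T" "elts a \<subseteq> T" "T \<subseteq> Y" "\<And>w. w \<in> T \<Longrightarrow> c w \<subseteq> T"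
    by (rule countable_closure[OF c, where X = "elts a"])
      (assumption, use a in \<open>simp add: ctbl_subsets_def\<close>, use a in \<open>simp add: ctbl_subsets_def\<close>, rule that)
  then have "vset T \<in> {a \<in> ctbl_subsets Y. \<forall>w\<in>elts a. c w \<subseteq> elts a}"
    by (simp add: ctbl_subsets_def elts_vset[OF small_countable])
  then show "\<exists>b\<in>{a \<in> ctbl_subsets Y. \<forall>w\<in>elts a. c w \<subseteq> elts a}. elts a \<subseteq> elts b"
    using T(2) elts_vset[OF small_countable[OF T(1)]] by (intro bexI[of _ "vset T"]) simp_all
next
  fix f :: "nat \<Rightarrow> 'v"
  assume f: "\<forall>n. f n \<in> {a \<in> ctbl_subsets Y. \<forall>w\<in>elts a. c w \<subseteq> elts a} \<and> elts (f n) \<subseteq> elts (f (Suc n))"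
  have e: "elts (vset (\<Union>n. elts (f n))) = (\<Union>n. elts (f n))"
    by (rule elts_vset[OF small_countable]) (use f in \<open>auto simp: ctbl_subsets_def\<close>)
  have "c w \<subseteq> (\<Union>n. elts (f n))" if "w \<in> (\<Union>n. elts (f n))" for w
    using that f by blast
  then show "vset (\<Union>n. elts (f n)) \<in> {a \<in> ctbl_subsets Y. \<forall>w\<in>elts a. c w \<subseteq> elts a}"
    using f by (auto simp: ctbl_subsets_def e)
qed blast

text \<open>The definition speaks of a whole module and its submodules; it is applied to
  \<open>submod M Z'\<close> and read as a statement about intervals of submodules of M.\<close>

lemma quotient_hereditary_Filt:
  fixes M :: "('v::zfc_universe, 'v) module"
  assumes M: "rmodule R M" and \<C>: "\<And>K. K \<in> \<C> \<Longrightarrow> left_module R K" and qh: "quotient_hereditary R \<C>"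
    and Z: "submodule Z R M" "submodule Z' R M" "Z \<subseteq> Z'"
    and f: "Filt (quo_class R \<C> M) {\<zero>\<^bsub>M\<^esub>} Z" "Filt (quo_class R \<C> M) Z Z'"
    and U: "submodule U R M" "U \<subseteq> Z'"
  shows "Filt (quo_class R \<C> M) {\<zero>\<^bsub>M\<^esub>} (U \<inter> Z)" "Filt (quo_class R \<C> M) (U \<inter> Z) U"
proof -
  interpret M: lmod R M using M by (rule rmodule_lmod)
  have UZ: "submodule (U \<inter> Z) R M" by (rule M.sub_Int[OF U(1) Z(1)])
  have "rmodule R (submod M Z')" by (rule rmodule_submod[OF M Z(2)])
  moreover have "submodule Z R (submod M Z')" "submodule U R (submod M Z')"
    using M.sub_submod[OF Z(2)] Z U by blast+
  moreover have "filtered R \<C> (submod (submod M Z') Z)"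
    using filtered_submod[OF M Z(1) \<C>] f(1) by simp
  moreover have "filtered R \<C> (quot_module (submod M Z') Z)"
    using filtered_quot[OF M Z \<C>] f(2) by simp
  ultimately have "filtered R \<C> (submod (submod M Z') (U \<inter> Z)) \<and>
      filtered R \<C> (quot_module (submod (submod M Z') U) (U \<inter> Z))"
    using qh unfolding quotient_hereditary_def by blast
  then show "Filt (quo_class R \<C> M) {\<zero>\<^bsub>M\<^esub>} (U \<inter> Z)" "Filt (quo_class R \<C> M) (U \<inter> Z) U"
    using filtered_submod[OF M UZ \<C>] filtered_quot[OF M UZ U(1) _ \<C>] by auto
qed

text \<open>Separates reflection from the game: the general theorem uses it for its own class, the
  free game uses it for the countably presented projectives.\<close>

lemma reflection_dichotomy:
  fixes M :: "('v::zfc_universe, 'v) module"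
  assumes RP: "RP_internal TYPE('v)" and M: "rmodule R M"
    and \<C>: "\<And>K. K \<in> \<C> \<Longrightarrow> rmodule R K \<and> countably_presented R K" and qh: "quotient_hereditary R \<C>"
    and unc: "uncountable (carrier M)"
  obtains
    (club) \<D> where "\<And>a. a \<in> \<D> \<Longrightarrow> countable a \<and> a \<subseteq> carrier M"
      "\<And>f :: nat \<Rightarrow> 'v set. (\<And>n. f n \<in> \<D>) \<Longrightarrow> (\<And>n. f n \<subseteq> f (Suc n)) \<Longrightarrow> (\<Union>n. f n) \<in> \<D>"
      "\<And>X. countable X \<Longrightarrow> X \<subseteq> carrier M \<Longrightarrow> \<exists>b\<in>\<D>. X \<subseteq> b"
      "\<And>a. a \<in> \<D> \<Longrightarrow> Filt (quo_class R \<C> M) {\<zero>\<^bsub>M\<^esub>} (span R M a)"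
      "\<And>a b. a \<in> \<D> \<Longrightarrow> countable b \<Longrightarrow> a \<subseteq> b \<Longrightarrow> b \<subseteq> carrier M \<Longrightarrow>
        Filt (quo_class R \<C> M) (span R M a) (span R M b)"
  | (reflect) B where "B \<subseteq> carrier M" "B \<lesssim> elts (omega1 :: 'v)"
      "\<And>V. submodule V R M \<Longrightarrow> B \<subseteq> V \<Longrightarrow> \<not> Filt (quo_class R \<C> M) {\<zero>\<^bsub>M\<^esub>} V"
proof -
  interpret M: lmod R M using M by (rule rmodule_lmod)
  have \<C>': "left_module R K" if "K \<in> \<C>" for K using \<C>[OF that] by (simp add: rmodule_def)
  let ?Filt = "Filt (quo_class R \<C> M)"
  define wit where "wit a b \<longleftrightarrow> countable b \<and> a \<subseteq> b \<and> b \<subseteq> carrier M \<and> \<not> ?Filt (span R M a) (span R M b)" for a b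
  define S where "S = {s \<in> ctbl_subsets (carrier M).
    \<not> ?Filt {\<zero>\<^bsub>M\<^esub>} (span R M (elts s)) \<or> (\<exists>b. wit (elts s) b)}"
  obtain X where X: "elts X = carrier M" using M by (auto simp: rmodule_def small_def)
  show thesis
  proof (cases "stationary_in (carrier M) S")
    case False
    moreover have "S \<subseteq> ctbl_subsets (carrier M)" by (auto simp: S_def)
    ultimately obtain D where D: "club_in (carrier M) D" "S \<inter> D = {}"
      unfolding stationary_in_def by blast
    have D1: "D \<subseteq> ctbl_subsets (carrier M)" "\<And>a. a \<in> ctbl_subsets (carrier M) \<Longrightarrow> \<exists>b\<in>D. elts a \<subseteq> elts b"
      "\<And>f :: nat \<Rightarrow> 'v. (\<And>n. f n \<in> D) \<Longrightarrow> (\<And>n. elts (f n) \<subseteq> elts (f (Suc n))) \<Longrightarrow> vset (\<Union>n. elts (f n)) \<in> D"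
      using D(1) unfolding club_in_def by auto
    have D2: "countable (elts a) \<and> elts a \<subseteq> carrier M" if "a \<in> D" for a
      using D1(1) that by (auto simp: ctbl_subsets_def)
    have good: "?Filt {\<zero>\<^bsub>M\<^esub>} (span R M (elts a))" "\<not> wit (elts a) b" if "a \<in> D" for a b
      using D1(1) D(2) that unfolding S_def by blast+
    show thesis
    proof (rule club[of "elts ` D"])
      show "countable a \<and> a \<subseteq> carrier M" if "a \<in> elts ` D" for a using D2 that by blast
      show "\<exists>b\<in>elts ` D. Y \<subseteq> b" if "countable Y" "Y \<subseteq> carrier M" for Y
        using D1(2)[of "vset Y"] elts_vset[OF small_countable[OF that(1)]] that
        by (auto simp: ctbl_subsets_def)
      show "(\<Union>n. f n) \<in> elts ` D" if f: "\<And>n. f n \<in> elts ` D" "\<And>n. f n \<subseteq> f (Suc n)" for f :: "nat \<Rightarrow> 'v set"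
      proof -
        have "\<forall>n. \<exists>x. x \<in> D \<and> f n = elts x" using f(1) by blast
        then obtain g where g: "\<And>n. g n \<in> D" "\<And>n. f n = elts (g n)" by metis
        then have "vset (\<Union>n. elts (g n)) \<in> D" using D1(3) f(2) by simp
        moreover have "elts (vset (\<Union>n. elts (g n))) = (\<Union>n. elts (g n))"
          by (rule elts_vset[OF small_countable]) (use D2 g in auto)
        ultimately show ?thesis unfolding g(2) by (metis image_eqI)
      qed
    qed (use good in \<open>auto simp: wit_def\<close>)
  next
    case True
    obtain \<theta> where \<theta>: "regular_cardinal \<theta>" "X \<in> Hset \<theta>" "elts X \<subseteq> Hset \<theta>" by (rule obtain_regular)
    define bad where "bad a = (SOME b. wit a b)" for a
    have bad: "wit a (bad a)" if "\<exists>b. wit a b" for a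
      unfolding bad_def using that by (rule someI_ex)
    \<comment> \<open>The value of the n-th function symbol at a is the n-th element of a chosen
      witness for a, with the zero of M as default. A substructure containing a thus contains the
      whole witness.\<close>
    define w where "w n a = (if \<exists>b. wit (elts a) b then from_nat_into (bad (elts a)) n else \<zero>\<^bsub>M\<^esub>)"
      for n and a :: 'v
    \<comment> \<open>An empty witness would force a to be empty too, and \<open>Filt\<close> is
      reflexive; so \<open>from_nat_into\<close> enumerates the witness.\<close>
    have ne: "b \<noteq> {}" if "wit a b" for a b using that by (auto simp: wit_def)
    have w: "w n a \<in> carrier M" for n a
    proof (cases "\<exists>b. wit (elts a) b")
      case True
      note s = bad[OF True]
      have "from_nat_into (bad (elts a)) n \<in> bad (elts a)" by (rule from_nat_into[OF ne[OF s]])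
      moreover have "bad (elts a) \<subseteq> carrier M" using s by (simp add: wit_def)
      ultimately show ?thesis using True by (auto simp: w_def)
    qed (simp add: w_def)
    \<comment> \<open>The unary function symbols are the functions w, all other arities return X, in
      particular the constant symbols. The unary relation symbols denote S, the binary ones
      membership.\<close>
    define \<AA> :: "'v fo_structure" where "\<AA> = \<lparr>Dom = Hset \<theta>,
      fun_of = (\<lambda>n xs. case xs of [a] \<Rightarrow> w n a | _ \<Rightarrow> X),
      rel_of = (\<lambda>n xs. case xs of [x] \<Rightarrow> x \<in> S | [x, y] \<Rightarrow> x \<in> elts y | _ \<Rightarrow> False)\<rparr>"
    have "expands_H \<AA> \<theta> X S"
      unfolding expands_H_def fo_structure_def \<AA>_def using \<theta>(2,3) w X by (auto split: list.split)
    then obtain W where W: "elementary_sub W \<AA>" "W \<approx> elts (omega1 :: 'v)"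
      "stationary_in (W \<inter> elts X) (S \<inter> W \<inter> ctbl_subsets (W \<inter> elts X))"
      using RP True unc \<theta>(1,2) unfolding RP_internal_def X[symmetric] by metis
    have clW: "w n a \<in> W" if "a \<in> W" for n a
    proof -
      have "fo_structure (\<AA>\<lparr>Dom := W\<rparr>)" using W(1) by (simp add: elementary_sub_def)
      then have "fun_of \<AA> n [a] \<in> W" using that unfolding fo_structure_def by simp
      then show ?thesis by (simp add: \<AA>_def)
    qed
    let ?B = "W \<inter> carrier M"
    show thesis
    proof (rule reflect[of ?B])
      show "?B \<lesssim> elts (omega1 :: 'v)"
        using W(2) by (meson Int_lower1 lepoll_trans2 subset_imp_lepoll)
      fix V assume V: "submodule V R M" "?B \<subseteq> V"
      show "\<not> ?Filt {\<zero>\<^bsub>M\<^esub>} V"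
      proof
        assume FV: "?Filt {\<zero>\<^bsub>M\<^esub>} V"
        define N where "N = span R M ?B"
        have N: "submodule N R M" unfolding N_def by (rule M.span_sub) simp
        have NV: "N \<subseteq> V" unfolding N_def by (rule M.span_least[OF V])
        \<comment> \<open>Quotient-heredity for V over itself, with N as the submodule.\<close>
        have "?Filt {\<zero>\<^bsub>M\<^esub>} (N \<inter> V)"
          by (rule quotient_hereditary_Filt(1)[OF M \<C>' qh V(1) V(1) _ FV _ N NV]) simp_all
        then have FN: "?Filt {\<zero>\<^bsub>M\<^esub>} N" using NV by (simp add: Int_absorb2)
        obtain c where c: "\<And>w. w \<in> ?B \<Longrightarrow> countable (c w) \<and> c w \<subseteq> ?B"
          "\<And>a. a \<subseteq> ?B \<Longrightarrow> \<forall>w\<in>a. c w \<subseteq> a \<Longrightarrow> ?Filt (span R M a) N"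
          by (rule Filt_closure_operator[OF M N \<C> FN Int_lower2 N_def], assumption) (rule that)
        let ?D = "{a \<in> ctbl_subsets ?B. \<forall>w\<in>elts a. c w \<subseteq> elts a}"
        have "club_in ?B ?D"
          by (rule club_closed_under[OF c(1)])
        \<comment> \<open>The club of sets closed under c meets those bad sets that are elements of
          W, which is what the internal form of reflection provides.\<close>
        then have "S \<inter> W \<inter> ctbl_subsets ?B \<inter> ?D \<noteq> {}"
          using W(3) unfolding stationary_in_def X by simp
        then obtain s where s: "s \<in> S" "s \<in> W" "elts s \<subseteq> ?B" "\<forall>w\<in>elts s. c w \<subseteq> elts s"
          by (auto simp: ctbl_subsets_def)
        have sub: "submodule (span R M (elts s)) R M" using s(3) by (intro M.span_sub) blast
        have sN: "span R M (elts s) \<subseteq> N" unfolding N_def by (rule M.span_mono[OF s(3)])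
        have FsN: "?Filt (span R M (elts s)) N" by (rule c(2)[OF s(3,4)])
        have "?Filt {\<zero>\<^bsub>M\<^esub>} (span R M (elts s) \<inter> N)"
          by (rule quotient_hereditary_Filt(1)[OF M \<C>' qh N N _ FN _ sub sN]) simp_all
        then have F0: "?Filt {\<zero>\<^bsub>M\<^esub>} (span R M (elts s))" using sN by (simp add: Int_absorb2)
        \<comment> \<open>Badness of the first kind is excluded, so s has a witness; it is contained
          in W because s is an element of W.\<close>
        then have ex: "\<exists>b. wit (elts s) b" using s(1) by (simp add: S_def)
        define b where "b = bad (elts s)"
        have b: "wit (elts s) b" unfolding b_def using ex by (rule bad)
        have "b = range (from_nat_into b)"
          using b ne[OF b] by (simp add: wit_def range_from_nat_into)
        also have "\<dots> \<subseteq> W"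
          using clW[OF s(2)] ex unfolding w_def b_def by auto
        finally have "b \<subseteq> ?B" using b by (auto simp: wit_def)
        then have bN: "span R M b \<subseteq> N" unfolding N_def by (rule M.span_mono)
        have "submodule (span R M b) R M" using b by (intro M.span_sub) (simp add: wit_def)
        \<comment> \<open>Quotient-heredity with Z spanned by s, Z' = N and U spanned by b. The
          intersection is the span of s because b extends s.\<close>
        then have "?Filt (span R M b \<inter> span R M (elts s)) (span R M b)"
          by (rule quotient_hereditary_Filt(2)[OF M \<C>' qh sub N sN F0 FsN _ bN, rotated])
        moreover have "span R M (elts s) \<subseteq> span R M b" using b by (intro M.span_mono) (simp add: wit_def)
        ultimately have "?Filt (span R M (elts s)) (span R M b)" by (simp add: Int_absorb1)
        then show False using b by (simp add: wit_def)
      qed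
    qed simp
  qed
qed

text \<open>Reflection is about uncountable sets, so a countable carrier is settled as a countably
  generated module.\<close>

lemma determined_quotient_hereditary:
  fixes M :: "('v::zfc_universe, 'v) module"
  assumes RP: "RP_internal TYPE('v)" and M: "rmodule R M"
    and \<C>: "\<And>K. K \<in> \<C> \<Longrightarrow> rmodule R K \<and> countably_presented R K" and qh: "quotient_hereditary R \<C>"
  shows "filtration_game_determined R \<C> omega1 M"
proof -
  interpret M: lmod R M using M by (rule rmodule_lmod)
  have \<C>': "left_module R K" if "K \<in> \<C>" for K using \<C>[OF that] by (simp add: rmodule_def)
  show ?thesis
  proof (cases "countable (carrier M)")
    case True
    show ?thesis
      by (rule determined_countably_generated[OF M \<C>' True]) (simp_all add: M.span_of_sub[OF M.sub_carrier])
  next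
    case False
    show ?thesis
    proof (rule reflection_dichotomy[OF RP M \<C> qh False])
      fix \<D> :: "'v set set"
      assume D: "\<And>a. a \<in> \<D> \<Longrightarrow> countable a \<and> a \<subseteq> carrier M"
        "\<And>f :: nat \<Rightarrow> 'v set. (\<And>n. f n \<in> \<D>) \<Longrightarrow> (\<And>n. f n \<subseteq> f (Suc n)) \<Longrightarrow> (\<Union>n. f n) \<in> \<D>"
        "\<And>X. countable X \<Longrightarrow> X \<subseteq> carrier M \<Longrightarrow> \<exists>b\<in>\<D>. X \<subseteq> b"
        "\<And>a. a \<in> \<D> \<Longrightarrow> Filt (quo_class R \<C> M) {\<zero>\<^bsub>M\<^esub>} (span R M a)"
        "\<And>a b. a \<in> \<D> \<Longrightarrow> countable b \<Longrightarrow> a \<subseteq> b \<Longrightarrow> b \<subseteq> carrier M \<Longrightarrow>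
          Filt (quo_class R \<C> M) (span R M a) (span R M b)"
      have "\<exists>\<tau>. \<forall>X Z. follows2 omega1 \<tau> X Z \<longrightarrow> \<not> player1_wins R \<C> M omega1 X Z"
      proof (rule player2_strategy_club[OF M \<C>' D(1,2)])
        fix a X assume a: "a \<in> insert {} \<D>" and X: "countable X" "X \<subseteq> carrier M"
        have "countable (a \<union> X)" "a \<union> X \<subseteq> carrier M" using a X D(1) by auto
        then obtain b where b: "b \<in> \<D>" "a \<union> X \<subseteq> b" using D(3) by blast
        have "Filt (quo_class R \<C> M) (span R M a) (span R M b)"
          using a b D(1,4,5) by (cases "a = {}") (auto simp: M.span_empty)
        then show "\<exists>b\<in>\<D>. a \<union> X \<subseteq> b \<and> Filt (quo_class R \<C> M) (span R M a) (span R M b)"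
          using b by blast
      qed
      then show ?thesis by (simp add: filtration_game_determined_def)
    next
      fix B assume "B \<subseteq> carrier M" "B \<lesssim> elts (omega1 :: 'v)"
        "\<And>V. submodule V R M \<Longrightarrow> B \<subseteq> V \<Longrightarrow> \<not> Filt (quo_class R \<C> M) {\<zero>\<^bsub>M\<^esub>} V"
      note B = this
      have "\<exists>\<sigma>. \<forall>X Z. follows1 omega1 \<sigma> X Z \<longrightarrow> player1_wins R \<C> M omega1 X Z"
        by (rule player1_strategy_enumerate[OF M \<C>' B])
      then show ?thesis by (simp add: filtration_game_determined_def)
    qed
  qed
qed

section \<open>Projective subquotients\<close>

text \<open>\<open>B / A\<close> is a direct summand of the free module on \<open>J\<close>, expressed by a section \<open>s\<close> and a
  retraction \<open>p\<close>.\<close>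

definition psplit ::
  "'r ring \<Rightarrow> ('r, 'm) module \<Rightarrow> 'j set \<Rightarrow> 'm set \<Rightarrow> 'm set \<Rightarrow> bool" where
  "psplit R M J A B \<longleftrightarrow> (\<exists>s\<in>module_hom R (submod M B) (free_module R J).
     \<exists>p\<in>module_hom R (free_module R J) (submod M B).
       (\<forall>x\<in>A. s x = \<zero>\<^bsub>free_module R J\<^esub>) \<and> (\<forall>x\<in>B. x \<ominus>\<^bsub>M\<^esub> p (s x) \<in> A))"

lemma psplitE:
  assumes "psplit R M J A B"
  obtains s p where "s \<in> module_hom R (submod M B) (free_module R J)"
    "p \<in> module_hom R (free_module R J) (submod M B)"
    "\<And>x. x \<in> A \<Longrightarrow> s x = \<zero>\<^bsub>free_module R J\<^esub>" "\<And>x. x \<in> B \<Longrightarrow> x \<ominus>\<^bsub>M\<^esub> p (s x) \<in> A"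
  using assms unfolding psplit_def by blast

lemma psplitI:
  assumes "s \<in> module_hom R (submod M B) (free_module R J)"
    "p \<in> module_hom R (free_module R J) (submod M B)"
    "\<And>x. x \<in> A \<Longrightarrow> s x = \<zero>\<^bsub>free_module R J\<^esub>" "\<And>x. x \<in> B \<Longrightarrow> x \<ominus>\<^bsub>M\<^esub> p (s x) \<in> A"
  shows "psplit R M J A B"
  using assms unfolding psplit_def by blast

text \<open>A member of the free module is determined by its graph over J, a subset of the square of
  an infinite small set. The bound provides the copy inside the universe against which
  \<open>projective\<close> can be tested.\<close>

lemma free_module_lepoll:
  fixes R :: "'v::zfc_universe ring" and J :: "'v set"
  assumes "small (carrier R)" "small J"
  shows "\<exists>x :: 'v. carrier (free_module R J) \<lesssim> elts x"
proof -
  let ?Y = "J \<union> carrier R \<union> range ord_of"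
  have Y: "small ?Y" "infinite ?Y"
    using small_Un[OF small_Un[OF assms(2,1)] small_ord_of] infinite_ord_of by auto
  obtain g where g: "inj_on g (?Y \<times> ?Y)" "g ` (?Y \<times> ?Y) \<subseteq> ?Y"
    using infinite_times_lepoll[OF Y(2)] unfolding lepoll_def by blast
  define h where "h f = g ` {(j, f j) | j. j \<in> J}" for f :: "'v \<Rightarrow> 'v"
  have gr: "{(j, f j) | j. j \<in> J} \<subseteq> ?Y \<times> ?Y" if "f \<in> carrier (free_module R J)" for f
    using that by (auto simp: free_module_carrier)
  have "inj_on h (carrier (free_module R J))"
  proof (rule inj_onI)
    fix f f' assume ff: "f \<in> carrier (free_module R J)" "f' \<in> carrier (free_module R J)" "h f = h f'"
    then have eq: "{(j, f j) | j. j \<in> J} = {(j, f' j) | j. j \<in> J}"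
      unfolding h_def using inj_on_image_eq_iff[OF g(1) gr[OF ff(1)] gr[OF ff(2)]] by blast
    show "f = f'"
    proof
      fix j
      show "f j = f' j"
      proof (cases "j \<in> J")
        case True
        then have "(j, f j) \<in> {(j, f' j) | j. j \<in> J}" unfolding eq[symmetric] by blast
        then show ?thesis by blast
      next
        case False
        then have "f j = \<zero>\<^bsub>R\<^esub>" "f' j = \<zero>\<^bsub>R\<^esub>" using ff by (auto simp: free_module_carrier)
        then show ?thesis by simp
      qed
    qed
  qed
  moreover have "h f \<subseteq> ?Y" if "f \<in> carrier (free_module R J)" for f
    unfolding h_def using gr[OF that] g(2) by blast
  then have "h ` carrier (free_module R J) \<subseteq> Pow ?Y" by blast
  ultimately have "carrier (free_module R J) \<lesssim> Pow ?Y" unfolding lepoll_def by blast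
  then show ?thesis by (rule small_Pow[OF Y(1)])
qed

text \<open>The free module on the carrier of K maps onto K, and projectivity, tested against its
  copy \<open>F'\<close>, yields a section \<sigma>. Then s is \<sigma> after the map from B to K,
  and p sends each basis vector to a preimage in B.\<close>

lemma projective_imp_psplit:
  fixes M :: "('v::zfc_universe, 'v) module"
  assumes R: "small (carrier R)" and M: "lmod R M" and AB: "submodule A R M" "submodule B R M" "A \<subseteq> B"
    and K: "projective R K" and q: "quo R M A B K"
  shows "psplit R M (carrier K) A B"
proof -
  have rK: "rmodule R K" using K by (simp add: projective_def)
  interpret M: lmod R M by (rule M)
  interpret K: lmod R K using rK by (rule rmodule_lmod)
  interpret S: lmod R "submod M B" by (rule M.lmod_submod[OF AB(2)])
  let ?F = "free_module R (carrier K)"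
  interpret F: lmod R ?F by (rule M.free.free_lmod)
  obtain \<theta> where \<theta>: "\<theta> \<in> module_hom R (submod M B) K" "\<theta> ` B = carrier K"
    "\<And>x. x \<in> B \<Longrightarrow> \<theta> x = \<zero>\<^bsub>K\<^esub> \<longleftrightarrow> x \<in> A" using q by (rule quoE) (rule that)
  have "\<exists>x :: 'v. carrier ?F \<lesssim> elts x"
    by (rule free_module_lepoll[OF R]) (use rK in \<open>simp add: rmodule_def\<close>)
  then obtain x :: 'v where "carrier ?F \<lesssim> elts x" by blast
  then obtain F' h where h: "rmodule R F'" "h \<in> module_hom R ?F F'" "bij_betw h (carrier ?F) (carrier F')"
    using exists_rmodule_copy[OF F.left_module_axioms] by metis
  interpret F': lmod R F' using h(1) by (rule rmodule_lmod)
  have h0: "f = \<zero>\<^bsub>?F\<^esub>" if "f \<in> carrier ?F" "h f = \<zero>\<^bsub>F'\<^esub>" for f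
    using that inj_onD[OF bij_betw_imp_inj_on[OF h(3)], of f "\<zero>\<^bsub>?F\<^esub>"] F.M.zero_closed
      hom_props(1)[OF h(2) F.lmod_axioms F'.lmod_axioms] by simp
  have hs: "h ` carrier ?F = carrier F'" using h(3) by (simp add: bij_betw_def)
  obtain hi where hi: "hi \<in> module_hom R F' ?F" "\<And>f. f \<in> carrier ?F \<Longrightarrow> hi (h f) = f"
    by (rule hom_factor[OF h(2) hs module_hom_id F.lmod_axioms F'.lmod_axioms F.lmod_axioms h0])
      (assumption, assumption, rule that)
  obtain e where e: "e \<in> module_hom R ?F K" "\<And>k. k \<in> carrier K \<Longrightarrow> e (unit_vec R k) = k"
    by (rule M.free.free_hom_exists[OF K.lmod_axioms, of "carrier K" "\<lambda>k. k"]) (assumption, rule that)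
  have "(\<lambda>z. e (hi z)) ` carrier F' = carrier K"
  proof
    show "(\<lambda>z. e (hi z)) ` carrier F' \<subseteq> carrier K"
      using module_homD(1)[OF e(1)] module_homD(1)[OF hi(1)] by blast
    show "carrier K \<subseteq> (\<lambda>z. e (hi z)) ` carrier F'"
    proof
      fix k assume k: "k \<in> carrier K"
      then have "k = e (hi (h (unit_vec R k)))" using hi(2)[OF M.free.unit_vec_closed[OF k]] e(2) by simp
      then show "k \<in> (\<lambda>z. e (hi z)) ` carrier F'"
        using module_homD(1)[OF h(2) M.free.unit_vec_closed[OF k]] by blast
    qed
  qed
  moreover have "(\<lambda>z. e (hi z)) \<in> module_hom R F' K" by (rule module_hom_comp[OF hi(1) e(1)])
  ultimately have "\<exists>\<sigma>\<in>module_hom R K F'. \<forall>x\<in>carrier K. e (hi (\<sigma> x)) = x"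
    using K[unfolded projective_def, THEN conjunct2, rule_format, of F' K "\<lambda>z. e (hi z)" "\<lambda>x. x"]
      h(1) rK module_hom_id[of R K] by simp
  then obtain \<sigma> where \<sigma>: "\<sigma> \<in> module_hom R K F'" "\<And>x. x \<in> carrier K \<Longrightarrow> e (hi (\<sigma> x)) = x" by blast
  have "\<exists>y\<in>B. \<theta> y = k" if "k \<in> carrier K" for k using that \<theta>(2) by (metis imageE)
  then obtain y where y: "\<And>k. k \<in> carrier K \<Longrightarrow> y k \<in> B" "\<And>k. k \<in> carrier K \<Longrightarrow> \<theta> (y k) = k" by metis
  obtain p where p: "p \<in> module_hom R ?F (submod M B)" "\<And>k. k \<in> carrier K \<Longrightarrow> p (unit_vec R k) = y k"
    by (rule M.free.free_hom_exists[OF S.lmod_axioms, of "carrier K" y]) (simp add: y(1), rule that)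
  have \<theta>p: "\<theta> (p f) = e f" if "f \<in> carrier ?F" for f
    by (rule M.free.free_hom_eqI[OF module_hom_comp[OF p(1) \<theta>(1)] e(1) K.lmod_axioms _ that])
      (use that p(2) y(2) e(2) in \<open>simp add: free_module_carrier\<close>)
  show ?thesis
  proof (rule psplitI[of "\<lambda>x. hi (\<sigma> (\<theta> x))" _ _ _ _ p])
    show "(\<lambda>x. hi (\<sigma> (\<theta> x))) \<in> module_hom R (submod M B) ?F"
      by (rule module_hom_comp[OF module_hom_comp[OF \<theta>(1) \<sigma>(1)] hi(1)])
    show "hi (\<sigma> (\<theta> x)) = \<zero>\<^bsub>?F\<^esub>" if "x \<in> A" for x
      using that AB(3) \<theta>(3) hom_props(1)[OF \<sigma>(1) K.lmod_axioms F'.lmod_axioms]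
        hom_props(1)[OF hi(1) F'.lmod_axioms F.lmod_axioms] by (metis subsetD)
    fix x assume x: "x \<in> B"
    have kx: "\<theta> x \<in> carrier K" using \<theta>(2) x by blast
    have f: "hi (\<sigma> (\<theta> x)) \<in> carrier ?F"
      by (rule module_homD(1)[OF hi(1) module_homD(1)[OF \<sigma>(1) kx]])
    have pB: "p (hi (\<sigma> (\<theta> x))) \<in> B" using module_homD(1)[OF p(1) f] by simp
    have "\<theta> (x \<ominus>\<^bsub>M\<^esub> p (hi (\<sigma> (\<theta> x)))) = \<zero>\<^bsub>K\<^esub>"
      using hom_props(3)[OF \<theta>(1) S.lmod_axioms K.lmod_axioms] x pB \<theta>p[OF f] \<sigma>(2)[OF kx] kx
      by (simp add: M.minus_submod[OF AB(2)] K.diff_self)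
    then show "x \<ominus>\<^bsub>M\<^esub> p (hi (\<sigma> (\<theta> x))) \<in> A"
      using \<theta>(3)[OF M.subD(7)[OF AB(2) x pB]] by simp
  qed (rule p(1))
qed

text \<open>The map to B' is lifted along g on basis vectors, where mere choice suffices.
  Composition with s kills A, so the lift descends to K, and it is a lift of f because x and
  \<open>p (s x)\<close> agree modulo A.\<close>

lemma psplit_imp_projective:
  fixes M :: "('v::zfc_universe, 'v) module"
  assumes M: "lmod R M" and AB: "submodule A R M" "submodule B R M" "A \<subseteq> B"
    and K: "rmodule R K" and q: "quo R M A B K" and ps: "psplit R M J A B"
  shows "projective R K"
  unfolding projective_def
proof (intro conjI allI impI)
  interpret M: lmod R M by (rule M)
  interpret K: lmod R K using K by (rule rmodule_lmod)
  interpret S: lmod R "submod M B" by (rule M.lmod_submod[OF AB(2)])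
  let ?F = "free_module R J"
  interpret F: lmod R ?F by (rule M.free.free_lmod)
  obtain s p where sp: "s \<in> module_hom R (submod M B) ?F" "p \<in> module_hom R ?F (submod M B)"
    "\<And>x. x \<in> A \<Longrightarrow> s x = \<zero>\<^bsub>?F\<^esub>" "\<And>x. x \<in> B \<Longrightarrow> x \<ominus>\<^bsub>M\<^esub> p (s x) \<in> A"
    using ps by (rule psplitE) (rule that)
  obtain \<theta> where \<theta>: "\<theta> \<in> module_hom R (submod M B) K" "\<theta> ` B = carrier K"
    "\<And>x. x \<in> B \<Longrightarrow> \<theta> x = \<zero>\<^bsub>K\<^esub> \<longleftrightarrow> x \<in> A" using q by (rule quoE) (rule that)
  fix A' B' :: "('v, 'v) module" and g f
  assume *: "rmodule R A' \<and> rmodule R B' \<and> g \<in> module_hom R A' B' \<and> g ` carrier A' = carrier B' \<and>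
    f \<in> module_hom R K B'"
  interpret A': lmod R A' using * rmodule_lmod by blast
  interpret B': lmod R B' using * rmodule_lmod by blast
  have g: "g \<in> module_hom R A' B'" and f: "f \<in> module_hom R K B'" using * by blast+
  have pB: "p (unit_vec R j) \<in> B" if "j \<in> J" for j
    using module_homD(1)[OF sp(2) M.free.unit_vec_closed[OF that]] by simp
  have "\<exists>a\<in>carrier A'. g a = f (\<theta> (p (unit_vec R j)))" if "j \<in> J" for j
    using * module_homD(1)[OF f] module_homD(1)[OF \<theta>(1)] pB[OF that] by (metis imageE submod_simps(1))
  then obtain a where a: "\<And>j. j \<in> J \<Longrightarrow> a j \<in> carrier A'" "\<And>j. j \<in> J \<Longrightarrow> g (a j) = f (\<theta> (p (unit_vec R j)))"
    by metis
  obtain h where h: "h \<in> module_hom R ?F A'" "\<And>j. j \<in> J \<Longrightarrow> h (unit_vec R j) = a j"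
    by (rule M.free.free_hom_exists[OF A'.lmod_axioms, of J a]) (simp add: a(1), rule that)
  have gh: "g (h z) = f (\<theta> (p z))" if "z \<in> carrier ?F" for z
    by (rule M.free.free_hom_eqI[OF module_hom_comp[OF h(1) g] module_hom_comp[OF module_hom_comp[OF sp(2) \<theta>(1)] f]
        B'.lmod_axioms _ that])
      (use that h(2) a(2) in \<open>simp add: free_module_carrier\<close>)
  obtain h' where h': "h' \<in> module_hom R K A'" "\<And>x. x \<in> carrier (submod M B) \<Longrightarrow> h' (\<theta> x) = h (s x)"
  proof (rule hom_factor[OF \<theta>(1) _ module_hom_comp[OF sp(1) h(1)] S.lmod_axioms K.lmod_axioms A'.lmod_axioms])
    show "\<theta> ` carrier (submod M B) = carrier K" using \<theta>(2) by simp
    show "h (s x) = \<zero>\<^bsub>A'\<^esub>" if "x \<in> carrier (submod M B)" "\<theta> x = \<zero>\<^bsub>K\<^esub>" for x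
      using that \<theta>(3) sp(3) hom_props(1)[OF h(1) F.lmod_axioms A'.lmod_axioms] by simp
  qed (rule that)
  have "g (h' k) = f k" if k: "k \<in> carrier K" for k
  proof -
    obtain x where x: "x \<in> B" "k = \<theta> x" using k \<theta>(2) by blast
    have sx: "s x \<in> carrier ?F" using module_homD(1)[OF sp(1)] x by simp
    then have psx: "p (s x) \<in> B" using module_homD(1)[OF sp(2)] by simp
    have "\<theta> (x \<ominus>\<^bsub>M\<^esub> p (s x)) = \<zero>\<^bsub>K\<^esub>"
      using sp(4)[OF x(1)] \<theta>(3) AB(3) by blast
    then have "\<theta> x = \<theta> (p (s x))"
      using hom_props(3)[OF \<theta>(1) S.lmod_axioms K.lmod_axioms] x psx module_homD(1)[OF \<theta>(1)]
      by (simp add: M.minus_submod[OF AB(2)] K.diff_zero_iff)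
    then show ?thesis using h'(2)[of x] x gh[OF sx] by simp
  qed
  then show "\<exists>h\<in>module_hom R K A'. \<forall>x\<in>carrier K. g (h x) = f x" using h'(1) by blast
qed (rule K)

text \<open>Sending the basis vectors outside the image of u to zero makes k a left inverse of the
  embedding i.\<close>

lemma psplit_reindex:
  assumes M: "lmod R M" and B: "submodule B R M" and ps: "psplit R M J A B"
    and u: "inj_on u J" "u ` J \<subseteq> J'"
  shows "psplit R M J' A B"
proof -
  interpret M: lmod R M by (rule M)
  let ?F = "free_module R J" and ?G = "free_module R J'"
  interpret S: lmod R "submod M B" by (rule M.lmod_submod[OF B])
  interpret F: lmod R ?F by (rule M.free.free_lmod)
  interpret G: lmod R ?G by (rule M.free.free_lmod)
  obtain s p where sp: "s \<in> module_hom R (submod M B) ?F" "p \<in> module_hom R ?F (submod M B)"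
    "\<And>x. x \<in> A \<Longrightarrow> s x = \<zero>\<^bsub>?F\<^esub>" "\<And>x. x \<in> B \<Longrightarrow> x \<ominus>\<^bsub>M\<^esub> p (s x) \<in> A"
    using ps by (rule psplitE) (rule that)
  obtain i where i: "i \<in> module_hom R ?F ?G" "\<And>j. j \<in> J \<Longrightarrow> i (unit_vec R j) = unit_vec R (u j)"
    by (rule M.free.free_hom_exists[OF G.lmod_axioms, of J "\<lambda>j. unit_vec R (u j)"])
      (rule M.free.unit_vec_closed, use u(2) in blast, rule that)
  obtain k where k: "k \<in> module_hom R ?G ?F"
    "\<And>j. j \<in> J' \<Longrightarrow> k (unit_vec R j) = (if j \<in> u ` J then unit_vec R (inv_into J u j) else \<zero>\<^bsub>?F\<^esub>)"
    by (rule M.free.free_hom_exists[OF F.lmod_axioms, of J'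
          "\<lambda>j. if j \<in> u ` J then unit_vec R (inv_into J u j) else \<zero>\<^bsub>?F\<^esub>"])
      (use M.free.unit_vec_closed[of _ J] inv_into_into[of _ u J] F.M.zero_closed
        in \<open>simp del: free_module_simps\<close>, rule that)
  have "k (i (unit_vec R j)) = unit_vec R j" if j: "j \<in> J" for j
  proof -
    have "u j \<in> J'" "u j \<in> u ` J" using j u(2) by blast+
    then show ?thesis using j i(2) k(2) u(1) by simp
  qed
  then have ki: "k (i f) = f" if "f \<in> carrier ?F" for f
    by (intro M.free.free_hom_eqI[OF module_hom_comp[OF i(1) k(1)] module_hom_id F.lmod_axioms _ that])
      (use that in \<open>simp add: free_module_carrier\<close>)
  show ?thesis
  proof (rule psplitI[OF module_hom_comp[OF sp(1) i(1)] module_hom_comp[OF k(1) sp(2)]])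
    show "i (s x) = \<zero>\<^bsub>?G\<^esub>" if "x \<in> A" for x
      using sp(3)[OF that] hom_props(1)[OF i(1) F.lmod_axioms G.lmod_axioms] by simp
    show "x \<ominus>\<^bsub>M\<^esub> p (k (i (s x))) \<in> A" if "x \<in> B" for x
      using ki[of "s x"] sp(4)[OF that] module_homD(1)[OF sp(1)] that by simp
  qed
qed

text \<open>The kernel of the free module over K is the image of d = 1 - s p, hence spanned by the
  images of the countably many basis vectors. J is renamed into the natural numbers, where
  \<open>countably_presented\<close> expects its indices.\<close>

lemma psplit_imp_countably_presented:
  assumes M: "lmod R M" and AB: "submodule A R M" "submodule B R M" "A \<subseteq> B"
    and K: "lmod R K" and q: "quo R M A B K" and ps: "psplit R M J A B" and J: "countable J"
  shows "countably_presented R K"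
proof -
  interpret M: lmod R M by (rule M)
  interpret K: lmod R K by (rule K)
  interpret S: lmod R "submod M B" by (rule M.lmod_submod[OF AB(2)])
  define J' where "J' = to_nat_on J ` J"
  let ?F = "free_module R J'"
  interpret F: lmod R ?F by (rule M.free.free_lmod)
  have "psplit R M J' A B" unfolding J'_def by (rule psplit_reindex[OF M AB(2) ps inj_on_to_nat_on[OF J] order_refl])
  then obtain s p where sp: "s \<in> module_hom R (submod M B) ?F" "p \<in> module_hom R ?F (submod M B)"
    "\<And>x. x \<in> A \<Longrightarrow> s x = \<zero>\<^bsub>?F\<^esub>" "\<And>x. x \<in> B \<Longrightarrow> x \<ominus>\<^bsub>M\<^esub> p (s x) \<in> A"
    by (rule psplitE) (rule that)
  obtain \<theta> where \<theta>: "\<theta> \<in> module_hom R (submod M B) K" "\<theta> ` B = carrier K"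
    "\<And>x. x \<in> B \<Longrightarrow> \<theta> x = \<zero>\<^bsub>K\<^esub> \<longleftrightarrow> x \<in> A" using q by (rule quoE) (rule that)
  have pB: "p f \<in> B" if "f \<in> carrier ?F" for f using module_homD(1)[OF sp(2) that] by simp
  have sF: "s x \<in> carrier ?F" if "x \<in> B" for x using module_homD(1)[OF sp(1)] that by simp
  have \<theta>eq: "\<theta> x = \<theta> (p (s x))" if x: "x \<in> B" for x
  proof -
    have "\<theta> (x \<ominus>\<^bsub>M\<^esub> p (s x)) = \<zero>\<^bsub>K\<^esub>" using sp(4)[OF x] \<theta>(3) AB(3) by blast
    then show ?thesis
      using hom_props(3)[OF \<theta>(1) S.lmod_axioms K.lmod_axioms] x pB[OF sF[OF x]] module_homD(1)[OF \<theta>(1)]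
      by (simp add: M.minus_submod[OF AB(2)] K.diff_zero_iff)
  qed
  define d where "d f = f \<ominus>\<^bsub>?F\<^esub> s (p f)" for f
  have d: "d \<in> module_hom R ?F ?F"
    unfolding d_def by (rule hom_diff[OF module_hom_id module_hom_comp[OF sp(2,1)] F.lmod_axioms F.lmod_axioms])
  define G where "G = (\<lambda>j. d (unit_vec R j)) ` J'"
  have G: "G \<subseteq> carrier ?F"
    unfolding G_def by (rule image_subsetI) (rule module_homD(1)[OF d M.free.unit_vec_closed])
  have im: "d ` carrier ?F = span R ?F G"
  proof -
    have u: "unit_vec R ` J' \<subseteq> carrier ?F" by (rule image_subsetI) (rule M.free.unit_vec_closed)
    show ?thesis
      using F.span_image[OF d F.lmod_axioms u] M.free.free_carrier_span[of J'] by (simp add: G_def image_image)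
  qed
  have "quo R ?F (span R ?F G) (carrier ?F) K"
  proof (rule quoI[of "\<lambda>f. \<theta> (p f)"])
    show "(\<lambda>f. \<theta> (p f)) \<in> module_hom R (submod ?F (carrier ?F)) K"
      using module_hom_comp[OF sp(2) \<theta>(1)] by simp
    show "(\<lambda>f. \<theta> (p f)) ` carrier ?F = carrier K"
    proof
      show "(\<lambda>f. \<theta> (p f)) ` carrier ?F \<subseteq> carrier K" using pB \<theta>(2) by blast
      show "carrier K \<subseteq> (\<lambda>f. \<theta> (p f)) ` carrier ?F" unfolding \<theta>(2)[symmetric] using \<theta>eq sF by auto
    qed
    fix f assume f: "f \<in> carrier ?F"
    have "f \<in> span R ?F G" if "\<theta> (p f) = \<zero>\<^bsub>K\<^esub>"
    proof -
      have "s (p f) = \<zero>\<^bsub>?F\<^esub>" using that \<theta>(3)[OF pB[OF f]] sp(3) by blast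
      then have "d f = f" unfolding d_def using F.diff_zero[OF f] by simp
      then show ?thesis using im f by (metis imageI)
    qed
    moreover have "\<theta> (p f) = \<zero>\<^bsub>K\<^esub>" if fG: "f \<in> span R ?F G"
    proof -
      obtain f' where f': "f' \<in> carrier ?F" "f = d f'" using fG im by (metis imageE)
      have "p f = p f' \<ominus>\<^bsub>submod M B\<^esub> p (s (p f'))"
        unfolding f'(2) d_def
        by (rule hom_props(3)[OF sp(2) F.lmod_axioms S.lmod_axioms f'(1) sF[OF pB[OF f'(1)]]])
      then show ?thesis
        using sp(4)[OF pB[OF f'(1)]] \<theta>(3)[OF pB[OF f]] M.minus_submod[OF AB(2) pB[OF f'(1)] pB[OF sF[OF pB[OF f'(1)]]]]
        by simp
    qed
    ultimately show "\<theta> (p f) = \<zero>\<^bsub>K\<^esub> \<longleftrightarrow> f \<in> span R ?F G" by blast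
  qed
  then have "module_iso R (quot_module ?F (span R ?F G)) K"
    using F.quo_iff_iso[OF F.span_sub[OF G] F.sub_carrier F.span_closed[OF G] K.left_module_axioms] by simp
  moreover have "countable G" unfolding G_def J'_def using J by simp
  ultimately show ?thesis
    unfolding countably_presented_def using G by blast
qed

text \<open>Partial sections into the free module on \<open>B\<close> extend along each projective step.\<close>

lemma Filt_imp_psplit:
  fixes M :: "('r, 'm) module"
  assumes M: "lmod R M" and AB: "submodule A R M" "submodule B R M"
    and filt: "Filt Q A B"
    and Q: "\<And>N N'. Q N N' \<Longrightarrow> submodule N R M \<and> submodule N' R M \<and> (\<exists>J :: 'm set. psplit R M J N N')"
  shows "psplit R M B A B"
proof -
  interpret M: lmod R M by (rule M)
  interpret S: lmod R "submod M B" by (rule M.lmod_submod[OF AB(2)])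
  let ?F = "free_module R B"
  interpret F: lmod R ?F by (rule M.free.free_lmod)
  obtain \<F> where \<F>: "A \<in> \<F>" "\<And>N. N \<in> \<F> \<Longrightarrow> A \<subseteq> N" "\<And>N. N \<in> \<F> \<Longrightarrow> N \<subseteq> B"
    "\<And>\<G>. \<G> \<subseteq> \<F> \<Longrightarrow> \<G> \<noteq> {} \<Longrightarrow> chain\<^sub>\<subseteq> \<G> \<Longrightarrow> \<Union>\<G> \<in> \<F>"
    "\<And>N. N \<in> \<F> \<Longrightarrow> N \<noteq> B \<Longrightarrow> \<exists>N'\<in>\<F>. N \<subset> N' \<and> Q N N'"
    by (rule FiltE[OF filt]) (rule that)
  have sub: "submodule N R M" if "N \<in> \<F>" for N using \<F>(5)[OF that] Q AB(2) by blast
  \<comment> \<open>The basis is B itself, so every element of B has its unit vector as a canonical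
    preimage whenever a section is to be extended.\<close>
  obtain e where e: "e \<in> module_hom R ?F (submod M B)" "\<And>b. b \<in> B \<Longrightarrow> e (unit_vec R b) = b"
    by (rule M.free.free_hom_exists[OF S.lmod_axioms, of B "\<lambda>b. b"]) (simp, rule that)
  have eB: "e f \<in> B" if "f \<in> carrier ?F" for f using module_homD(1)[OF e(1) that] by simp
  have e0: "e \<zero>\<^bsub>?F\<^esub> = \<zero>\<^bsub>M\<^esub>" using hom_props(1)[OF e(1) F.lmod_axioms S.lmod_axioms] by simp
  define sec where "sec N s \<longleftrightarrow> N \<in> \<F> \<and> s \<in> module_hom R (submod M N) ?F \<and> (\<forall>x\<in>A. s x = \<zero>\<^bsub>?F\<^esub>) \<and>
     (\<forall>x\<in>N. x \<ominus>\<^bsub>M\<^esub> e (s x) \<in> A)" for N s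
  \<comment> \<open>Zorn's lemma is applied to graphs: two functions may agree on N and differ
    elsewhere, whereas inclusion of graphs is exactly extension of sections.\<close>
  define gr where "gr N s = {(x, s x) | x. x \<in> N}" for N and s :: "'m \<Rightarrow> 'm \<Rightarrow> 'r"
  define \<S> where "\<S> = {gr N s | N s. sec N s}"
  have fst_gr: "fst ` gr N s = N" for N s unfolding gr_def by force
  have "\<exists>m\<in>\<S>. \<forall>X\<in>\<S>. m \<subseteq> X \<longrightarrow> X = m"
  proof (rule subset_Zorn_nonempty)
    have "sec A (\<lambda>_. \<zero>\<^bsub>?F\<^esub>)"
      unfolding sec_def
    proof (intro conjI ballI)
      show "(\<lambda>_. \<zero>\<^bsub>?F\<^esub>) \<in> module_hom R (submod M A) ?F"
        by (rule module_homI) (use F.M.zero_closed F.M.l_zero F.smult_r_null in \<open>simp_all del: free_module_simps\<close>)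
      show "x \<ominus>\<^bsub>M\<^esub> e \<zero>\<^bsub>?F\<^esub> \<in> A" if "x \<in> A" for x
        using that M.subD(7)[OF AB(1) that M.subD(3)[OF AB(1)]] e0 by simp
    qed (use \<F>(1) in auto)
    then show "\<S> \<noteq> {}" unfolding \<S>_def by blast
  next
    fix \<C> assume \<C>: "\<C> \<noteq> {}" "subset.chain \<S> \<C>"
    then have ch: "\<C> \<subseteq> \<S>" "\<And>X Y. X \<in> \<C> \<Longrightarrow> Y \<in> \<C> \<Longrightarrow> X \<subseteq> Y \<or> Y \<subseteq> X"
      by (auto simp: subset.chain_def)
    have secX: "\<exists>s. X = gr (fst ` X) s \<and> sec (fst ` X) s" if X: "X \<in> \<C>" for X
    proof -
      obtain N s where "X = gr N s" "sec N s" using ch(1) X unfolding \<S>_def by blast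
      then show ?thesis using fst_gr[of N s] by auto
    qed
    define N where "N = (\<Union>X\<in>\<C>. fst ` X)"
    have NF: "N \<in> \<F>"
      unfolding N_def
    proof (rule \<F>(4))
      show "(\<lambda>X. fst ` X) ` \<C> \<subseteq> \<F>" using secX by (auto simp: sec_def)
      show "(\<lambda>X. fst ` X) ` \<C> \<noteq> {}" using \<C>(1) by simp
      show "chain\<^sub>\<subseteq> ((\<lambda>X. fst ` X) ` \<C>)" unfolding chain_subset_def using ch(2) by blast
    qed
    have sv: "y = y'" if xy: "(x, y) \<in> \<Union>\<C>" "(x, y') \<in> \<Union>\<C>" for x y y'
    proof -
      obtain X where X: "X \<in> \<C>" "(x, y) \<in> X" "(x, y') \<in> X" using xy ch(2) by blast
      then obtain t where "X = gr (fst ` X) t" using secX by blast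
      then have "(x, y) \<in> gr (fst ` X) t" "(x, y') \<in> gr (fst ` X) t" using X by simp_all
      then show ?thesis by (simp add: gr_def)
    qed
    define s where "s x = (THE y. (x, y) \<in> \<Union>\<C>)" for x
    have sX: "s x = t x" if "X \<in> \<C>" "X = gr (fst ` X) t" "x \<in> fst ` X" for X t x
    proof -
      have "(x, t x) \<in> gr (fst ` X) t" unfolding gr_def using that(3) by blast
      then have "(x, t x) \<in> \<Union>\<C>" using that by blast
      then show ?thesis unfolding s_def using sv by (intro the_equality)
    qed
    have un: "\<Union>\<C> = gr N s"
    proof (intro subset_antisym subsetI)
      fix z assume "z \<in> \<Union>\<C>"
      then obtain X where X: "X \<in> \<C>" "z \<in> X" by blast
      then obtain t where t: "X = gr (fst ` X) t" using secX by blast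
      then obtain x where "z = (x, t x)" "x \<in> fst ` X" using X(2) unfolding gr_def by blast
      then show "z \<in> gr N s" unfolding gr_def N_def using sX[OF X(1) t] X(1) by auto
    next
      fix z assume "z \<in> gr N s"
      then obtain x X where x: "z = (x, s x)" "X \<in> \<C>" "x \<in> fst ` X" unfolding gr_def N_def by blast
      then obtain t where t: "X = gr (fst ` X) t" using secX by blast
      have "z = (x, t x)" using sX[OF x(2) t x(3)] x(1) by simp
      then have "z \<in> X" using t x(3) unfolding gr_def by blast
      then show "z \<in> \<Union>\<C>" using x(2) by blast
    qed
    have pair: "\<exists>X t. X \<in> \<C> \<and> X = gr (fst ` X) t \<and> sec (fst ` X) t \<and> x \<in> fst ` X \<and> y \<in> fst ` X"
      if xy: "x \<in> N" "y \<in> N" for x y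
    proof -
      obtain X Y where XY: "X \<in> \<C>" "x \<in> fst ` X" "Y \<in> \<C>" "y \<in> fst ` Y" using xy unfolding N_def by blast
      from ch(2)[OF XY(1,3)] obtain Z where Z: "Z \<in> \<C>" "x \<in> fst ` Z" "y \<in> fst ` Z"
      proof
        assume "X \<subseteq> Y" then have "fst ` X \<subseteq> fst ` Y" by (rule image_mono)
        then show thesis using XY by (intro that[of Y]) auto
      next
        assume "Y \<subseteq> X" then have "fst ` Y \<subseteq> fst ` X" by (rule image_mono)
        then show thesis using XY by (intro that[of X]) auto
      qed
      obtain t where "Z = gr (fst ` Z) t" "sec (fst ` Z) t" using secX[OF Z(1)] by blast
      then show ?thesis using Z by (intro exI[of _ Z] exI[of _ t]) simp
    qed
    have "sec N s"
      unfolding sec_def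
    proof (intro conjI ballI)
      show "s \<in> module_hom R (submod M N) ?F"
      proof (rule module_homI)
        fix x y assume "x \<in> carrier (submod M N)" "y \<in> carrier (submod M N)"
        then have xN: "x \<in> N" and yN: "y \<in> N" by simp_all
        obtain X t where t: "X \<in> \<C>" "X = gr (fst ` X) t" "sec (fst ` X) t" "x \<in> fst ` X" "y \<in> fst ` X"
          using pair[OF xN yN] by (elim exE conjE) (rule that)
        then have h: "t \<in> module_hom R (submod M (fst ` X)) ?F" and "fst ` X \<in> \<F>" by (auto simp: sec_def)
        then have "x \<oplus>\<^bsub>M\<^esub> y \<in> fst ` X" using M.subD(4)[OF sub t(4,5)] by blast
        then show "s (x \<oplus>\<^bsub>submod M N\<^esub> y) = s x \<oplus>\<^bsub>?F\<^esub> s y"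
          using module_homD(2)[OF h] sX[OF t(1,2)] t(4,5) by (simp del: free_module_simps)
        show "s x \<in> carrier ?F" using module_homD(1)[OF h] sX[OF t(1,2)] t(4) by simp
      next
        fix a x assume a: "a \<in> carrier R" and "x \<in> carrier (submod M N)"
        then have xN: "x \<in> N" by simp
        obtain X t where t: "X \<in> \<C>" "X = gr (fst ` X) t" "sec (fst ` X) t" "x \<in> fst ` X"
          using pair[OF xN xN] by (elim exE conjE) (rule that)
        then have h: "t \<in> module_hom R (submod M (fst ` X)) ?F" and "fst ` X \<in> \<F>" by (auto simp: sec_def)
        then have "a \<odot>\<^bsub>M\<^esub> x \<in> fst ` X" using M.subD(5)[OF sub a t(4)] by blast
        then show "s (a \<odot>\<^bsub>submod M N\<^esub> x) = a \<odot>\<^bsub>?F\<^esub> s x"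
          using module_homD(3)[OF h a] sX[OF t(1,2)] t(4) by (simp del: free_module_simps)
      qed
      show "s x = \<zero>\<^bsub>?F\<^esub>" if "x \<in> A" for x
      proof -
        have xN: "x \<in> N" using that \<F>(2)[OF NF] by blast
        obtain X t where t: "X \<in> \<C>" "X = gr (fst ` X) t" "sec (fst ` X) t" "x \<in> fst ` X"
          using pair[OF xN xN] by (elim exE conjE) (rule that)
        then show ?thesis using sX[OF t(1,2,4)] that by (simp add: sec_def)
      qed
      show "x \<ominus>\<^bsub>M\<^esub> e (s x) \<in> A" if xN: "x \<in> N" for x
      proof -
        obtain X t where t: "X \<in> \<C>" "X = gr (fst ` X) t" "sec (fst ` X) t" "x \<in> fst ` X"
          using pair[OF xN xN] by (elim exE conjE) (rule that)
        have "\<forall>y\<in>fst ` X. y \<ominus>\<^bsub>M\<^esub> e (t y) \<in> A" using t(3) unfolding sec_def by blast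
        then show ?thesis using sX[OF t(1,2,4)] t(4) by auto
      qed
    qed (rule NF)
    then show "\<Union>\<C> \<in> \<S>" unfolding un \<S>_def by blast
  qed
  then obtain m where m: "m \<in> \<S>" "\<And>X. X \<in> \<S> \<Longrightarrow> m \<subseteq> X \<Longrightarrow> X = m" by blast
  obtain N s where N: "sec N s" and mN: "m = gr N s" using m(1) unfolding \<S>_def by blast
  have max: "gr N' s' = gr N s" if "sec N' s'" "gr N s \<subseteq> gr N' s'" for N' s'
    using m(2)[of "gr N' s'"] that unfolding \<S>_def mN by blast
  have s: "N \<in> \<F>" "s \<in> module_hom R (submod M N) ?F" "\<And>x. x \<in> A \<Longrightarrow> s x = \<zero>\<^bsub>?F\<^esub>" "\<And>x. x \<in> N \<Longrightarrow> x \<ominus>\<^bsub>M\<^esub> e (s x) \<in> A"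
    using N by (auto simp: sec_def)
  have "N = B"
  proof (rule ccontr)
    assume "N \<noteq> B"
    then obtain N' where N': "N' \<in> \<F>" "N \<subset> N'" "Q N N'" using \<F>(5)[OF s(1)] by blast
    have subN: "submodule N R M" "submodule N' R M" using sub s(1) N'(1) by auto
    interpret SN: lmod R "submod M N" by (rule M.lmod_submod[OF subN(1)])
    interpret SN': lmod R "submod M N'" by (rule M.lmod_submod[OF subN(2)])
    obtain J :: "'m set" where "psplit R M J N N'" using Q[OF N'(3)] by blast
    then obtain t q where t: "t \<in> module_hom R (submod M N') (free_module R J)"
      "q \<in> module_hom R (free_module R J) (submod M N')"
      "\<And>x. x \<in> N \<Longrightarrow> t x = \<zero>\<^bsub>free_module R J\<^esub>" "\<And>x. x \<in> N' \<Longrightarrow> x \<ominus>\<^bsub>M\<^esub> q (t x) \<in> N"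
      by (rule psplitE) (rule that)
    let ?G = "free_module R J"
    interpret G: lmod R ?G by (rule M.free.free_lmod)
    have qN': "q f \<in> N'" "q f \<in> B" if "f \<in> carrier ?G" for f
      using module_homD(1)[OF t(2) that] \<F>(3)[OF N'(1)] by auto
    have tG: "t x \<in> carrier ?G" if "x \<in> N'" for x using module_homD(1)[OF t(1)] that by simp
    \<comment> \<open>The basis vector j of the step goes to the unit vector indexed by
      \<open>q (unit_vec R j)\<close>, which makes e composed with i equal to q.\<close>
    obtain i where i: "i \<in> module_hom R ?G ?F" "\<And>j. j \<in> J \<Longrightarrow> i (unit_vec R j) = unit_vec R (q (unit_vec R j))"
      by (rule M.free.free_hom_exists[OF F.lmod_axioms, of J "\<lambda>j. unit_vec R (q (unit_vec R j))"])
        (simp add: M.free.unit_vec_closed qN'(2), rule that)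
    have ei: "e (i f) = q f" if "f \<in> carrier ?G" for f
    proof (rule M.free.free_hom_eqI[OF module_hom_comp[OF i(1) e(1)] _ S.lmod_axioms _ that])
      show "q \<in> module_hom R ?G (submod M B)"
        by (rule module_homI) (use module_homD[OF t(2)] qN' in simp_all)
      fix j assume "f j \<noteq> \<zero>\<^bsub>R\<^esub>"
      then have "j \<in> J" using that by (simp add: free_module_carrier)
      then show "e (i (unit_vec R j)) = q (unit_vec R j)"
        using i(2) e(2) qN'(2) M.free.unit_vec_closed[of j J] by simp
    qed
    define v where "v x = x \<ominus>\<^bsub>M\<^esub> q (t x)" for x
    have v: "v \<in> module_hom R (submod M N') (submod M N)"
    proof -
      have "(\<lambda>x. x \<ominus>\<^bsub>submod M N'\<^esub> q (t x)) \<in> module_hom R (submod M N') (submod M N')"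
        by (rule hom_diff[OF module_hom_id module_hom_comp[OF t(1,2)] SN'.lmod_axioms SN'.lmod_axioms])
      then have "v \<in> module_hom R (submod M N') (submod M N')"
        by (rule module_hom_cong[OF _ SN'.lmod_axioms]) (simp add: v_def M.minus_submod[OF subN(2)] qN' tG)
      then have "v \<in> module_hom R (submod M N') (submod (submod M N') N)"
        by (rule module_hom_cod) (use t(4) in \<open>auto simp: v_def\<close>)
      then show ?thesis by simp
    qed
    \<comment> \<open>An element x of N' is the sum of \<open>v x\<close>, which lies in N, where s
      is available, and of \<open>q (t x)\<close>, which i lifts.\<close>
    define s' where "s' x = s (v x) \<oplus>\<^bsub>?F\<^esub> i (t x)" for x
    have s': "s' \<in> module_hom R (submod M N') ?F"
      unfolding s'_def by (rule hom_add[OF module_hom_comp[OF v s(2)] module_hom_comp[OF t(1) i(1)] F.lmod_axioms])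
    have ext: "s' x = s x" if "x \<in> N" for x
    proof -
      have x: "x \<in> carrier M" using M.subD(2)[OF subN(1) that] .
      have "v x = x"
        unfolding v_def t(3)[OF that] using hom_props(1)[OF t(2) G.lmod_axioms SN'.lmod_axioms] x
        by (simp add: M.diff_zero)
      moreover have "i (t x) = \<zero>\<^bsub>?F\<^esub>"
        unfolding t(3)[OF that] by (rule hom_props(1)[OF i(1) G.lmod_axioms F.lmod_axioms])
      moreover have "s x \<in> carrier ?F" using module_homD(1)[OF s(2)] that by simp
      ultimately show ?thesis unfolding s'_def by (simp del: free_module_simps)
    qed
    have "sec N' s'"
      unfolding sec_def
    proof (intro conjI ballI)
      show "s' x = \<zero>\<^bsub>?F\<^esub>" if "x \<in> A" for x using ext s(3) that \<F>(2)[OF s(1)] by auto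
      fix x assume x: "x \<in> N'"
      have vx: "v x \<in> N" using t(4)[OF x] by (simp add: v_def)
      have c: "s (v x) \<in> carrier ?F" "i (t x) \<in> carrier ?F"
        using module_homD(1)[OF s(2)] vx module_homD(1)[OF i(1) tG[OF x]] by simp_all
      have "e (s' x) = e (s (v x)) \<oplus>\<^bsub>M\<^esub> q (t x)"
        unfolding s'_def using module_homD(2)[OF e(1) c] ei[OF tG[OF x]] by simp
      moreover have "x = v x \<oplus>\<^bsub>M\<^esub> q (t x)"
        unfolding v_def using M.subD(2)[OF subN(2)] x qN'(1)[OF tG[OF x]]
        by (simp add: a_minus_def M.M.a_assoc M.M.l_neg)
      ultimately have "x \<ominus>\<^bsub>M\<^esub> e (s' x) = v x \<ominus>\<^bsub>M\<^esub> e (s (v x))"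
        using M.diff_cancel_right[of "v x" "e (s (v x))" "q (t x)"] M.subD(2)[OF subN(1) vx]
          M.subD(2)[OF AB(2) eB[OF c(1)]] M.subD(2)[OF subN(2) qN'(1)[OF tG[OF x]]] by simp
      then show "x \<ominus>\<^bsub>M\<^esub> e (s' x) \<in> A" using s(4)[OF vx] by simp
    qed (use N'(1) s' in simp_all)
    moreover have "gr N s \<subseteq> gr N' s'" unfolding gr_def using ext N'(2) by auto
    ultimately have "gr N' s' = gr N s" by (rule max)
    then have "N' = N" using fst_gr by metis
    then show False using N'(2) by blast
  qed
  then show ?thesis
    using s e(1) by (intro psplitI[of s _ _ _ _ e]) auto
qed

section \<open>Kaplansky's decomposition of projective modules\<close>

abbreviation cp_projectives :: "'v::zfc_universe ring \<Rightarrow> ('v, 'v) module set" where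
  "cp_projectives R \<equiv> {N. countably_presented R N \<and> projective R N}"

lemma zero_hom: "lmod R N \<Longrightarrow> (\<lambda>_. \<zero>\<^bsub>N\<^esub>) \<in> module_hom R M N"
proof -
  assume "lmod R N"
  then interpret N: lmod R N .
  show ?thesis by (rule module_homI) (simp_all add: N.smult_r_null)
qed

lemma free_module_mono: "T \<subseteq> J \<Longrightarrow> f \<in> carrier (free_module R T) \<Longrightarrow> f \<in> carrier (free_module R J)"
  by (auto simp: free_module_carrier)

lemma (in plain_ring) free_module_submodule:
  assumes "T \<subseteq> J"
  shows "submodule (carrier (free_module R T)) R (free_module R J)"
proof -
  interpret F: lmod R "free_module R J" by (rule free_lmod)
  interpret T: lmod R "free_module R T" by (rule free_lmod)
  show ?thesis
  proof (rule F.subI)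
    show "carrier (free_module R T) \<subseteq> carrier (free_module R J)" using free_module_mono[OF assms] by blast
    show "\<zero>\<^bsub>free_module R J\<^esub> \<in> carrier (free_module R T)" using T.M.zero_closed by simp
    show "f \<oplus>\<^bsub>free_module R J\<^esub> g \<in> carrier (free_module R T)"
      if "f \<in> carrier (free_module R T)" "g \<in> carrier (free_module R T)" for f g
      using free_add_closed[OF that] by simp
    show "a \<odot>\<^bsub>free_module R J\<^esub> f \<in> carrier (free_module R T)"
      if "a \<in> carrier R" "f \<in> carrier (free_module R T)" for a f
      using free_smult_closed[OF that] by simp
  qed
qed

text \<open>Kaplansky: the submodules \<open>N\<close> containing every basis image that occurs in the coordinates
  of their elements form a tower with countably generated projective steps.\<close>

lemma psplit_imp_Filt:
  fixes M :: "('v::zfc_universe, 'v) module"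
  assumes rM: "rmodule R M" and AB: "submodule A R M" "submodule B R M" "A \<subseteq> B"
    and ps: "psplit R M J A B"
  shows "Filt (quo_class R (cp_projectives R) M) A B"
proof -
  interpret M: lmod R M using rM by (rule rmodule_lmod)
  interpret S: lmod R "submod M B" by (rule M.lmod_submod[OF AB(2)])
  let ?F = "free_module R J"
  interpret F: lmod R ?F by (rule M.free.free_lmod)
  obtain s p where sp: "s \<in> module_hom R (submod M B) ?F" "p \<in> module_hom R ?F (submod M B)"
    "\<And>x. x \<in> A \<Longrightarrow> s x = \<zero>\<^bsub>?F\<^esub>" "\<And>x. x \<in> B \<Longrightarrow> x \<ominus>\<^bsub>M\<^esub> p (s x) \<in> A"
    using ps by (rule psplitE) (rule that)
  have pB: "p f \<in> B" if "f \<in> carrier ?F" for f using module_homD(1)[OF sp(2) that] by simp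
  have sF: "s x \<in> carrier ?F" if "x \<in> B" for x using module_homD(1)[OF sp(1)] that by simp
  have Bc: "x \<in> carrier M" if "x \<in> B" for x using M.subD(2)[OF AB(2) that] .
  let ?e = "unit_vec R"
  have eF: "?e j \<in> carrier ?F" if "j \<in> J" for j by (rule M.free.unit_vec_closed[OF that])
  define \<F> where "\<F> = {N. submodule N R M \<and> A \<subseteq> N \<and> N \<subseteq> B \<and> (\<forall>x\<in>N. \<forall>j. s x j \<noteq> \<zero>\<^bsub>R\<^esub> \<longrightarrow> p (?e j) \<in> N)}"
  show ?thesis
  proof (rule FiltI[of _ \<F>])
    show "A \<in> \<F>" unfolding \<F>_def using AB sp(3) by simp
    show "A \<subseteq> N" "N \<subseteq> B" if "N \<in> \<F>" for N using that by (simp_all add: \<F>_def)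
  next
    fix \<G> assume \<G>: "\<G> \<subseteq> \<F>" "\<G> \<noteq> {}" "chain\<^sub>\<subseteq> \<G>"
    have G: "submodule N R M" "A \<subseteq> N" "N \<subseteq> B" "\<And>x j. x \<in> N \<Longrightarrow> s x j \<noteq> \<zero>\<^bsub>R\<^esub> \<Longrightarrow> p (?e j) \<in> N"
      if "N \<in> \<G>" for N
      using that \<G>(1) unfolding \<F>_def by auto
    have "submodule (\<Union>\<G>) R M" by (rule M.sub_Union[OF \<G>(2) G(1) \<G>(3)])
    moreover have "A \<subseteq> \<Union>\<G>" using \<G>(2) G(2) by blast
    moreover have "\<Union>\<G> \<subseteq> B" using G(3) by blast
    moreover have "p (?e j) \<in> \<Union>\<G>" if "x \<in> \<Union>\<G>" "s x j \<noteq> \<zero>\<^bsub>R\<^esub>" for x j using that G(4) by blast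
    ultimately show "\<Union>\<G> \<in> \<F>" unfolding \<F>_def by blast
  next
    fix N assume NF: "N \<in> \<F>" and NB: "N \<noteq> B"
    then have N: "submodule N R M" "A \<subseteq> N" "N \<subseteq> B" "\<And>x j. x \<in> N \<Longrightarrow> s x j \<noteq> \<zero>\<^bsub>R\<^esub> \<Longrightarrow> p (?e j) \<in> N"
      unfolding \<F>_def by auto
    obtain x where x: "x \<in> B" "x \<notin> N" using N(3) NB by blast
    \<comment> \<open>The support of the new element x is closed under passing from j to the
      coordinates of \<open>p (?e j)\<close>. The result T is countable, and s p maps the free
      module on T into itself.\<close>
    define c where "c j = {i. s (p (?e j)) i \<noteq> \<zero>\<^bsub>R\<^esub>}" for j
    have c: "countable (c j) \<and> c j \<subseteq> J" if "j \<in> J" for j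
      using sF[OF pB[OF eF[OF that]]] by (auto simp: c_def free_module_carrier countable_finite)
    have X: "countable {i. s x i \<noteq> \<zero>\<^bsub>R\<^esub>}" "{i. s x i \<noteq> \<zero>\<^bsub>R\<^esub>} \<subseteq> J"
      using sF[OF x(1)] by (auto simp: free_module_carrier countable_finite)
    obtain T where T: "countable T" "{i. s x i \<noteq> \<zero>\<^bsub>R\<^esub>} \<subseteq> T" "T \<subseteq> J" "\<And>j. j \<in> T \<Longrightarrow> c j \<subseteq> T"
      by (rule countable_closure[OF c X]) (assumption, rule that)
    let ?T = "free_module R T"
    have Tsub: "submodule (carrier ?T) R ?F" by (rule M.free.free_module_submodule[OF T(3)])
    have TF: "f \<in> carrier ?F" if "f \<in> carrier ?T" for f using free_module_mono[OF T(3) that] .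
    have spT: "s (p f) \<in> carrier ?T" if f: "f \<in> carrier ?T" for f
    proof -
      have "f \<in> {f \<in> carrier ?F. s (p f) \<in> carrier ?T}"
      proof (rule M.free.free_mem_submodule[OF _ TF[OF f]])
        show "submodule {f \<in> carrier ?F. s (p f) \<in> carrier ?T} R ?F"
          by (rule hom_ker_sub[OF module_hom_comp[OF sp(2,1)] F.lmod_axioms F.lmod_axioms Tsub])
        fix j assume "f j \<noteq> \<zero>\<^bsub>R\<^esub>"
        then have j: "j \<in> T" using f by (simp add: free_module_carrier)
        then have jJ: "j \<in> J" using T(3) by blast
        have "s (p (?e j)) \<in> carrier ?T"
          using T(4)[OF j] sF[OF pB[OF eF[OF jJ]]] by (auto simp: c_def free_module_carrier)
        then show "?e j \<in> {f \<in> carrier ?F. s (p f) \<in> carrier ?T}" using eF[OF jJ] by blast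
      qed
      then show ?thesis by blast
    qed
    define P where "P = p ` carrier ?T"
    have PB: "P \<subseteq> B" unfolding P_def using pB TF by blast
    have P: "submodule P R M"
      using hom_image_sub[OF sp(2) F.lmod_axioms S.lmod_axioms Tsub] M.sub_submod[OF AB(2)]
      unfolding P_def by blast
    define N' where "N' = M.msum N P"
    have N's: "submodule N' R M" unfolding N'_def by (rule M.msum_sub[OF N(1) P])
    have NN': "N \<subseteq> N'" "P \<subseteq> N'" unfolding N'_def by (rule M.msum_upper[OF N(1) P])+
    have N'B: "N' \<subseteq> B" unfolding N'_def by (rule M.msum_least[OF AB(2) N(3) PB])
    have sxT: "s x \<in> carrier ?T" using sF[OF x(1)] T(2) by (auto simp: free_module_carrier)
    have "x \<in> N'"
    proof -
      have "p (s x) \<in> P" unfolding P_def using sxT by blast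
      moreover have "x = (x \<ominus>\<^bsub>M\<^esub> p (s x)) \<oplus>\<^bsub>M\<^esub> p (s x)"
        using Bc[OF x(1)] Bc[OF pB[OF sF[OF x(1)]]] by (simp add: a_minus_def M.M.a_assoc M.M.l_neg)
      ultimately show ?thesis unfolding N'_def M.msum_def using sp(4)[OF x(1)] N(2) by blast
    qed
    then have strict: "N \<subset> N'" using NN' x(2) by blast
    \<comment> \<open>A coordinate of n + p f occurs in n, whose basis images lie in N, or in
      \<open>s (p f)\<close>, which is supported on T. Both the membership of N' in the family and
      the splitting of N' over N rest on this.\<close>
    have supp: "p (?e j) \<in> N \<or> j \<in> T" if "y \<in> N'" "s y j \<noteq> \<zero>\<^bsub>R\<^esub>" for y j
    proof (rule ccontr)
      assume neg: "\<not> (p (?e j) \<in> N \<or> j \<in> T)"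
      obtain n f where y: "y = n \<oplus>\<^bsub>M\<^esub> p f" "n \<in> N" "f \<in> carrier ?T"
        using \<open>y \<in> N'\<close> unfolding N'_def M.msum_def P_def by blast
      have "s n j = \<zero>\<^bsub>R\<^esub>" using neg N(4)[OF y(2)] by blast
      moreover have "s (p f) j = \<zero>\<^bsub>R\<^esub>" using neg spT[OF y(3)] by (auto simp: free_module_carrier)
      moreover have "s y = s n \<oplus>\<^bsub>?F\<^esub> s (p f)"
        unfolding y(1) using module_homD(2)[OF sp(1), of n "p f"] y(2) N(3) pB[OF TF[OF y(3)]] by auto
      ultimately show False using that(2) by simp
    qed
    have eP: "p (?e j) \<in> P" if "j \<in> T" for j unfolding P_def using M.free.unit_vec_closed[OF that] by blast
    have "N' \<in> \<F>"
      unfolding \<F>_def using N's N(2) NN' N'B supp eP by blast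
    moreover have "quo_class R (cp_projectives R) M N N'"
    proof -
      \<comment> \<open>Basis vectors whose image lies in N already are dropped: they are the only
        ones occurring in s y for y in N, so the projection r onto the remaining ones makes the new
        section vanish on N.\<close>
      define J1 where "J1 = T - {j. p (?e j) \<in> N}"
      let ?J = "free_module R J1"
      have J1: "J1 \<subseteq> T" "J1 \<subseteq> J" "countable J1" using T(1,3) by (auto simp: J1_def)
      interpret J1: lmod R ?J by (rule M.free.free_lmod)
      interpret N': lmod R "submod M N'" by (rule M.lmod_submod[OF N's])
      obtain r where r: "r \<in> module_hom R ?F ?J"
        "\<And>j. j \<in> J \<Longrightarrow> r (?e j) = (if j \<in> J1 then ?e j else \<zero>\<^bsub>?J\<^esub>)"
        by (rule M.free.free_hom_exists[OF J1.lmod_axioms, of J "\<lambda>j. if j \<in> J1 then ?e j else \<zero>\<^bsub>?J\<^esub>"])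
          (use M.free.unit_vec_closed[of _ J1] J1.M.zero_closed in \<open>simp del: free_module_simps\<close>, rule that)
      have JF: "f \<in> carrier ?F" if "f \<in> carrier ?J" for f using free_module_mono[OF J1(2) that] .
      have pN': "p f \<in> N'" if "f \<in> carrier ?J" for f
        using free_module_mono[OF J1(1) that] NN'(2) unfolding P_def by blast
      have p1: "p \<in> module_hom R ?J (submod M N')"
        by (rule module_homI) (use module_homD[OF sp(2)] JF pN' in auto)
      have s1: "s \<in> module_hom R (submod M N') ?F" by (rule module_hom_restrict_dom[OF sp(1) N'B])
      have "psplit R M J1 N N'"
      proof (rule psplitI[OF module_hom_comp[OF s1 r(1)] p1])
        fix y assume y: "y \<in> N"
        have yB: "y \<in> B" using y N(3) by blast
        show "r (s y) = \<zero>\<^bsub>?J\<^esub>"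
        proof (rule M.free.free_hom_eqI[OF r(1) zero_hom[OF J1.lmod_axioms] J1.lmod_axioms _ sF[OF yB]])
          fix j assume j: "s y j \<noteq> \<zero>\<^bsub>R\<^esub>"
          then have "j \<in> J" using sF[OF yB] by (simp add: free_module_carrier)
          then show "r (?e j) = \<zero>\<^bsub>?J\<^esub>" using r(2) N(4)[OF y j] by (simp add: J1_def)
        qed
      next
        fix y assume y: "y \<in> N'"
        have yB: "y \<in> B" using y N'B by blast
        let ?d = "\<lambda>f. p f \<ominus>\<^bsub>submod M B\<^esub> p (r f)"
        have pr: "(\<lambda>f. p (r f)) \<in> module_hom R ?F (submod M B)"
          by (rule module_homI) (use module_homD[OF module_hom_comp[OF r(1) p1]] N'B in auto)
        have d: "?d \<in> module_hom R ?F (submod M B)"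
          by (rule hom_diff[OF sp(2) pr S.lmod_axioms F.lmod_axioms])
        have NS: "submodule N R (submod M B)" using M.sub_submod[OF AB(2)] N(1,3) by blast
        have prB: "p (r f) \<in> B" if "f \<in> carrier ?F" for f using module_homD(1)[OF pr that] by simp
        have "s y \<in> {f \<in> carrier ?F. ?d f \<in> N}"
        proof (rule M.free.free_mem_submodule[OF hom_ker_sub[OF d F.lmod_axioms S.lmod_axioms NS] sF[OF yB]])
          fix j assume j: "s y j \<noteq> \<zero>\<^bsub>R\<^esub>"
          then have jJ: "j \<in> J" using sF[OF yB] by (simp add: free_module_carrier)
          have "?d (?e j) \<in> N"
          proof (cases "j \<in> J1")
            case True
            then show ?thesis
              using r(2)[OF jJ] S.diff_self[of "p (?e j)"] pB[OF eF[OF jJ]] M.subD(3)[OF N(1)] by simp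
          next
            case False
            then have pe: "p (?e j) \<in> N" using supp[OF y j] by (auto simp: J1_def)
            have "p (r (?e j)) = \<zero>\<^bsub>M\<^esub>"
              using r(2)[OF jJ] False hom_props(1)[OF p1 J1.lmod_axioms N'.lmod_axioms] by simp
            then show ?thesis
              using S.diff_zero[of "p (?e j)"] pB[OF eF[OF jJ]] pe by simp
          qed
          then show "?e j \<in> {f \<in> carrier ?F. ?d f \<in> N}" using eF[OF jJ] by simp
        qed
        then have "p (s y) \<ominus>\<^bsub>M\<^esub> p (r (s y)) \<in> N"
          using M.minus_submod[OF AB(2) pB[OF sF[OF yB]] prB[OF sF[OF yB]]] by simp
        moreover have "y \<ominus>\<^bsub>M\<^esub> p (s y) \<in> N" using sp(4)[OF yB] N(2) by blast
        ultimately have "(y \<ominus>\<^bsub>M\<^esub> p (s y)) \<oplus>\<^bsub>M\<^esub> (p (s y) \<ominus>\<^bsub>M\<^esub> p (r (s y))) \<in> N"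
          by (rule M.subD(4)[OF N(1), rotated])
        moreover have "(y \<ominus>\<^bsub>M\<^esub> p (s y)) \<oplus>\<^bsub>M\<^esub> (p (s y) \<ominus>\<^bsub>M\<^esub> p (r (s y))) = y \<ominus>\<^bsub>M\<^esub> p (r (s y))"
          using Bc[OF yB] Bc[OF pB[OF sF[OF yB]]] Bc[OF prB[OF sF[OF yB]]]
          by (simp add: a_minus_def M.M.a_assoc M.M.r_neg1)
        ultimately show "y \<ominus>\<^bsub>M\<^esub> p (r (s y)) \<in> N" by simp
      qed
      moreover obtain K :: "('v, 'v) module" where K: "rmodule R K" "quo R M N N' K"
        by (rule exists_quo[OF rM N(1) N's NN'(1)]) (rule that)
      ultimately have "K \<in> cp_projectives R"
        using psplit_imp_projective[OF M.lmod_axioms N(1) N's NN'(1) K]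
          psplit_imp_countably_presented[OF M.lmod_axioms N(1) N's NN'(1) rmodule_lmod[OF K(1)] K(2) _ J1(3)]
        by simp
      then show ?thesis unfolding quo_class_def using N(1) N's NN'(1) K(2) by blast
    qed
    ultimately show "\<exists>N'\<in>\<F>. N \<subset> N' \<and> quo_class R (cp_projectives R) M N N'" using strict by blast
  qed
qed

section \<open>Projective filtrations over hereditary rings\<close>

lemma Filt_projective_imp_psplit:
  fixes M :: "('v::zfc_universe, 'v) module"
  assumes R: "small (carrier R)" and M: "lmod R M" and AB: "submodule A R M" "submodule B R M"
    and filt: "Filt (quo_class R \<C> M) A B" and \<C>: "\<And>K. K \<in> \<C> \<Longrightarrow> projective R K"
  shows "psplit R M B A B"
proof (rule Filt_imp_psplit[OF M AB filt])
  fix N N' assume "quo_class R \<C> M N N'"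
  then obtain K where K: "K \<in> \<C>" "quo R M N N' K" and N: "submodule N R M" "submodule N' R M" "N \<subseteq> N'"
    unfolding quo_class_def by blast
  show "submodule N R M \<and> submodule N' R M \<and> (\<exists>J :: 'v set. psplit R M J N N')"
    using projective_imp_psplit[OF R M N \<C>[OF K(1)] K(2)] N by blast
qed

text \<open>B / A is represented by a projective K in the universe, and B' / A by the image of B' in
  K, to which \<open>hereditary_ring\<close> applies.\<close>

lemma psplit_hereditary:
  fixes M :: "('v::zfc_universe, 'v) module"
  assumes R: "small (carrier R)" and her: "hereditary_ring R" and rM: "rmodule R M"
    and AB: "submodule A R M" "submodule B R M" "A \<subseteq> B" and B': "submodule B' R M" "A \<subseteq> B'" "B' \<subseteq> B"
    and ps: "psplit R M J A B"
  shows "\<exists>J' :: 'v set. psplit R M J' A B'"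
proof -
  interpret M: lmod R M using rM by (rule rmodule_lmod)
  interpret S: lmod R "submod M B" by (rule M.lmod_submod[OF AB(2)])
  obtain K :: "('v, 'v) module" where K: "rmodule R K" "quo R M A B K"
    by (rule exists_quo[OF rM AB]) (rule that)
  interpret K: lmod R K using K(1) by (rule rmodule_lmod)
  obtain \<theta> where \<theta>: "\<theta> \<in> module_hom R (submod M B) K" "\<theta> ` B = carrier K"
    "\<And>x. x \<in> B \<Longrightarrow> \<theta> x = \<zero>\<^bsub>K\<^esub> \<longleftrightarrow> x \<in> A" using K(2) by (rule quoE) (rule that)
  have "projective R K" by (rule psplit_imp_projective[OF M.lmod_axioms AB K ps])
  moreover have im: "submodule (\<theta> ` B') R K"
    by (rule hom_image_sub[OF \<theta>(1) S.lmod_axioms K.lmod_axioms]) (use M.sub_submod[OF AB(2)] B' in blast)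
  ultimately have "projective R (submod K (\<theta> ` B'))" using her unfolding hereditary_ring_def by blast
  moreover have "quo R M A B' (submod K (\<theta> ` B'))"
  proof (rule quoI)
    have "\<theta> \<in> module_hom R (submod M B') K" by (rule module_hom_restrict_dom[OF \<theta>(1) B'(3)])
    then show "\<theta> \<in> module_hom R (submod M B') (submod K (\<theta> ` B'))"
      by (rule module_hom_cod) simp
    show "\<theta> ` B' = carrier (submod K (\<theta> ` B'))" by simp
    show "\<theta> x = \<zero>\<^bsub>submod K (\<theta> ` B')\<^esub> \<longleftrightarrow> x \<in> A" if "x \<in> B'" for x using \<theta>(3) that B'(3) by auto
  qed
  ultimately show ?thesis
    using projective_imp_psplit[OF R M.lmod_axioms AB(1) B'(1,2)] by blast
qed

text \<open>The section s restricts to U, but p need not map into U; so each basis vector is sent to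
  an element of U congruent to its image modulo Z, and the error stays in Z.\<close>

lemma psplit_second_iso:
  assumes M: "lmod R M" and U: "submodule U R M" and Z: "submodule Z R M"
    and ps: "psplit R M J Z (lmod.msum M U Z)"
  shows "psplit R M J (U \<inter> Z) U"
proof -
  interpret M: lmod R M by (rule M)
  let ?B = "M.msum U Z" and ?F = "free_module R J"
  have B: "submodule ?B R M" by (rule M.msum_sub[OF U Z])
  have UB: "U \<subseteq> ?B" by (rule M.msum_upper(1)[OF U Z])
  have ZB: "Z \<subseteq> ?B" by (rule M.msum_upper(2)[OF U Z])
  interpret S: lmod R "submod M ?B" by (rule M.lmod_submod[OF B])
  interpret SU: lmod R "submod M U" by (rule M.lmod_submod[OF U])
  interpret F: lmod R ?F by (rule M.free.free_lmod)
  obtain s p where sp: "s \<in> module_hom R (submod M ?B) ?F" "p \<in> module_hom R ?F (submod M ?B)"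
    "\<And>x. x \<in> Z \<Longrightarrow> s x = \<zero>\<^bsub>?F\<^esub>" "\<And>x. x \<in> ?B \<Longrightarrow> x \<ominus>\<^bsub>M\<^esub> p (s x) \<in> Z"
    using ps by (rule psplitE) (rule that)
  have pB: "p f \<in> ?B" if "f \<in> carrier ?F" for f using module_homD(1)[OF sp(2) that] by simp
  have sF: "s x \<in> carrier ?F" if "x \<in> ?B" for x using module_homD(1)[OF sp(1)] that by simp
  have "\<exists>u\<in>U. p (unit_vec R j) \<ominus>\<^bsub>M\<^esub> u \<in> Z" if j: "j \<in> J" for j
  proof -
    obtain u z where uz: "p (unit_vec R j) = u \<oplus>\<^bsub>M\<^esub> z" "u \<in> U" "z \<in> Z"
      using pB[OF M.free.unit_vec_closed[OF j]] unfolding M.msum_def by blast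
    then have "p (unit_vec R j) \<ominus>\<^bsub>M\<^esub> u = z"
      using M.subD(2)[OF U uz(2)] M.subD(2)[OF Z uz(3)]
      by (simp add: a_minus_def M.M.a_comm[of u z] M.M.a_assoc M.M.r_neg)
    then show ?thesis using uz by blast
  qed
  then obtain u where u: "\<And>j. j \<in> J \<Longrightarrow> u j \<in> U" "\<And>j. j \<in> J \<Longrightarrow> p (unit_vec R j) \<ominus>\<^bsub>M\<^esub> u j \<in> Z" by metis
  obtain q where q: "q \<in> module_hom R ?F (submod M U)" "\<And>j. j \<in> J \<Longrightarrow> q (unit_vec R j) = u j"
    by (rule M.free.free_hom_exists[OF SU.lmod_axioms, of J u]) (simp add: u(1), rule that)
  have qU: "q f \<in> U" if "f \<in> carrier ?F" for f using module_homD(1)[OF q(1) that] by simp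
  have q': "q \<in> module_hom R ?F (submod M ?B)"
    by (rule module_homI) (use module_homD[OF q(1)] UB in auto)
  have d: "(\<lambda>f. p f \<ominus>\<^bsub>submod M ?B\<^esub> q f) \<in> module_hom R ?F (submod M ?B)"
    by (rule hom_diff[OF sp(2) q' S.lmod_axioms F.lmod_axioms])
  have ZS: "submodule Z R (submod M ?B)" using M.sub_submod[OF B] Z ZB by blast
  have diff: "p f \<ominus>\<^bsub>M\<^esub> q f \<in> Z" if f: "f \<in> carrier ?F" for f
  proof -
    have eq: "p f \<ominus>\<^bsub>submod M ?B\<^esub> q f = p f \<ominus>\<^bsub>M\<^esub> q f" if "f \<in> carrier ?F" for f
      by (rule M.minus_submod[OF B pB[OF that]]) (use qU[OF that] UB in blast)
    have "f \<in> {f \<in> carrier ?F. p f \<ominus>\<^bsub>submod M ?B\<^esub> q f \<in> Z}"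
    proof (rule M.free.free_mem_submodule[OF hom_ker_sub[OF d F.lmod_axioms S.lmod_axioms ZS] f])
      fix j assume "f j \<noteq> \<zero>\<^bsub>R\<^esub>"
      then have "j \<in> J" using f by (simp add: free_module_carrier)
      then show "unit_vec R j \<in> {f \<in> carrier ?F. p f \<ominus>\<^bsub>submod M ?B\<^esub> q f \<in> Z}"
        using u(2) q(2) eq[OF M.free.unit_vec_closed] M.free.unit_vec_closed[of j J] by simp
    qed
    then show ?thesis using eq[OF f] by simp
  qed
  show ?thesis
  proof (rule psplitI[OF module_hom_restrict_dom[OF sp(1) UB] q(1)])
    show "s x = \<zero>\<^bsub>?F\<^esub>" if "x \<in> U \<inter> Z" for x using sp(3) that by blast
    fix x assume x: "x \<in> U"
    then have xB: "x \<in> ?B" using UB by blast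
    have "(x \<ominus>\<^bsub>M\<^esub> p (s x)) \<oplus>\<^bsub>M\<^esub> (p (s x) \<ominus>\<^bsub>M\<^esub> q (s x)) \<in> Z"
      by (rule M.subD(4)[OF Z sp(4)[OF xB] diff[OF sF[OF xB]]])
    moreover have "(x \<ominus>\<^bsub>M\<^esub> p (s x)) \<oplus>\<^bsub>M\<^esub> (p (s x) \<ominus>\<^bsub>M\<^esub> q (s x)) = x \<ominus>\<^bsub>M\<^esub> q (s x)"
      using M.subD(2)[OF U x] M.subD(2)[OF B pB[OF sF[OF xB]]] M.subD(2)[OF U qU[OF sF[OF xB]]]
      by (simp add: a_minus_def M.M.a_assoc M.M.r_neg1)
    ultimately show "x \<ominus>\<^bsub>M\<^esub> q (s x) \<in> U \<inter> Z" using M.subD(7)[OF U x qU[OF sF[OF xB]]] by simp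
  qed
qed

text \<open>U \<inter> Z is a submodule of the projective Z, and U / (U \<inter> Z) \<cong> (U + Z)
  / Z is a submodule of the projective quotient by Z.\<close>

lemma hereditary_imp_quotient_hereditary:
  fixes R :: "'v::zfc_universe ring"
  assumes R: "small (carrier R)" and her: "hereditary_ring R"
  shows "quotient_hereditary R (cp_projectives R)"
  unfolding quotient_hereditary_def
proof (intro allI impI)
  fix M :: "('v, 'v) module" and Z U
  assume *: "rmodule R M \<and> submodule Z R M \<and> filtered R (cp_projectives R) (submod M Z) \<and>
    filtered R (cp_projectives R) (quot_module M Z)" and U: "submodule U R M"
  then have M: "rmodule R M" and Z: "submodule Z R M" by blast+
  interpret M: lmod R M using M by (rule rmodule_lmod)
  have \<C>: "left_module R K" if "K \<in> cp_projectives R" for K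
    using that by (simp add: projective_def rmodule_def)
  have \<C>': "projective R K" if "K \<in> cp_projectives R" for K using that by simp
  note Zc = M.subD(1)[OF Z] and c = M.sub_carrier
  have UZ: "submodule (U \<inter> Z) R M" by (rule M.sub_Int[OF U Z])
  have "Filt (quo_class R (cp_projectives R) M) {\<zero>\<^bsub>M\<^esub>} Z"
    using filtered_submod[OF M Z \<C>] * by blast
  then have "psplit R M Z {\<zero>\<^bsub>M\<^esub>} Z"
    by (rule Filt_projective_imp_psplit[OF R M.lmod_axioms M.sub_zero Z _ \<C>'])
  then have "\<exists>J :: 'v set. psplit R M J {\<zero>\<^bsub>M\<^esub>} (U \<inter> Z)"
    by (rule psplit_hereditary[OF R her M M.sub_zero Z _ UZ, rotated 3]) (use M.subD(3)[OF Z] M.subD(3)[OF UZ] in auto)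
  then obtain J :: "'v set" where "psplit R M J {\<zero>\<^bsub>M\<^esub>} (U \<inter> Z)" by blast
  then have "Filt (quo_class R (cp_projectives R) M) {\<zero>\<^bsub>M\<^esub>} (U \<inter> Z)"
    by (rule psplit_imp_Filt[OF M M.sub_zero UZ, rotated]) (use M.subD(3)[OF UZ] in auto)
  then have 1: "filtered R (cp_projectives R) (submod M (U \<inter> Z))"
    using filtered_submod[OF M UZ \<C>] by blast
  have "Filt (quo_class R (cp_projectives R) M) Z (carrier M)"
  proof -
    have "filtered R (cp_projectives R) (quot_module (submod M (carrier M)) Z)"
      using * by simp
    then show ?thesis using filtered_quot[OF M Z c Zc \<C>] by blast
  qed
  then have "psplit R M (carrier M) Z (carrier M)"
    by (rule Filt_projective_imp_psplit[OF R M.lmod_axioms Z c _ \<C>'])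
  then have "\<exists>J :: 'v set. psplit R M J Z (M.msum U Z)"
    by (rule psplit_hereditary[OF R her M Z c Zc M.msum_sub[OF U Z] M.msum_upper(2)[OF U Z] M.subD(1)[OF M.msum_sub[OF U Z]]])
  then obtain J :: "'v set" where "psplit R M J Z (M.msum U Z)" by blast
  then have "psplit R M J (U \<inter> Z) U"
    by (rule psplit_second_iso[OF M.lmod_axioms U Z])
  then have "Filt (quo_class R (cp_projectives R) M) (U \<inter> Z) U"
    by (rule psplit_imp_Filt[OF M UZ U Int_lower1])
  then have 2: "filtered R (cp_projectives R) (quot_module (submod M U) (U \<inter> Z))"
    using filtered_quot[OF M UZ U Int_lower1 \<C>] by blast
  show "filtered R (cp_projectives R) (submod M (U \<inter> Z)) \<and>
      filtered R (cp_projectives R) (quot_module (submod M U) (U \<inter> Z))"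
    using 1 2 by blast
qed

section \<open>Free filtrations\<close>

lemma regular_module_simps [simp]:
  "carrier (regular_module R) = carrier R" "zero (regular_module R) = zero R"
  "add (regular_module R) = add R" "smult (regular_module R) = mult R"
  by (simp_all add: regular_module_def)

lemma (in plain_ring) regular_lmod: "lmod R (regular_module R)"
proof -
  have "abelian_group (regular_module R)"
    by (rule abelian_groupI) (auto simp: a_ac intro: l_neg exI[of _ "\<ominus> _"] bexI[of _ "\<ominus> _"])
  then show ?thesis
    unfolding lmod_def
    by (intro left_module.intro ring_axioms left_module_axioms.intro) (auto simp: l_distr r_distr m_assoc)
qed

lemma (in plain_ring) coordinate_hom: "(\<lambda>f. f j) \<in> module_hom R (free_module R J) (regular_module R)"
  by (rule module_homI) (auto simp: free_module_carrier)

lemma (in plain_ring) scalar_unit_vec: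
  "r \<in> carrier R \<Longrightarrow> j \<in> J \<Longrightarrow> (\<lambda>i. r \<otimes> unit_vec R j i) \<in> carrier (free_module R J)"
  by (rule free_smult_closed[OF _ unit_vec_closed])

text \<open>R is free on one generator: the split data are multiplication of the unit vector at 0
  and evaluation at 0.\<close>

lemma regular_module_cp_projective:
  fixes R :: "'v::zfc_universe ring"
  assumes "ring R" "small (carrier R)"
  shows "regular_module R \<in> cp_projectives R" "rmodule R (regular_module R)"
proof -
  interpret plain_ring R using assms(1) by (simp add: plain_ring_def)
  let ?M = "regular_module R" and ?F = "free_module R {0 :: nat}"
  interpret M: lmod R ?M by (rule regular_lmod)
  show r: "rmodule R ?M" using M.left_module_axioms assms(2) by (simp add: rmodule_def)
  note sub = M.sub_zero M.sub_carrier
  have z: "{\<zero>\<^bsub>?M\<^esub>} \<subseteq> carrier ?M" by simp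
  have q: "quo R ?M {\<zero>\<^bsub>?M\<^esub>} (carrier ?M) ?M"
  proof (rule quoI[of "\<lambda>x. x"])
    show "(\<lambda>x. x) \<in> module_hom R (submod ?M (carrier ?M)) ?M"
      unfolding submod_simps(6) by (rule module_hom_id)
  qed auto
  have ps: "psplit R ?M {0 :: nat} {\<zero>\<^bsub>?M\<^esub>} (carrier ?M)"
  proof (rule psplitI[of "\<lambda>r i. r \<otimes>\<^bsub>R\<^esub> unit_vec R 0 i" _ _ _ _ "\<lambda>f. f 0"])
    show "(\<lambda>r i. r \<otimes>\<^bsub>R\<^esub> unit_vec R 0 i) \<in> module_hom R (submod ?M (carrier ?M)) ?F"
    proof (rule module_homI)
      show "(\<lambda>i. x \<otimes>\<^bsub>R\<^esub> unit_vec R 0 i) \<in> carrier ?F" if "x \<in> carrier (submod ?M (carrier ?M))" for x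
        using scalar_unit_vec[of x 0 "{0 :: nat}"] that by simp
    qed (auto simp: l_distr m_assoc unit_vec_def)
    show "(\<lambda>f. f 0) \<in> module_hom R ?F (submod ?M (carrier ?M))"
      unfolding submod_simps(6) by (rule coordinate_hom)
    show "x \<ominus>\<^bsub>?M\<^esub> x \<otimes>\<^bsub>R\<^esub> unit_vec R (0 :: nat) 0 \<in> {\<zero>\<^bsub>?M\<^esub>}" if "x \<in> carrier ?M" for x
      using M.diff_self[OF that] that by (simp add: unit_vec_def)
  qed (auto simp: unit_vec_def)
  show "?M \<in> cp_projectives R"
    using psplit_imp_projective[OF M.lmod_axioms sub z r q ps]
      psplit_imp_countably_presented[OF M.lmod_axioms sub z M.lmod_axioms q ps] by simp
qed

text \<open>The map x - p (s x) sends B into A, and s vanishes on A. It thereby extends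
  homomorphisms from A to B.\<close>

lemma psplit_retraction:
  assumes M: "lmod R M" and AB: "submodule A R M" "submodule B R M" "A \<subseteq> B" and ps: "psplit R M J A B"
  obtains \<rho> where "\<rho> \<in> module_hom R (submod M B) (submod M A)" "\<And>x. x \<in> A \<Longrightarrow> \<rho> x = x"
proof -
  interpret M: lmod R M by (rule M)
  interpret S: lmod R "submod M B" by (rule M.lmod_submod[OF AB(2)])
  interpret F: lmod R "free_module R J" by (rule M.free.free_lmod)
  obtain s p where sp: "s \<in> module_hom R (submod M B) (free_module R J)"
    "p \<in> module_hom R (free_module R J) (submod M B)"
    "\<And>x. x \<in> A \<Longrightarrow> s x = \<zero>\<^bsub>free_module R J\<^esub>" "\<And>x. x \<in> B \<Longrightarrow> x \<ominus>\<^bsub>M\<^esub> p (s x) \<in> A"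
    using ps by (rule psplitE) (rule that)
  have psB: "p (s x) \<in> B" if "x \<in> B" for x
    using module_homD(1)[OF sp(2) module_homD(1)[OF sp(1)]] that by simp
  let ?r = "\<lambda>x. x \<ominus>\<^bsub>submod M B\<^esub> p (s x)"
  have r: "?r x = x \<ominus>\<^bsub>M\<^esub> p (s x)" if "x \<in> B" for x by (rule M.minus_submod[OF AB(2) that psB[OF that]])
  have "?r \<in> module_hom R (submod M B) (submod M B)"
    by (rule hom_diff[OF module_hom_id module_hom_comp[OF sp(1,2)] S.lmod_axioms S.lmod_axioms])
  then have "?r \<in> module_hom R (submod M B) (submod (submod M B) A)"
    by (rule module_hom_cod) (use r sp(4) in auto)
  moreover have "?r x = x" if "x \<in> A" for x
    using sp(3)[OF that] hom_props(1)[OF sp(2) F.lmod_axioms S.lmod_axioms] S.diff_zero[of x] that AB(3) by auto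
  ultimately show thesis using that by simp
qed

text \<open>A first step N with N / A \<cong> R is split off. B over N is filtered by copies of R,
  hence projective, so N is a retract of B and the map from N onto R extends to B.\<close>

lemma Filt_regular_imp_surj:
  fixes M :: "('v::zfc_universe, 'v) module"
  assumes R: "ring R" "small (carrier R)" and M: "lmod R M" and AB: "submodule A R M" "submodule B R M" "A \<noteq> B"
    and filt: "Filt (quo_class R {regular_module R} M) A B"
  obtains \<phi> where "\<phi> \<in> module_hom R (submod M B) (regular_module R)" "\<And>x. x \<in> A \<Longrightarrow> \<phi> x = \<zero>\<^bsub>R\<^esub>"
    "\<phi> ` B = carrier R"
proof -
  obtain N where N: "A \<subset> N" "quo_class R {regular_module R} M A N" "Filt (quo_class R {regular_module R} M) N B"
    by (rule Filt_split[OF filt AB(3)]) (rule that)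
  have Ns: "submodule N R M" and q: "quo R M A N (regular_module R)" using N(2) by (auto simp: quo_class_def)
  have NB: "N \<subseteq> B" by (rule Filt_subset[OF N(3)])
  obtain \<theta> where \<theta>: "\<theta> \<in> module_hom R (submod M N) (regular_module R)" "\<theta> ` N = carrier (regular_module R)"
    "\<And>x. x \<in> N \<Longrightarrow> \<theta> x = \<zero>\<^bsub>regular_module R\<^esub> \<longleftrightarrow> x \<in> A" using q by (rule quoE) (rule that)
  have "psplit R M B N B"
    by (rule Filt_projective_imp_psplit[OF R(2) M Ns AB(2) N(3)])
      (use regular_module_cp_projective[OF R] in simp)
  then obtain \<rho> where \<rho>: "\<rho> \<in> module_hom R (submod M B) (submod M N)" "\<And>x. x \<in> N \<Longrightarrow> \<rho> x = x"
    by (rule psplit_retraction[OF M Ns AB(2) NB]) (rule that)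
  show thesis
  proof (rule that[of "\<lambda>x. \<theta> (\<rho> x)"])
    show "(\<lambda>x. \<theta> (\<rho> x)) \<in> module_hom R (submod M B) (regular_module R)"
      by (rule module_hom_comp[OF \<rho>(1) \<theta>(1)])
    show "\<theta> (\<rho> x) = \<zero>\<^bsub>R\<^esub>" if "x \<in> A" for x using that N(1) \<rho>(2) \<theta>(3) by auto
    show "(\<lambda>x. \<theta> (\<rho> x)) ` B = carrier R"
    proof
      show "(\<lambda>x. \<theta> (\<rho> x)) ` B \<subseteq> carrier R"
        using module_homD(1)[OF \<theta>(1)] module_homD(1)[OF \<rho>(1)] by auto
      show "carrier R \<subseteq> (\<lambda>x. \<theta> (\<rho> x)) ` B"
        using \<theta>(2) \<rho>(2) NB by force
    qed
  qed
qed

text \<open>The free module is filtered by the submodules of vectors with support below n; the n-th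
  coordinate identifies each step with R.\<close>

lemma quo_free_imp_Filt:
  fixes M :: "('v::zfc_universe, 'v) module"
  assumes M: "lmod R M" and AB: "submodule A R M" "submodule B R M" "A \<subseteq> B"
    and q: "quo R M A B (free_module R (UNIV :: nat set))"
  shows "Filt (quo_class R {regular_module R} M) A B"
proof -
  interpret M: lmod R M by (rule M)
  interpret S: lmod R "submod M B" by (rule M.lmod_submod[OF AB(2)])
  let ?F = "free_module R (UNIV :: nat set)"
  interpret F: lmod R ?F by (rule M.free.free_lmod)
  obtain \<theta> where \<theta>: "\<theta> \<in> module_hom R (submod M B) ?F" "\<theta> ` B = carrier ?F"
    "\<And>x. x \<in> B \<Longrightarrow> \<theta> x = \<zero>\<^bsub>?F\<^esub> \<longleftrightarrow> x \<in> A" using q by (rule quoE) (rule that)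
  have \<theta>F: "\<theta> x \<in> carrier ?F" if "x \<in> B" for x using module_homD(1)[OF \<theta>(1)] that by simp
  define N where "N n = {x \<in> B. \<theta> x \<in> carrier (free_module R {..<n})}" for n
  have Nsub: "submodule (N n) R M" for n
    using hom_ker_sub[OF \<theta>(1) S.lmod_axioms F.lmod_axioms M.free.free_module_submodule[of "{..<n}" UNIV]]
      M.sub_submod[OF AB(2)] by (simp add: N_def)
  have N: "x \<in> N n \<longleftrightarrow> x \<in> B \<and> (\<forall>j. \<theta> x j \<noteq> \<zero>\<^bsub>R\<^esub> \<longrightarrow> j < n)" for x n
    using \<theta>F[of x] by (auto simp: N_def free_module_carrier)
  have NS: "N n \<subseteq> N (Suc n)" for n unfolding N by (auto simp: N less_Suc_eq)
  have quo: "quo R M (N n) (N (Suc n)) (regular_module R)" for n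
  proof (rule quoI[of "\<lambda>x. \<theta> x n"])
    have NB: "N (Suc n) \<subseteq> B" by (auto simp: N)
    show "(\<lambda>x. \<theta> x n) \<in> module_hom R (submod M (N (Suc n))) (regular_module R)"
      by (rule module_hom_comp[OF module_hom_restrict_dom[OF \<theta>(1) NB] M.free.coordinate_hom])
    show "(\<lambda>x. \<theta> x n) ` N (Suc n) = carrier (regular_module R)"
    proof
      show "(\<lambda>x. \<theta> x n) ` N (Suc n) \<subseteq> carrier (regular_module R)"
        using \<theta>F NB by (auto simp: free_module_carrier)
      show "carrier (regular_module R) \<subseteq> (\<lambda>x. \<theta> x n) ` N (Suc n)"
      proof
        fix r assume "r \<in> carrier (regular_module R)"
        then have r: "r \<in> carrier R" by simp
        then have "(\<lambda>i. r \<otimes>\<^bsub>R\<^esub> unit_vec R n i) \<in> carrier ?F" by (rule M.free.scalar_unit_vec) simp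
        then obtain x where x: "x \<in> B" "\<theta> x = (\<lambda>i. r \<otimes>\<^bsub>R\<^esub> unit_vec R n i)" using \<theta>(2) by (metis imageE)
        then have "x \<in> N (Suc n)" "\<theta> x n = r" using r by (auto simp: N unit_vec_def split: if_splits)
        then show "r \<in> (\<lambda>x. \<theta> x n) ` N (Suc n)" by blast
      qed
    qed
    show "\<theta> x n = \<zero>\<^bsub>regular_module R\<^esub> \<longleftrightarrow> x \<in> N n" if "x \<in> N (Suc n)" for x
      using that by (auto simp: N less_Suc_eq)
  qed
  have "Filt (quo_class R {regular_module R} M) (N 0) (\<Union>n. N n)"
  proof (rule Filt_nat[of N, OF NS])
    show "Filt (quo_class R {regular_module R} M) (N n) (N (Suc n))" for n
      by (rule Filt_step[OF NS]) (use Nsub NS quo in \<open>simp add: quo_class_def\<close>)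
  qed
  moreover have "N 0 = A" using \<theta>(3) AB(3) by (auto simp: N fun_eq_iff)
  moreover have "(\<Union>n. N n) = B"
  proof
    show "(\<Union>n. N n) \<subseteq> B" by (auto simp: N)
    show "B \<subseteq> (\<Union>n. N n)"
    proof
      fix x assume x: "x \<in> B"
      then have "finite {j. \<theta> x j \<noteq> \<zero>\<^bsub>R\<^esub>}" using \<theta>F by (simp add: free_module_carrier)
      then obtain n where "\<forall>j\<in>{j. \<theta> x j \<noteq> \<zero>\<^bsub>R\<^esub>}. j < n" using finite_nat_set_iff_bounded by blast
      then show "x \<in> (\<Union>n. N n)" using x by (auto simp: N)
    qed
  qed
  ultimately show ?thesis by simp
qed

text \<open>The Eilenberg swindle: \<open>\<Psi> 0, \<Psi> 1, \<dots>\<close> are the coordinates of \<open>B / A = P \<oplus> F \<oplus> F \<oplus> \<dots>\<close>, where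
  \<open>E\<close> is the idempotent of \<open>F\<close> with image \<open>P\<close>, and the regrouping
  \<open>(P \<oplus> ker E) \<oplus> (im E \<oplus> ker E) \<oplus> \<dots>\<close> turns every summand into a copy of \<open>F\<close>.\<close>

lemma swindle:
  fixes M :: "('v::zfc_universe, 'v) module" and R :: "'v ring"
  defines "F \<equiv> free_module R (UNIV :: nat set)"
  assumes M: "lmod R M" and AB: "submodule A R M" "submodule B R M" "A \<subseteq> B"
    and \<Psi>: "\<And>n :: nat. \<Psi> n \<in> module_hom R (submod M B) F"
    and \<xi>: "\<And>n :: nat. \<xi> n \<in> module_hom R F (submod M B)"
    and E: "E \<in> module_hom R F F" "\<And>f. f \<in> carrier F \<Longrightarrow> E (E f) = E f"
    and orth: "\<And>m n f. m \<noteq> n \<Longrightarrow> f \<in> carrier F \<Longrightarrow> \<Psi> m (\<xi> n f) = \<zero>\<^bsub>F\<^esub>"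
      "\<And>n f. f \<in> carrier F \<Longrightarrow> \<Psi> n (\<xi> n (E f)) = E f"
      "\<And>n f. f \<in> carrier F \<Longrightarrow> \<Psi> (Suc n) (\<xi> (Suc n) f) = f"
    and fin: "\<And>x. x \<in> B \<Longrightarrow> \<exists>k. \<forall>m>k. \<Psi> m x = \<zero>\<^bsub>F\<^esub>"
    and ker: "\<And>x. x \<in> B \<Longrightarrow> x \<in> A \<longleftrightarrow> (\<forall>m>0. \<Psi> m x = \<zero>\<^bsub>F\<^esub>) \<and> E (\<Psi> 0 x) = \<zero>\<^bsub>F\<^esub>"
  shows "Filt (quo_class R {regular_module R} M) A B"
proof -
  interpret M: lmod R M by (rule M)
  interpret S: lmod R "submod M B" by (rule M.lmod_submod[OF AB(2)])
  interpret F: lmod R F unfolding F_def by (rule M.free.free_lmod)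
  have \<Psi>F: "\<Psi> n x \<in> carrier F" if "x \<in> B" for n x using module_homD(1)[OF \<Psi>] that by simp
  have EF: "E f \<in> carrier F" if "f \<in> carrier F" for f using module_homD(1)[OF E(1) that] .
  have \<xi>B: "\<xi> n f \<in> B" if "f \<in> carrier F" for n f using module_homD(1)[OF \<xi> that] by simp
  note E0 = hom_props(1)[OF E(1) F.lmod_axioms F.lmod_axioms]
  note Ediff = hom_props(3)[OF E(1) F.lmod_axioms F.lmod_axioms]
  \<comment> \<open>\<open>N k\<close> contains the summands before k in full and, of summand k, the
    part killed by E. So the step from k to k + 1 adds the image of E in summand k and the kernel of
    E in summand k + 1, together a copy of F.\<close>
  define N where "N k = {x \<in> B. (\<forall>m>k. \<Psi> m x = \<zero>\<^bsub>F\<^esub>) \<and> E (\<Psi> k x) = \<zero>\<^bsub>F\<^esub>}" for k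
  have Nsub: "submodule (N k) R M" for k
  proof (rule M.subI)
    show "N k \<subseteq> carrier M" using M.subD(2)[OF AB(2)] by (auto simp: N_def)
    show "\<zero>\<^bsub>M\<^esub> \<in> N k"
      using M.subD(3)[OF AB(2)] hom_props(1)[OF \<Psi> S.lmod_axioms F.lmod_axioms] E0 by (simp add: N_def)
    show "x \<oplus>\<^bsub>M\<^esub> y \<in> N k" if "x \<in> N k" "y \<in> N k" for x y
      using that M.subD(4)[OF AB(2), of x y] module_homD(2)[OF \<Psi>, of x y] \<Psi>F[of x] \<Psi>F[of y] module_homD(2)[OF E(1)]
      by (auto simp: N_def)
    show "a \<odot>\<^bsub>M\<^esub> x \<in> N k" if "a \<in> carrier R" "x \<in> N k" for a x
      using that M.subD(5)[OF AB(2), of a x] module_homD(3)[OF \<Psi>, of a x] \<Psi>F[of x] module_homD(3)[OF E(1)]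
      by (auto simp: N_def F.smult_r_null)
  qed
  have NS: "N k \<subseteq> N (Suc k)" for k using E0 by (auto simp: N_def)
  have step: "quo R M (N k) (N (Suc k)) F" for k
  proof (rule quoI[of "\<lambda>x. E (\<Psi> k x) \<oplus>\<^bsub>F\<^esub> \<Psi> (Suc k) x"])
    have NB: "N (Suc k) \<subseteq> B" by (auto simp: N_def)
    note \<Psi>N = module_hom_restrict_dom[OF \<Psi> NB]
    show "(\<lambda>x. E (\<Psi> k x) \<oplus>\<^bsub>F\<^esub> \<Psi> (Suc k) x) \<in> module_hom R (submod M (N (Suc k))) F"
      by (rule hom_add[OF module_hom_comp[OF \<Psi>N E(1)] \<Psi>N F.lmod_axioms])
    show "(\<lambda>x. E (\<Psi> k x) \<oplus>\<^bsub>F\<^esub> \<Psi> (Suc k) x) ` N (Suc k) = carrier F"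
    proof
      show "(\<lambda>x. E (\<Psi> k x) \<oplus>\<^bsub>F\<^esub> \<Psi> (Suc k) x) ` N (Suc k) \<subseteq> carrier F"
        using \<Psi>F EF NB by auto
      show "carrier F \<subseteq> (\<lambda>x. E (\<Psi> k x) \<oplus>\<^bsub>F\<^esub> \<Psi> (Suc k) x) ` N (Suc k)"
      proof
        fix r assume r: "r \<in> carrier F"
        \<comment> \<open>The preimage of r has \<open>E r\<close> in summand k and the rest in
          summand k + 1. For k = 0 the map \<open>\<xi> k\<close> inverts \<open>\<Psi> k\<close>
          only on the image of E, and only \<open>E r\<close> is placed there.\<close>
        define r' where "r' = r \<ominus>\<^bsub>F\<^esub> E r"
        have r': "r' \<in> carrier F" "E r' = \<zero>\<^bsub>F\<^esub>"
          unfolding r'_def using r EF[OF r] Ediff[OF r EF[OF r]] E(2)[OF r] by (simp_all add: F.diff_self)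
        define x where "x = \<xi> k (E r) \<oplus>\<^bsub>M\<^esub> \<xi> (Suc k) r'"
        have xB: "x \<in> B" unfolding x_def using M.subD(4)[OF AB(2) \<xi>B \<xi>B] EF[OF r] r'(1) by blast
        have \<Psi>x: "\<Psi> m x = \<Psi> m (\<xi> k (E r)) \<oplus>\<^bsub>F\<^esub> \<Psi> m (\<xi> (Suc k) r')" for m
          unfolding x_def using module_homD(2)[OF \<Psi>, of "\<xi> k (E r)" "\<xi> (Suc k) r'"] \<xi>B EF[OF r] r'(1) by simp
        have "\<Psi> k x = E r" unfolding \<Psi>x using orth(1)[of k "Suc k" r'] orth(2)[OF r] r'(1) EF[OF r] by simp
        moreover have "\<Psi> (Suc k) x = r'" unfolding \<Psi>x using orth(1)[of "Suc k" k "E r"] orth(3)[OF r'(1)] r'(1) EF[OF r] by simp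
        moreover have "\<Psi> m x = \<zero>\<^bsub>F\<^esub>" if "m > Suc k" for m
          unfolding \<Psi>x using orth(1)[of m k "E r"] orth(1)[of m "Suc k" r'] that r'(1) EF[OF r] by simp
        ultimately have "x \<in> N (Suc k)" "E (\<Psi> k x) \<oplus>\<^bsub>F\<^esub> \<Psi> (Suc k) x = r"
          using xB r'(2) E(2)[OF r] F.add_diff_cancel[OF r EF[OF r]] by (simp_all add: N_def r'_def)
        then show "r \<in> (\<lambda>x. E (\<Psi> k x) \<oplus>\<^bsub>F\<^esub> \<Psi> (Suc k) x) ` N (Suc k)" by (intro rev_image_eqI[of x]) simp_all
      qed
    qed
    fix x assume x: "x \<in> N (Suc k)"
    then have xB: "x \<in> B" and x0: "E (\<Psi> (Suc k) x) = \<zero>\<^bsub>F\<^esub>" by (simp_all add: N_def)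
    have "x \<in> N k" if eq: "E (\<Psi> k x) \<oplus>\<^bsub>F\<^esub> \<Psi> (Suc k) x = \<zero>\<^bsub>F\<^esub>"
    proof -
      have "E (E (\<Psi> k x) \<oplus>\<^bsub>F\<^esub> \<Psi> (Suc k) x) = E (\<Psi> k x)"
        using module_homD(2)[OF E(1) EF[OF \<Psi>F[OF xB]] \<Psi>F[OF xB]] E(2)[OF \<Psi>F[OF xB]] x0 EF[OF \<Psi>F[OF xB]] by simp
      then have 0: "E (\<Psi> k x) = \<zero>\<^bsub>F\<^esub>" using eq E0 by simp
      then have "\<Psi> (Suc k) x = \<zero>\<^bsub>F\<^esub>" using eq \<Psi>F[OF xB] by simp
      then have "\<Psi> m x = \<zero>\<^bsub>F\<^esub>" if "m > k" for m
        using that x by (cases "m = Suc k") (auto simp: N_def)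
      then show ?thesis using 0 xB by (simp add: N_def)
    qed
    moreover have "E (\<Psi> k x) \<oplus>\<^bsub>F\<^esub> \<Psi> (Suc k) x = \<zero>\<^bsub>F\<^esub>" if "x \<in> N k"
      using that by (simp add: N_def)
    ultimately show "E (\<Psi> k x) \<oplus>\<^bsub>F\<^esub> \<Psi> (Suc k) x = \<zero>\<^bsub>F\<^esub> \<longleftrightarrow> x \<in> N k" by blast
  qed
  have "Filt (quo_class R {regular_module R} M) (N 0) (\<Union>n. N n)"
    by (rule Filt_nat[of N, OF NS quo_free_imp_Filt[OF M Nsub Nsub NS step[unfolded F_def]]])
  moreover have "N 0 = A" using ker AB(3) by (auto simp: N_def)
  moreover have "(\<Union>n. N n) = B"
  proof
    show "(\<Union>n. N n) \<subseteq> B" by (auto simp: N_def)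
    show "B \<subseteq> (\<Union>n. N n)"
    proof
      fix x assume x: "x \<in> B"
      then obtain k where "\<forall>m>k. \<Psi> m x = \<zero>\<^bsub>F\<^esub>" using fin by blast
      then have "x \<in> N (Suc k)" using x E0 by (simp add: N_def)
      then show "x \<in> (\<Union>n. N n)" by blast
    qed
  qed
  ultimately show ?thesis by simp
qed

text \<open>The epimorphism \<Phi> splits, so B / A is the sum of P, the kernel of \<Phi> modulo A,
  and a copy of F. P is a direct summand of F since B / A is, and F is a direct sum of countably
  many copies of itself; these are the data of \<open>swindle\<close>.\<close>

lemma psplit_free_surj_imp_Filt:
  fixes M :: "('v::zfc_universe, 'v) module" and R :: "'v ring"
  defines "F \<equiv> free_module R (UNIV :: nat set)"
  assumes M: "lmod R M" and AB: "submodule A R M" "submodule B R M" "A \<subseteq> B"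
    and ps: "psplit R M (UNIV :: nat set) A B"
    and \<Phi>: "\<Phi> \<in> module_hom R (submod M B) F" "\<Phi> ` B = carrier F" "\<And>x. x \<in> A \<Longrightarrow> \<Phi> x = \<zero>\<^bsub>F\<^esub>"
  shows "Filt (quo_class R {regular_module R} M) A B"
proof -
  interpret M: lmod R M by (rule M)
  interpret S: lmod R "submod M B" by (rule M.lmod_submod[OF AB(2)])
  interpret F: lmod R F unfolding F_def by (rule M.free.free_lmod)
  obtain s p where sp: "s \<in> module_hom R (submod M B) F" "p \<in> module_hom R F (submod M B)"
    "\<And>x. x \<in> A \<Longrightarrow> s x = \<zero>\<^bsub>F\<^esub>" "\<And>x. x \<in> B \<Longrightarrow> x \<ominus>\<^bsub>M\<^esub> p (s x) \<in> A"
    by (rule psplitE[OF ps, folded F_def]) (rule that)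
  have F0: "\<zero>\<^bsub>F\<^esub> = (\<lambda>_. \<zero>\<^bsub>R\<^esub>)" unfolding F_def by simp
  have "\<exists>z\<in>B. \<Phi> z = unit_vec R j" for j
    using \<Phi>(2) M.free.unit_vec_closed[of j UNIV] unfolding F_def by (metis UNIV_I imageE)
  then obtain z where z: "\<And>j. z j \<in> B" "\<And>j. \<Phi> (z j) = unit_vec R j" by metis
  obtain \<zeta> where \<zeta>: "\<zeta> \<in> module_hom R F (submod M B)" "\<And>j. \<zeta> (unit_vec R j) = z j"
    unfolding F_def
    by (rule M.free.free_hom_exists[OF S.lmod_axioms, of UNIV z]) (simp add: z(1), use that in blast)
  have \<Phi>\<zeta>: "\<Phi> (\<zeta> f) = f" if "f \<in> carrier F" for f
    by (rule M.free.free_hom_eqI[OF module_hom_comp[OF \<zeta>(1) \<Phi>(1), unfolded F_def]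
        module_hom_id M.free.free_lmod _ that[unfolded F_def]]) (simp add: \<zeta>(2) z(2))
  have \<Phi>F: "\<Phi> x \<in> carrier F" if "x \<in> B" for x using module_homD(1)[OF \<Phi>(1)] that by simp
  have \<zeta>B: "\<zeta> f \<in> B" if "f \<in> carrier F" for f using module_homD(1)[OF \<zeta>(1) that] by simp
  have pB: "p f \<in> B" if "f \<in> carrier F" for f using module_homD(1)[OF sp(2) that] by simp
  have sF: "s x \<in> carrier F" if "x \<in> B" for x using module_homD(1)[OF sp(1)] that by simp
  note \<Phi>diff = hom_props(3)[OF \<Phi>(1) S.lmod_axioms F.lmod_axioms]
  note \<zeta>0 = hom_props(1)[OF \<zeta>(1) F.lmod_axioms S.lmod_axioms]
  \<comment> \<open>The projection of B onto the kernel of \<Phi> along the section \<zeta>.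
    Composed with it, the splitting s, p of B / A becomes a splitting \<open>s'\<close>,
    \<open>p'\<close> of P.\<close>
  define \<chi> where "\<chi> x = x \<ominus>\<^bsub>submod M B\<^esub> \<zeta> (\<Phi> x)" for x
  have \<chi>: "\<chi> \<in> module_hom R (submod M B) (submod M B)"
    unfolding \<chi>_def by (rule hom_diff[OF module_hom_id module_hom_comp[OF \<Phi>(1) \<zeta>(1)] S.lmod_axioms S.lmod_axioms])
  have \<chi>B: "\<chi> x \<in> B" if "x \<in> B" for x using module_homD(1)[OF \<chi>] that by simp
  have \<chi>id: "\<chi> x = x" if "x \<in> B" "\<Phi> x = \<zero>\<^bsub>F\<^esub>" for x
    unfolding \<chi>_def that(2) using \<zeta>0 S.diff_zero[of x] that(1) by simp
  have \<Phi>\<chi>: "\<Phi> (\<chi> x) = \<zero>\<^bsub>F\<^esub>" if "x \<in> B" for x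
    unfolding \<chi>_def using \<Phi>diff[of x "\<zeta> (\<Phi> x)"] that \<zeta>B \<Phi>F[OF that] \<Phi>\<zeta> by (simp add: F.diff_self)
  have \<chi>\<zeta>: "\<chi> (\<zeta> f) = \<zero>\<^bsub>M\<^esub>" if "f \<in> carrier F" for f
    unfolding \<chi>_def using \<Phi>\<zeta>[OF that] S.diff_self[of "\<zeta> f"] \<zeta>B[OF that] by simp
  define s' where "s' x = s (\<chi> x)" for x
  define p' where "p' f = \<chi> (p f)" for f
  define E where "E f = s' (p' f)" for f
  have s': "s' \<in> module_hom R (submod M B) F" unfolding s'_def by (rule module_hom_comp[OF \<chi> sp(1)])
  have p': "p' \<in> module_hom R F (submod M B)" unfolding p'_def by (rule module_hom_comp[OF sp(2) \<chi>])
  have E: "E \<in> module_hom R F F" unfolding E_def by (rule module_hom_comp[OF p' s'])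
  have p'B: "p' f \<in> B" if "f \<in> carrier F" for f using module_homD(1)[OF p' that] by simp
  have s'F: "s' x \<in> carrier F" if "x \<in> B" for x using module_homD(1)[OF s'] that by simp
  have s'\<zeta>: "s' (\<zeta> f) = \<zero>\<^bsub>F\<^esub>" if "f \<in> carrier F" for f
    unfolding s'_def \<chi>\<zeta>[OF that] using hom_props(1)[OF sp(1) S.lmod_axioms F.lmod_axioms] by simp
  have \<Phi>p': "\<Phi> (p' f) = \<zero>\<^bsub>F\<^esub>" if "f \<in> carrier F" for f
    unfolding p'_def by (rule \<Phi>\<chi>[OF pB[OF that]])
  have near: "\<chi> x \<ominus>\<^bsub>M\<^esub> p' (s' x) \<in> A" if x: "x \<in> B" for x
  proof -
    define y where "y = p (s' x)"
    have y: "y \<in> B" unfolding y_def by (rule pB[OF s'F[OF x]])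
    have d: "\<chi> x \<ominus>\<^bsub>M\<^esub> y \<in> A" unfolding y_def s'_def by (rule sp(4)[OF \<chi>B[OF x]])
    \<comment> \<open>The difference of \<open>\<chi> x\<close> and y lies in A, hence in the kernel
      of \<Phi>, where \<chi> is the identity. So applying \<chi> leaves the difference unchanged,
      but replaces y by \<open>p' (s' x)\<close>.\<close>
    have "\<chi> (\<chi> x \<ominus>\<^bsub>submod M B\<^esub> y) = \<chi> (\<chi> x) \<ominus>\<^bsub>submod M B\<^esub> \<chi> y"
      by (rule hom_props(3)[OF \<chi> S.lmod_axioms S.lmod_axioms]) (use \<chi>B[OF x] y in simp_all)
    moreover have "\<chi> (\<chi> x) = \<chi> x" by (rule \<chi>id[OF \<chi>B[OF x] \<Phi>\<chi>[OF x]])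
    moreover have "\<chi> (\<chi> x \<ominus>\<^bsub>M\<^esub> y) = \<chi> x \<ominus>\<^bsub>M\<^esub> y"
      by (rule \<chi>id) (use d AB(3) \<Phi>(3) in auto)
    ultimately have "\<chi> x \<ominus>\<^bsub>M\<^esub> y = \<chi> x \<ominus>\<^bsub>M\<^esub> \<chi> y"
      using M.minus_submod[OF AB(2) \<chi>B[OF x] y] M.minus_submod[OF AB(2) \<chi>B[OF x] \<chi>B[OF y]] by simp
    then show ?thesis using d by (simp add: p'_def y_def)
  qed
  have Es': "E (s' x) = s' x" if x: "x \<in> B" for x
  proof -
    have s'A: "s' a = \<zero>\<^bsub>F\<^esub>" if "a \<in> A" for a
      unfolding s'_def using \<chi>id[of a] that AB(3) \<Phi>(3) sp(3) by auto
    have "s' (\<chi> x \<ominus>\<^bsub>submod M B\<^esub> p' (s' x)) = s' (\<chi> x) \<ominus>\<^bsub>F\<^esub> s' (p' (s' x))"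
      by (rule hom_props(3)[OF s' S.lmod_axioms F.lmod_axioms]) (use \<chi>B[OF x] p'B[OF s'F[OF x]] in simp_all)
    moreover have "\<chi> x \<ominus>\<^bsub>submod M B\<^esub> p' (s' x) \<in> A"
      using near[OF x] M.minus_submod[OF AB(2) \<chi>B[OF x] p'B[OF s'F[OF x]]] by simp
    ultimately have "s' (\<chi> x) \<ominus>\<^bsub>F\<^esub> s' (p' (s' x)) = \<zero>\<^bsub>F\<^esub>" using s'A by simp
    then have "s' (\<chi> x) = s' (p' (s' x))"
      using F.diff_zero_iff[OF s'F[OF \<chi>B[OF x]] s'F[OF p'B[OF s'F[OF x]]]] by simp
    moreover have "s' (\<chi> x) = s' x" unfolding s'_def using \<chi>id[OF \<chi>B[OF x] \<Phi>\<chi>[OF x]] by simp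
    ultimately show ?thesis by (simp add: E_def)
  qed
  \<comment> \<open>The pairing function divides the coordinates of F into countably many blocks;
    \<open>co n\<close> reads block n and \<open>inc n\<close> fills it.\<close>
  define co where "co n f = (\<lambda>j. f (prod_encode (n, j)))" for n and f :: "nat \<Rightarrow> 'v"
  define inc where "inc n f = (\<lambda>i. if fst (prod_decode i) = n then f (snd (prod_decode i)) else \<zero>\<^bsub>R\<^esub>)"
    for n and f :: "nat \<Rightarrow> 'v"
  have Fc: "f \<in> carrier F \<longleftrightarrow> (\<forall>j. f j \<in> carrier R) \<and> finite {j. f j \<noteq> \<zero>\<^bsub>R\<^esub>}" for f
    unfolding F_def by (simp add: free_module_carrier)
  have Fadd: "f \<oplus>\<^bsub>F\<^esub> g = (\<lambda>j. f j \<oplus>\<^bsub>R\<^esub> g j)" and Fsm: "a \<odot>\<^bsub>F\<^esub> f = (\<lambda>j. a \<otimes>\<^bsub>R\<^esub> f j)" for f g a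
    unfolding F_def by simp_all
  have co: "co n \<in> module_hom R F F" for n
  proof (rule module_homI)
    fix f assume f: "f \<in> carrier F"
    have "{j. f (prod_encode (n, j)) \<noteq> \<zero>\<^bsub>R\<^esub>} = (\<lambda>j. prod_encode (n, j)) -` {j. f j \<noteq> \<zero>\<^bsub>R\<^esub>}" by auto
    moreover have "finite ((\<lambda>j. prod_encode (n, j)) -` {j. f j \<noteq> \<zero>\<^bsub>R\<^esub>})"
      by (rule finite_vimageI) (use f in \<open>auto simp: Fc inj_def\<close>)
    ultimately show "co n f \<in> carrier F" using f by (simp add: Fc co_def)
  qed (simp_all add: co_def Fadd Fsm)
  have inc: "inc n \<in> module_hom R F F" for n
  proof (rule module_homI)
    fix f assume f: "f \<in> carrier F"
    have "{i. inc n f i \<noteq> \<zero>\<^bsub>R\<^esub>} \<subseteq> (\<lambda>j. prod_encode (n, j)) ` {j. f j \<noteq> \<zero>\<^bsub>R\<^esub>}"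
    proof
      fix i assume "i \<in> {i. inc n f i \<noteq> \<zero>\<^bsub>R\<^esub>}"
      then have "fst (prod_decode i) = n" "f (snd (prod_decode i)) \<noteq> \<zero>\<^bsub>R\<^esub>"
        by (auto simp: inc_def split: if_splits)
      then show "i \<in> (\<lambda>j. prod_encode (n, j)) ` {j. f j \<noteq> \<zero>\<^bsub>R\<^esub>}"
        by (intro image_eqI[of _ _ "snd (prod_decode i)"]) auto
    qed
    then have "finite {i. inc n f i \<noteq> \<zero>\<^bsub>R\<^esub>}" by (rule finite_subset) (use f in \<open>simp add: Fc\<close>)
    then show "inc n f \<in> carrier F" using f by (simp add: Fc) (simp add: inc_def)
  qed (auto simp: inc_def Fadd Fsm)
  have co_inc: "co m (inc n f) = (if m = n then f else \<zero>\<^bsub>F\<^esub>)" for m n f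
    unfolding F0 by (auto simp: co_def inc_def)
  have incF: "inc n f \<in> carrier F" if "f \<in> carrier F" for n f using module_homD(1)[OF inc that] .
  have co0: "co n \<zero>\<^bsub>F\<^esub> = \<zero>\<^bsub>F\<^esub>" for n by (rule hom_props(1)[OF co F.lmod_axioms F.lmod_axioms])
  \<comment> \<open>Summand 0 is P, seen inside F as the image of E; summand k + 1 is block k of the
    free part.\<close>
  define \<Psi> where "\<Psi> n = (case n of 0 \<Rightarrow> s' | Suc k \<Rightarrow> (\<lambda>x. co k (\<Phi> x)))" for n
  define \<xi> where "\<xi> n = (case n of 0 \<Rightarrow> p' | Suc k \<Rightarrow> (\<lambda>f. \<zeta> (inc k f)))" for n
  show ?thesis
  proof (rule swindle[OF M AB, of \<Psi> \<xi> E, folded F_def])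
    show "\<Psi> n \<in> module_hom R (submod M B) F" for n
      using s' module_hom_comp[OF \<Phi>(1) co] by (cases n) (simp_all add: \<Psi>_def)
    show "\<xi> n \<in> module_hom R F (submod M B)" for n
      using p' module_hom_comp[OF inc \<zeta>(1)] by (cases n) (simp_all add: \<xi>_def)
    show EE: "E (E f) = E f" if "f \<in> carrier F" for f
      using Es'[OF p'B[OF that]] by (simp add: E_def)
    show "\<Psi> m (\<xi> n f) = \<zero>\<^bsub>F\<^esub>" if "m \<noteq> n" "f \<in> carrier F" for m n f
      using that s'\<zeta>[OF incF[OF that(2)]] \<Phi>p'[OF that(2)] \<Phi>\<zeta>[OF incF[OF that(2)]] co0 co_inc
      by (cases m; cases n) (simp_all add: \<Psi>_def \<xi>_def)
    show "\<Psi> n (\<xi> n (E f)) = E f" if f: "f \<in> carrier F" for n f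
    proof (cases n)
      case 0
      then show ?thesis using EE[OF f] by (simp add: \<Psi>_def \<xi>_def E_def[of "E f"])
    next
      case (Suc k)
      then show ?thesis
        using \<Phi>\<zeta>[OF incF[OF module_homD(1)[OF E f]]] co_inc by (simp add: \<Psi>_def \<xi>_def)
    qed
    show "\<Psi> (Suc n) (\<xi> (Suc n) f) = f" if "f \<in> carrier F" for n f
      using \<Phi>\<zeta>[OF incF[OF that]] co_inc by (simp add: \<Psi>_def \<xi>_def)
    show "\<exists>k. \<forall>m>k. \<Psi> m x = \<zero>\<^bsub>F\<^esub>" if x: "x \<in> B" for x
    proof -
      have "finite {j. \<Phi> x j \<noteq> \<zero>\<^bsub>R\<^esub>}" using \<Phi>F[OF x] by (simp add: Fc)
      then have "finite ((\<lambda>i. fst (prod_decode i)) ` {j. \<Phi> x j \<noteq> \<zero>\<^bsub>R\<^esub>})" by simp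
      then obtain k where k: "\<forall>n\<in>(\<lambda>i. fst (prod_decode i)) ` {j. \<Phi> x j \<noteq> \<zero>\<^bsub>R\<^esub>}. n < k"
        using finite_nat_set_iff_bounded by blast
      have "\<Psi> m x = \<zero>\<^bsub>F\<^esub>" if m: "m > k" for m
      proof -
        obtain l where l: "m = Suc l" "l \<ge> k" using m by (cases m) auto
        have "\<Phi> x (prod_encode (l, j)) = \<zero>\<^bsub>R\<^esub>" for j
          using k l(2) by (force simp: image_iff)
        then show ?thesis by (simp add: \<Psi>_def l(1) co_def F0)
      qed
      then show ?thesis by blast
    qed
    show "x \<in> A \<longleftrightarrow> (\<forall>m>0. \<Psi> m x = \<zero>\<^bsub>F\<^esub>) \<and> E (\<Psi> 0 x) = \<zero>\<^bsub>F\<^esub>" if x: "x \<in> B" for x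
    proof
      assume a: "x \<in> A"
      have "\<Psi> m x = \<zero>\<^bsub>F\<^esub>" if "m > 0" for m
        using that \<Phi>(3)[OF a] co0 by (cases m) (simp_all add: \<Psi>_def)
      moreover have "s' x = \<zero>\<^bsub>F\<^esub>" using \<chi>id[OF x \<Phi>(3)[OF a]] sp(3)[OF a] by (simp add: s'_def)
      ultimately show "(\<forall>m>0. \<Psi> m x = \<zero>\<^bsub>F\<^esub>) \<and> E (\<Psi> 0 x) = \<zero>\<^bsub>F\<^esub>"
        using hom_props(1)[OF E F.lmod_axioms F.lmod_axioms] by (simp add: \<Psi>_def)
    next
      assume *: "(\<forall>m>0. \<Psi> m x = \<zero>\<^bsub>F\<^esub>) \<and> E (\<Psi> 0 x) = \<zero>\<^bsub>F\<^esub>"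
      have "\<Phi> x i = \<zero>\<^bsub>R\<^esub>" for i
      proof -
        obtain n j where i: "i = prod_encode (n, j)" by (metis prod_decode_inverse surj_pair)
        have "co n (\<Phi> x) = \<zero>\<^bsub>F\<^esub>" using *[THEN conjunct1, rule_format, of "Suc n"] by (simp add: \<Psi>_def)
        then show ?thesis unfolding i by (metis F0 co_def)
      qed
      then have "\<Phi> x = \<zero>\<^bsub>F\<^esub>" unfolding F0 by blast
      then have "\<chi> x = x" by (rule \<chi>id[OF x])
      moreover have "s' x = \<zero>\<^bsub>F\<^esub>" using * Es'[OF x] by (simp add: \<Psi>_def)
      moreover have "p' \<zero>\<^bsub>F\<^esub> = \<zero>\<^bsub>M\<^esub>" using hom_props(1)[OF p' F.lmod_axioms S.lmod_axioms] by simp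
      ultimately show "x \<in> A" using near[OF x] M.diff_zero[of x] M.subD(2)[OF AB(2) x] by simp
    qed
  qed (rule E)
qed

section \<open>The free filtration game\<close>

text \<open>The values of s at countably many generators involve countably many coordinates, so s
  maps B into the free module on these, to which p is restricted.\<close>

lemma psplit_countably_generated:
  assumes M: "lmod R M" and AB: "submodule A R M" "submodule B R M" "A \<subseteq> B"
    and ps: "psplit R M J A B" and b: "countable b" "B = span R M b"
  shows "psplit R M (UNIV :: nat set) A B"
proof -
  interpret M: lmod R M by (rule M)
  interpret S: lmod R "submod M B" by (rule M.lmod_submod[OF AB(2)])
  let ?F = "free_module R J"
  interpret F: lmod R ?F by (rule M.free.free_lmod)
  obtain s p where sp: "s \<in> module_hom R (submod M B) ?F" "p \<in> module_hom R ?F (submod M B)"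
    "\<And>x. x \<in> A \<Longrightarrow> s x = \<zero>\<^bsub>?F\<^esub>" "\<And>x. x \<in> B \<Longrightarrow> x \<ominus>\<^bsub>M\<^esub> p (s x) \<in> A"
    using ps by (rule psplitE) (rule that)
  have bB: "b \<subseteq> B" unfolding b(2) by (rule M.span_superset)
  have sF: "s x \<in> carrier ?F" if "x \<in> B" for x using module_homD(1)[OF sp(1)] that by simp
  define J0 where "J0 = (\<Union>x\<in>b. {j. s x j \<noteq> \<zero>\<^bsub>R\<^esub>})"
  have "countable {j. s x j \<noteq> \<zero>\<^bsub>R\<^esub>}" if "x \<in> b" for x
    using sF[of x] that bB by (auto simp: free_module_carrier intro: countable_finite)
  then have J0: "countable J0" unfolding J0_def by (intro countable_UN[OF b(1)])
  have "j \<in> J" if "x \<in> b" "s x j \<noteq> \<zero>\<^bsub>R\<^esub>" for x j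
    using sF[of x] that bB by (auto simp: free_module_carrier)
  then have J0J: "J0 \<subseteq> J" unfolding J0_def by blast
  have ker: "submodule {x \<in> carrier (submod M B). s x \<in> carrier (free_module R J0)} R (submod M B)"
    by (rule hom_ker_sub[OF sp(1) S.lmod_axioms F.lmod_axioms M.free.free_module_submodule[OF J0J]])
  have "s x \<in> carrier (free_module R J0)" if "x \<in> b" for x
    using sF[of x] that bB unfolding J0_def by (auto simp: free_module_carrier)
  then have "b \<subseteq> {x \<in> carrier (submod M B). s x \<in> carrier (free_module R J0)}" using bB by auto
  then have "span R (submod M B) b \<subseteq> {x \<in> carrier (submod M B). s x \<in> carrier (free_module R J0)}"
    by (rule S.span_least[OF ker])
  moreover have "span R (submod M B) b = B"
    by (rule trans[OF M.span_submod[OF AB(2) bB] b(2)[symmetric]])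
  ultimately have "B \<subseteq> {x \<in> carrier (submod M B). s x \<in> carrier (free_module R J0)}"
    by simp
  then have s0: "s x \<in> carrier (free_module R J0)" if "x \<in> B" for x using that by auto
  have "psplit R M J0 A B"
  proof (rule psplitI[of s _ _ _ _ p])
    show "s \<in> module_hom R (submod M B) (free_module R J0)"
      by (rule module_homI) (use module_homD[OF sp(1)] s0 in simp_all)
    show "p \<in> module_hom R (free_module R J0) (submod M B)"
    proof -
      have "f \<in> carrier ?F" if "f \<in> carrier (free_module R J0)" for f
        using free_module_mono[OF J0J that] .
      then show ?thesis by (intro module_homI) (use module_homD[OF sp(2)] in simp_all)
    qed
  qed (use sp(3,4) in simp_all)
  then show ?thesis
    by (rule psplit_reindex[OF M AB(2) _ inj_on_to_nat_on[OF J0] subset_UNIV])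
qed

text \<open>The hypothesis \<open>rich\<close> is iterated \<omega> times above a \<union> X. Each
  step contributes a map onto R, and together they map B onto a free module of countable rank with A
  in the kernel, as \<open>psplit_free_surj_imp_Filt\<close> requires.\<close>

lemma free_extension:
  fixes M :: "('v::zfc_universe, 'v) module"
  assumes R: "ring R" "small (carrier R)" and M: "rmodule R M"
    and D: "\<And>a. a \<in> \<D> \<Longrightarrow> countable a \<and> a \<subseteq> carrier M"
      "\<And>f :: nat \<Rightarrow> 'v set. (\<And>n. f n \<in> \<D>) \<Longrightarrow> (\<And>n. f n \<subseteq> f (Suc n)) \<Longrightarrow> (\<Union>n. f n) \<in> \<D>"
    and F0: "\<And>a. a \<in> \<D> \<Longrightarrow> Filt (quo_class R (cp_projectives R) M) {\<zero>\<^bsub>M\<^esub>} (span R M a)"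
    and F1: "\<And>a b. a \<in> \<D> \<Longrightarrow> countable b \<Longrightarrow> a \<subseteq> b \<Longrightarrow> b \<subseteq> carrier M \<Longrightarrow>
        Filt (quo_class R (cp_projectives R) M) (span R M a) (span R M b)"
    and rich: "\<And>b. countable b \<Longrightarrow> b \<subseteq> carrier M \<Longrightarrow> \<exists>c\<in>\<D>. b \<subseteq> c \<and>
      (\<exists>\<phi>\<in>module_hom R (submod M (span R M c)) (regular_module R). (\<forall>x\<in>b. \<phi> x = \<zero>\<^bsub>R\<^esub>) \<and> \<phi> ` span R M c = carrier R)"
    and a: "a \<in> insert {} \<D>" and X: "countable X" "X \<subseteq> carrier M"
  shows "\<exists>b\<in>\<D>. a \<union> X \<subseteq> b \<and> Filt (quo_class R {regular_module R} M) (span R M a) (span R M b)"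
proof -
  interpret M: lmod R M using M by (rule rmodule_lmod)
  let ?R = "regular_module R" and ?F = "free_module R (UNIV :: nat set)"
  interpret Reg: lmod R ?R by (rule M.free.regular_lmod)
  interpret F: lmod R ?F by (rule M.free.free_lmod)
  define ext where "ext b c \<phi> \<longleftrightarrow> c \<in> \<D> \<and> b \<subseteq> c \<and> \<phi> \<in> module_hom R (submod M (span R M c)) ?R \<and>
    (\<forall>x\<in>b. \<phi> x = \<zero>\<^bsub>R\<^esub>) \<and> \<phi> ` span R M c = carrier R" for b c \<phi>
  have "\<exists>c \<phi>. ext b c \<phi>" if "countable b" "b \<subseteq> carrier M" for b
    using rich[OF that] unfolding ext_def by blast
  then obtain C \<phi>' where ext: "\<And>b. countable b \<Longrightarrow> b \<subseteq> carrier M \<Longrightarrow> ext b (C b) (\<phi>' b)" by metis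
  \<comment> \<open>The sequence starts at \<open>C (a \<union> X)\<close> instead of a \<union> X,
    so that every \<open>c n\<close> belongs to \<open>\<D>\<close>.\<close>
  define c where "c n = (C ^^ Suc n) (a \<union> X)" for n
  have aX: "countable (a \<union> X)" "a \<union> X \<subseteq> carrier M" using a X D(1) by auto
  have c0: "c 0 = C (a \<union> X)" and cS: "c (Suc n) = C (c n)" for n by (simp_all add: c_def)
  have cD: "c n \<in> \<D>" for n
  proof (induction n)
    case 0 then show ?case using ext[OF aX] by (simp add: c0 ext_def)
  next
    case (Suc n) then show ?case using ext[of "c n"] D(1) by (auto simp: cS ext_def)
  qed
  have cc: "countable (c n)" "c n \<subseteq> carrier M" for n using D(1)[OF cD] by auto
  define \<phi> where "\<phi> n = \<phi>' (c n)" for n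
  have e: "ext (c n) (c (Suc n)) (\<phi> n)" for n unfolding \<phi>_def cS by (rule ext[OF cc])
  have inc: "c n \<subseteq> c (Suc n)" for n using e by (simp add: ext_def)
  have mono: "m \<le> n \<Longrightarrow> c m \<subseteq> c n" for m n using inc by (rule lift_Suc_mono_le)
  define b where "b = (\<Union>n. c n)"
  have bD: "b \<in> \<D>" unfolding b_def by (rule D(2)[of c, OF cD inc])
  have bc: "countable b" "b \<subseteq> carrier M" using D(1)[OF bD] by auto
  have cb: "c n \<subseteq> b" for n unfolding b_def by blast
  have aXb: "a \<union> X \<subseteq> b" using ext[OF aX] cb[of 0] unfolding c0 ext_def by blast
  define B where "B = span R M b"
  define N where "N n = span R M (c n)" for n
  have Bs: "submodule B R M" unfolding B_def by (rule M.span_sub[OF bc(2)])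
  have Ns: "submodule (N n) R M" for n unfolding N_def by (rule M.span_sub[OF cc(2)])
  have NB: "N n \<subseteq> B" for n unfolding N_def B_def by (rule M.span_mono[OF cb])
  have Nmono: "m \<le> n \<Longrightarrow> N m \<subseteq> N n" for m n unfolding N_def using mono by (intro M.span_mono)
  have BN: "B = (\<Union>n. N n)"
    unfolding B_def b_def N_def by (rule M.span_UN[OF cc(2)]) (use inc M.span_superset in blast)
  have \<phi>: "\<phi> n \<in> module_hom R (submod M (N (Suc n))) ?R" "\<phi> n ` N (Suc n) = carrier R" for n
    using e[of n] by (simp_all add: ext_def N_def)
  have \<phi>0: "\<phi> n x = \<zero>\<^bsub>R\<^esub>" if "x \<in> N n" for n x
  proof -
    interpret S: lmod R "submod M (N (Suc n))" by (rule M.lmod_submod[OF Ns])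
    have k: "submodule {x \<in> carrier (submod M (N (Suc n))). \<phi> n x \<in> {\<zero>\<^bsub>?R\<^esub>}} R (submod M (N (Suc n)))"
      by (rule hom_ker_sub[OF \<phi>(1) S.lmod_axioms Reg.lmod_axioms Reg.sub_zero])
    have cN: "c n \<subseteq> N (Suc n)" unfolding N_def using inc M.span_superset by blast
    then have "c n \<subseteq> {x \<in> carrier (submod M (N (Suc n))). \<phi> n x \<in> {\<zero>\<^bsub>?R\<^esub>}}"
      using e[of n] by (auto simp: ext_def)
    then have "span R (submod M (N (Suc n))) (c n) \<subseteq> {x \<in> carrier (submod M (N (Suc n))). \<phi> n x \<in> {\<zero>\<^bsub>?R\<^esub>}}"
      by (rule S.span_least[OF k])
    then show ?thesis using that M.span_submod[OF Ns cN] by (auto simp: N_def)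
  qed
  have proj: "projective R K" if "K \<in> cp_projectives R" for K using that by simp
  have "psplit R M B (N n) B" for n
    by (rule Filt_projective_imp_psplit[OF R(2) M.lmod_axioms Ns Bs _ proj])
      (use F1[OF cD bc(1) cb bc(2)] in \<open>auto simp: N_def B_def\<close>)
  then have "\<exists>\<rho>\<in>module_hom R (submod M B) (submod M (N n)). \<forall>x\<in>N n. \<rho> x = x" for n
    using psplit_retraction[OF M.lmod_axioms Ns Bs NB] by metis
  then obtain \<rho> where \<rho>: "\<And>n. \<rho> n \<in> module_hom R (submod M B) (submod M (N n))" "\<And>n x. x \<in> N n \<Longrightarrow> \<rho> n x = x"
    by metis
  \<comment> \<open>The map \<open>\<phi> n\<close> is defined on \<open>N (Suc n)\<close> only; a
    retraction of B, available because B over this submodule is projective, extends it.\<close>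
  define \<psi> where "\<psi> n x = \<phi> n (\<rho> (Suc n) x)" for n x
  have \<psi>: "\<psi> n \<in> module_hom R (submod M B) ?R" for n
    unfolding \<psi>_def by (rule module_hom_comp[OF \<rho>(1) \<phi>(1)])
  have \<psi>0: "\<psi> n x = \<zero>\<^bsub>R\<^esub>" if "x \<in> N n" for n x
    using that \<rho>(2)[of x "Suc n"] \<phi>0 Nmono[of n "Suc n"] by (auto simp: \<psi>_def)
  have \<psi>\<phi>: "\<psi> n x = \<phi> n x" if "x \<in> N (Suc n)" for n x using \<rho>(2)[OF that] by (simp add: \<psi>_def)
  \<comment> \<open>On \<open>N n\<close> all maps \<open>\<psi> j\<close> with j \<ge> n vanish, so
    the values of \<Phi> have finite support.\<close>
  define \<Phi> where "\<Phi> x = (\<lambda>n. \<psi> n x)" for x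
  have supp: "\<Phi> x \<in> carrier (free_module R {..<n})" if "x \<in> N n" for x n
  proof -
    have x: "x \<in> B" using that NB by blast
    have z: "j < n" if "\<psi> j x \<noteq> \<zero>\<^bsub>R\<^esub>" for j
      using that \<psi>0[of x j] \<open>x \<in> N n\<close> Nmono[of n j] by (cases "j < n") auto
    then have "{j. \<psi> j x \<noteq> \<zero>\<^bsub>R\<^esub>} \<subseteq> {..<n}" by blast
    then have "finite {j. \<psi> j x \<noteq> \<zero>\<^bsub>R\<^esub>}" using finite_subset by blast
    then show ?thesis
      using z module_homD(1)[OF \<psi>] x by (simp add: free_module_carrier \<Phi>_def)
  qed
  have \<Phi>F: "\<Phi> x \<in> carrier ?F" if x: "x \<in> B" for x
  proof -
    obtain n where "x \<in> N n" using x BN by blast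
    then show ?thesis using free_module_mono[OF subset_UNIV supp] by blast
  qed
  have \<Phi>: "\<Phi> \<in> module_hom R (submod M B) ?F"
    by (rule module_homI) (use \<Phi>F module_homD[OF \<psi>] in \<open>simp_all add: \<Phi>_def\<close>)
  \<comment> \<open>Triangular elimination: the last coordinate of f is hit by some z in
    \<open>N (Suc n)\<close>, where the later coordinates vanish, and what remains of f has support
    below n.\<close>
  have onto: "\<forall>f\<in>carrier (free_module R {..<n}). \<exists>z\<in>B. \<Phi> z = f" for n
  proof (induction n)
    case 0
    show ?case
    proof
      fix f assume "f \<in> carrier (free_module R {..<0 :: nat})"
      then have "f = \<zero>\<^bsub>?F\<^esub>" by (auto simp: free_module_carrier)
      then show "\<exists>z\<in>B. \<Phi> z = f"
        using M.subD(3)[OF Bs] hom_props(1)[OF \<Phi> M.lmod_submod[OF Bs] F.lmod_axioms] by auto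
    qed
  next
    case (Suc n)
    show ?case
    proof
      fix f assume f: "f \<in> carrier (free_module R {..<Suc n})"
      then have fF: "f \<in> carrier ?F" by (rule free_module_mono[OF subset_UNIV])
      have "f n \<in> carrier R" using f by (simp add: free_module_carrier)
      then obtain z where z: "z \<in> N (Suc n)" "\<phi> n z = f n" using \<phi>(2) by (metis imageE)
      have zB: "z \<in> B" using z NB by blast
      have Fn: "lmod R (free_module R {..<Suc n})" by (rule M.free.free_lmod)
      interpret Fn: lmod R "free_module R {..<Suc n}" by (rule Fn)
      define g where "g = f \<ominus>\<^bsub>free_module R {..<Suc n}\<^esub> \<Phi> z"
      have g: "g \<in> carrier (free_module R {..<Suc n})"
        unfolding g_def by (rule Fn.M.minus_closed[OF f supp[OF z(1)]])
      have "f = \<Phi> z \<oplus>\<^bsub>free_module R {..<Suc n}\<^esub> g"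
        unfolding g_def by (rule Fn.add_diff_cancel[OF f supp[OF z(1)], symmetric])
      then have fg: "f = \<Phi> z \<oplus>\<^bsub>?F\<^esub> g" by simp
      have "f n = f n \<oplus>\<^bsub>R\<^esub> g n"
        using fun_cong[OF fg, of n] \<psi>\<phi>[OF z(1)] z(2) by (simp add: \<Phi>_def)
      then have "g n = \<zero>\<^bsub>R\<^esub>"
        using g f M.R.add.r_cancel_one'[of "f n" "g n"] by (simp add: free_module_carrier)
      then have "g \<in> carrier (free_module R {..<n})"
        using g less_Suc_eq by (fastforce simp: free_module_carrier)
      then obtain w where w: "w \<in> B" "\<Phi> w = g" using Suc.IH by blast
      have "\<Phi> (z \<oplus>\<^bsub>M\<^esub> w) = f"
        using module_homD(2)[OF \<Phi>, of z w] zB w fg by simp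
      then show "\<exists>z\<in>B. \<Phi> z = f" using M.subD(4)[OF Bs zB w(1)] by blast
    qed
  qed
  have \<Phi>surj: "\<Phi> ` B = carrier ?F"
  proof
    show "\<Phi> ` B \<subseteq> carrier ?F" using \<Phi>F by blast
    show "carrier ?F \<subseteq> \<Phi> ` B"
    proof
      fix f assume f: "f \<in> carrier ?F"
      then have "finite {j. f j \<noteq> \<zero>\<^bsub>R\<^esub>}" by (simp add: free_module_carrier)
      then obtain n where "\<forall>j\<in>{j. f j \<noteq> \<zero>\<^bsub>R\<^esub>}. j < n" using finite_nat_set_iff_bounded by blast
      then have "f \<in> carrier (free_module R {..<n})" using f by (simp add: free_module_carrier)
      then obtain z where "z \<in> B" "\<Phi> z = f" using onto by blast
      then show "f \<in> \<Phi> ` B" by blast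
    qed
  qed
  define A where "A = span R M a"
  have ac: "a \<subseteq> carrier M" using aX(2) by blast
  have As: "submodule A R M" unfolding A_def by (rule M.span_sub[OF ac])
  have AN: "A \<subseteq> N 0" unfolding A_def N_def
    using ext[OF aX] by (intro M.span_mono) (auto simp: c0 ext_def)
  then have AB: "A \<subseteq> B" using NB by blast
  have "Filt (quo_class R (cp_projectives R) M) A B"
  proof (cases "a = {}")
    case True
    then show ?thesis using F0[OF bD] by (simp add: A_def B_def M.span_empty)
  next
    case False
    then show ?thesis using F1[of a b] a bc aXb by (simp add: A_def B_def)
  qed
  then have "psplit R M B A B"
    by (rule Filt_projective_imp_psplit[OF R(2) M.lmod_axioms As Bs _ proj])
  then have "psplit R M (UNIV :: nat set) A B"
    by (rule psplit_countably_generated[OF M.lmod_axioms As Bs AB _ bc(1) B_def])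
  moreover have "\<Phi> x = \<zero>\<^bsub>?F\<^esub>" if "x \<in> A" for x
    using supp[of x 0] that AN by (auto simp: free_module_carrier fun_eq_iff)
  ultimately have "Filt (quo_class R {?R} M) A B"
    by (rule psplit_free_surj_imp_Filt[OF M.lmod_axioms As Bs AB _ \<Phi> \<Phi>surj])
  then show ?thesis using bD aXb unfolding A_def B_def by blast
qed

text \<open>If no \<open>c \<in> \<D>\<close> above \<open>b\<^sub>0\<close> has a free quotient modulo \<open>b\<^sub>0\<close>, Player 1 plays \<open>b\<^sub>0\<close> and then
  steers into \<open>\<D>\<close> in \<open>\<omega>\<close> rounds, forcing a nonzero free quotient.\<close>

lemma player1_strategy_poor:
  fixes M :: "('v::zfc_universe, 'v) module"
  assumes R: "ring R" "small (carrier R)" and M: "rmodule R M"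
    and ncg: "\<And>m. countable m \<Longrightarrow> m \<subseteq> carrier M \<Longrightarrow> span R M m \<noteq> carrier M"
    and D: "\<And>a. a \<in> \<D> \<Longrightarrow> countable a \<and> a \<subseteq> carrier M"
      "\<And>f :: nat \<Rightarrow> 'v set. (\<And>n. f n \<in> \<D>) \<Longrightarrow> (\<And>n. f n \<subseteq> f (Suc n)) \<Longrightarrow> (\<Union>n. f n) \<in> \<D>"
      "\<And>X. countable X \<Longrightarrow> X \<subseteq> carrier M \<Longrightarrow> \<exists>b\<in>\<D>. X \<subseteq> b"
    and b0: "countable b0" "b0 \<subseteq> carrier M"
    and poor: "\<And>c \<phi>. c \<in> \<D> \<Longrightarrow> b0 \<subseteq> c \<Longrightarrow> \<phi> \<in> module_hom R (submod M (span R M c)) (regular_module R) \<Longrightarrow>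
      (\<And>x. x \<in> b0 \<Longrightarrow> \<phi> x = \<zero>\<^bsub>R\<^esub>) \<Longrightarrow> \<phi> ` span R M c \<noteq> carrier R"
  shows "\<exists>\<sigma>. \<forall>X Z. follows1 omega1 \<sigma> X Z \<longrightarrow> player1_wins R {regular_module R} M omega1 X Z"
proof -
  interpret M: lmod R M using M by (rule rmodule_lmod)
  let ?C = "{regular_module R}"
  have \<C>: "left_module R K" if "K \<in> ?C" for K
    using that regular_module_cp_projective(2)[OF R] by (simp add: rmodule_def)
  \<comment> \<open>The answer also contains a point outside \<langle>Y\<rangle>, which exists
    because M is not countably generated; without it the game might stand still.\<close>
  have "\<exists>c\<in>\<D>. Y \<union> b0 \<subseteq> c \<and> \<not> c \<subseteq> span R M Y" if Y: "countable Y" "Y \<subseteq> carrier M" for Y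
  proof -
    obtain x where x: "x \<in> carrier M" "x \<notin> span R M Y"
      using ncg[OF Y] M.span_closed[OF Y(2)] by blast
    have "countable (insert x (Y \<union> b0))" "insert x (Y \<union> b0) \<subseteq> carrier M" using x Y b0 by auto
    then obtain c where "c \<in> \<D>" "insert x (Y \<union> b0) \<subseteq> c" using D(3) by blast
    then show ?thesis using x(2) by blast
  qed
  then obtain e where e: "\<And>Y. countable Y \<Longrightarrow> Y \<subseteq> carrier M \<Longrightarrow> e Y \<in> \<D> \<and> Y \<union> b0 \<subseteq> e Y \<and> \<not> e Y \<subseteq> span R M Y"
    by metis
  \<comment> \<open>Player 1 plays above all earlier moves of both players. His first \<omega> moves
    thus increase to a member c of \<open>\<D>\<close>, and \<langle>c\<rangle> is the union of the
    spans of Player 2's first \<omega> moves.\<close>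
  define \<sigma> where "\<sigma> i X Z = e (\<Union>k\<in>elts i. X k \<union> Z k)" for i :: 'v and X Z
  have "player1_wins R ?C M omega1 X Z" if fol: "follows1 omega1 \<sigma> X Z" for X Z
  proof (rule ccontr)
    assume nw: "\<not> player1_wins R ?C M omega1 X Z"
    define U where "U i = (\<Union>k\<in>elts i. X k \<union> Z k)" for i
    have X: "X i = e (U i)" if "i \<in> elts omega1" for i
      using fol that by (simp add: follows1_def \<sigma>_def U_def)
    have Uc: "countable (U i)" "U i \<subseteq> carrier M"
      if i: "i \<in> elts omega1" and l: "\<forall>k\<in>elts i. legal1 M omega1 (X k)" "\<forall>k\<in>elts i. legal2 R ?C M omega1 X Z k" for i
    proof -
      have "countable (elts i)" using i by (simp add: elts_omega1)
      moreover have "countable (X k \<union> Z k) \<and> X k \<union> Z k \<subseteq> carrier M" if "k \<in> elts i" for k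
        using l that by (simp add: legal1_def legal2_def lesspoll_omega1_iff)
      ultimately show "countable (U i)" "U i \<subseteq> carrier M" unfolding U_def by auto
    qed
    have "legal1 M omega1 (X i)"
      if i: "i \<in> elts omega1" and l: "\<forall>k\<in>elts i. legal1 M omega1 (X k)" "\<forall>k\<in>elts i. legal2 R ?C M omega1 X Z k" for i
      unfolding X[OF i] legal1_def lesspoll_omega1_iff using e[OF Uc[OF i l]] D(1) by blast
    then have leg: "legal1 M omega1 (X i) \<and> legal2 R ?C M omega1 X Z i" if "i \<in> elts omega1" for i
      using play_legal[OF Ord_omega1 _ nw] that by blast
    have le: "e (U i) \<in> \<D> \<and> U i \<union> b0 \<subseteq> e (U i) \<and> \<not> e (U i) \<subseteq> span R M (U i)" if i: "i \<in> elts omega1" for i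
      by (rule e[OF Uc[OF i]]) (use leg Ord_trans[OF Ord_omega1 i] in blast)+
    define x where "x n = X (ord_of n)" for n
    define z where "z n = Z (ord_of n)" for n
    note om = ord_of_in_omega1
    have x: "x n \<in> \<D>" "b0 \<subseteq> x n" "\<not> x n \<subseteq> span R M (U (ord_of n))" for n
      using le[OF om[of n]] X[OF om[of n]] by (auto simp: x_def)
    have xz: "x m \<subseteq> x n" "z m \<subseteq> x n" "z m \<subseteq> U (ord_of n)" if "m < n" for m n
    proof -
      have "ord_of m \<in> elts (ord_of n)" using that by (auto simp: elts_ord_of)
      then have "X (ord_of m) \<subseteq> U (ord_of n)" "Z (ord_of m) \<subseteq> U (ord_of n)" unfolding U_def by blast+
      then show "x m \<subseteq> x n" "z m \<subseteq> x n" "z m \<subseteq> U (ord_of n)"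
        using le[OF om[of n]] X[OF om[of n]] unfolding x_def z_def by blast+
    qed
    define N where "N n = span R M (z n)" for n
    have zc: "z n \<subseteq> carrier M" for n using leg[OF om[of n]] by (simp add: legal2_def z_def)
    have xN: "x n \<subseteq> N n" for n using leg[OF om[of n]] by (simp add: legal2_def z_def x_def N_def)
    have xc: "x n \<subseteq> carrier M" for n using D(1)[OF x(1)] by simp
    have Ns: "submodule (N n) R M" for n unfolding N_def by (rule M.span_sub[OF zc])
    define c where "c = (\<Union>n. x n)"
    have cD: "c \<in> \<D>" unfolding c_def by (rule D(2)[of x, OF x(1) xz(1)]) simp
    have cN: "span R M c = (\<Union>n. N n)"
    proof -
      have "span R M c = (\<Union>n. span R M (x n))"
        unfolding c_def by (rule M.span_UN[OF xc]) (use xz(1)[OF lessI] M.span_superset in blast)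
      moreover have "span R M (x n) \<subseteq> N n" for n by (rule M.span_least[OF Ns xN])
      then have "(\<Union>n. span R M (x n)) \<subseteq> (\<Union>n. N n)" by blast
      moreover have "N n \<subseteq> span R M (x (Suc n))" for n unfolding N_def by (rule M.span_mono[OF xz(2)[OF lessI]])
      then have "(\<Union>n. N n) \<subseteq> (\<Union>n. span R M (x n))" by blast
      ultimately show ?thesis by simp
    qed
    have "Filt (quo_class R ?C M) (N 0) (\<Union>n. N n)"
    proof (rule Filt_nat[of N])
      show "N n \<subseteq> N (Suc n)" for n
      proof -
        have "z n \<subseteq> N (Suc n)" using xz(2)[OF lessI, of n] xN[of "Suc n"] by blast
        then show ?thesis unfolding N_def[of n] by (rule M.span_least[OF Ns])
      qed
      show "Filt (quo_class R ?C M) (N n) (N (Suc n))" for n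
      proof -
        have "span R M (\<Union>k\<in>elts (ord_of (Suc n)). Z k) = N n"
          unfolding N_def z_def ord_of.simps by (rule legal2_span[OF M.lmod_axioms]) (use leg[OF om[of n]] in blast)
        moreover have "Filt (quo_class R ?C M) (span R M (\<Union>k\<in>elts (ord_of (Suc n)). Z k)) (span R M (Z (ord_of (Suc n))))"
          by (rule legal2_Filt[OF M \<C>]) (use leg[OF om[of "Suc n"]] in auto)
        ultimately show ?thesis by (simp add: N_def z_def)
      qed
    qed
    then have filt: "Filt (quo_class R ?C M) (N 0) (span R M c)" using cN by simp
    have cs: "submodule (span R M c) R M" using D(1)[OF cD] by (intro M.span_sub) simp
    \<comment> \<open>Player 1's second move contains a point outside the span of the moves of round
      0, in particular outside \<open>N 0\<close>.\<close>
    have "N 0 \<noteq> span R M c"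
    proof
      assume eq: "N 0 = span R M c"
      have "x 1 \<subseteq> c" unfolding c_def by blast
      also have "c \<subseteq> N 0" unfolding eq by (rule M.span_superset)
      also have "N 0 \<subseteq> span R M (U (ord_of 1))" unfolding N_def by (rule M.span_mono[OF xz(3)]) simp
      finally show False using x(3) by blast
    qed
    \<comment> \<open>\<langle>c\<rangle> over \<open>N 0\<close> is nonzero and filtered by copies
      of R, so it maps onto R. The map kills \<open>N 0\<close>, which contains Player 1's opening
      move and hence b0; this contradicts the choice of b0.\<close>
    then obtain \<phi> where \<phi>: "\<phi> \<in> module_hom R (submod M (span R M c)) (regular_module R)"
      "\<And>x. x \<in> N 0 \<Longrightarrow> \<phi> x = \<zero>\<^bsub>R\<^esub>" "\<phi> ` span R M c = carrier R"
      by (rule Filt_regular_imp_surj[OF R M.lmod_axioms Ns cs _ filt]) (rule that)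
    have "b0 \<subseteq> c" "b0 \<subseteq> N 0" using x(2)[of 0] xN[of 0] unfolding c_def by blast+
    then show False using poor[OF cD _ \<phi>(1)] \<phi>(2,3) by blast
  qed
  then show ?thesis by blast
qed

text \<open>Reflection is used for the countably presented projectives. As R is one of them,
  submodules that are not filtered by projectives are not filtered by R either, so Player 1's
  enumeration also wins here. In the club case the question whether every countable b is
  \<open>rich\<close> decides between the players; the countably generated modules are treated
  separately because Player 1 then needs room to grow.\<close>

lemma determined_free:
  fixes M :: "('v::zfc_universe, 'v) module"
  assumes RP: "RP_internal TYPE('v)" and R: "ring R" "small (carrier R)" and her: "hereditary_ring R"
    and M: "rmodule R M"
  shows "filtration_game_determined R {regular_module R} omega1 M"
proof -
  interpret M: lmod R M using M by (rule rmodule_lmod)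
  let ?C = "{regular_module R}"
  note reg = regular_module_cp_projective[OF R]
  have \<C>: "left_module R K" if "K \<in> ?C" for K using that reg(2) by (simp add: rmodule_def)
  show ?thesis
  proof (cases "\<exists>m. countable m \<and> m \<subseteq> carrier M \<and> span R M m = carrier M")
    case True
    then obtain m where m: "countable m" "m \<subseteq> carrier M" "span R M m = carrier M" by blast
    show ?thesis by (rule determined_countably_generated[OF M \<C> m])
  next
    case False
    then have ncg: "span R M m \<noteq> carrier M" if "countable m" "m \<subseteq> carrier M" for m using that by blast
    then have unc: "uncountable (carrier M)" using M.span_of_sub[OF M.sub_carrier] by blast
    have cp: "rmodule R K \<and> countably_presented R K" if "K \<in> cp_projectives R" for K
      using that by (simp add: projective_def)
    show ?thesis
    proof (rule reflection_dichotomy[OF RP M cp hereditary_imp_quotient_hereditary[OF R(2) her] unc])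
      fix B assume B: "B \<subseteq> carrier M" "B \<lesssim> elts (omega1 :: 'v)"
        and no: "\<And>V. submodule V R M \<Longrightarrow> B \<subseteq> V \<Longrightarrow> \<not> Filt (quo_class R (cp_projectives R) M) {\<zero>\<^bsub>M\<^esub>} V"
      have noC: "\<not> Filt (quo_class R ?C M) {\<zero>\<^bsub>M\<^esub>} V" if V: "submodule V R M" "B \<subseteq> V" for V
      proof
        assume "Filt (quo_class R ?C M) {\<zero>\<^bsub>M\<^esub>} V"
        then have "Filt (quo_class R (cp_projectives R) M) {\<zero>\<^bsub>M\<^esub>} V"
          by (rule Filt_mono) (use reg(1) in \<open>auto simp: quo_class_def\<close>)
        then show False using no[OF V] by blast
      qed
      have "\<exists>\<sigma>. \<forall>X Z. follows1 omega1 \<sigma> X Z \<longrightarrow> player1_wins R ?C M omega1 X Z"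
        by (rule player1_strategy_enumerate[OF M \<C> B noC])
      then show ?thesis by (simp add: filtration_game_determined_def)
    next
      fix \<D> :: "'v set set"
      assume D: "\<And>a. a \<in> \<D> \<Longrightarrow> countable a \<and> a \<subseteq> carrier M"
        "\<And>f :: nat \<Rightarrow> 'v set. (\<And>n. f n \<in> \<D>) \<Longrightarrow> (\<And>n. f n \<subseteq> f (Suc n)) \<Longrightarrow> (\<Union>n. f n) \<in> \<D>"
        "\<And>X. countable X \<Longrightarrow> X \<subseteq> carrier M \<Longrightarrow> \<exists>b\<in>\<D>. X \<subseteq> b"
        and F: "\<And>a. a \<in> \<D> \<Longrightarrow> Filt (quo_class R (cp_projectives R) M) {\<zero>\<^bsub>M\<^esub>} (span R M a)"
        "\<And>a b. a \<in> \<D> \<Longrightarrow> countable b \<Longrightarrow> a \<subseteq> b \<Longrightarrow> b \<subseteq> carrier M \<Longrightarrow>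
          Filt (quo_class R (cp_projectives R) M) (span R M a) (span R M b)"
      define rich where "rich b \<longleftrightarrow> (\<exists>c\<in>\<D>. b \<subseteq> c \<and>
        (\<exists>\<phi>\<in>module_hom R (submod M (span R M c)) (regular_module R).
          (\<forall>x\<in>b. \<phi> x = \<zero>\<^bsub>R\<^esub>) \<and> \<phi> ` span R M c = carrier R))" for b
      show ?thesis
      proof (cases "\<forall>b. countable b \<longrightarrow> b \<subseteq> carrier M \<longrightarrow> rich b")
        case True
        have "\<exists>\<tau>. \<forall>X Z. follows2 omega1 \<tau> X Z \<longrightarrow> \<not> player1_wins R ?C M omega1 X Z"
          by (rule player2_strategy_club[OF M \<C> D(1,2) free_extension[OF R M D(1,2) F]])
            (use True in \<open>simp_all add: rich_def\<close>)
        then show ?thesis by (simp add: filtration_game_determined_def)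
      next
        case False
        then obtain b0 where b0: "countable b0" "b0 \<subseteq> carrier M" "\<not> rich b0" by blast
        have poor: "\<phi> ` span R M c \<noteq> carrier R"
          if "c \<in> \<D>" "b0 \<subseteq> c" "\<phi> \<in> module_hom R (submod M (span R M c)) (regular_module R)"
            "\<And>x. x \<in> b0 \<Longrightarrow> \<phi> x = \<zero>\<^bsub>R\<^esub>" for c \<phi>
          using b0(3) that unfolding rich_def by blast
        have "\<exists>\<sigma>. \<forall>X Z. follows1 omega1 \<sigma> X Z \<longrightarrow> player1_wins R ?C M omega1 X Z"
          by (rule player1_strategy_poor[OF R M ncg D b0(1,2) poor])
        then show ?thesis by (simp add: filtration_game_determined_def)
      qed
    qed
  qed
qed

theorem theorem1p2:
  fixes R :: "'v::zfc_universe ring"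
  assumes RP: "RP_internal TYPE('v)"
    and R: "ring R" "carrier R \<lesssim> elts (omega1 :: 'v)"
  shows "(\<forall>\<C> M. (\<forall>N\<in>\<C>. rmodule R N \<and> countably_presented R N) \<and>
             quotient_hereditary R \<C> \<and> rmodule R M \<longrightarrow>
             filtration_game_determined R \<C> omega1 M) \<and>
         (hereditary_ring R \<longrightarrow>
           (\<forall>M. rmodule R M \<longrightarrow>
              filtration_game_determined R {N. countably_presented R N \<and> projective R N} omega1 M \<and>
              filtration_game_determined R {regular_module R} omega1 M))"
proof (intro conjI allI impI)
  have small: "small (carrier R)" by (rule small_lepoll[OF small_elts R(2)])
  show "filtration_game_determined R \<C> omega1 M"
    if "(\<forall>N\<in>\<C>. rmodule R N \<and> countably_presented R N) \<and> quotient_hereditary R \<C> \<and> rmodule R M" for \<C> M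
    using determined_quotient_hereditary[OF RP] that by blast
  fix M assume her: "hereditary_ring R" and M: "rmodule R M"
  show "filtration_game_determined R (cp_projectives R) omega1 M"
    by (rule determined_quotient_hereditary[OF RP M _ hereditary_imp_quotient_hereditary[OF small her]])
      (simp add: projective_def)
  show "filtration_game_determined R {regular_module R} omega1 M"
    by (rule determined_free[OF RP R(1) small her M])
qed

end
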